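(* Let $X$ be a finite topological space and $n=\dim X$. The dualizing complex $D_X$ is isomorphic (in $D(X)$) to a complex $$0\to D_X^{-n}\to\cdots\to D_X^0\to 0$$ where $$D_X^{-p}=\bigoplus_{x_0<\cdots<x_p}\mathbb{Z}_{C_{x_p}},$$ the sum running over the chains $x_0<\cdots<x_p$ in $X$. In particular, $D_X$ is of finite type and has amplitude $[-n,0]$.
   Context: A finite topological space $X$ carries the preorder: $p\le q$ iff $\overline{\{p\}}\subseteq\overline{\{q\}}$; $<$ denotes the associated strict relation. $C_p=\{q: q\le p\}$ is the closure of $p$; open sets are the up-closed sets. $\dim X$ is the maximum of the lengths $n$ of the chains $x_0<x_1<\cdots<x_n$ in $X$. An abelian data $F$ on $X$ is a functor from the preordered set $X$ to abelian groups ($F_p$, with $r_{pq}\colon F_p\to F_q$ for $p\le q$), equivalently a sheaf of abelian groups, with $\Gamma(X,F)=\varprojlim_{x\in X}F_x$. $D(X)$ is the (unbounded) derived category of abelian data on $X$. For a locally closed $S\subseteq X$, $\mathbb{Z}_S$ is the abelian data with stalk $\mathbb{Z}$ at points of $S$ and $0$ elsewhere, with restriction maps the identity inside $S$ and zero otherwise. $F\in D(X)$ is of finite type if $H^i(F_x)$ is finitely generated for all $i$ and all $x\in X$; amplitude $[-n,0]$ means cohomology concentrated in degrees $-n,\dots,0$. The dualizing complex is $D_X:=\pi^!\mathbb{Z}$, where $\pi\colon X\to\{*\}$ and $\pi^!$ is the right adjoint of $\mathbb{R}\pi_*=\mathbb{R}\Gamma(X,-)\colon D(X)\to D(\{*\})$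 (which exists); thus, naturally in $F\in D(X)$, $\mathbb{R}\mathrm{Hom}^\bullet(F,D_X)=\mathbb{R}\mathrm{Hom}^\bullet(\mathbb{R}\Gamma(X,F),\mathbb{Z})$.
   Formalization: The chains x_0<...<x_p are taken up to identifying points with the same closure (chains of closures); for T0 spaces this is the literal formula, while for non-T0 spaces the literal sum over chains of points is false (two-point indiscrete space). *)

theory Defs
  imports "HOL-Analysis.Abstract_Topological_Spaces" "HOL-Algebra.Product_Groups"
begin

section \<open>Categories, localization, derived functors, adjoints\<close>

text \<open>The objects are passed to \<open>Comp\<close> explicitly: \<open>Comp C a b c g f\<close> is the composite of
  \<open>f : a \<rightarrow> b\<close> followed by \<open>g : b \<rightarrow> c\<close>. Hom sets of different pairs of objects need not be disjoint.\<close>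

record ('o, 'm) cat =
  Obj :: "'o set"
  Hom :: "'o \<Rightarrow> 'o \<Rightarrow> 'm set"
  Idt :: "'o \<Rightarrow> 'm"
  Comp :: "'o \<Rightarrow> 'o \<Rightarrow> 'o \<Rightarrow> 'm \<Rightarrow> 'm \<Rightarrow> 'm"

definition is_category :: "('o, 'm) cat \<Rightarrow> bool" where
  "is_category C \<longleftrightarrow>
     (\<forall>a\<in>Obj C. Idt C a \<in> Hom C a a) \<and>
     (\<forall>a\<in>Obj C. \<forall>b\<in>Obj C. \<forall>c\<in>Obj C. \<forall>f\<in>Hom C a b. \<forall>g\<in>Hom C b c.
        Comp C a b c g f \<in> Hom C a c) \<and>
     (\<forall>a\<in>Obj C. \<forall>b\<in>Obj C. \<forall>f\<in>Hom C a b.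
        Comp C a a b f (Idt C a) = f \<and> Comp C a b b (Idt C b) f = f) \<and>
     (\<forall>a\<in>Obj C. \<forall>b\<in>Obj C. \<forall>c\<in>Obj C. \<forall>d\<in>Obj C.
        \<forall>f\<in>Hom C a b. \<forall>g\<in>Hom C b c. \<forall>h\<in>Hom C c d.
        Comp C a b d (Comp C b c d h g) f = Comp C a c d h (Comp C a b c g f))"

definition isomorphic_in :: "('o, 'm) cat \<Rightarrow> 'o \<Rightarrow> 'o \<Rightarrow> bool" where
  "isomorphic_in C a b \<longleftrightarrow> a \<in> Obj C \<and> b \<in> Obj C \<and>
     (\<exists>f\<in>Hom C a b. \<exists>g\<in>Hom C b a. Comp C a b a g f = Idt C a \<and> Comp C b a b f g = Idt C b)"

record ('o, 'm, 'p, 'n) ftor =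
  onObj :: "'o \<Rightarrow> 'p"
  onHom :: "'o \<Rightarrow> 'o \<Rightarrow> 'm \<Rightarrow> 'n"

definition is_functor :: "('o, 'm) cat \<Rightarrow> ('p, 'n) cat \<Rightarrow> ('o, 'm, 'p, 'n) ftor \<Rightarrow> bool" where
  "is_functor C D T \<longleftrightarrow>
     (\<forall>a\<in>Obj C. onObj T a \<in> Obj D) \<and>
     (\<forall>a\<in>Obj C. \<forall>b\<in>Obj C. \<forall>f\<in>Hom C a b. onHom T a b f \<in> Hom D (onObj T a) (onObj T b)) \<and>
     (\<forall>a\<in>Obj C. onHom T a a (Idt C a) = Idt D (onObj T a)) \<and>
     (\<forall>a\<in>Obj C. \<forall>b\<in>Obj C. \<forall>c\<in>Obj C. \<forall>f\<in>Hom C a b. \<forall>g\<in>Hom C b c.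
        onHom T a c (Comp C a b c g f) =
          Comp D (onObj T a) (onObj T b) (onObj T c) (onHom T b c g) (onHom T a b f))"

definition fcomp :: "('p, 'n, 'q, 'k) ftor \<Rightarrow> ('o, 'm, 'p, 'n) ftor \<Rightarrow> ('o, 'm, 'q, 'k) ftor" where
  "fcomp S T = \<lparr>onObj = (\<lambda>a. onObj S (onObj T a)),
                onHom = (\<lambda>a b f. onHom S (onObj T a) (onObj T b) (onHom T a b f))\<rparr>"

definition is_nat_trans ::
  "('o, 'm) cat \<Rightarrow> ('p, 'n) cat \<Rightarrow> ('o, 'm, 'p, 'n) ftor \<Rightarrow> ('o, 'm, 'p, 'n) ftor \<Rightarrow> ('o \<Rightarrow> 'n) \<Rightarrow> bool" where
  "is_nat_trans C D S T \<eta> \<longleftrightarrow>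
     (\<forall>a\<in>Obj C. \<eta> a \<in> Hom D (onObj S a) (onObj T a)) \<and>
     (\<forall>a\<in>Obj C. \<forall>b\<in>Obj C. \<forall>f\<in>Hom C a b.
        Comp D (onObj S a) (onObj S b) (onObj T b) (\<eta> b) (onHom S a b f) =
        Comp D (onObj S a) (onObj T a) (onObj T b) (onHom T a b f) (\<eta> a))"

text \<open>Gabriel--Zisman localization of \<open>C\<close> at a class \<open>W\<close> of morphisms: arrows are zigzags, read
  from left to right, modulo the congruence that makes \<open>Fwd\<close> functorial and makes \<open>Bwd a b w : b \<rightarrow> a\<close>
  inverse to \<open>Fwd a b w : a \<rightarrow> b\<close> for \<open>w\<close> in \<open>W\<close>.\<close>

datatype ('o, 'm) arrow = Fwd 'o 'o 'm | Bwd 'o 'o 'm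

inductive zigzag :: "('o, 'm) cat \<Rightarrow> ('o \<Rightarrow> 'o \<Rightarrow> 'm \<Rightarrow> bool) \<Rightarrow> 'o \<Rightarrow> 'o \<Rightarrow> ('o, 'm) arrow list \<Rightarrow> bool"
  for C W where
  zz_nil: "a \<in> Obj C \<Longrightarrow> zigzag C W a a []"
| zz_fwd: "a \<in> Obj C \<Longrightarrow> b \<in> Obj C \<Longrightarrow> f \<in> Hom C a b \<Longrightarrow> zigzag C W b c u \<Longrightarrow>
     zigzag C W a c (Fwd a b f # u)"
| zz_bwd: "a \<in> Obj C \<Longrightarrow> b \<in> Obj C \<Longrightarrow> w \<in> Hom C a b \<Longrightarrow> W a b w \<Longrightarrow> zigzag C W a c u \<Longrightarrow>
     zigzag C W b c (Bwd a b w # u)"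

inductive zeq :: "('o, 'm) cat \<Rightarrow> ('o \<Rightarrow> 'o \<Rightarrow> 'm \<Rightarrow> bool) \<Rightarrow> 'o \<Rightarrow> 'o \<Rightarrow>
    ('o, 'm) arrow list \<Rightarrow> ('o, 'm) arrow list \<Rightarrow> bool"
  for C W where
  zeq_refl: "zigzag C W a b u \<Longrightarrow> zeq C W a b u u"
| zeq_sym: "zeq C W a b u v \<Longrightarrow> zeq C W a b v u"
| zeq_trans: "zeq C W a b u v \<Longrightarrow> zeq C W a b v w \<Longrightarrow> zeq C W a b u w"
| zeq_app: "zeq C W a b u v \<Longrightarrow> zeq C W b c u' v' \<Longrightarrow> zeq C W a c (u @ u') (v @ v')"
| zeq_id: "a \<in> Obj C \<Longrightarrow> zeq C W a a [Fwd a a (Idt C a)] []"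
| zeq_comp: "a \<in> Obj C \<Longrightarrow> b \<in> Obj C \<Longrightarrow> c \<in> Obj C \<Longrightarrow> f \<in> Hom C a b \<Longrightarrow> g \<in> Hom C b c \<Longrightarrow>
     zeq C W a c [Fwd a b f, Fwd b c g] [Fwd a c (Comp C a b c g f)]"
| zeq_inv1: "a \<in> Obj C \<Longrightarrow> b \<in> Obj C \<Longrightarrow> w \<in> Hom C a b \<Longrightarrow> W a b w \<Longrightarrow>
     zeq C W a a [Fwd a b w, Bwd a b w] []"
| zeq_inv2: "a \<in> Obj C \<Longrightarrow> b \<in> Obj C \<Longrightarrow> w \<in> Hom C a b \<Longrightarrow> W a b w \<Longrightarrow>
     zeq C W b b [Bwd a b w, Fwd a b w] []"

definition zclass :: "('o, 'm) cat \<Rightarrow> ('o \<Rightarrow> 'o \<Rightarrow> 'm \<Rightarrow> bool) \<Rightarrow> 'o \<Rightarrow> 'o \<Rightarrow>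
    ('o, 'm) arrow list \<Rightarrow> ('o, 'm) arrow list set" where
  "zclass C W a b u = {v. zeq C W a b u v}"

definition localization ::
  "('o, 'm) cat \<Rightarrow> ('o \<Rightarrow> 'o \<Rightarrow> 'm \<Rightarrow> bool) \<Rightarrow> ('o, ('o, 'm) arrow list set) cat" where
  "localization C W =
     \<lparr>Obj = Obj C,
      Hom = (\<lambda>a b. zclass C W a b ` {u. zigzag C W a b u}),
      Idt = (\<lambda>a. zclass C W a a []),
      Comp = (\<lambda>a b c g f. \<Union>u\<in>f. \<Union>v\<in>g. zclass C W a c (u @ v))\<rparr>"

definition loc_functor ::
  "('o, 'm) cat \<Rightarrow> ('o \<Rightarrow> 'o \<Rightarrow> 'm \<Rightarrow> bool) \<Rightarrow> ('o, 'm, 'o, ('o, 'm) arrow list set) ftor" where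
  "loc_functor C W = \<lparr>onObj = (\<lambda>a. a), onHom = (\<lambda>a b f. zclass C W a b [Fwd a b f])\<rparr>"

text \<open>\<open>(R, \<epsilon>)\<close> is the total right derived functor of \<open>T : C \<rightarrow> C'\<close>: the left Kan extension of
  \<open>C \<rightarrow> C' \<rightarrow> C'[W'\<inverse>]\<close> along \<open>C \<rightarrow> C[W\<inverse>]\<close>.\<close>

definition is_total_right_derived ::
  "('o, 'm) cat \<Rightarrow> ('o \<Rightarrow> 'o \<Rightarrow> 'm \<Rightarrow> bool) \<Rightarrow> ('p, 'n) cat \<Rightarrow> ('p \<Rightarrow> 'p \<Rightarrow> 'n \<Rightarrow> bool) \<Rightarrow>
   ('o, 'm, 'p, 'n) ftor \<Rightarrow>
   ('o, ('o, 'm) arrow list set, 'p, ('p, 'n) arrow list set) ftor \<Rightarrow>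
   ('o \<Rightarrow> ('p, 'n) arrow list set) \<Rightarrow> bool" where
  "is_total_right_derived C W C' W' T R \<epsilon> \<longleftrightarrow>
    (let L = localization C W; Q = loc_functor C W;
         L' = localization C' W'; Q' = loc_functor C' W' in
     is_functor L L' R \<and> is_nat_trans C L' (fcomp Q' T) (fcomp R Q) \<epsilon> \<and>
     (\<forall>S \<eta>. is_functor L L' S \<and> is_nat_trans C L' (fcomp Q' T) (fcomp S Q) \<eta> \<longrightarrow>
        (\<exists>\<theta>. is_nat_trans L L' R S \<theta> \<and>
             (\<forall>a\<in>Obj C. Comp L' (onObj T a) (onObj R a) (onObj S a) (\<theta> a) (\<epsilon> a) = \<eta> a)) \<and>
        (\<forall>\<theta> \<theta>'. is_nat_trans L L' R S \<theta> \<and> is_nat_trans L L' R S \<theta>' \<and>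
             (\<forall>a\<in>Obj C. Comp L' (onObj T a) (onObj R a) (onObj S a) (\<theta> a) (\<epsilon> a) = \<eta> a) \<and>
             (\<forall>a\<in>Obj C. Comp L' (onObj T a) (onObj R a) (onObj S a) (\<theta>' a) (\<epsilon> a) = \<eta> a) \<longrightarrow>
             (\<forall>a\<in>Obj C. \<theta> a = \<theta>' a))))"

text \<open>\<open>e\<close> is the value at \<open>d\<close> of the right adjoint of \<open>L : C \<rightarrow> D\<close>, that is,
  \<open>Hom C a e = Hom D (L a) d\<close>, naturally in \<open>a\<close>.\<close>

definition right_adjoint_value ::
  "('o, 'm) cat \<Rightarrow> ('p, 'n) cat \<Rightarrow> ('o, 'm, 'p, 'n) ftor \<Rightarrow> 'p \<Rightarrow> 'o \<Rightarrow> bool" where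
  "right_adjoint_value C D L d e \<longleftrightarrow> e \<in> Obj C \<and> d \<in> Obj D \<and>
     (\<exists>\<Phi>. (\<forall>a\<in>Obj C. bij_betw (\<Phi> a) (Hom C a e) (Hom D (onObj L a) d)) \<and>
          (\<forall>a\<in>Obj C. \<forall>b\<in>Obj C. \<forall>f\<in>Hom C a b. \<forall>g\<in>Hom C b e.
             \<Phi> a (Comp C a b e g f) = Comp D (onObj L a) (onObj L b) d (\<Phi> b g) (onHom L a b f)))"


section \<open>Abelian data on a topological space\<close>

abbreviation pt_closure :: "'x topology \<Rightarrow> 'x \<Rightarrow> 'x set" where
  "pt_closure X p \<equiv> X closure_of {p}"

definition pt_le :: "'x topology \<Rightarrow> 'x \<Rightarrow> 'x \<Rightarrow> bool" where
  "pt_le X p q \<longleftrightarrow> p \<in> topspace X \<and> q \<in> topspace X \<and> pt_closure X p \<subseteq> pt_closure X q"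

definition pt_less :: "'x topology \<Rightarrow> 'x \<Rightarrow> 'x \<Rightarrow> bool" where
  "pt_less X p q \<longleftrightarrow> pt_le X p q \<and> \<not> pt_le X q p"

text \<open>Abelian groups are commutative groups (written multiplicatively by \<^theory>\<open>HOL-Algebra.Group\<close>)
  whose elements lie in a type \<open>'u\<close>, which acts as the universe.\<close>

record ('x, 'u) adata =
  stalk :: "'x \<Rightarrow> 'u monoid"
  res :: "'x \<Rightarrow> 'x \<Rightarrow> 'u \<Rightarrow> 'u"

definition abelian_data :: "'x topology \<Rightarrow> ('x, 'u) adata set" where
  "abelian_data X = {A.
     (\<forall>p\<in>topspace X. comm_group (stalk A p)) \<and>
     (\<forall>p q. pt_le X p q \<longrightarrow> res A p q \<in> hom (stalk A p) (stalk A q)) \<and>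
     (\<forall>p\<in>topspace X. \<forall>s\<in>carrier (stalk A p). res A p p s = s) \<and>
     (\<forall>p q r. pt_le X p q \<and> pt_le X q r \<longrightarrow>
        (\<forall>s\<in>carrier (stalk A p). res A q r (res A p q s) = res A p r s))}"

text \<open>The extensionality conditions make morphisms that agree on all stalks equal.\<close>

definition ad_hom :: "'x topology \<Rightarrow> ('x, 'u) adata \<Rightarrow> ('x, 'v) adata \<Rightarrow> ('x \<Rightarrow> 'u \<Rightarrow> 'v) set" where
  "ad_hom X A B = {f \<in> extensional (topspace X).
     (\<forall>p\<in>topspace X. f p \<in> hom (stalk A p) (stalk B p) \<inter> extensional (carrier (stalk A p))) \<and>
     (\<forall>p q. pt_le X p q \<longrightarrow> (\<forall>s\<in>carrier (stalk A p). f q (res A p q s) = res B p q (f p s)))}"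

definition ad_id :: "'x topology \<Rightarrow> ('x, 'u) adata \<Rightarrow> 'x \<Rightarrow> 'u \<Rightarrow> 'u" where
  "ad_id X A = (\<lambda>p\<in>topspace X. \<lambda>s\<in>carrier (stalk A p). s)"

definition ad_comp :: "'x topology \<Rightarrow> ('x, 'u) adata \<Rightarrow> ('x \<Rightarrow> 'v \<Rightarrow> 'w) \<Rightarrow> ('x \<Rightarrow> 'u \<Rightarrow> 'v) \<Rightarrow> 'x \<Rightarrow> 'u \<Rightarrow> 'w"
  where "ad_comp X A g f = (\<lambda>p\<in>topspace X. compose (carrier (stalk A p)) (g p) (f p))"

text \<open>The two sides may live in different universes.\<close>

definition ad_isomorphic :: "'x topology \<Rightarrow> ('x, 'u) adata \<Rightarrow> ('x, 'v) adata \<Rightarrow> bool" where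
  "ad_isomorphic X A B \<longleftrightarrow>
     (\<exists>f\<in>ad_hom X A B. \<forall>p\<in>topspace X. f p \<in> iso (stalk A p) (stalk B p))"

definition ad_is_zero :: "'x topology \<Rightarrow> ('x, 'u) adata \<Rightarrow> bool" where
  "ad_is_zero X A \<longleftrightarrow> (\<forall>p\<in>topspace X. trivial_group (stalk A p))"

definition Z_on :: "'x set \<Rightarrow> ('x, int) adata" where
  "Z_on S = \<lparr>stalk = (\<lambda>p. if p \<in> S then integer_group else singleton_group 0),
             res = (\<lambda>p q s. if p \<in> S \<and> q \<in> S then s else 0)\<rparr>"

definition ad_sum :: "'c set \<Rightarrow> ('c \<Rightarrow> ('x, 'u) adata) \<Rightarrow> ('x, 'c \<Rightarrow> 'u) adata" where
  "ad_sum I A = \<lparr>stalk = (\<lambda>p. sum_group I (\<lambda>c. stalk (A c) p)),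
                 res = (\<lambda>p q s. \<lambda>c\<in>I. res (A c) p q (s c))\<rparr>"


section \<open>Complexes and the derived category\<close>

record ('x, 'u) acomplex =
  trm :: "int \<Rightarrow> ('x, 'u) adata"
  dif :: "int \<Rightarrow> 'x \<Rightarrow> 'u \<Rightarrow> 'u"

type_synonym ('x, 'u) amap = "int \<Rightarrow> 'x \<Rightarrow> 'u \<Rightarrow> 'u"

definition acomplexes :: "'x topology \<Rightarrow> ('x, 'u) acomplex set" where
  "acomplexes X = {F. \<forall>i. trm F i \<in> abelian_data X \<and>
     dif F i \<in> ad_hom X (trm F i) (trm F (i + 1)) \<and>
     (\<forall>p\<in>topspace X. \<forall>s\<in>carrier (stalk (trm F i) p).
        dif F (i + 1) p (dif F i p s) = \<one>\<^bsub>stalk (trm F (i + 2)) p\<^esub>)}"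

definition chain_maps :: "'x topology \<Rightarrow> ('x, 'u) acomplex \<Rightarrow> ('x, 'u) acomplex \<Rightarrow> ('x, 'u) amap set" where
  "chain_maps X F G = {f. \<forall>i. f i \<in> ad_hom X (trm F i) (trm G i) \<and>
     (\<forall>p\<in>topspace X. \<forall>s\<in>carrier (stalk (trm F i) p).
        f (i + 1) p (dif F i p s) = dif G i p (f i p s))}"

definition Ch :: "'x topology \<Rightarrow> (('x, 'u) acomplex, ('x, 'u) amap) cat" where
  "Ch X = \<lparr>Obj = acomplexes X, Hom = chain_maps X,
           Idt = (\<lambda>F i. ad_id X (trm F i)),
           Comp = (\<lambda>F G H g f i. ad_comp X (trm F i) (g i) (f i))\<rparr>"

text \<open>Kernels and cokernels of abelian data are computed stalkwise, so \<open>cohomology F i p\<close> is the stalk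
  at \<open>p\<close> of the \<open>i\<close>-th cohomology, equivalently the \<open>i\<close>-th cohomology of the complex of stalks at \<open>p\<close>.\<close>

definition cocycles :: "('x, 'u) acomplex \<Rightarrow> int \<Rightarrow> 'x \<Rightarrow> 'u monoid" where
  "cocycles F i p = (stalk (trm F i) p)
     \<lparr>carrier := kernel (stalk (trm F i) p) (stalk (trm F (i + 1)) p) (dif F i p)\<rparr>"

definition coboundaries :: "('x, 'u) acomplex \<Rightarrow> int \<Rightarrow> 'x \<Rightarrow> 'u set" where
  "coboundaries F i p = dif F (i - 1) p ` carrier (stalk (trm F (i - 1)) p)"

definition cohomology :: "('x, 'u) acomplex \<Rightarrow> int \<Rightarrow> 'x \<Rightarrow> 'u set monoid" where
  "cohomology F i p = cocycles F i p Mod coboundaries F i p"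

definition cohomology_map ::
  "('x, 'u) acomplex \<Rightarrow> ('x, 'u) amap \<Rightarrow> int \<Rightarrow> 'x \<Rightarrow> 'u set \<Rightarrow> 'u set" where
  "cohomology_map G f i p c = coboundaries G i p <#>\<^bsub>cocycles G i p\<^esub> (f i p ` c)"

definition quasi_iso :: "'x topology \<Rightarrow> ('x, 'u) acomplex \<Rightarrow> ('x, 'u) acomplex \<Rightarrow> ('x, 'u) amap \<Rightarrow> bool" where
  "quasi_iso X F G f \<longleftrightarrow> f \<in> chain_maps X F G \<and>
     (\<forall>i. \<forall>p\<in>topspace X. cohomology_map G f i p \<in> iso (cohomology F i p) (cohomology G i p))"

type_synonym ('x, 'u) dmap = "(('x, 'u) acomplex, ('x, 'u) amap) arrow list set"

definition DCat :: "'x topology \<Rightarrow> (('x, 'u) acomplex, ('x, 'u) dmap) cat" where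
  "DCat X = localization (Ch X) (quasi_iso X)"

definition finitely_generated :: "('a, 'b) monoid_scheme \<Rightarrow> bool" where
  "finitely_generated G \<longleftrightarrow> (\<exists>S. finite S \<and> S \<subseteq> carrier G \<and> generate G S = carrier G)"

definition of_finite_type :: "'x topology \<Rightarrow> ('x, 'u) acomplex \<Rightarrow> bool" where
  "of_finite_type X F \<longleftrightarrow> (\<forall>i. \<forall>p\<in>topspace X. finitely_generated (cohomology F i p))"

definition has_amplitude :: "'x topology \<Rightarrow> ('x, 'u) acomplex \<Rightarrow> int set \<Rightarrow> bool" where
  "has_amplitude X F J \<longleftrightarrow> (\<forall>i. i \<notin> J \<longrightarrow> (\<forall>p\<in>topspace X. trivial_group (cohomology F i p)))"


section \<open>Global sections and the dualizing complex\<close>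

abbreviation point :: "unit topology" where
  "point \<equiv> discrete_topology UNIV"

definition sections :: "'x topology \<Rightarrow> ('x, 'u) adata \<Rightarrow> ('x \<Rightarrow> 'u) monoid" where
  "sections X A = (product_group (topspace X) (stalk A))
     \<lparr>carrier := {s \<in> (\<Pi>\<^sub>E p\<in>topspace X. carrier (stalk A p)).
        \<forall>p q. pt_le X p q \<longrightarrow> res A p q (s p) = s q}\<rparr>"

text \<open>The functor of global sections, from complexes of abelian data on \<open>X\<close> (in the universe \<open>'u\<close>) to
  complexes of abelian data on the point (in the universe \<open>'x \<Rightarrow> 'u\<close>).\<close>

definition Gamma :: "'x topology \<Rightarrow>
    (('x, 'u) acomplex, ('x, 'u) amap, (unit, 'x \<Rightarrow> 'u) acomplex, (unit, 'x \<Rightarrow> 'u) amap) ftor" where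
  "Gamma X =
     \<lparr>onObj = (\<lambda>F.
        \<lparr>trm = (\<lambda>i. \<lparr>stalk = (\<lambda>_. sections X (trm F i)), res = (\<lambda>_ _ s. s)\<rparr>),
         dif = (\<lambda>i _. \<lambda>s\<in>carrier (sections X (trm F i)). \<lambda>p\<in>topspace X. dif F i p (s p))\<rparr>),
      onHom = (\<lambda>F G f i _. \<lambda>s\<in>carrier (sections X (trm F i)). \<lambda>p\<in>topspace X. f i p (s p))\<rparr>"

definition is_RGamma :: "'x topology \<Rightarrow>
    (('x, 'u) acomplex, ('x, 'u) dmap, (unit, 'x \<Rightarrow> 'u) acomplex, (unit, 'x \<Rightarrow> 'u) dmap) ftor \<Rightarrow> bool" where
  "is_RGamma X R \<longleftrightarrow>
     (\<exists>\<epsilon>. is_total_right_derived (Ch X) (quasi_iso X) (Ch point) (quasi_iso point) (Gamma X) R \<epsilon>)"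

text \<open>Copies in the universe \<open>'v\<close> of the integers, as a complex concentrated in degree \<open>0\<close>.\<close>

definition is_integers :: "(unit, 'v) acomplex \<Rightarrow> bool" where
  "is_integers Z \<longleftrightarrow> Z \<in> acomplexes point \<and> ad_isomorphic point (trm Z 0) (Z_on UNIV) \<and>
     (\<forall>i. i \<noteq> 0 \<longrightarrow> ad_is_zero point (trm Z i))"

definition is_dualizing_complex :: "'x topology \<Rightarrow> ('x, 'u) acomplex \<Rightarrow> bool" where
  "is_dualizing_complex X D \<longleftrightarrow>
     (\<exists>R Z. is_RGamma X R \<and> is_integers Z \<and> right_adjoint_value (DCat X) (DCat point) R Z D)"


section \<open>Chains\<close>

definition strict_chains :: "'x topology \<Rightarrow> nat \<Rightarrow> 'x list set" where
  "strict_chains X p = {xs. length xs = Suc p \<and> set xs \<subseteq> topspace X \<and> sorted_wrt (pt_less X) xs}"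

definition dim_space :: "'x topology \<Rightarrow> nat" where
  "dim_space X = Max {p. strict_chains X p \<noteq> {}}"

text \<open>Chains of the poset attached to the preordered set \<open>X\<close>: the chain \<open>x\<^sub>0 < \<dots> < x\<^sub>p\<close> is recorded as
  the list of closures of its points, whose last entry is the closure of \<open>x\<^sub>p\<close>. On a \<open>T\<^sub>0\<close> space these
  are the chains of points (lemma \<open>bij_betw_chains\<close> below). On other spaces points with the
  same closure must not be counted separately: on the indiscrete space with two points, which is
  equivalent to a point as a category, the dualizing complex is the constant data, with stalks the
  integers, whereas there are two chains of length \<open>0\<close> of points.\<close>

definition closure_chains :: "'x topology \<Rightarrow> nat \<Rightarrow> 'x set list set" where
  "closure_chains X p = map (pt_closure X) ` strict_chains X p"

definition chain_term :: "'x topology \<Rightarrow> nat \<Rightarrow> ('x, 'x set list \<Rightarrow> int) adata" where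
  "chain_term X p = ad_sum (closure_chains X p) (\<lambda>c. Z_on (last c))"

lemma bij_betw_chains:
  assumes "t0_space X"
  shows "bij_betw (map (pt_closure X)) (strict_chains X p) (closure_chains X p)"
proof -
  have eq: "x = y"
    if xy: "x \<in> topspace X" "y \<in> topspace X" and cl: "pt_closure X x = pt_closure X y" for x y
  proof -
    have mem: "x \<in> pt_closure X x" "y \<in> pt_closure X y"
      using xy by (simp_all add: in_closure_of)
    then have "x \<in> pt_closure X y" "y \<in> pt_closure X x"
      by (simp_all add: cl)
    then have "\<forall>U. openin X U \<longrightarrow> x \<in> U \<longleftrightarrow> y \<in> U"
      by (auto simp: in_closure_of)
    then show "x = y"
      using assms xy unfolding t0_space_def by metis
  qed
  have "inj_on (pt_closure X) (topspace X)"
    by (rule inj_onI) (rule eq)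
  then have "inj_on (map (pt_closure X)) (lists (topspace X))"
    by (simp add: inj_on_map_lists)
  then have "inj_on (map (pt_closure X)) (strict_chains X p)"
    by (rule inj_on_subset) (auto simp: strict_chains_def)
  then show ?thesis
    by (simp add: bij_betw_def closure_chains_def)
qed

end

(* On a finite space, RGamma(X, F) is computed by the total complex T F of cochains on all strict
   chains x_0 < ... < x_p with values in the stalks of F at x_p.  The same cochains on the up-sets of
   the points form a functorial resolution F -> C F by flabby data, on which Gamma and T agree up to
   quasi-isomorphism; hence T is a total right derived functor of Gamma.  Already on complexes T has
   an explicit right adjoint U, given by cochains on chains with values in constant data on the
   closures of their last points.  Both preserve quasi-isomorphisms, so the adjunction descends to
   the localizations, and U Z is the complex of the theorem.  Right adjoint values are unique up to
   isomorphism, so every dualizing complex is isomorphic to it.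
   The element types of the complexes are fixed by the statement, so T, C and U are transported along
   injections of their stalks; a closure argument of Loewenheim-Skolem type shows that
   passing to complexes on a small carrier does not change morphisms in the localization. *)
theory Submission imports Defs "HOL-Library.Sublist" "HOL-Algebra.FiniteProduct"
begin

text \<open>Universe bookkeeping shapes much of the proof. \<open>Gamma X\<close> leads from
  \<open>'u\<close> to \<open>'x => 'u\<close>, which is larger than \<open>'u\<close> for suitable
  infinite \<open>'x\<close>. The adjoint \<open>U\<close> must land in \<open>'u\<close> again,
  which works only for complexes on the point whose stalks embed into \<open>'u\<close>. So the
  adjunction is set up with these as target; the values of \<open>T\<close> and the integers are
  among them, and their localization embeds fully faithfully into the derived category of the point.
  Quasi-isomorphisms are tested by \<open>qcrit\<close>, acyclicity of the mapping cone on elements.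
  It avoids quotient groups, compares complexes in different universes, and lets partial solutions
  be subtracted, so that comparisons of filtered complexes become finite inductions, on chain length
  or on the size of an up-set. Strict chains through all points would compute the wrong limit when
  distinct points have the same closure: two indiscrete points would give a product of two stalks.
  Hence chains run in a set \<open>P\<close> of representatives, on which the preorder is
  antisymmetric, and the sum of the theorem is reached through closures.\<close>

abbreviation (input) mult_in ("_ *[_] _" [70, 0, 71] 70) where "x *[G] y \<equiv> x \<otimes>\<^bsub>G\<^esub> y"
abbreviation (input) one_in ("1[_]") where "1[G] \<equiv> \<one>\<^bsub>G\<^esub>"
abbreviation (input) ob where "ob \<equiv> onObj"
abbreviation (input) hm where "hm \<equiv> onHom"
abbreviation (input) acs where "acs \<equiv> acomplexes"
abbreviation (input) tsp where "tsp \<equiv> topspace"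
abbreviation (input) inv_in ("inv[_] _" [0, 81] 80) where "inv[G] x \<equiv> inv\<^bsub>G\<^esub> x"

section \<open>Localizations\<close>

lemma is_categoryD: assumes "is_category C" shows "a \<in> Obj C ==> Idt C a \<in> Hom C a a"
    and "a \<in> Obj C ==> b \<in> Obj C ==> c \<in> Obj C ==> f \<in> Hom C a b ==> g \<in> Hom C b c ==> Comp C a b c g f \<in> Hom C a c"
    and "a \<in> Obj C ==> b \<in> Obj C ==> f \<in> Hom C a b ==> Comp C a a b f (Idt C a) = f"
    and "a \<in> Obj C ==> b \<in> Obj C ==> f \<in> Hom C a b ==> Comp C a b b (Idt C b) f = f"
    and "a \<in> Obj C ==> b \<in> Obj C ==> c \<in> Obj C ==> d \<in> Obj C ==> f \<in> Hom C a b ==> g \<in> Hom C b c ==> h \<in> Hom C c d ==>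
        Comp C a b d (Comp C b c d h g) f = Comp C a c d h (Comp C a b c g f)"
  using assms unfolding is_category_def by blast+

lemma is_functorD: assumes "is_functor C D T" shows "a \<in> Obj C ==> ob T a \<in> Obj D"
    and "a \<in> Obj C ==> b \<in> Obj C ==> f \<in> Hom C a b ==> hm T a b f \<in> Hom D (ob T a) (ob T b)"
    and "a \<in> Obj C ==> hm T a a (Idt C a) = Idt D (ob T a)"
    and "a \<in> Obj C ==> b \<in> Obj C ==> c \<in> Obj C ==> f \<in> Hom C a b ==> g \<in> Hom C b c ==> hm T a c (Comp C a b c g f) =
          Comp D (ob T a) (ob T b) (ob T c) (hm T b c g) (hm T a b f)"
  using assms unfolding is_functor_def by blast+

lemma is_nat_transD: assumes "is_nat_trans C D S T et" shows "a \<in> Obj C ==> et a \<in> Hom D (ob S a) (ob T a)"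
    and "a \<in> Obj C ==> b \<in> Obj C ==> f \<in> Hom C a b ==> Comp D (ob S a) (ob S b) (ob T b) (et b) (hm S a b f) =
        Comp D (ob S a) (ob T a) (ob T b) (hm T a b f) (et a)"
  using assms unfolding is_nat_trans_def by blast+

lemma zigzag_objs: "zigzag C W a b u ==> a \<in> Obj C \<and> b \<in> Obj C" by (induction rule: zigzag.induct) auto

lemma zigzag_append: "zigzag C W a b u ==> zigzag C W b c v ==> zigzag C W a c (u @ v)" by (induction rule: zigzag.induct) (auto intro: zigzag.intros)

lemma zeq_zigzag: assumes "is_category C" shows "zeq C W a b u v ==> zigzag C W a b u \<and> zigzag C W a b v" by (induction rule: zeq.induct)
     (auto intro!: zigzag.intros intro: zigzag_append is_categoryD[OF assms])

lemma zigzag_Fwd: "a \<in> Obj C ==> b \<in> Obj C ==> f \<in> Hom C a b ==> zigzag C W a b [Fwd a b f]" by (auto intro: zigzag.intros)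

lemma zigzag_Bwd: "a \<in> Obj C ==> b \<in> Obj C ==> w \<in> Hom C a b ==> W a b w ==> zigzag C W b a [Bwd a b w]" by (auto intro: zigzag.intros)

lemma zeq_appL: "zigzag C W a b u ==> zeq C W b c v v' ==> zeq C W a c (u @ v) (u @ v')" by (auto intro: zeq.intros)

lemma zeq_appR: "zeq C W a b u u' ==> zigzag C W b c v ==> zeq C W a c (u @ v) (u' @ v)" by (auto intro: zeq.intros)

text \<open>In the localization \<open>g w = w' f\<close> may be multiplied by the inverse of
  \<open>w\<close> on one side and of \<open>w'\<close> on the other. This is what moves a natural
  transformation across a backward arrow.\<close>

lemma zeq_Fwd_Bwd_square: assumes C: "is_category C" and obj: "a \<in> Obj C" "b \<in> Obj C" "c \<in> Obj C" "d \<in> Obj C"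
    and w: "w \<in> Hom C a b" "W a b w" and w': "w' \<in> Hom C c d" "W c d w'"
    and f: "f \<in> Hom C a c" and g: "g \<in> Hom C b d"
    and sq: "Comp C a b d g w = Comp C a c d w' f"
  shows "zeq C W b c [Bwd a b w, Fwd a c f] [Fwd b d g, Bwd c d w']"
proof -
  note z = zigzag_Fwd zigzag_Bwd
  have 1: "zeq C W a d [Fwd a b w, Fwd b d g] [Fwd a c f, Fwd c d w']" using zeq_comp[of a C b d w g W] zeq_comp[of a C c d f w' W] sq obj w w' f g
    by (metis zeq_sym zeq_trans)
  have 2: "zeq C W b d ([Bwd a b w] @ [Fwd a b w, Fwd b d g]) ([Bwd a b w] @ [Fwd a c f, Fwd c d w'])" by (rule zeq_appL[OF _ 1]) (use obj w in "auto intro: z")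
  have 3: "zeq C W b d ([Bwd a b w, Fwd a b w] @ [Fwd b d g]) ([] @ [Fwd b d g])" by (rule zeq_appR) (use obj w g in "auto intro: z zeq_inv2")
  have 4: "zeq C W b d [Fwd b d g] ([Bwd a b w] @ [Fwd a c f, Fwd c d w'])" using zeq_trans[OF zeq_sym[OF 3[simplified]] 2[simplified]] by simp
  have 5: "zeq C W b c ([Fwd b d g] @ [Bwd c d w']) (([Bwd a b w] @ [Fwd a c f, Fwd c d w']) @ [Bwd c d w'])" by (rule zeq_appR[OF 4]) (use obj w' in "auto intro: z")
  have "zigzag C W b c [Bwd a b w, Fwd a c f]" using obj w f by (auto intro: zigzag.intros)
  then have 6: "zeq C W b c ([Bwd a b w, Fwd a c f] @ [Fwd c d w', Bwd c d w']) ([Bwd a b w, Fwd a c f] @ [])" by (rule zeq_appL) (use obj w' in "auto intro: zeq_inv1")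
  show ?thesis using zeq_trans[OF zeq_sym[OF 6[simplified]] zeq_sym[OF 5[simplified]]] by simp
qed

lemma zclass_eqI: "zeq C W a b u v ==> zclass C W a b u = zclass C W a b v" unfolding zclass_def by (auto intro: zeq_sym zeq_trans)

lemma zclass_eq_iff: assumes u: "zigzag C W a b u" shows "zclass C W a b u = zclass C W a b v \<longleftrightarrow> zeq C W a b u v"
proof
  assume eq: "zclass C W a b u = zclass C W a b v"
  have "u \<in> zclass C W a b v" unfolding eq[symmetric] using u by (simp add: zclass_def zeq_refl)
  then show "zeq C W a b u v" by (simp add: zclass_def zeq_sym)
qed (rule zclass_eqI)

lemma Obj_localization [simp]: "Obj (localization C W) = Obj C" by (simp add: localization_def)

lemma Idt_localization [simp]: "Idt (localization C W) a = zclass C W a a []" by (simp add: localization_def)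

lemma Hom_localizationI: "zigzag C W a b u ==> zclass C W a b u \<in> Hom (localization C W) a b" by (simp add: localization_def)

lemma Hom_localizationE: assumes "f \<in> Hom (localization C W) a b" obtains u where "zigzag C W a b u" "f = zclass C W a b u"
  using assms by (auto simp: localization_def)

text \<open>By \<open>zeq_app\<close> all members of the union in the definition of
  \<open>Comp\<close> are one and the same class, and the union is over nonempty sets.\<close>

lemma Comp_localization: assumes u: "zigzag C W a b u" and v: "zigzag C W b c v"
  shows "Comp (localization C W) a b c (zclass C W b c v) (zclass C W a b u) = zclass C W a c (u @ v)"
proof -
  have "zclass C W a c (u' @ v') = zclass C W a c (u @ v)" if "u' \<in> zclass C W a b u" "v' \<in> zclass C W b c v" for u' v'
    using that by (intro zclass_eqI) (auto simp: zclass_def intro: zeq_app zeq_sym)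
  then have "(\<Union>u'\<in>zclass C W a b u. \<Union>v'\<in>zclass C W b c v. zclass C W a c (u' @ v')) =
      (\<Union>u'\<in>zclass C W a b u. \<Union>v'\<in>zclass C W b c v. zclass C W a c (u @ v))"
    by (intro SUP_cong refl)
  moreover have "u \<in> zclass C W a b u" "v \<in> zclass C W b c v" using u v by (simp_all add: zclass_def zeq_refl)
  then have "zclass C W a b u \<noteq> {}" "zclass C W b c v \<noteq> {}" by blast+
  ultimately show ?thesis by (simp add: localization_def)
qed

lemma is_category_localization: "is_category (localization C W)" unfolding is_category_def
proof (intro conjI ballI)
  fix a assume "a \<in> Obj (localization C W)"
  then show "Idt (localization C W) a \<in> Hom (localization C W) a a" by (simp add: Hom_localizationI zz_nil)
next
  fix a b c f g
  assume "f \<in> Hom (localization C W) a b" "g \<in> Hom (localization C W) b c"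
  then obtain u v where uv: "zigzag C W a b u" "f = zclass C W a b u" "zigzag C W b c v" "g = zclass C W b c v" by (elim Hom_localizationE)
  show "Comp (localization C W) a b c g f \<in> Hom (localization C W) a c"
    unfolding uv Comp_localization[OF uv(1,3)] by (rule Hom_localizationI[OF zigzag_append[OF uv(1,3)]])
next
  fix a b f
  assume ab: "a \<in> Obj (localization C W)" "b \<in> Obj (localization C W)" and f: "f \<in> Hom (localization C W) a b"
  have nil: "zigzag C W a a []" "zigzag C W b b []" using ab by (auto intro: zz_nil)
  show "Comp (localization C W) a a b f (Idt (localization C W) a) = f" using f nil by (auto elim!: Hom_localizationE simp: Comp_localization)
  show "Comp (localization C W) a b b (Idt (localization C W) b) f = f" using f nil by (auto elim!: Hom_localizationE simp: Comp_localization)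
next
  fix a b c d f g h
  assume "f \<in> Hom (localization C W) a b" "g \<in> Hom (localization C W) b c" "h \<in> Hom (localization C W) c d"
  then obtain u v w where uvw: "zigzag C W a b u" "f = zclass C W a b u" "zigzag C W b c v" "g = zclass C W b c v" "zigzag C W c d w" "h = zclass C W c d w"
    by (elim Hom_localizationE)
  note app = zigzag_append[OF uvw(1,3)] zigzag_append[OF uvw(3,5)]
  show "Comp (localization C W) a b d (Comp (localization C W) b c d h g) f = Comp (localization C W) a c d h (Comp (localization C W) a b c g f)"
    using uvw(1,3,5) app unfolding uvw by (simp add: Comp_localization)
qed

lemma onHom_loc_functor [simp]: "hm (loc_functor C W) a b f = zclass C W a b [Fwd a b f]" and onObj_loc_functor [simp]: "ob (loc_functor C W) a = a"
  by (simp_all add: loc_functor_def)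

lemma loc_functor_Comp: assumes "a \<in> Obj C" "b \<in> Obj C" "c \<in> Obj C" "f \<in> Hom C a b" "g \<in> Hom C b c"
  shows "Comp (localization C W) a b c (zclass C W b c [Fwd b c g]) (zclass C W a b [Fwd a b f]) = zclass C W a c [Fwd a c (Comp C a b c g f)]"
  using assms by (simp add: Comp_localization zigzag_Fwd zclass_eqI zeq_comp)

subsection \<open>Functors that preserve the inverted morphisms\<close>

definition preserves :: "('o, 'm) cat => ('o => 'o => 'm => bool) => ('p => 'p => 'n => bool) => ('o, 'm, 'p, 'n) ftor => bool" where
  "preserves C W W' T \<longleftrightarrow> (\<forall>a\<in>Obj C. \<forall>b\<in>Obj C. \<forall>w\<in>Hom C a b. W a b w --> W' (ob T a) (ob T b) (hm T a b w))"

fun map_arrow :: "('o, 'm, 'p, 'n) ftor => ('o, 'm) arrow => ('p, 'n) arrow" where "map_arrow T (Fwd a b f) = Fwd (ob T a) (ob T b) (hm T a b f)"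
| "map_arrow T (Bwd a b f) = Bwd (ob T a) (ob T b) (hm T a b f)"

context
  fixes C :: "('o, 'm) cat" and D :: "('p, 'n) cat" and W W' and T :: "('o, 'm, 'p, 'n) ftor"
  assumes T: "is_functor C D T" and pres: "preserves C W W' T"
begin

lemma zigzag_map: "zigzag C W a b u ==> zigzag D W' (ob T a) (ob T b) (map (map_arrow T) u)"
proof (induction rule: zigzag.induct)
  case (zz_bwd a b w c u)
  then show ?case using pres by (auto intro!: zigzag.intros is_functorD[OF T] simp: preserves_def)
qed (auto intro!: zigzag.intros is_functorD[OF T])

lemma zeq_map: "zeq C W a b u v ==> zeq D W' (ob T a) (ob T b) (map (map_arrow T) u) (map (map_arrow T) v)"
proof (induction rule: zeq.induct)
  case (zeq_id a)
  then show ?case using zeq.zeq_id[of "ob T a" D W'] by (simp add: is_functorD[OF T])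
next
  case (zeq_comp a b c f g)
  then show ?case using zeq.zeq_comp[of "ob T a" D "ob T b" "ob T c" "hm T a b f" "hm T b c g" W'] by (simp add: is_functorD[OF T])
next
  case (zeq_inv1 a b w)
  then show ?case using pres by (auto intro!: zeq.zeq_inv1 is_functorD[OF T] simp: preserves_def)
next
  case (zeq_inv2 a b w)
  then show ?case using pres by (auto intro!: zeq.zeq_inv2 is_functorD[OF T] simp: preserves_def)
qed (auto intro: zeq.intros zigzag_map)

end

text \<open>The union avoids the choice of a representative: if \<open>T\<close> preserves the
  inverted morphisms, equivalent zigzags have equivalent images, so only one class occurs.\<close>

definition loc_lift :: "('o, 'm) cat => ('p, 'n) cat => ('p => 'p => 'n => bool) => ('o, 'm, 'p, 'n) ftor =>
   ('o, ('o, 'm) arrow list set, 'p, ('p, 'n) arrow list set) ftor" where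
  "loc_lift C D W' T = \<lparr>onObj = ob T, onHom = (%a b f. \<Union>u\<in>f. zclass D W' (ob T a) (ob T b) (map (map_arrow T) u))\<rparr>"

lemma onObj_loc_lift [simp]: "ob (loc_lift C D W' T) = ob T" by (simp add: loc_lift_def)

lemma onHom_loc_lift: assumes "is_functor C D T" "preserves C W W' T" "zigzag C W a b u" shows "hm (loc_lift C D W' T) a b (zclass C W a b u) =
    zclass D W' (ob T a) (ob T b) (map (map_arrow T) u)"
proof -
  have "zclass D W' (ob T a) (ob T b) (map (map_arrow T) v) = zclass D W' (ob T a) (ob T b) (map (map_arrow T) u)" if "v \<in> zclass C W a b u" for v
    by (rule zclass_eqI[OF zeq_map[OF assms(1,2) zeq_sym]]) (use that in "simp add: zclass_def")
  then have "(\<Union>v\<in>zclass C W a b u. zclass D W' (ob T a) (ob T b) (map (map_arrow T) v)) =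
      (\<Union>v\<in>zclass C W a b u. zclass D W' (ob T a) (ob T b) (map (map_arrow T) u))"
    by (intro SUP_cong refl)
  moreover have "u \<in> zclass C W a b u" using assms by (simp add: zclass_def zeq_refl)
  then have "zclass C W a b u \<noteq> {}" by blast
  ultimately show ?thesis by (simp add: loc_lift_def)
qed

lemma is_functor_loc_lift: assumes "is_functor C D T" "preserves C W W' T" shows "is_functor (localization C W) (localization D W') (loc_lift C D W' T)"
  unfolding is_functor_def
proof (intro conjI ballI)
  fix a assume a: "a \<in> Obj (localization C W)"
  then show "ob (loc_lift C D W' T) a \<in> Obj (localization D W')" using is_functorD[OF assms(1)] by simp
  show "hm (loc_lift C D W' T) a a (Idt (localization C W) a) = Idt (localization D W') (ob (loc_lift C D W' T) a)" using a by (simp add: onHom_loc_lift[OF assms] zz_nil)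
next
  fix a b f assume "f \<in> Hom (localization C W) a b"
  then obtain u where u: "zigzag C W a b u" "f = zclass C W a b u" by (rule Hom_localizationE)
  show "hm (loc_lift C D W' T) a b f \<in> Hom (localization D W') (ob (loc_lift C D W' T) a) (ob (loc_lift C D W' T) b)" using zigzag_map[OF assms u(1)] unfolding u(2)
    by (simp add: onHom_loc_lift[OF assms u(1)] Hom_localizationI)
next
  fix a b c f g assume "f \<in> Hom (localization C W) a b" "g \<in> Hom (localization C W) b c"
  then obtain u v where uv: "zigzag C W a b u" "f = zclass C W a b u" "zigzag C W b c v" "g = zclass C W b c v" by (elim Hom_localizationE)
  show "hm (loc_lift C D W' T) a c (Comp (localization C W) a b c g f) = Comp (localization D W') (ob (loc_lift C D W' T) a) (ob (loc_lift C D W' T) b)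
        (ob (loc_lift C D W' T) c) (hm (loc_lift C D W' T) b c g) (hm (loc_lift C D W' T) a b f)"
    using uv(1,3) zigzag_append[OF uv(1,3)] zigzag_map[OF assms uv(1)] zigzag_map[OF assms uv(3)]
    unfolding uv by (simp add: onHom_loc_lift[OF assms] Comp_localization)
qed

text \<open>The component of \<open>al\<close> is pushed through the zigzag one arrow at a time:
  forward arrows by naturality, backward arrows by \<open>zeq_Fwd_Bwd_square\<close>. The statement
  stays on zigzags so that it can be combined with further arrows before passing to classes.\<close>

lemma zeq_naturality: assumes D: "is_category D" and S: "is_functor C D S" "preserves C W W' S"
    and T: "is_functor C D T" "preserves C W W' T" and al: "is_nat_trans C D S T al"
  shows "zigzag C W a b u ==> zeq D W' (ob S a) (ob T b) (map (map_arrow S) u @ [Fwd (ob S b) (ob T b) (al b)]) (Fwd (ob S a) (ob T a) (al a) # map (map_arrow T) u)"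
proof (induction rule: zigzag.induct)
  case (zz_nil a)
  then show ?case by (simp add: zeq_refl zigzag_Fwd is_functorD[OF S(1)] is_functorD[OF T(1)] is_nat_transD[OF al])
next
  case (zz_fwd a b f c u)
  have o: "a \<in> Obj C" "b \<in> Obj C" "c \<in> Obj C" using zz_fwd.hyps zigzag_objs[OF zz_fwd.hyps(4)] by simp_all
  note i = is_functorD[OF S(1)] is_functorD[OF T(1)] is_nat_transD(1)[OF al]
  have 1: "zeq D W' (ob S a) (ob T c) ([Fwd (ob S a) (ob S b) (hm S a b f)] @ map (map_arrow S) u @ [Fwd (ob S c) (ob T c) (al c)])
     ([Fwd (ob S a) (ob S b) (hm S a b f)] @ (Fwd (ob S b) (ob T b) (al b) # map (map_arrow T) u))"
    by (rule zeq_appL[OF zigzag_Fwd zz_fwd.IH]) (use o zz_fwd in "simp_all add: i")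
  have "zeq D W' (ob S a) (ob T b) [Fwd (ob S a) (ob S b) (hm S a b f), Fwd (ob S b) (ob T b) (al b)] [Fwd (ob S a) (ob T a) (al a), Fwd (ob T a) (ob T b) (hm T a b f)]"
  proof (rule zeq_trans[OF zeq_comp zeq_sym])
    show "zeq D W' (ob S a) (ob T b) [Fwd (ob S a) (ob T a) (al a), Fwd (ob T a) (ob T b) (hm T a b f)]
     [Fwd (ob S a) (ob T b) (Comp D (ob S a) (ob S b) (ob T b) (al b) (hm S a b f))]" unfolding is_nat_transD(2)[OF al o(1,2) zz_fwd.hyps(3)]
      by (rule zeq_comp) (use o zz_fwd.hyps in "simp_all add: i")
  qed (use o zz_fwd.hyps in "simp_all add: i")
  then have 2: "zeq D W' (ob S a) (ob T c) ([Fwd (ob S a) (ob S b) (hm S a b f), Fwd (ob S b) (ob T b) (al b)] @ map (map_arrow T) u)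
     ([Fwd (ob S a) (ob T a) (al a), Fwd (ob T a) (ob T b) (hm T a b f)] @ map (map_arrow T) u)"
    by (rule zeq_appR[OF _ zigzag_map[OF T zz_fwd.hyps(4)]])
  show ?case using zeq_trans[OF 1[simplified] 2[simplified]] by simp
next
  case (zz_bwd a b w c u)
  have o: "a \<in> Obj C" "b \<in> Obj C" "c \<in> Obj C" using zz_bwd.hyps zigzag_objs[OF zz_bwd.hyps(5)] by simp_all
  note i = is_functorD[OF S(1)] is_functorD[OF T(1)] is_nat_transD(1)[OF al]
  have W: "W' (ob S a) (ob S b) (hm S a b w)" "W' (ob T a) (ob T b) (hm T a b w)" using S(2) T(2) zz_bwd unfolding preserves_def by blast+
  have 1: "zeq D W' (ob S b) (ob T c) ([Bwd (ob S a) (ob S b) (hm S a b w)] @ map (map_arrow S) u @ [Fwd (ob S c) (ob T c) (al c)])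
     ([Bwd (ob S a) (ob S b) (hm S a b w)] @ (Fwd (ob S a) (ob T a) (al a) # map (map_arrow T) u))"
    by (rule zeq_appL[OF zigzag_Bwd zz_bwd.IH]) (use o zz_bwd W in "simp_all add: i")
  have "zeq D W' (ob S b) (ob T a) [Bwd (ob S a) (ob S b) (hm S a b w), Fwd (ob S a) (ob T a) (al a)] [Fwd (ob S b) (ob T b) (al b), Bwd (ob T a) (ob T b) (hm T a b w)]"
    by (rule zeq_Fwd_Bwd_square[OF D]) (use o zz_bwd.hyps W is_nat_transD(2)[OF al o(1,2)] in "simp_all add: i")
  then have 2: "zeq D W' (ob S b) (ob T c) ([Bwd (ob S a) (ob S b) (hm S a b w), Fwd (ob S a) (ob T a) (al a)] @ map (map_arrow T) u)
     ([Fwd (ob S b) (ob T b) (al b), Bwd (ob T a) (ob T b) (hm T a b w)] @ map (map_arrow T) u)"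
    by (rule zeq_appR[OF _ zigzag_map[OF T zz_bwd.hyps(5)]])
  show ?case using zeq_trans[OF 1[simplified] 2[simplified]] by simp
qed

subsection \<open>Adjunctions descend to localizations\<close>

definition id_functor :: "('o, 'm, 'o, 'm) ftor" where "id_functor = \<lparr>onObj = (%a. a), onHom = (%a b f. f)\<rparr>"

lemma id_functor [simp]: "ob id_functor a = a" "hm id_functor a b f = f" "map_arrow id_functor = (%x. x)" "is_functor C C id_functor" "preserves C W W id_functor"
proof -
  show "map_arrow (id_functor :: ('o, 'm, 'o, 'm) ftor) = (%x. x)" by (rule ext, rename_tac x, case_tac x) (auto simp: id_functor_def)
qed (auto simp: id_functor_def is_functor_def preserves_def)

lemma fcomp_simps [simp]: "ob (fcomp S T) a = ob S (ob T a)" "hm (fcomp S T) a b f = hm S (ob T a) (ob T b) (hm T a b f)"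
  "map_arrow (fcomp S T) = map_arrow S \<circ> map_arrow T"
proof -
  show "map_arrow (fcomp S T) = map_arrow S \<circ> map_arrow T" by (rule ext, rename_tac x, case_tac x) (auto simp: fcomp_def)
qed (auto simp: fcomp_def)

lemma is_functor_fcomp: "is_functor C D T ==> is_functor D E S ==> is_functor C E (fcomp S T)" by (simp add: is_functor_def)

lemma preserves_fcomp: "is_functor C D T ==> preserves C W W' T ==> preserves D W' W'' S ==> preserves C W W'' (fcomp S T)" by (simp add: is_functor_def preserves_def)

definition hom_adjunction :: "('o, 'm) cat => ('p, 'n) cat => ('o, 'm, 'p, 'n) ftor => ('p, 'n, 'o, 'm) ftor => ('o => 'p => 'n => 'm) => bool" where
  "hom_adjunction C D T U Ps \<longleftrightarrow> (\<forall>a\<in>Obj C. \<forall>d\<in>Obj D. bij_betw (Ps a d) (Hom D (ob T a) d) (Hom C a (ob U d))) \<and>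
     (\<forall>a\<in>Obj C. \<forall>d\<in>Obj D. \<forall>d'\<in>Obj D. \<forall>f\<in>Hom D (ob T a) d. \<forall>g\<in>Hom D d d'. Ps a d' (Comp D (ob T a) d d' g f) =
        Comp C a (ob U d) (ob U d') (hm U d d' g) (Ps a d f)) \<and>
     (\<forall>a\<in>Obj C. \<forall>b\<in>Obj C. \<forall>d\<in>Obj D. \<forall>h\<in>Hom C a b. \<forall>f\<in>Hom D (ob T b) d.
        Ps a d (Comp D (ob T a) (ob T b) d f (hm T a b h)) =
        Comp C a b (ob U d) (Ps b d f) h)"

lemma hom_adjunctionD: assumes "hom_adjunction C D T U Ps" shows "a \<in> Obj C ==> d \<in> Obj D ==> bij_betw (Ps a d) (Hom D (ob T a) d) (Hom C a (ob U d))"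
    and "a \<in> Obj C ==> d \<in> Obj D ==> d' \<in> Obj D ==> f \<in> Hom D (ob T a) d ==> g \<in> Hom D d d' ==> Ps a d' (Comp D (ob T a) d d' g f) =
        Comp C a (ob U d) (ob U d') (hm U d d' g) (Ps a d f)"
    and "a \<in> Obj C ==> b \<in> Obj C ==> d \<in> Obj D ==> h \<in> Hom C a b ==> f \<in> Hom D (ob T b) d ==> Ps a d (Comp D (ob T a) (ob T b) d f (hm T a b h)) =
        Comp C a b (ob U d) (Ps b d f) h"
  using assms unfolding hom_adjunction_def by blast+

text \<open>Unit and counit are natural transformations satisfying the triangle identities. These
  are equations between arrows, so they survive localization, and naturality extends to zigzags by
  \<open>zeq_naturality\<close>.\<close>

lemma right_adjoint_value_localization: assumes C: "is_category C" and D: "is_category D" and T: "is_functor C D T" "preserves C W W' T"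
    and U: "is_functor D C U" "preserves D W' W U"
    and adj: "hom_adjunction C D T U Ps" and d: "d \<in> Obj D"
  shows "right_adjoint_value (localization C W) (localization D W') (loc_lift C D W' T) d (ob U d)"
proof -
  note A = hom_adjunctionD[OF adj]
  note CD = is_categoryD[OF C]
  note DD = is_categoryD[OF D]
  note TD = is_functorD[OF T(1)]
  note UD = is_functorD[OF U(1)]
  \<comment> \<open>Unit and counit, the transposes of identities under \<open>Ps\<close> and its
    inverse.\<close>
  define et where "et a = Ps a (ob T a) (Idt D (ob T a))" for a
  define ka where "ka e = inv_into (Hom D (ob T (ob U e)) e) (Ps (ob U e) e) (Idt C (ob U e))" for e
  have Ps: "Ps a e f \<in> Hom C a (ob U e)" if "a \<in> Obj C" "e \<in> Obj D" "f \<in> Hom D (ob T a) e" for a e f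
    using A(1)[OF that(1,2)] that(3) by (auto simp: bij_betw_def)
  have Ps_inj: "f = g" if "Ps a e f = Ps a e g" "a \<in> Obj C" "e \<in> Obj D" "f \<in> Hom D (ob T a) e" "g \<in> Hom D (ob T a) e" for a e f g
    using A(1)[OF that(2,3)] that by (auto simp: bij_betw_def inj_on_def)
  have et: "et a \<in> Hom C a (ob U (ob T a))" if "a \<in> Obj C" for a unfolding et_def using that by (simp add: Ps TD DD)
  have ka: "ka e \<in> Hom D (ob T (ob U e)) e" "Ps (ob U e) e (ka e) = Idt C (ob U e)" if "e \<in> Obj D" for e
  proof -
    have "Idt C (ob U e) \<in> Ps (ob U e) e ` Hom D (ob T (ob U e)) e" using A(1)[of "ob U e" e] UD(1)[OF that] CD(1)[of "ob U e"] that by (simp add: bij_betw_def)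
    then show "ka e \<in> Hom D (ob T (ob U e)) e" "Ps (ob U e) e (ka e) = Idt C (ob U e)" unfolding ka_def by (rule inv_into_into, rule f_inv_into_f)
  qed
  have natet: "is_nat_trans C C id_functor (fcomp U T) et" unfolding is_nat_trans_def
  proof (intro conjI ballI)
    fix a b h assume h: "a \<in> Obj C" "b \<in> Obj C" "h \<in> Hom C a b"
    have "Comp C a b (ob U (ob T b)) (et b) h = Ps a (ob T b) (Comp D (ob T a) (ob T b) (ob T b) (Idt D (ob T b)) (hm T a b h))"
      unfolding et_def by (rule A(3)[symmetric]) (use h in "simp_all add: TD DD")
    also have "\<dots> = Ps a (ob T b) (Comp D (ob T a) (ob T a) (ob T b) (hm T a b h) (Idt D (ob T a)))" using h by (simp add: DD TD)
    also have "\<dots> = Comp C a (ob U (ob T a)) (ob U (ob T b)) (hm U (ob T a) (ob T b) (hm T a b h)) (et a)"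
      unfolding et_def by (rule A(2)) (use h in "simp_all add: TD DD")
    finally show "Comp C (ob id_functor a) (ob id_functor b) (ob (fcomp U T) b) (et b) (hm id_functor a b h) =
        Comp C (ob id_functor a) (ob (fcomp U T) a) (ob (fcomp U T) b) (hm (fcomp U T) a b h) (et a)"
      by simp
  qed (auto simp: et)
  have natka: "is_nat_trans D D (fcomp T U) id_functor ka" unfolding is_nat_trans_def
  proof (intro conjI ballI)
    fix e e' g assume g: "e \<in> Obj D" "e' \<in> Obj D" "g \<in> Hom D e e'"
    note o = UD(1)[OF g(1)] UD(1)[OF g(2)]
    have "Ps (ob U e) e' (Comp D (ob T (ob U e)) (ob T (ob U e')) e' (ka e') (hm T (ob U e) (ob U e') (hm U e e' g))) =
        Comp C (ob U e) (ob U e') (ob U e') (Idt C (ob U e')) (hm U e e' g)"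
      using g o by (subst A(3)) (simp_all add: ka UD)
    also have "\<dots> = Comp C (ob U e) (ob U e) (ob U e') (hm U e e' g) (Idt C (ob U e))" using g o by (simp add: CD UD)
    also have "\<dots> = Ps (ob U e) e' (Comp D (ob T (ob U e)) e e' g (ka e))" using g o by (subst A(2)) (simp_all add: ka)
    finally have "Comp D (ob T (ob U e)) (ob T (ob U e')) e' (ka e') (hm T (ob U e) (ob U e') (hm U e e' g)) = Comp D (ob T (ob U e)) e e' g (ka e)"
      by (rule Ps_inj) (use g o in "simp_all add: DD(2) ka TD UD")
    then show "Comp D (ob (fcomp T U) e) (ob (fcomp T U) e') (ob id_functor e') (ka e') (hm (fcomp T U) e e' g) =
        Comp D (ob (fcomp T U) e) (ob id_functor e) (ob id_functor e') (hm id_functor e e' g) (ka e)"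
      by simp
  qed (auto simp: ka)
  have tri1: "Comp D (ob T a) (ob T (ob U (ob T a))) (ob T a) (ka (ob T a)) (hm T a (ob U (ob T a)) (et a)) = Idt D (ob T a)" if a: "a \<in> Obj C" for a
  proof (rule Ps_inj)
    note o = TD(1)[OF a] UD(1)[OF TD(1)[OF a]]
    show "Ps a (ob T a) (Comp D (ob T a) (ob T (ob U (ob T a))) (ob T a) (ka (ob T a)) (hm T a (ob U (ob T a)) (et a))) = Ps a (ob T a) (Idt D (ob T a))"
      using a o by (subst A(3)) (simp_all add: ka et CD et_def[symmetric])
  qed (use a in "simp_all add: DD TD UD et ka")
  have tri2: "Comp C (ob U e) (ob U (ob T (ob U e))) (ob U e) (hm U (ob T (ob U e)) e (ka e)) (et (ob U e)) = Idt C (ob U e)" if e: "e \<in> Obj D" for e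
  proof -
    note o = UD(1)[OF e] TD(1)[OF UD(1)[OF e]]
    have "Comp C (ob U e) (ob U (ob T (ob U e))) (ob U e) (hm U (ob T (ob U e)) e (ka e)) (et (ob U e)) =
      Ps (ob U e) e (Comp D (ob T (ob U e)) (ob T (ob U e)) e (ka e) (Idt D (ob T (ob U e))))"
      unfolding et_def using o e by (subst A(2)) (simp_all add: ka DD)
    then show ?thesis using o e by (simp add: ka DD)
  qed
  let ?L = "localization C W" and ?M = "localization D W'" and ?R = "loc_lift C D W' T"
  let ?k = "zclass D W' (ob T (ob U d)) d [Fwd (ob T (ob U d)) d (ka d)]"
  note R = is_functor_loc_lift[OF T]
  note oU = UD(1)[OF d] TD(1)[OF UD(1)[OF d]]
  \<comment> \<open>The usual transpose: apply \<open>T\<close>, then the counit. Its inverse puts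
    the unit in front of the image under \<open>U\<close>.\<close>
  define Ph where "Ph a g = Comp ?M (ob T a) (ob T (ob U d)) d ?k (hm ?R a (ob U d) g)" for a g
  have zk: "zigzag D W' (ob T (ob U d)) d [Fwd (ob T (ob U d)) d (ka d)]" using oU d ka by (auto intro: zigzag_Fwd)
  have Ph: "Ph a (zclass C W a (ob U d) u) = zclass D W' (ob T a) d (map (map_arrow T) u @ [Fwd (ob T (ob U d)) d (ka d)])" if "zigzag C W a (ob U d) u" for a u
    unfolding Ph_def using that zk by (simp add: onHom_loc_lift[OF T] Comp_localization zigzag_map[OF T])
  have UT: "is_functor C C (fcomp U T)" "preserves C W W (fcomp U T)" using is_functor_fcomp[OF T(1) U(1)] preserves_fcomp[OF T U(2)] by auto
  have TU: "is_functor D D (fcomp T U)" "preserves D W' W' (fcomp T U)" using is_functor_fcomp[OF U(1) T(1)] preserves_fcomp[OF U T(2)] by auto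
  \<comment> \<open>By naturality of the unit \<open>u\<close> slides to the front; what is left at
    \<open>U d\<close> is the identity by \<open>tri2\<close>.\<close>
  have left: "zeq C W a (ob U d) (Fwd a (ob U (ob T a)) (et a) # map (map_arrow U) (map (map_arrow T) u @ [Fwd (ob T (ob U d)) d (ka d)])) u"
    if u: "zigzag C W a (ob U d) u" for a u
  proof -
    have a: "a \<in> Obj C" using zigzag_objs[OF u] by simp
    note nu = zeq_naturality[OF C id_functor(4,5) UT natet u]
    have 1: "zeq C W a (ob U d) ((Fwd a (ob U (ob T a)) (et a) # map (map_arrow U \<circ> map_arrow T) u) @
            [Fwd (ob U (ob T (ob U d))) (ob U d) (hm U (ob T (ob U d)) d (ka d))])
        ((u @ [Fwd (ob U d) (ob U (ob T (ob U d))) (et (ob U d))]) @ [Fwd (ob U (ob T (ob U d))) (ob U d) (hm U (ob T (ob U d)) d (ka d))])"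
      by (rule zeq_appR[OF zeq_sym]) (use nu zigzag_map[OF U zk] in simp_all)
    have "zeq C W (ob U d) (ob U d) [Fwd (ob U d) (ob U (ob T (ob U d))) (et (ob U d)), Fwd (ob U (ob T (ob U d))) (ob U d) (hm U (ob T (ob U d)) d (ka d))] []"
    proof (rule zeq_trans[OF zeq_comp])
      show "zeq C W (ob U d) (ob U d) [Fwd (ob U d) (ob U d) (Comp C (ob U d) (ob U (ob T (ob U d))) (ob U d) (hm U (ob T (ob U d)) d (ka d)) (et (ob U d)))] []"
        unfolding tri2[OF d] by (rule zeq_id[OF oU(1)])
    qed (use oU d in "simp_all add: et ka UD")
    then have 2: "zeq C W a (ob U d) (u @ [Fwd (ob U d) (ob U (ob T (ob U d))) (et (ob U d)),
        Fwd (ob U (ob T (ob U d))) (ob U d) (hm U (ob T (ob U d)) d (ka d))]) (u @ [])"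
      by (rule zeq_appL[OF u])
    show ?thesis using zeq_trans[OF 1[simplified] 2[simplified]] by simp
  qed
  \<comment> \<open>Dually, \<open>v\<close> slides past the counit, and \<open>tri1\<close> removes
    what is left at \<open>T a\<close>.\<close>
  have right: "zeq D W' (ob T a) d (map (map_arrow T) (Fwd a (ob U (ob T a)) (et a) # map (map_arrow U) v) @ [Fwd (ob T (ob U d)) d (ka d)]) v"
    if a: "a \<in> Obj C" and v: "zigzag D W' (ob T a) d v" for a v
  proof -
    note o = TD(1)[OF a] UD(1)[OF TD(1)[OF a]] TD(1)[OF UD(1)[OF TD(1)[OF a]]]
    note nu = zeq_naturality[OF D TU id_functor(4,5) natka v]
    have 1: "zeq D W' (ob T a) d ([Fwd (ob T a) (ob T (ob U (ob T a))) (hm T a (ob U (ob T a)) (et a))] @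
           (map (map_arrow T \<circ> map_arrow U) v @ [Fwd (ob T (ob U d)) d (ka d)]))
        ([Fwd (ob T a) (ob T (ob U (ob T a))) (hm T a (ob U (ob T a)) (et a))] @ (Fwd (ob T (ob U (ob T a))) (ob T a) (ka (ob T a)) # v))"
      by (rule zeq_appL) (use nu a o in "simp_all add: zigzag_Fwd et TD")
    have "zeq D W' (ob T a) (ob T a) [Fwd (ob T a) (ob T (ob U (ob T a))) (hm T a (ob U (ob T a)) (et a)), Fwd (ob T (ob U (ob T a))) (ob T a) (ka (ob T a))] []"
    proof (rule zeq_trans[OF zeq_comp])
      show "zeq D W' (ob T a) (ob T a) [Fwd (ob T a) (ob T a) (Comp D (ob T a) (ob T (ob U (ob T a))) (ob T a) (ka (ob T a)) (hm T a (ob U (ob T a)) (et a)))] []"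
        unfolding tri1[OF a] by (rule zeq_id[OF o(1)])
    qed (use o a in "simp_all add: et ka TD")
    then have 2: "zeq D W' (ob T a) d ([Fwd (ob T a) (ob T (ob U (ob T a))) (hm T a (ob U (ob T a)) (et a)),
        Fwd (ob T (ob U (ob T a))) (ob T a) (ka (ob T a))] @ v) ([] @ v)"
      by (rule zeq_appR[OF _ v])
    show ?thesis using zeq_trans[OF 1[simplified] 2[simplified]] by simp
  qed
  have bij: "bij_betw (Ph a) (Hom ?L a (ob U d)) (Hom ?M (ob ?R a) d)" if a: "a \<in> Obj C" for a unfolding bij_betw_def
  proof
    show "inj_on (Ph a) (Hom ?L a (ob U d))"
    proof (rule inj_onI)
      fix f g assume fg: "f \<in> Hom ?L a (ob U d)" "g \<in> Hom ?L a (ob U d)" "Ph a f = Ph a g"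
      obtain u v where uv: "zigzag C W a (ob U d) u" "f = zclass C W a (ob U d) u" "zigzag C W a (ob U d) v" "g = zclass C W a (ob U d) v"
        using fg by (auto elim!: Hom_localizationE)
      let ?e = "[Fwd (ob T (ob U d)) d (ka d)]"
      have "zigzag D W' (ob T a) d (map (map_arrow T) u @ ?e)" by (rule zigzag_append[OF zigzag_map[OF T uv(1)] zk])
      then have "zeq D W' (ob T a) d (map (map_arrow T) u @ ?e) (map (map_arrow T) v @ ?e)"
        using fg(3) unfolding uv(2,4) Ph[OF uv(1)] Ph[OF uv(3)] by (rule zclass_eq_iff[THEN iffD1])
      from zeq_map[OF U this]
      have "zeq C W a (ob U d) ([Fwd a (ob U (ob T a)) (et a)] @ map (map_arrow U) (map (map_arrow T) u @ ?e))
          ([Fwd a (ob U (ob T a)) (et a)] @ map (map_arrow U) (map (map_arrow T) v @ ?e))"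
        by (rule zeq_appL[rotated]) (use a in "simp_all add: zigzag_Fwd et TD UD")
      then have "zeq C W a (ob U d) u v" using zeq_trans[OF zeq_trans[OF zeq_sym[OF left[OF uv(1)]]] left[OF uv(3)]] by simp
      then show "f = g" unfolding uv(2,4) by (rule zclass_eqI)
    qed
    show "Ph a ` Hom ?L a (ob U d) = Hom ?M (ob ?R a) d"
    proof (intro equalityI subsetI)
      fix g assume "g \<in> Ph a ` Hom ?L a (ob U d)"
      then obtain u where u: "zigzag C W a (ob U d) u" "g = Ph a (zclass C W a (ob U d) u)" by (auto elim!: Hom_localizationE)
      show "g \<in> Hom ?M (ob ?R a) d" unfolding u(2) Ph[OF u(1)] onObj_loc_lift by (rule Hom_localizationI[OF zigzag_append[OF zigzag_map[OF T u(1)] zk]])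
    next
      fix g assume "g \<in> Hom ?M (ob ?R a) d"
      then obtain v where v: "zigzag D W' (ob T a) d v" "g = zclass D W' (ob T a) d v" by (auto elim!: Hom_localizationE)
      let ?u = "Fwd a (ob U (ob T a)) (et a) # map (map_arrow U) v"
      have u: "zigzag C W a (ob U d) ?u" using zigzag_map[OF U v(1)] a by (simp add: zz_fwd et TD UD)
      have "Ph a (zclass C W a (ob U d) ?u) = g" unfolding Ph[OF u] v(2) by (rule zclass_eqI[OF right[OF a v(1)]])
      then show "g \<in> Ph a ` Hom ?L a (ob U d)" using Hom_localizationI[OF u] by (metis image_eqI)
    qed
  qed
  have nat: "Ph a (Comp ?L a b (ob U d) g f) = Comp ?M (ob ?R a) (ob ?R b) d (Ph b g) (hm ?R a b f)" if fg: "f \<in> Hom ?L a b" "g \<in> Hom ?L b (ob U d)" for a b f g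
  proof -
    obtain u v where uv: "zigzag C W a b u" "f = zclass C W a b u" "zigzag C W b (ob U d) v" "g = zclass C W b (ob U d) v" using fg by (elim Hom_localizationE)
    show ?thesis using uv(1,3) zigzag_append[OF uv(1,3)] zigzag_map[OF T uv(1)] zigzag_append[OF zigzag_map[OF T uv(3)] zk]
      unfolding uv by (simp add: Comp_localization Ph onHom_loc_lift[OF T])
  qed
  show ?thesis unfolding right_adjoint_value_def using bij nat oU d by (intro conjI exI[of _ Ph]) simp_all
qed

section \<open>Representing objects and derived functors\<close>

definition inv_pair :: "('o, 'm) cat => 'o => 'o => 'm => 'm => bool" where
  "inv_pair C a b f g \<longleftrightarrow> a \<in> Obj C \<and> b \<in> Obj C \<and> f \<in> Hom C a b \<and> g \<in> Hom C b a \<and>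
     Comp C a b a g f = Idt C a \<and> Comp C b a b f g = Idt C b"

lemma inv_pairD: assumes "inv_pair C a b f g" shows "a \<in> Obj C" "b \<in> Obj C" "f \<in> Hom C a b" "g \<in> Hom C b a"
    "Comp C a b a g f = Idt C a" "Comp C b a b f g = Idt C b"
  using assms by (auto simp: inv_pair_def)

lemma inv_pair_sym: "inv_pair C a b f g ==> inv_pair C b a g f" by (auto simp: inv_pair_def)

lemma inv_pair_cancel_left: assumes C: "is_category C" and p: "inv_pair C a b f g" and c: "c \<in> Obj C" "u \<in> Hom C c a"
  shows "Comp C c b a g (Comp C c a b f u) = u"
  using is_categoryD(5)[OF C c(1) inv_pairD(1,2,1)[OF p] c(2) inv_pairD(3,4)[OF p]] inv_pairD[OF p] c by (simp add: is_categoryD[OF C])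

lemma inv_pair_cancel_right: assumes C: "is_category C" and p: "inv_pair C a b f g" and c: "c \<in> Obj C" "u \<in> Hom C a c"
  shows "Comp C b a c u g \<in> Hom C b c" "Comp C a b c (Comp C b a c u g) f = u"
  using is_categoryD(5)[OF C inv_pairD(1,2,1)[OF p] c(1) inv_pairD(3,4)[OF p] c(2)] inv_pairD[OF p] c by (simp_all add: is_categoryD[OF C])

lemma inv_pair_functor: assumes "is_functor C D T" "inv_pair C a b f g" shows "inv_pair D (ob T a) (ob T b) (hm T a b f) (hm T b a g)"
proof -
  note i = inv_pairD[OF assms(2)]
  show ?thesis using i is_functorD(4)[OF assms(1) i(1,2,1,3,4)] is_functorD(4)[OF assms(1) i(2,1,2,4,3)] by (simp add: inv_pair_def is_functorD[OF assms(1)])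
qed

lemma inv_pair_localization: assumes "a \<in> Obj C" "b \<in> Obj C" "w \<in> Hom C a b" "W a b w"
  shows "inv_pair (localization C W) a b (zclass C W a b [Fwd a b w]) (zclass C W b a [Bwd a b w])"
proof -
  note z = zigzag_Fwd[OF assms(1-3), of W] zigzag_Bwd[where W = W, OF assms]
  show ?thesis using assms z zeq_inv1[where W = W, OF assms] zeq_inv2[where W = W, OF assms] by (simp add: inv_pair_def Hom_localizationI Comp_localization zclass_eqI)
qed

text \<open>Yoneda: the two bijections turn the identities of \<open>e\<close> and \<open>e'\<close>
  into morphisms between them, and naturality shows that both composites correspond to
  identities.\<close>

lemma right_adjoint_value_unique: assumes C: "is_category C" and D: "is_category D" and R: "is_functor C D R"
    and e: "right_adjoint_value C D R z e" and e': "right_adjoint_value C D R z e'"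
  shows "isomorphic_in C e e'"
proof -
  note CD = is_categoryD[OF C]
  obtain Ph where Ph: "\<And>a. a \<in> Obj C ==> bij_betw (Ph a) (Hom C a e) (Hom D (ob R a) z)"
      "\<And>a b f g. a \<in> Obj C ==> b \<in> Obj C ==> f \<in> Hom C a b ==> g \<in> Hom C b e ==>
        Ph a (Comp C a b e g f) = Comp D (ob R a) (ob R b) z (Ph b g) (hm R a b f)"
    using e unfolding right_adjoint_value_def by blast
  obtain Ph' where Ph': "\<And>a. a \<in> Obj C ==> bij_betw (Ph' a) (Hom C a e') (Hom D (ob R a) z)"
      "\<And>a b f g. a \<in> Obj C ==> b \<in> Obj C ==> f \<in> Hom C a b ==> g \<in> Hom C b e' ==>
        Ph' a (Comp C a b e' g f) = Comp D (ob R a) (ob R b) z (Ph' b g) (hm R a b f)"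
    using e' unfolding right_adjoint_value_def by blast
  have o: "e \<in> Obj C" "e' \<in> Obj C" using e e' by (auto simp: right_adjoint_value_def)
  have "Ph e (Idt C e) \<in> Hom D (ob R e) z" "Ph' e' (Idt C e') \<in> Hom D (ob R e') z"
    using Ph(1)[OF o(1)] Ph'(1)[OF o(2)] CD(1)[OF o(1)] CD(1)[OF o(2)] bij_betwE by metis+
  then obtain f g where f: "f \<in> Hom C e e'" "Ph' e f = Ph e (Idt C e)" and g: "g \<in> Hom C e' e" "Ph e' g = Ph' e' (Idt C e')"
    using Ph'(1)[OF o(1)] Ph(1)[OF o(2)] unfolding bij_betw_def by (metis imageE)
  have gf: "Comp C e e' e g f \<in> Hom C e e" "Comp C e' e e' f g \<in> Hom C e' e'" using o f g by (simp_all add: CD(2))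
  have "Ph e (Comp C e e' e g f) = Ph' e (Comp C e e' e' (Idt C e') f)" using o f g by (simp add: Ph(2) Ph'(2) CD(1))
  then have "Ph e (Comp C e e' e g f) = Ph e (Idt C e)" using o f by (simp add: CD)
  then have 1: "Comp C e e' e g f = Idt C e" using Ph(1)[OF o(1)] gf CD(1)[OF o(1)] by (meson bij_betw_imp_inj_on inj_onD)
  have "Ph' e' (Comp C e' e e' f g) = Ph e' (Comp C e' e e (Idt C e) g)" using o f g by (simp add: Ph(2) Ph'(2) CD(1))
  then have "Ph' e' (Comp C e' e e' f g) = Ph' e' (Idt C e')" using o g by (simp add: CD)
  then have 2: "Comp C e' e e' f g = Idt C e'" using Ph'(1)[OF o(2)] gf CD(1)[OF o(2)] by (meson bij_betw_imp_inj_on inj_onD)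
  show ?thesis unfolding isomorphic_in_def using o f g 1 2 by blast
qed

text \<open>Composing with the invertible components of \<open>th\<close> carries the bijections for
  \<open>R\<close> to bijections for \<open>R'\<close>. It serves to replace an arbitrary derived
  functor by the explicit one.\<close>

lemma right_adjoint_value_nat_iso: assumes C: "is_category C" and D: "is_category D" and R: "is_functor C D R" and R': "is_functor C D R'"
    and th: "is_nat_trans C D R' R th"
    and inv: "\<And>a. a \<in> Obj C ==> inv_pair D (ob R' a) (ob R a) (th a) (th' a)"
    and e: "right_adjoint_value C D R z e"
  shows "right_adjoint_value C D R' z e"
proof -
  note DD = is_categoryD[OF D]
  obtain Ph where Ph: "\<And>a. a \<in> Obj C ==> bij_betw (Ph a) (Hom C a e) (Hom D (ob R a) z)"
      "\<And>a b f g. a \<in> Obj C ==> b \<in> Obj C ==> f \<in> Hom C a b ==> g \<in> Hom C b e ==>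
        Ph a (Comp C a b e g f) = Comp D (ob R a) (ob R b) z (Ph b g) (hm R a b f)"
    using e unfolding right_adjoint_value_def by blast
  have o: "e \<in> Obj C" "z \<in> Obj D" using e by (auto simp: right_adjoint_value_def)
  define Ps where "Ps a g = Comp D (ob R' a) (ob R a) z (Ph a g) (th a)" for a g
  have pre: "bij_betw (%h. Comp D (ob R' a) (ob R a) z h (th a)) (Hom D (ob R a) z) (Hom D (ob R' a) z)" if a: "a \<in> Obj C" for a
  proof (rule bij_betwI)
    note i = inv_pairD[OF inv[OF a]]
    show "(%h. Comp D (ob R' a) (ob R a) z h (th a)) \<in> Hom D (ob R a) z \<rightarrow> Hom D (ob R' a) z" using i o by (simp add: DD(2))
    show "(%h. Comp D (ob R a) (ob R' a) z h (th' a)) \<in> Hom D (ob R' a) z \<rightarrow> Hom D (ob R a) z" using i o by (simp add: DD(2))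
  qed (use inv_pair_cancel_right[OF D inv[OF a] o(2)] inv_pair_cancel_right[OF D inv_pair_sym[OF inv[OF a]] o(2)] in simp_all)
  have "bij_betw (Ps a) (Hom C a e) (Hom D (ob R' a) z)" if a: "a \<in> Obj C" for a
    using bij_betw_trans[OF Ph(1)[OF a] pre[OF a]] by (simp add: Ps_def[abs_def] comp_def)
  moreover have "Ps a (Comp C a b e g f) = Comp D (ob R' a) (ob R' b) z (Ps b g) (hm R' a b f)"
    if h: "a \<in> Obj C" "b \<in> Obj C" "f \<in> Hom C a b" "g \<in> Hom C b e" for a b f g
  proof -
    note ia = inv_pairD[OF inv[OF h(1)]] and ib = inv_pairD[OF inv[OF h(2)]]
    have gz: "Ph b g \<in> Hom D (ob R b) z" using Ph(1)[OF h(2)] h(4) by (auto simp: bij_betw_def)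
    note f = is_functorD(2)[OF R h(1,2,3)] is_functorD(2)[OF R' h(1,2,3)]
    have "Ps a (Comp C a b e g f) = Comp D (ob R' a) (ob R b) z (Ph b g) (Comp D (ob R' a) (ob R a) (ob R b) (hm R a b f) (th a))"
      unfolding Ps_def Ph(2)[OF h] using gz f ia ib o by (simp add: DD(5))
    also have "\<dots> = Comp D (ob R' a) (ob R b) z (Ph b g) (Comp D (ob R' a) (ob R' b) (ob R b) (th b) (hm R' a b f))" using is_nat_transD(2)[OF th h(1-3)] by simp
    also have "\<dots> = Comp D (ob R' a) (ob R' b) z (Ps b g) (hm R' a b f)" unfolding Ps_def using gz f ia ib o by (simp add: DD(5))
    finally show ?thesis .
  qed
  ultimately show ?thesis unfolding right_adjoint_value_def using o by blast
qed

lemma right_adjoint_value_fcomp: assumes L: "is_functor C D L" and e: "right_adjoint_value C D L d e" and d: "right_adjoint_value D E M z d"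
  shows "right_adjoint_value C E (fcomp M L) z e"
proof -
  obtain Ph where Ph: "\<And>a. a \<in> Obj C ==> bij_betw (Ph a) (Hom C a e) (Hom D (ob L a) d)"
      "\<And>a b f g. a \<in> Obj C ==> b \<in> Obj C ==> f \<in> Hom C a b ==> g \<in> Hom C b e ==>
        Ph a (Comp C a b e g f) = Comp D (ob L a) (ob L b) d (Ph b g) (hm L a b f)"
    using e unfolding right_adjoint_value_def by blast
  obtain Ph' where Ph': "\<And>a. a \<in> Obj D ==> bij_betw (Ph' a) (Hom D a d) (Hom E (ob M a) z)"
      "\<And>a b f g. a \<in> Obj D ==> b \<in> Obj D ==> f \<in> Hom D a b ==> g \<in> Hom D b d ==>
        Ph' a (Comp D a b d g f) = Comp E (ob M a) (ob M b) z (Ph' b g) (hm M a b f)"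
    using d unfolding right_adjoint_value_def by blast
  note LD = is_functorD[OF L]
  have in_hom: "Ph b g \<in> Hom D (ob L b) d" if "b \<in> Obj C" "g \<in> Hom C b e" for b g using Ph(1)[OF that(1)] that(2) by (auto simp: bij_betw_def)
  have "bij_betw (Ph' (ob L a) \<circ> Ph a) (Hom C a e) (Hom E (ob (fcomp M L) a) z)" if "a \<in> Obj C" for a
    using bij_betw_trans[OF Ph(1)[OF that] Ph'(1)[OF LD(1)[OF that]]] by simp
  moreover have "(Ph' (ob L a) \<circ> Ph a) (Comp C a b e g f) = Comp E (ob (fcomp M L) a) (ob (fcomp M L) b) z ((Ph' (ob L b) \<circ> Ph b) g) (hm (fcomp M L) a b f)"
    if "a \<in> Obj C" "b \<in> Obj C" "f \<in> Hom C a b" "g \<in> Hom C b e" for a b f g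
    using that by (simp add: Ph(2) Ph'(2) LD in_hom)
  ultimately show ?thesis using e d unfolding right_adjoint_value_def by (intro conjI exI[of _ "%a. Ph' (ob L a) \<circ> Ph a"]) blast+
qed

lemma right_adjoint_value_cong: assumes "\<And>a. a \<in> Obj C ==> ob R a = ob R' a"
    and "\<And>a b f. a \<in> Obj C ==> b \<in> Obj C ==> f \<in> Hom C a b ==> hm R a b f = hm R' a b f"
    and "right_adjoint_value C D R z e"
  shows "right_adjoint_value C D R' z e"
  using assms(3) unfolding right_adjoint_value_def by (simp add: assms(1,2))

subsection \<open>Commuting squares\<close>

text \<open>The side conditions on objects and arrows are bundled with the equation, so that squares
  can be pasted and inverted without repeating them: \<open>u\<close> and \<open>v\<close> are the
  sides that get composed, \<open>f\<close> and \<open>f'\<close> the edges that are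
  compared.\<close>

definition sq :: "('o, 'm) cat => 'o => 'o => 'o => 'o => 'm => 'm => 'm => 'm => bool" where
  "sq C a b a' b' u v f f' \<longleftrightarrow> a \<in> Obj C \<and> b \<in> Obj C \<and> a' \<in> Obj C \<and> b' \<in> Obj C \<and>
     u \<in> Hom C a a' \<and> v \<in> Hom C b b' \<and> f \<in> Hom C a b \<and> f' \<in> Hom C a' b' \<and>
     Comp C a b b' v f = Comp C a a' b' f' u"

lemma sq_comp: assumes C: "is_category C" and 1: "sq C a b a' b' u v f f'" and 2: "sq C a' b' a'' b'' u' v' f' f''"
  shows "sq C a b a'' b'' (Comp C a a' a'' u' u) (Comp C b b' b'' v' v) f f''"
proof -
  note CD = is_categoryD[OF C]
  note s = 1[unfolded sq_def] 2[unfolded sq_def]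
  have "Comp C a b b'' (Comp C b b' b'' v' v) f = Comp C a b' b'' v' (Comp C a a' b' f' u)" using s by (simp add: CD(5))
  also have "\<dots> = Comp C a a' b'' (Comp C a' b' b'' v' f') u" using s by (subst CD(5)) simp_all
  also have "\<dots> = Comp C a a'' b'' f'' (Comp C a a' a'' u' u)" using s by (simp add: CD(5))
  finally show ?thesis using s by (simp add: sq_def CD(2))
qed

lemma sq_inverse: assumes C: "is_category C" and s: "sq C a b a' b' u v f f'" and u: "inv_pair C a a' u u'" and v: "inv_pair C b b' v v'"
  shows "sq C a' b' a b u' v' f' f"
proof -
  note CD = is_categoryD[OF C]
  note s = s[unfolded sq_def] inv_pairD[OF u] inv_pairD[OF v]
  have "Comp C a' b' b v' f' = Comp C a' b' b v' (Comp C a' a b' (Comp C a a' b' f' u) u')" using s by (simp add: CD)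
  also have "\<dots> = Comp C a' b' b v' (Comp C a' b b' v (Comp C a' a b f u'))" using s by (metis CD(5))
  also have "\<dots> = Comp C a' a b f u'" by (rule inv_pair_cancel_left[OF C v]) (use s in "simp_all add: CD(2)")
  finally show ?thesis using s by (simp add: sq_def)
qed

lemma is_nat_trans_iff_sq: assumes "is_functor C D S" "is_functor C D T"
  shows "is_nat_trans C D S T et \<longleftrightarrow> (\<forall>a\<in>Obj C. et a \<in> Hom D (ob S a) (ob T a)) \<and>
    (\<forall>a\<in>Obj C. \<forall>b\<in>Obj C. \<forall>f\<in>Hom C a b. sq D (ob S a) (ob S b) (ob T a) (ob T b) (et a) (et b) (hm S a b f) (hm T a b f))"
  unfolding is_nat_trans_def sq_def
  using is_functorD(1,2)[OF assms(1)] is_functorD(1,2)[OF assms(2)] by blast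

text \<open>Squares can be pasted, and functors turn the inverted arrows into invertible ones, so
  naturality against arrows of \<open>C\<close> passes to inverses and then to all zigzags.\<close>

lemma is_nat_trans_localizationI: assumes C: "is_category C" and D: "is_category D" and S: "is_functor (localization C W) D S" and T: "is_functor (localization C W) D T"
    and th: "\<And>a. a \<in> Obj C ==> th a \<in> Hom D (ob S a) (ob T a)"
    and nat: "\<And>a b f. a \<in> Obj C ==> b \<in> Obj C ==> f \<in> Hom C a b ==> sq D (ob S a) (ob S b) (ob T a) (ob T b) (th a) (th b)
        (hm S a b (zclass C W a b [Fwd a b f])) (hm T a b (zclass C W a b [Fwd a b f]))"
  shows "is_nat_trans (localization C W) D S T th"
proof -
  let ?L = "localization C W"
  have main: "sq D (ob S a) (ob S b) (ob T a) (ob T b) (th a) (th b) (hm S a b (zclass C W a b u)) (hm T a b (zclass C W a b u))" if "zigzag C W a b u" for a b u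
    using that
  proof (induction rule: zigzag.induct)
    case (zz_nil a)
    then show ?case using is_functorD(1,3)[OF S, of a] is_functorD(1,3)[OF T, of a] th[of a] by (simp add: sq_def is_categoryD[OF D])
  next
    case (zz_fwd a b f c u)
    note o = zz_fwd.hyps(1,2) zigzag_objs[OF zz_fwd.hyps(4), THEN conjunct2]
    have eq: "zclass C W a c (Fwd a b f # u) = Comp ?L a b c (zclass C W b c u) (zclass C W a b [Fwd a b f])"
      using zz_fwd.hyps by (simp add: Comp_localization zigzag_Fwd)
    have h: "zclass C W a b [Fwd a b f] \<in> Hom ?L a b" "zclass C W b c u \<in> Hom ?L b c" using zz_fwd.hyps by (simp_all add: Hom_localizationI zigzag_Fwd)
    have "hm S a c (zclass C W a c (Fwd a b f # u)) = Comp D (ob S a) (ob S b) (ob S c) (hm S b c (zclass C W b c u)) (hm S a b (zclass C W a b [Fwd a b f]))"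
      "hm T a c (zclass C W a c (Fwd a b f # u)) = Comp D (ob T a) (ob T b) (ob T c) (hm T b c (zclass C W b c u)) (hm T a b (zclass C W a b [Fwd a b f]))"
      unfolding eq using h o by (simp_all add: is_functorD(4)[OF S] is_functorD(4)[OF T])
    moreover have "sq D (ob S a) (ob T a) (ob S b) (ob T b) (hm S a b (zclass C W a b [Fwd a b f])) (hm T a b (zclass C W a b [Fwd a b f])) (th a) (th b)"
      using nat[OF zz_fwd.hyps(1-3)] by (auto simp: sq_def)
    moreover have "sq D (ob S b) (ob T b) (ob S c) (ob T c) (hm S b c (zclass C W b c u)) (hm T b c (zclass C W b c u)) (th b) (th c)"
      using zz_fwd.IH by (auto simp: sq_def)
    ultimately show ?case using sq_comp[OF D] by (fastforce simp: sq_def)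
  next
    case (zz_bwd a b w c u)
    note o = zz_bwd.hyps(1,2) zigzag_objs[OF zz_bwd.hyps(5), THEN conjunct2]
    have eq: "zclass C W b c (Bwd a b w # u) = Comp ?L b a c (zclass C W a c u) (zclass C W b a [Bwd a b w])"
      using zz_bwd.hyps by (simp add: Comp_localization zigzag_Bwd)
    have h: "zclass C W b a [Bwd a b w] \<in> Hom ?L b a" "zclass C W a c u \<in> Hom ?L a c" using zz_bwd.hyps by (simp_all add: Hom_localizationI zigzag_Bwd)
    note ip = inv_pair_localization[where C = C and W = W, OF zz_bwd.hyps(1-4)]
    have "hm S b c (zclass C W b c (Bwd a b w # u)) = Comp D (ob S b) (ob S a) (ob S c) (hm S a c (zclass C W a c u)) (hm S b a (zclass C W b a [Bwd a b w]))"
      "hm T b c (zclass C W b c (Bwd a b w # u)) = Comp D (ob T b) (ob T a) (ob T c) (hm T a c (zclass C W a c u)) (hm T b a (zclass C W b a [Bwd a b w]))"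
      unfolding eq using h o by (simp_all add: is_functorD(4)[OF S] is_functorD(4)[OF T])
    moreover have "sq D (ob S a) (ob T a) (ob S b) (ob T b) (hm S a b (zclass C W a b [Fwd a b w])) (hm T a b (zclass C W a b [Fwd a b w])) (th a) (th b)"
      using nat[OF zz_bwd.hyps(1-3)] by (auto simp: sq_def)
    then have "sq D (ob S b) (ob T b) (ob S a) (ob T a) (hm S b a (zclass C W b a [Bwd a b w])) (hm T b a (zclass C W b a [Bwd a b w])) (th b) (th a)"
      by (rule sq_inverse[OF D _ inv_pair_functor[OF S ip] inv_pair_functor[OF T ip]])
    moreover have "sq D (ob S a) (ob T a) (ob S c) (ob T c) (hm S a c (zclass C W a c u)) (hm T a c (zclass C W a c u)) (th a) (th c)"
      using zz_bwd.IH by (auto simp: sq_def)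
    ultimately show ?case using sq_comp[OF D] by (fastforce simp: sq_def)
  qed
  show ?thesis unfolding is_nat_trans_iff_sq[OF S T] using th main by (auto elim!: Hom_localizationE)
qed

subsection \<open>Derived functors from resolutions\<close>

text \<open>A resolution \<open>i : a \<rightarrow> K a\<close>, functorial in \<open>C\<close>, with \<open>G (K a) \<rightarrow> T (K a)\<close> inverted,
  forces the comparison \<open>th a : T a \<rightarrow> S a\<close> to be \<open>S(i)\<inverse> \<circ> et(K a) \<circ> eps(K a)\<inverse> \<circ> T(i)\<close>.\<close>

lemma is_total_right_derivedI: assumes C: "is_category C" and D: "is_category D" and G: "is_functor C D G" and T: "is_functor C D T" "preserves C W W' T"
    and eps: "is_nat_trans C D G T eps"
    and K: "is_functor C C K" and i: "is_nat_trans C C id_functor K i"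
    and Wi: "\<And>a. a \<in> Obj C ==> W a (ob K a) (i a)"
    and Weps: "\<And>a. a \<in> Obj C ==> W' (ob G (ob K a)) (ob T (ob K a)) (eps (ob K a))"
  shows "is_total_right_derived C W D W' G (loc_lift C D W' T) (%a. zclass D W' (ob G a) (ob T a) [Fwd (ob G a) (ob T a) (eps a)])"
proof -
  let ?L = "localization C W" and ?M = "localization D W'" and ?R = "loc_lift C D W' T"
  let ?Q = "%a b f. zclass C W a b [Fwd a b f]" and ?P = "%a b f. zclass D W' a b [Fwd a b f]"
  let ?G = "ob G" and ?T = "ob T" and ?K = "ob K"
  note L = is_category_localization[of C W] and M = is_category_localization[of D W']
  note LD = is_categoryD[OF L] and MD = is_categoryD[OF M]
  note GD = is_functorD[OF G] and TD = is_functorD[OF T(1)] and KD = is_functorD[OF K]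
  note R = is_functor_loc_lift[OF T]
  note iD = is_nat_transD[OF i, simplified] and epsD = is_nat_transD[OF eps]
  have RQ: "hm ?R a b (?Q a b f) = ?P (?T a) (?T b) (hm T a b f)" if "a \<in> Obj C" "b \<in> Obj C" "f \<in> Hom C a b" for a b f
    by (simp add: onHom_loc_lift[OF T zigzag_Fwd[OF that]])
  have Qin: "?Q a b f \<in> Hom ?L a b" if "a \<in> Obj C" "b \<in> Obj C" "f \<in> Hom C a b" for a b f by (rule Hom_localizationI[OF zigzag_Fwd[OF that]])
  have Pin: "?P a b f \<in> Hom ?M a b" if "a \<in> Obj D" "b \<in> Obj D" "f \<in> Hom D a b" for a b f by (rule Hom_localizationI[OF zigzag_Fwd[OF that]])
  have sqP: "sq ?M a b a' b' (?P a a' u) (?P b b' v) (?P a b f) (?P a' b' f')" if "sq D a b a' b' u v f f'" for a b a' b' u v f f'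
    using that by (simp add: sq_def Pin loc_functor_Comp)
  have sqQ: "sq ?L a b a' b' (?Q a a' u) (?Q b b' v) (?Q a b f) (?Q a' b' f')" if "sq C a b a' b' u v f f'" for a b a' b' u v f f'
    using that by (simp add: sq_def Qin loc_functor_Comp)
  have sqeps: "sq D (?G a) (?G b) (?T a) (?T b) (eps a) (eps b) (hm G a b f) (hm T a b f)" if "a \<in> Obj C" "b \<in> Obj C" "f \<in> Hom C a b" for a b f
    using that by (simp add: sq_def GD TD epsD)
  have sqi: "sq C a b (?K a) (?K b) (i a) (i b) f (hm K a b f)" if "a \<in> Obj C" "b \<in> Obj C" "f \<in> Hom C a b" for a b f using that by (simp add: sq_def KD iD)
  have sqF: "sq E2 (ob F a) (ob F b) (ob F a') (ob F b') (hm F a a' u) (hm F b b' v) (hm F a b f) (hm F a' b' f')"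
    if s: "sq E1 a b a' b' u v f f'" and F: "is_functor E1 E2 F" for E1 :: "('c1,'c2) cat" and E2 :: "('c3,'c4) cat" and a b a' b' u v f f' F
    using s is_functorD(4)[OF F, of a b b' f v] is_functorD(4)[OF F, of a a' b' u f'] by (simp add: sq_def is_functorD(1,2)[OF F])
  have ei: "inv_pair ?M (?G (?K a)) (?T (?K a)) (?P (?G (?K a)) (?T (?K a)) (eps (?K a)))
      (zclass D W' (?T (?K a)) (?G (?K a)) [Bwd (?G (?K a)) (?T (?K a)) (eps (?K a))])"
    if "a \<in> Obj C" for a
    by (rule inv_pair_localization) (use that in "simp_all add: Weps GD TD KD epsD")
  have ii: "inv_pair ?L a (?K a) (?Q a (?K a) (i a)) (zclass C W (?K a) a [Bwd a (?K a) (i a)])" if "a \<in> Obj C" for a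
    by (rule inv_pair_localization) (use that in "simp_all add: Wi KD iD")
  have nateps: "is_nat_trans C ?M (fcomp (loc_functor D W') G) (fcomp ?R (loc_functor C W)) (%a. ?P (?G a) (?T a) (eps a))"
    using sqP[OF sqeps] by (simp add: is_nat_trans_def sq_def RQ Pin GD TD epsD)
  have main: "(\<exists>th. is_nat_trans ?L ?M ?R S th \<and> (\<forall>a\<in>Obj C. Comp ?M (?G a) (?T a) (ob S a) (th a) (?P (?G a) (?T a) (eps a)) = et a)) \<and>
     (\<forall>th th'. is_nat_trans ?L ?M ?R S th \<and> is_nat_trans ?L ?M ?R S th' \<and>
       (\<forall>a\<in>Obj C. Comp ?M (?G a) (?T a) (ob S a) (th a) (?P (?G a) (?T a) (eps a)) = et a) \<and>
       (\<forall>a\<in>Obj C. Comp ?M (?G a) (?T a) (ob S a) (th' a) (?P (?G a) (?T a) (eps a)) = et a) -->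
       (\<forall>a\<in>Obj C. th a = th' a))"
    if S: "is_functor ?L ?M S" and et: "is_nat_trans C ?M (fcomp (loc_functor D W') G) (fcomp S (loc_functor C W)) et"
    for S et
  proof -
    let ?S = "ob S"
    note SD = is_functorD[OF S, simplified]
    note etD = is_nat_transD[OF et, simplified]
    note si = inv_pair_functor[OF S ii]
    define s where "s a = hm S (?K a) a (zclass C W (?K a) a [Bwd a (?K a) (i a)])" for a
    define e where "e a = zclass D W' (?T (?K a)) (?G (?K a)) [Bwd (?G (?K a)) (?T (?K a)) (eps (?K a))]" for a
    define th where "th a = Comp ?M (?T a) (?S (?K a)) (?S a) (s a) (Comp ?M (?T a) (?G (?K a)) (?S (?K a)) (et (?K a))
        (Comp ?M (?T a) (?T (?K a)) (?G (?K a)) (e a) (?P (?T a) (?T (?K a)) (hm T a (?K a) (i a)))))" for a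
    \<comment> \<open>Four pasted squares, one for each factor of \<open>th\<close>:
      \<open>T\<close> applied to \<open>i\<close>, the inverse of \<open>eps\<close> at
      \<open>K\<close>, the given \<open>et\<close>, and the inverse of \<open>S\<close> applied to
      \<open>i\<close>.\<close>
    have sqth: "sq ?M (?T a) (?T b) (?S a) (?S b) (th a) (th b) (?P (?T a) (?T b) (hm T a b f)) (hm S a b (?Q a b f))"
      if ab: "a \<in> Obj C" "b \<in> Obj C" "f \<in> Hom C a b" for a b f
      unfolding th_def
    proof (intro sq_comp[OF M])
      note Kf = KD(2)[OF ab]
      show "sq ?M (?T a) (?T b) (?T (?K a)) (?T (?K b)) (?P (?T a) (?T (?K a)) (hm T a (?K a) (i a)))
         (?P (?T b) (?T (?K b)) (hm T b (?K b) (i b))) (?P (?T a) (?T b) (hm T a b f))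
         (?P (?T (?K a)) (?T (?K b)) (hm T (?K a) (?K b) (hm K a b f)))"
        by (rule sqP[OF sqF[OF sqi[OF ab] T(1)]])
      show "sq ?M (?T (?K a)) (?T (?K b)) (?G (?K a)) (?G (?K b)) (e a) (e b) (?P (?T (?K a)) (?T (?K b)) (hm T (?K a) (?K b) (hm K a b f)))
         (?P (?G (?K a)) (?G (?K b)) (hm G (?K a) (?K b) (hm K a b f)))"
        unfolding e_def by (rule sq_inverse[OF M sqP[OF sqeps] ei ei]) (use ab KD in simp_all)
      show "sq ?M (?G (?K a)) (?G (?K b)) (?S (?K a)) (?S (?K b)) (et (?K a)) (et (?K b)) (?P (?G (?K a)) (?G (?K b)) (hm G (?K a) (?K b) (hm K a b f)))
         (hm S (?K a) (?K b) (?Q (?K a) (?K b) (hm K a b f)))"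
        using ab by (simp add: sq_def etD SD GD KD Pin Qin)
      show "sq ?M (?S (?K a)) (?S (?K b)) (?S a) (?S b) (s a) (s b) (hm S (?K a) (?K b) (?Q (?K a) (?K b) (hm K a b f))) (hm S a b (?Q a b f))"
        unfolding s_def by (rule sq_inverse[OF M sqF[OF sqQ[OF sqi] S] si si]) (use ab in simp_all)
    qed
    have sin: "s a \<in> Hom ?M (?S (?K a)) (?S a)" if "a \<in> Obj C" for a using inv_pairD(4)[OF si[OF that]] by (simp add: s_def)
    have ein: "e a \<in> Hom ?M (?T (?K a)) (?G (?K a))" if "a \<in> Obj C" for a using inv_pairD(4)[OF ei[OF that]] by (simp add: e_def)
    have thin: "th a \<in> Hom ?M (?T a) (?S a)" if "a \<in> Obj C" for a unfolding th_def using that by (simp add: MD(2) sin ein etD SD GD KD TD Pin iD)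
    have nat: "is_nat_trans ?L ?M ?R S th" by (rule is_nat_trans_localizationI[OF C M R S]) (simp_all add: thin sqth RQ)
    have "Comp ?M (?G a) (?T a) (?S a) (th a) (?P (?G a) (?T a) (eps a)) = et a" if a: "a \<in> Obj C" for a
    proof -
      let ?i = "?P (?T a) (?T (?K a)) (hm T a (?K a) (i a))"
      note o = a KD(1)[OF a] GD(1)[OF a] TD(1)[OF a] GD(1)[OF KD(1)[OF a]] TD(1)[OF KD(1)[OF a]] SD(1)[OF a] SD(1)[OF KD(1)[OF a]]
      note h = iD(1)[OF a] sin[OF a] ein[OF a] etD(1)[OF o(2)] etD(1)[OF a] epsD(1)[OF a] epsD(1)[OF o(2)]
      have 1: "Comp ?M (?G a) (?T a) (?T (?K a)) ?i (?P (?G a) (?T a) (eps a)) = Comp ?M (?G a) (?G (?K a)) (?T (?K a)) (?P (?G (?K a)) (?T (?K a)) (eps (?K a)))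
           (?P (?G a) (?G (?K a)) (hm G a (?K a) (i a)))"
        using sqP[OF sqeps[OF o(1,2) h(1)]] by (simp add: sq_def)
      have 2: "Comp ?M (?G a) (?T (?K a)) (?G (?K a)) (e a) (Comp ?M (?G a) (?T a) (?T (?K a)) ?i (?P (?G a) (?T a) (eps a)))
         = ?P (?G a) (?G (?K a)) (hm G a (?K a) (i a))"
        unfolding 1 e_def by (rule inv_pair_cancel_left[OF M ei[OF a]]) (use o h in "simp_all add: Pin GD")
      have 3: "Comp ?M (?G a) (?G (?K a)) (?S (?K a)) (et (?K a)) (?P (?G a) (?G (?K a)) (hm G a (?K a) (i a)))
         = Comp ?M (?G a) (?S a) (?S (?K a)) (hm S a (?K a) (?Q a (?K a) (i a))) (et a)"
        using o h by (simp add: etD)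
      have "Comp ?M (?G a) (?T a) (?S a) (th a) (?P (?G a) (?T a) (eps a)) = Comp ?M (?G a) (?S (?K a)) (?S a) (s a) (Comp ?M (?G a) (?G (?K a)) (?S (?K a)) (et (?K a))
            (Comp ?M (?G a) (?T (?K a)) (?G (?K a)) (e a) (Comp ?M (?G a) (?T a) (?T (?K a)) ?i (?P (?G a) (?T a) (eps a)))))"
        unfolding th_def using o h by (simp add: MD(2,5) Pin TD)
      also have "\<dots> = Comp ?M (?G a) (?S (?K a)) (?S a) (s a) (Comp ?M (?G a) (?S a) (?S (?K a)) (hm S a (?K a) (?Q a (?K a) (i a))) (et a))" unfolding 2 3 ..
      also have "\<dots> = et a" unfolding s_def by (rule inv_pair_cancel_left[OF M si[OF a]]) (use o h in simp_all)
      finally show ?thesis .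
    qed
    with nat have ex: "\<exists>th. is_nat_trans ?L ?M ?R S th \<and> (\<forall>a\<in>Obj C. Comp ?M (?G a) (?T a) (?S a) (th a) (?P (?G a) (?T a) (eps a)) = et a)"
      by blast
    have uniq: "th1 a = th2 a" if 1: "is_nat_trans ?L ?M ?R S th1" and 2: "is_nat_trans ?L ?M ?R S th2"
      and e1: "\<And>a. a \<in> Obj C ==> Comp ?M (?G a) (?T a) (?S a) (th1 a) (?P (?G a) (?T a) (eps a)) = et a"
      and e2: "\<And>a. a \<in> Obj C ==> Comp ?M (?G a) (?T a) (?S a) (th2 a) (?P (?G a) (?T a) (eps a)) = et a"
      and a: "a \<in> Obj C" for th1 th2 a
    proof -
      note o = a KD(1)[OF a] GD(1)[OF a] TD(1)[OF a] GD(1)[OF KD(1)[OF a]] TD(1)[OF KD(1)[OF a]] SD(1)[OF a] SD(1)[OF KD(1)[OF a]]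
      note 1 = is_nat_transD[OF 1, simplified] and 2 = is_nat_transD[OF 2, simplified]
      have o8: "?S (?K a) \<in> Obj ?M" using o by simp
      \<comment> \<open>At \<open>K a\<close> the component is determined because \<open>eps\<close>
        is invertible there. Naturality along \<open>i\<close> then determines it at
        \<open>a\<close>, since \<open>S\<close> makes \<open>i\<close> invertible.\<close>
      have K: "th1 (?K a) = th2 (?K a)" using inv_pair_cancel_right(2)[OF M inv_pair_sym[OF ei[OF a]] o8 1(1)[OF o(2)]]
          inv_pair_cancel_right(2)[OF M inv_pair_sym[OF ei[OF a]] o8 2(1)[OF o(2)]]
        unfolding e1[OF o(2)] e2[OF o(2)] by simp
      have "Comp ?M (?T a) (?S a) (?S (?K a)) (hm S a (?K a) (?Q a (?K a) (i a))) (th1 a) = Comp ?M (?T a) (?S a) (?S (?K a)) (hm S a (?K a) (?Q a (?K a) (i a))) (th2 a)"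
        using 1(2)[OF o(1,2) Qin[OF o(1,2) iD(1)[OF a]]] 2(2)[OF o(1,2) Qin[OF o(1,2) iD(1)[OF a]]] K by simp
      moreover have "?T a \<in> Obj ?M" using o by simp
      ultimately show ?thesis using inv_pair_cancel_left[OF M si[OF a] _ 1(1)[OF a]] inv_pair_cancel_left[OF M si[OF a] _ 2(1)[OF a]] by metis
    qed
    show ?thesis
    proof (intro conjI allI impI ballI)
      fix th1 th2 a
      assume t: "is_nat_trans ?L ?M ?R S th1 \<and> is_nat_trans ?L ?M ?R S th2 \<and>
         (\<forall>a\<in>Obj C. Comp ?M (?G a) (?T a) (?S a) (th1 a) (?P (?G a) (?T a) (eps a)) = et a) \<and>
         (\<forall>a\<in>Obj C. Comp ?M (?G a) (?T a) (?S a) (th2 a) (?P (?G a) (?T a) (eps a)) = et a)"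
        and a: "a \<in> Obj C"
      show "th1 a = th2 a" by (rule uniq) (use t a in simp_all)
    qed (rule ex)
  qed
  show ?thesis unfolding is_total_right_derived_def Let_def onObj_loc_lift by (rule conjI[OF R conjI[OF nateps]], intro allI impI, rule main) simp_all
qed

text \<open>The universal property gives comparisons in both directions. Their composite and the
  identity are two endomorphisms of one derived functor that are compatible with its augmentation,
  so the uniqueness clause identifies them.\<close>

lemma total_right_derived_unique: assumes C: "is_category C" and D: "is_category D"
    and R: "is_total_right_derived C W D W' G R eps" and R': "is_total_right_derived C W D W' G R' eps'"
    and G: "is_functor C D G"
  shows "\<exists>th th'. is_nat_trans (localization C W) (localization D W') R R' th \<and>
    (\<forall>a\<in>Obj C. inv_pair (localization D W') (ob R a) (ob R' a) (th a) (th' a))"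
proof -
  let ?L = "localization C W" and ?M = "localization D W'"
  let ?Q = "loc_functor C W" and ?P = "loc_functor D W'"
  note M = is_category_localization[of D W']
  note MD = is_categoryD[OF M]
  have half: "\<exists>th. is_nat_trans ?L ?M R1 R2 th \<and> (\<forall>a\<in>Obj C. Comp ?M (ob G a) (ob R1 a) (ob R2 a) (th a) (eps1 a) = eps2 a)"
    if "is_total_right_derived C W D W' G R1 eps1" "is_total_right_derived C W D W' G R2 eps2" for R1 R2 eps1 eps2
    using that unfolding is_total_right_derived_def Let_def by meson
  have cancel: "Comp ?M (ob R1 a) (ob R2 a) (ob R1 a) (th2 a) (th1 a) = Idt ?M (ob R1 a)"
    if R1: "is_total_right_derived C W D W' G R1 eps1" and R2: "is_total_right_derived C W D W' G R2 eps2" and 1: "is_nat_trans ?L ?M R1 R2 th1"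
      and e1: "\<And>a. a \<in> Obj C ==> Comp ?M (ob G a) (ob R1 a) (ob R2 a) (th1 a) (eps1 a) = eps2 a"
      and 2: "is_nat_trans ?L ?M R2 R1 th2"
      and e2: "\<And>a. a \<in> Obj C ==> Comp ?M (ob G a) (ob R2 a) (ob R1 a) (th2 a) (eps2 a) = eps1 a"
      and a: "a \<in> Obj C" for R1 R2 eps1 eps2 th1 th2 a
  proof -
    have F1: "is_functor ?L ?M R1" and F2: "is_functor ?L ?M R2" and n1: "is_nat_trans C ?M (fcomp ?P G) (fcomp R1 ?Q) eps1"
      using R1 R2 by (auto simp: is_total_right_derived_def Let_def)
    have uniq: "th a = th' a" if "is_nat_trans ?L ?M R1 R1 th" "is_nat_trans ?L ?M R1 R1 th'"
       "\<forall>a\<in>Obj C. Comp ?M (ob G a) (ob R1 a) (ob R1 a) (th a) (eps1 a) = eps1 a"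
       "\<forall>a\<in>Obj C. Comp ?M (ob G a) (ob R1 a) (ob R1 a) (th' a) (eps1 a) = eps1 a" for th th'
      using R1 F1 n1 that a unfolding is_total_right_derived_def Let_def by meson
    note F1D = is_functorD[OF F1, simplified] and F2D = is_functorD[OF F2, simplified]
    have nid: "is_nat_trans ?L ?M R1 R1 (%a. Idt ?M (ob R1 a))" unfolding is_nat_trans_iff_sq[OF F1 F1] sq_def
      by (simp add: F1D MD Idt_localization[symmetric] del: Idt_localization)
    have n12: "is_nat_trans ?L ?M R1 R1 (%a. Comp ?M (ob R1 a) (ob R2 a) (ob R1 a) (th2 a) (th1 a))" unfolding is_nat_trans_iff_sq[OF F1 F1]
    proof (intro conjI ballI)
      fix a assume "a \<in> Obj ?L"
      then show "Comp ?M (ob R1 a) (ob R2 a) (ob R1 a) (th2 a) (th1 a) \<in> Hom ?M (ob R1 a) (ob R1 a)"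
        using is_nat_transD(1)[OF 1, of a] is_nat_transD(1)[OF 2, of a] by (simp add: F1D F2D MD)
    next
      fix a b f assume ab: "a \<in> Obj ?L" "b \<in> Obj ?L" "f \<in> Hom ?L a b"
      show "sq ?M (ob R1 a) (ob R1 b) (ob R1 a) (ob R1 b) (Comp ?M (ob R1 a) (ob R2 a) (ob R1 a) (th2 a) (th1 a))
          (Comp ?M (ob R1 b) (ob R2 b) (ob R1 b) (th2 b) (th1 b)) (hm R1 a b f) (hm R1 a b f)"
        using 1[unfolded is_nat_trans_iff_sq[OF F1 F2]] 2[unfolded is_nat_trans_iff_sq[OF F2 F1]] ab by (intro sq_comp[OF M, where f' = "hm R2 a b f"]) blast+
    qed
    have "Comp ?M (ob G a) (ob R1 a) (ob R1 a) (Idt ?M (ob R1 a)) (eps1 a) = eps1 a" if "a \<in> Obj C" for a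
      using is_nat_transD(1)[OF n1 that] is_functorD(1)[OF G that] that by (simp add: MD(4) F1D del: Idt_localization)
    moreover have "Comp ?M (ob G a) (ob R1 a) (ob R1 a) (Comp ?M (ob R1 a) (ob R2 a) (ob R1 a) (th2 a) (th1 a)) (eps1 a) = eps1 a" if "a \<in> Obj C" for a
      using is_nat_transD(1)[OF n1 that] is_functorD(1)[OF G that] that e1[OF that] e2[OF that] is_nat_transD(1)[OF 1, of a] is_nat_transD(1)[OF 2, of a]
      by (simp add: MD(5) F1D F2D)
    ultimately show ?thesis using uniq[OF n12 nid] by simp
  qed
  obtain th th' where th: "is_nat_trans ?L ?M R R' th" "\<And>a. a \<in> Obj C ==> Comp ?M (ob G a) (ob R a) (ob R' a) (th a) (eps a) = eps' a"
    and th': "is_nat_trans ?L ?M R' R th'" "\<And>a. a \<in> Obj C ==> Comp ?M (ob G a) (ob R' a) (ob R a) (th' a) (eps' a) = eps a"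
    using half[OF R R'] half[OF R' R] by blast
  have F: "is_functor ?L ?M R" "is_functor ?L ?M R'" using R R' by (auto simp: is_total_right_derived_def Let_def)
  have "inv_pair ?M (ob R a) (ob R' a) (th a) (th' a)" if a: "a \<in> Obj C" for a unfolding inv_pair_def
    using cancel[OF R R' th th' a] cancel[OF R' R th' th a] is_functorD(1)[OF F(1), of a] is_functorD(1)[OF F(2), of a]
      is_nat_transD(1)[OF th(1), of a] is_nat_transD(1)[OF th'(1), of a] a by simp
  with th(1) show ?thesis by blast
qed

section \<open>Complexes of abelian data\<close>

abbreviation stk :: "('x, 'u) acomplex => int => 'x => 'u monoid" where "stk F i p \<equiv> stalk (trm F i) p"

abbreviation (input) stc :: "('x, 'u) acomplex => int => 'x => 'u set" where "stc F i p \<equiv> carrier (stk F i p)"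

text \<open>Chain maps between complexes whose elements may have different types;
  \<open>chain_maps\<close> is the case of one type. The functors \<open>T\<close>, \<open>C\<close>
  and \<open>U\<close> and the transports between universes are built before everything has been
  moved to one type.\<close>

definition cmap :: "'x topology => ('x, 'u) acomplex => ('x, 'v) acomplex => (int => 'x => 'u => 'v) => bool" where
  "cmap X F G f \<longleftrightarrow> (\<forall>i. f i \<in> ad_hom X (trm F i) (trm G i) \<and>
     (\<forall>p\<in>tsp X. \<forall>s\<in>stc F i p. f (i + 1) p (dif F i p s) = dif G i p (f i p s)))"

definition cc :: "'x topology => ('x, 'u) acomplex => (int => 'x => 'v => 'w) => (int => 'x => 'u => 'v) => int => 'x => 'u => 'w" where
  "cc X F g f = (%i. ad_comp X (trm F i) (g i) (f i))"

definition ci :: "'x topology => ('x, 'u) acomplex => ('x, 'u) amap" where "ci X F = (%i. ad_id X (trm F i))"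

lemma chain_maps_iff: "f \<in> chain_maps X F G \<longleftrightarrow> cmap X F G f" by (simp add: chain_maps_def cmap_def)

lemma Ch_simps [simp]: "Obj (Ch X) = acs X" "Hom (Ch X) = chain_maps X" "Idt (Ch X) F = ci X F" "Comp (Ch X) F G H g f = cc X F g f" by (auto simp: Ch_def cc_def ci_def)

lemma ci_app [simp]: "p \<in> tsp X ==> s \<in> stc F i p ==> ci X F i p s = s" by (simp add: ci_def ad_id_def)

lemma cc_app [simp]: "p \<in> tsp X ==> s \<in> stc F i p ==> cc X F g f i p s = g i p (f i p s)" by (simp add: cc_def ad_comp_def compose_def)

lemma pt_leD: "pt_le X p q ==> p \<in> tsp X" "pt_le X p q ==> q \<in> tsp X" by (simp_all add: pt_le_def)

lemma pt_le_refl [simp]: "pt_le X p p \<longleftrightarrow> p \<in> tsp X" by (simp add: pt_le_def)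

lemma pt_le_trans: "pt_le X p q ==> pt_le X q r ==> pt_le X p r" by (auto simp: pt_le_def)

lemma acD: assumes "F \<in> acs X" shows "p \<in> tsp X ==> comm_group (stk F i p)" and "p \<in> tsp X ==> group (stk F i p)"
    and "pt_le X p q ==> res (trm F i) p q \<in> hom (stk F i p) (stk F i q)"
    and "p \<in> tsp X ==> s \<in> stc F i p ==> res (trm F i) p p s = s"
    and "pt_le X p q ==> pt_le X q r ==> s \<in> stc F i p ==> res (trm F i) q r (res (trm F i) p q s) = res (trm F i) p r s"
    and "dif F i \<in> ad_hom X (trm F i) (trm F (i + 1))"
    and "p \<in> tsp X ==> dif F i p \<in> hom (stk F i p) (stk F (i + 1) p)"
    and "pt_le X p q ==> s \<in> stc F i p ==> dif F i q (res (trm F i) p q s) = res (trm F (i + 1)) p q (dif F i p s)"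
    and "p \<in> tsp X ==> s \<in> stc F i p ==> dif F (i + 1) p (dif F i p s) = 1[stk F (i + 2) p]"
  using assms unfolding acomplexes_def abelian_data_def ad_hom_def by (auto simp: comm_group_def)

lemma ac_closed: assumes "F \<in> acs X" shows "pt_le X p q ==> s \<in> stc F i p ==> res (trm F i) p q s \<in> stc F i q"
    and "p \<in> tsp X ==> s \<in> stc F i p ==> dif F i p s \<in> stc F (i + 1) p"
    and "p \<in> tsp X ==> 1[stk F i p] \<in> stc F i p"
    and "p \<in> tsp X ==> s \<in> stc F i p ==> t \<in> stc F i p ==> s *[stk F i p] t \<in> stc F i p"
    and "p \<in> tsp X ==> s \<in> stc F i p ==> inv[stk F i p] s \<in> stc F i p"
  using acD(3,7)[OF assms] acD(2)[OF assms, THEN group.is_monoid]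
  by (blast intro: hom_in_carrier monoid.m_closed monoid.one_closed group.inv_closed[OF acD(2)[OF assms]])+

lemma acomplexes_dif_dif': assumes "F \<in> acs X" "p \<in> tsp X" "s \<in> stc F (i - 1) p" shows "dif F i p (dif F (i - 1) p s) = 1[stk F (i + 1) p]"
proof -
  have "i - 1 + 2 = i + 1" "i - 1 + 1 = i" by simp_all
  then show ?thesis using acD(9)[OF assms] by metis
qed

lemma acomplexesI: assumes "\<And>i p. p \<in> tsp X ==> comm_group (stk F i p)" and "\<And>i p q. pt_le X p q ==> res (trm F i) p q \<in> hom (stk F i p) (stk F i q)"
    and "\<And>i p s. p \<in> tsp X ==> s \<in> stc F i p ==> res (trm F i) p p s = s"
    and "\<And>i p q r s. pt_le X p q ==> pt_le X q r ==> s \<in> stc F i p ==> res (trm F i) q r (res (trm F i) p q s) = res (trm F i) p r s"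
    and "\<And>i. dif F i \<in> extensional (tsp X)"
    and "\<And>i p. p \<in> tsp X ==> dif F i p \<in> extensional (stc F i p)"
    and "\<And>i p. p \<in> tsp X ==> dif F i p \<in> hom (stk F i p) (stk F (i + 1) p)"
    and "\<And>i p q s. pt_le X p q ==> s \<in> stc F i p ==> dif F i q (res (trm F i) p q s) = res (trm F (i + 1)) p q (dif F i p s)"
    and "\<And>i p s. p \<in> tsp X ==> s \<in> stc F i p ==> dif F (i + 1) p (dif F i p s) = 1[stk F (i + 2) p]"
  shows "F \<in> acs X"
  using assms by (simp add: acomplexes_def abelian_data_def ad_hom_def)

lemma cmapD: assumes "cmap X F G f" shows "f i \<in> ad_hom X (trm F i) (trm G i)" and "p \<in> tsp X ==> f i p \<in> hom (stk F i p) (stk G i p)"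
    and "p \<in> tsp X ==> s \<in> stc F i p ==> f i p s \<in> stc G i p"
    and "p \<in> tsp X ==> s \<in> stc F i p ==> t \<in> stc F i p ==> f i p (s *[stk F i p] t) = f i p s *[stk G i p] f i p t"
    and "pt_le X p q ==> s \<in> stc F i p ==> f i q (res (trm F i) p q s) = res (trm G i) p q (f i p s)"
    and "p \<in> tsp X ==> s \<in> stc F i p ==> f (i + 1) p (dif F i p s) = dif G i p (f i p s)"
  using assms unfolding cmap_def ad_hom_def hom_def by blast+

lemma cmapI: assumes "\<And>i. f i \<in> extensional (tsp X)" and "\<And>i p. p \<in> tsp X ==> f i p \<in> extensional (stc F i p)"
    and "\<And>i p s. p \<in> tsp X ==> s \<in> stc F i p ==> f i p s \<in> stc G i p"
    and "\<And>i p s t. p \<in> tsp X ==> s \<in> stc F i p ==> t \<in> stc F i p ==> f i p (s *[stk F i p] t) = f i p s *[stk G i p] f i p t"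
    and "\<And>i p q s. pt_le X p q ==> s \<in> stc F i p ==> f i q (res (trm F i) p q s) = res (trm G i) p q (f i p s)"
    and "\<And>i p s. p \<in> tsp X ==> s \<in> stc F i p ==> f (i + 1) p (dif F i p s) = dif G i p (f i p s)"
  shows "cmap X F G f"
  using assms unfolding cmap_def ad_hom_def by (auto simp: hom_def)

lemma cmap_eqI: assumes "cmap X F G f" "cmap X F G g" and "\<And>i p s. p \<in> tsp X ==> s \<in> stc F i p ==> f i p s = g i p s" shows "f = g"
proof (intro ext)
  fix i p s
  have *: "f i \<in> extensional (tsp X)" "g i \<in> extensional (tsp X)" "p \<in> tsp X ==> f i p \<in> extensional (stc F i p)"
    "p \<in> tsp X ==> g i p \<in> extensional (stc F i p)"
    using assms(1,2) by (auto simp: cmap_def ad_hom_def)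
  show "f i p s = g i p s" using assms(3) * by (cases "p \<in> tsp X"; cases "s \<in> stc F i p") (auto simp: extensional_def)
qed

lemma cmap_one: assumes "cmap X F G f" "F \<in> acs X" "G \<in> acs X" "p \<in> tsp X" shows "f i p 1[stk F i p] = 1[stk G i p]"
  using cmapD(2)[OF assms(1,4)] acD(2)[OF assms(2,4)] acD(2)[OF assms(3,4)] by (rule hom_one)

lemma hom_group_inv: "f \<in> hom G H ==> group G ==> group H ==> x \<in> carrier G ==> f (inv[G] x) = inv[H] (f x)"
  using group_hom.hom_inv[of G H f x] by (simp add: group_hom_def group_hom_axioms_def)

lemma cmap_cc: assumes F: "F \<in> acs X" and f: "cmap X F G f" and g: "cmap X G H g" shows "cmap X F H (cc X F g f)"
proof (rule cmapI)
  note cl = ac_closed[OF F] cmapD(3)[OF f] cmapD(3)[OF g]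
  fix i p q s
  show "cc X F g f i \<in> extensional (tsp X)" by (simp add: cc_def ad_comp_def)
  show "cc X F g f i p \<in> extensional (stc F i p)" if "p \<in> tsp X" using that by (simp add: cc_def ad_comp_def)
  show "cc X F g f i p s \<in> stc H i p" if "p \<in> tsp X" "s \<in> stc F i p" using that by (simp add: cl)
  show "cc X F g f i q (res (trm F i) p q s) = res (trm H i) p q (cc X F g f i p s)" if "pt_le X p q" "s \<in> stc F i p"
    using that pt_leD[OF that(1)] by (simp add: cl cmapD(5)[OF f] cmapD(5)[OF g])
  show "cc X F g f (i + 1) p (dif F i p s) = dif H i p (cc X F g f i p s)" if "p \<in> tsp X" "s \<in> stc F i p"
    using that by (simp add: cl cmapD(6)[OF f] cmapD(6)[OF g])
next
  note cl = ac_closed[OF F] cmapD(3)[OF f] cmapD(3)[OF g]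
  fix i p s t
  show "cc X F g f i p (s *[stk F i p] t) = cc X F g f i p s *[stk H i p] cc X F g f i p t" if "p \<in> tsp X" "s \<in> stc F i p" "t \<in> stc F i p"
    using that by (simp add: cl cmapD(4)[OF f] cmapD(4)[OF g])
qed

lemma cmap_ci: "F \<in> acs X ==> cmap X F F (ci X F)" by (rule cmapI) (auto simp: ci_def ad_id_def ac_closed pt_leD)

lemma cc_assoc: assumes "F \<in> acs X" "G \<in> acs X" "cmap X F G f" "cmap X G H g" "cmap X H K h" shows "cc X F (cc X G h g) f = cc X F h (cc X F g f)"
  by (rule cmap_eqI[of X F K]) (auto intro!: cmap_cc assms simp: cmapD(3)[OF assms(3)] intro: assms)

lemma cc_ci: assumes "F \<in> acs X" "cmap X F G f" shows "cc X F f (ci X F) = f" and "G \<in> acs X ==> cc X F (ci X G) f = f"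
proof -
  show "cc X F f (ci X F) = f" by (rule cmap_eqI[of X F G]) (auto intro!: cmap_cc[OF assms(1) cmap_ci] assms)
  show "cc X F (ci X G) f = f" if "G \<in> acs X" by (rule cmap_eqI[of X F G]) (auto intro!: cmap_cc[OF assms cmap_ci] assms that simp: cmapD(3)[OF assms(2)])
qed

lemma is_category_Ch: "is_category (Ch X)" unfolding is_category_def
proof (intro conjI ballI)
  fix a b c d f g h
  assume "a \<in> Obj (Ch X)" "b \<in> Obj (Ch X)" "c \<in> Obj (Ch X)" "d \<in> Obj (Ch X)" "f \<in> Hom (Ch X) a b" "g \<in> Hom (Ch X) b c" "h \<in> Hom (Ch X) c d"
  then show "Comp (Ch X) a b d (Comp (Ch X) b c d h g) f = Comp (Ch X) a c d h (Comp (Ch X) a b c g f)" by (simp add: chain_maps_iff cc_assoc[of a X b f c g d h])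
qed (auto simp: chain_maps_iff cmap_ci cmap_cc cc_ci)

subsection \<open>Quasi-isomorphisms\<close>

text \<open>Meant for cohomology. The last part reads an isomorphism of quotients on
  representatives: trivial kernel means that only elements of \<open>B\<close> land in
  \<open>B'\<close>, and surjectivity means that \<open>f\<close> reaches every element up to
  \<open>B'\<close>.\<close>

lemma quotient_map: assumes Z: "comm_group Z" and Z': "comm_group Z'" and B: "subgroup B Z" and B': "subgroup B' Z'"
    and f: "f \<in> hom Z Z'" and fB: "f ` B \<subseteq> B'"
  defines "ph \<equiv> %c. B' <#>\<^bsub>Z'\<^esub> (f ` c)"
  shows "a \<in> carrier Z ==> ph (B #>\<^bsub>Z\<^esub> a) = B' #>\<^bsub>Z'\<^esub> f a" and "ph \<in> hom (Z Mod B) (Z' Mod B')"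
    and "ph \<in> iso (Z Mod B) (Z' Mod B') \<longleftrightarrow>
      (\<forall>a\<in>carrier Z. f a \<in> B' --> a \<in> B) \<and> (\<forall>b\<in>carrier Z'. \<exists>a\<in>carrier Z. \<exists>c\<in>B'. b = f a *[Z'] c)"
proof -
  interpret Z: comm_group Z by fact
  interpret Z': comm_group Z' by fact
  interpret B: normal B Z by (rule Z.subgroup_imp_normal[OF B])
  interpret B': normal B' Z' by (rule Z'.subgroup_imp_normal[OF B'])
  have fc: "f x \<in> carrier Z'" if "x \<in> carrier Z" for x using f that by (simp add: hom_in_carrier)
  have fm: "f (x *[Z] y) = f x *[Z'] f y" if "x \<in> carrier Z" "y \<in> carrier Z" for x y using f that by (simp add: hom_mult)
  have B'1: "1[Z'] \<in> B'" "1[Z] \<in> B" by (simp_all add: B'.one_closed B.one_closed)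
  show cos: "ph (B #>\<^bsub>Z\<^esub> a) = B' #>\<^bsub>Z'\<^esub> f a" if a: "a \<in> carrier Z" for a
  proof (intro equalityI subsetI)
    fix x assume "x \<in> ph (B #>\<^bsub>Z\<^esub> a)"
    then obtain b' b where b: "b' \<in> B'" "b \<in> B" "x = b' *[Z'] f (b *[Z] a)" by (auto simp: ph_def set_mult_def r_coset_def)
    have "x = (b' *[Z'] f b) *[Z'] f a" "b' *[Z'] f b \<in> B'" using b a fB by (auto simp: fm fc Z'.m_assoc B'.m_closed)
    then show "x \<in> B' #>\<^bsub>Z'\<^esub> f a" by (auto simp: r_coset_def)
  next
    fix x assume "x \<in> B' #>\<^bsub>Z'\<^esub> f a"
    then obtain b' where b: "b' \<in> B'" "x = b' *[Z'] f (1[Z] *[Z] a)" using a by (auto simp: r_coset_def)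
    then show "x \<in> ph (B #>\<^bsub>Z\<^esub> a)" using B'1 unfolding ph_def set_mult_def r_coset_def by blast
  qed
  have car: "carrier (Z Mod B) = (%a. B #>\<^bsub>Z\<^esub> a) ` carrier Z" "carrier (Z' Mod B') = (%a. B' #>\<^bsub>Z'\<^esub> a) ` carrier Z'"
    by (auto simp: FactGroup_def RCOSETS_def)
  show hom: "ph \<in> hom (Z Mod B) (Z' Mod B')"
  proof (rule homI)
    fix c assume "c \<in> carrier (Z Mod B)"
    then show "ph c \<in> carrier (Z' Mod B')" using cos fc by (auto simp: car)
  next
    fix c d assume "c \<in> carrier (Z Mod B)" "d \<in> carrier (Z Mod B)"
    then obtain a b where ab: "a \<in> carrier Z" "c = B #>\<^bsub>Z\<^esub> a" "b \<in> carrier Z" "d = B #>\<^bsub>Z\<^esub> b" by (auto simp: car)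
    have "c *[Z Mod B] d = B #>\<^bsub>Z\<^esub> (a *[Z] b)" "ph c *[Z' Mod B'] ph d = B' #>\<^bsub>Z'\<^esub> (f a *[Z'] f b)"
      using ab fc by (simp_all add: FactGroup_def cos B.rcos_sum B'.rcos_sum)
    then show "ph (c *[Z Mod B] d) = ph c *[Z' Mod B'] ph d" using ab by (simp add: cos fm)
  qed
  interpret ph: group_hom "Z Mod B" "Z' Mod B'" ph using hom B.factorgroup_is_group B'.factorgroup_is_group by (simp add: group_hom_def group_hom_axioms_def)
  have one: "1[Z Mod B] = B" "1[Z' Mod B'] = B'" by (simp_all add: FactGroup_def)
  have eqB: "B #>\<^bsub>Z\<^esub> a = B \<longleftrightarrow> a \<in> B" if "a \<in> carrier Z" for a using Z.coset_join1[OF _ that B] Z.coset_join2[OF that B] by blast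
  have eqB': "B' #>\<^bsub>Z'\<^esub> a = B' \<longleftrightarrow> a \<in> B'" if "a \<in> carrier Z'" for a
    using Z'.coset_join1[OF _ that B'] Z'.coset_join2[OF that B'] by blast
  have "inj_on ph (carrier (Z Mod B)) \<longleftrightarrow> (\<forall>a\<in>carrier Z. ph (B #>\<^bsub>Z\<^esub> a) = B' --> B #>\<^bsub>Z\<^esub> a = B)"
    unfolding ph.inj_on_one_iff unfolding one car by blast
  then have inj: "inj_on ph (carrier (Z Mod B)) \<longleftrightarrow> (\<forall>a\<in>carrier Z. f a \<in> B' --> a \<in> B)" by (simp add: cos eqB eqB' fc)
  have "B' #>\<^bsub>Z'\<^esub> f a = B' #>\<^bsub>Z'\<^esub> b \<longleftrightarrow> (\<exists>c\<in>B'. b = f a *[Z'] c)" if "a \<in> carrier Z" "b \<in> carrier Z'" for a b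
  proof
    assume "B' #>\<^bsub>Z'\<^esub> f a = B' #>\<^bsub>Z'\<^esub> b"
    then have "b \<in> B' #>\<^bsub>Z'\<^esub> f a" using Z'.rcos_self[OF that(2) B'] by simp
    then show "\<exists>c\<in>B'. b = f a *[Z'] c" using fc[OF that(1)] by (auto simp: r_coset_def Z'.m_comm)
  next
    assume "\<exists>c\<in>B'. b = f a *[Z'] c"
    then have "b \<in> B' #>\<^bsub>Z'\<^esub> f a" using fc[OF that(1)] by (auto simp: r_coset_def Z'.m_comm)
    then show "B' #>\<^bsub>Z'\<^esub> f a = B' #>\<^bsub>Z'\<^esub> b" using Z'.repr_independence[OF _ fc[OF that(1)] B'] by simp
  qed
  then have "(\<forall>b\<in>carrier Z'. \<exists>a\<in>carrier Z. B' #>\<^bsub>Z'\<^esub> b = ph (B #>\<^bsub>Z\<^esub> a)) \<longleftrightarrow>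
     (\<forall>b\<in>carrier Z'. \<exists>a\<in>carrier Z. \<exists>c\<in>B'. b = f a *[Z'] c)"
    by (simp add: cos eq_commute)
  moreover have "ph ` carrier (Z Mod B) \<subseteq> carrier (Z' Mod B')" unfolding car using fc by (auto simp: cos)
  then have "ph ` carrier (Z Mod B) = carrier (Z' Mod B') \<longleftrightarrow> (\<forall>b\<in>carrier Z'. \<exists>a\<in>carrier Z. B' #>\<^bsub>Z'\<^esub> b = ph (B #>\<^bsub>Z\<^esub> a))"
    unfolding car set_eq_subset[of "ph ` _"] by (simp add: image_subset_iff image_iff)
  ultimately show "ph \<in> iso (Z Mod B) (Z' Mod B') \<longleftrightarrow>
      (\<forall>a\<in>carrier Z. f a \<in> B' --> a \<in> B) \<and> (\<forall>b\<in>carrier Z'. \<exists>a\<in>carrier Z. \<exists>c\<in>B'. b = f a *[Z'] c)"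
    using hom inj by (simp add: iso_def bij_betw_def)
qed

text \<open>Acyclicity of the mapping cone, spelled out for elements.\<close>

definition qcrit :: "(int => 'a monoid) => (int => 'a => 'a) => (int => 'b monoid) => (int => 'b => 'b) => (int => 'a => 'b) => bool" where
  "qcrit A d B e f \<longleftrightarrow> (\<forall>i. \<forall>a\<in>carrier (A (i + 1)). \<forall>b\<in>carrier (B i).
     d (i + 1) a = 1[A (i + 2)] \<and> e i b = f (i + 1) a -->
     (\<exists>a'\<in>carrier (A i). \<exists>b'\<in>carrier (B (i - 1)). d i a' = a \<and> b = f i a' *[B i] e (i - 1) b'))"

abbreviation crit :: "('x, 'u) acomplex => ('x, 'v) acomplex => (int => 'x => 'u => 'v) => 'x => bool" where
  "crit F G f p \<equiv> qcrit (%i. stk F i p) (%i. dif F i p) (%i. stk G i p) (%i. dif G i p) (%i. f i p)"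

lemma carrier_cocycles: "carrier (cocycles F i p) = {s \<in> stc F i p. dif F i p s = 1[stk F (i + 1) p]}" by (simp add: cocycles_def kernel_def)

lemma mult_cocycles [simp]: "monoid.mult (cocycles F i p) = monoid.mult (stk F i p)" and one_cocycles [simp]: "one (cocycles F i p) = one (stk F i p)"
  by (simp_all add: cocycles_def)

context
  fixes X :: "'x topology" and F :: "('x, 'u) acomplex" and p
  assumes F: "F \<in> acs X" and p: "p \<in> tsp X"
begin

lemma subgroup_cocycles: "subgroup (carrier (cocycles F i p)) (stk F i p)" using acD(2)[OF F p, of i] acD(2)[OF F p, of "i + 1"] acD(7)[OF F p, of i]
    group_hom.subgroup_kernel[of "stk F i p" "stk F (i + 1) p" "dif F i p"]
  by (simp add: cocycles_def group_hom_def group_hom_axioms_def)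

lemma comm_group_cocycles: "comm_group (cocycles F i p)"
proof -
  interpret comm_group "stk F i p" by (rule acD(1)[OF F p])
  have "group (stk F i p\<lparr>carrier := carrier (cocycles F i p)\<rparr>)" by (rule subgroup.subgroup_is_group[OF subgroup_cocycles is_group])
  then have "group (cocycles F i p)" by (simp add: cocycles_def)
  then show ?thesis by (rule group.group_comm_groupI) (simp add: carrier_cocycles m_comm)
qed

lemma subgroup_coboundaries: "subgroup (coboundaries F i p) (cocycles F i p)"
proof -
  interpret group_hom "stk F (i - 1) p" "stk F i p" "dif F (i - 1) p" using acD(2)[OF F p, of i] acD(2)[OF F p, of "i - 1"] acD(7)[OF F p, of "i - 1"]
    by (simp add: group_hom_def group_hom_axioms_def)
  have "coboundaries F i p \<subseteq> carrier (cocycles F i p)" using ac_closed(2)[OF F p, of _ "i - 1"]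
    by (auto simp: coboundaries_def carrier_cocycles acomplexes_dif_dif'[OF F p])
  moreover have "subgroup (coboundaries F i p) (stk F i p)" unfolding coboundaries_def by (rule img_is_subgroup)
  ultimately have "subgroup (coboundaries F i p) (stk F i p\<lparr>carrier := carrier (cocycles F i p)\<rparr>)" by (intro H.subgroup_incl subgroup_cocycles)
  then show ?thesis by (simp add: cocycles_def)
qed

lemma comm_group_cohomology: "comm_group (cohomology F i p)" unfolding cohomology_def by (rule comm_group.abelian_FactGroup[OF comm_group_cocycles subgroup_coboundaries])

end

context
  fixes X :: "'x topology" and F G :: "('x, 'u) acomplex" and f p
  assumes F: "F \<in> acs X" and G: "G \<in> acs X" and f: "cmap X F G f" and p: "p \<in> tsp X"
begin

lemma cmap_cocycles: "f i p \<in> hom (cocycles F i p) (cocycles G i p)"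
proof (rule homI)
  fix s assume s: "s \<in> carrier (cocycles F i p)"
  have "dif G i p (f i p s) = f (i + 1) p (dif F i p s)" using s p by (subst cmapD(6)[OF f]) (simp_all add: carrier_cocycles)
  then show "f i p s \<in> carrier (cocycles G i p)" using s p by (simp add: carrier_cocycles cmapD(3)[OF f] cmap_one[OF f F G])
qed (use p in "simp add: carrier_cocycles cmapD(4)[OF f]")

lemma cmap_coboundaries: "f i p ` coboundaries F i p \<subseteq> coboundaries G i p"
proof
  fix y assume "y \<in> f i p ` coboundaries F i p"
  then obtain s where s: "s \<in> stc F (i - 1) p" "y = f i p (dif F (i - 1) p s)" by (auto simp: coboundaries_def)
  then have "y = dif G (i - 1) p (f (i - 1) p s)" using cmapD(6)[OF f p s(1)] by simp
  then show "y \<in> coboundaries G i p" unfolding coboundaries_def using cmapD(3)[OF f p s(1)] by blast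
qed

lemmas cmap_quotient_map = quotient_map[OF comm_group_cocycles[OF F p] comm_group_cocycles[OF G p]
    subgroup_coboundaries[OF F p] subgroup_coboundaries[OF G p] cmap_cocycles cmap_coboundaries]

lemma cohomology_map_coset: "a \<in> carrier (cocycles F i p) ==>
    cohomology_map G f i p (coboundaries F i p #>\<^bsub>cocycles F i p\<^esub> a) = coboundaries G i p #>\<^bsub>cocycles G i p\<^esub> f i p a"
  unfolding cohomology_map_def by (rule cmap_quotient_map(1))

lemma cohomology_map_hom: "cohomology_map G f i p \<in> hom (cohomology F i p) (cohomology G i p)"
  using cmap_quotient_map(2)[of i] by (simp add: cohomology_map_def[abs_def] cohomology_def)

lemma cohomology_map_iso_iff: "cohomology_map G f i p \<in> iso (cohomology F i p) (cohomology G i p) \<longleftrightarrow>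
   (\<forall>a\<in>carrier (cocycles F i p). f i p a \<in> coboundaries G i p --> a \<in> coboundaries F i p) \<and>
   (\<forall>b\<in>carrier (cocycles G i p). \<exists>a\<in>carrier (cocycles F i p). \<exists>c\<in>coboundaries G i p. b = f i p a *[stk G i p] c)"
  using cmap_quotient_map(3)[of i] by (simp add: cohomology_map_def[abs_def] cohomology_def)

text \<open>A pair \<open>(a, b)\<close> as in \<open>crit\<close> is a cocycle of the mapping cone.
  Pairs that witness a boundary \<open>f a\<close> give injectivity, pairs with trivial
  \<open>a\<close> give surjectivity. Conversely injectivity disposes of \<open>a\<close>, and
  surjectivity of the cocycle that is then left of \<open>b\<close>.\<close>

lemma cohomology_map_iso_iff_crit: "(\<forall>i. cohomology_map G f i p \<in> iso (cohomology F i p) (cohomology G i p)) \<longleftrightarrow> crit F G f p"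
proof
  assume iso: "\<forall>i. cohomology_map G f i p \<in> iso (cohomology F i p) (cohomology G i p)"
  have inj: "a \<in> coboundaries F i p" if "a \<in> carrier (cocycles F i p)" "f i p a \<in> coboundaries G i p" for i a
    using iso that unfolding cohomology_map_iso_iff by blast
  have surj: "\<exists>a\<in>carrier (cocycles F i p). \<exists>c\<in>coboundaries G i p. b = f i p a *[stk G i p] c" if "b \<in> carrier (cocycles G i p)" for i b
    using iso that unfolding cohomology_map_iso_iff by blast
  show "crit F G f p" unfolding qcrit_def
  proof (intro allI ballI impI)
    fix i a b
    assume a: "a \<in> stc F (i + 1) p" and b: "b \<in> stc G i p" and ab: "dif F (i + 1) p a = 1[stk F (i + 2) p] \<and> dif G i p b = f (i + 1) p a"
    interpret H: comm_group "stk G i p" using acD(1)[OF G p] .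
    interpret A: comm_group "stk F i p" using acD(1)[OF F p] .
    interpret H1: comm_group "stk G (i + 1) p" using acD(1)[OF G p] .
    interpret A1: comm_group "stk F (i + 1) p" using acD(1)[OF F p] .
    note dG = acD(7)[OF G p, of i] and dF = acD(7)[OF F p, of i]
    have "i + 1 + 1 = i + 2" by simp
    then have "a \<in> carrier (cocycles F (i + 1) p)" using a ab unfolding carrier_cocycles mem_Collect_eq by (metis (no_types))
    moreover have "f (i + 1) p a \<in> coboundaries G (i + 1) p" using ab b by (auto simp: coboundaries_def intro!: image_eqI[of _ _ b])
    ultimately have "a \<in> coboundaries F (i + 1) p" by (rule inj)
    then obtain a0 where a0: "a0 \<in> stc F i p" "a = dif F i p a0" by (auto simp: coboundaries_def)
    have fa0: "f i p a0 \<in> stc G i p" using a0 p by (simp add: cmapD(3)[OF f])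
    \<comment> \<open>Removing the image of \<open>a0\<close> turns \<open>b\<close> into a cocycle,
      to which surjectivity applies.\<close>
    let ?b = "b *[stk G i p] inv[stk G i p] f i p a0"
    have "dif G i p (f i p a0) = dif G i p b" using ab a0 p by (simp add: cmapD(6)[OF f])
    then have "dif G i p ?b = 1[stk G (i + 1) p]" using b fa0 hom_in_carrier[OF dG b] by (simp add: hom_mult[OF dG] hom_group_inv[OF dG H.is_group H1.is_group])
    then have "?b \<in> carrier (cocycles G i p)" using b fa0 by (simp add: carrier_cocycles)
    from surj[OF this] obtain a1 c where c: "a1 \<in> carrier (cocycles F i p)" "c \<in> stc G (i - 1) p" "?b = f i p a1 *[stk G i p] dif G (i - 1) p c"
      by (auto simp: coboundaries_def)
    have a1: "a1 \<in> stc F i p" "dif F i p a1 = 1[stk F (i + 1) p]" using c by (simp_all add: carrier_cocycles)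
    have dc: "dif G (i - 1) p c \<in> stc G i p" using ac_closed(2)[OF G p c(2)] by simp
    have fa1: "f i p a1 \<in> stc G i p" using a1 p by (simp add: cmapD(3)[OF f])
    show "\<exists>a'\<in>stc F i p. \<exists>b'\<in>stc G (i - 1) p. dif F i p a' = a \<and> b = f i p a' *[stk G i p] dif G (i - 1) p b'"
    proof (intro bexI conjI)
      show "dif F i p (a0 *[stk F i p] a1) = a" using a0 a1 a by (simp add: hom_mult[OF dF])
      have "b = f i p a0 *[stk G i p] ?b" using b fa0 H.m_lcomm[of "f i p a0" b "inv[stk G i p] f i p a0"] by simp
      then show "b = f i p (a0 *[stk F i p] a1) *[stk G i p] dif G (i - 1) p c" unfolding c(3) using a0 a1 p fa0 fa1 dc by (simp add: cmapD(4)[OF f] H.m_assoc)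
    qed (use a0 a1 c in simp_all)
  qed
next
  assume crit: "crit F G f p"
  show "\<forall>i. cohomology_map G f i p \<in> iso (cohomology F i p) (cohomology G i p)" unfolding cohomology_map_iso_iff
  proof (intro allI conjI ballI impI)
    fix i a assume a: "a \<in> carrier (cocycles F i p)" "f i p a \<in> coboundaries G i p"
    then obtain b where b: "b \<in> stc G (i - 1) p" "f i p a = dif G (i - 1) p b" by (auto simp: coboundaries_def)
    have e: "i - 1 + 1 = i" "i - 1 + 2 = i + 1" by simp_all
    have "\<exists>a'\<in>stc F (i - 1) p. dif F (i - 1) p a' = a"
      using crit[unfolded qcrit_def, THEN spec, of "i - 1", unfolded e] a b unfolding carrier_cocycles by fastforce
    then show "a \<in> coboundaries F i p" by (auto simp: coboundaries_def)
  next
    fix i b assume b: "b \<in> carrier (cocycles G i p)"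
    have "\<exists>a'\<in>stc F i p. \<exists>b'\<in>stc G (i - 1) p. dif F i p a' = 1[stk F (i + 1) p] \<and> b = f i p a' *[stk G i p] dif G (i - 1) p b'"
    proof (rule crit[unfolded qcrit_def, rule_format])
      show "1[stk F (i + 1) p] \<in> stc F (i + 1) p" by (rule ac_closed(3)[OF F p])
      show "dif F (i + 1) p 1[stk F (i + 1) p] = 1[stk F (i + 2) p] \<and> dif G i p b = f (i + 1) p 1[stk F (i + 1) p]"
        using b hom_one[OF acD(7)[OF F p, of "i + 1"] acD(2)[OF F p] acD(2)[OF F p]] by (simp add: carrier_cocycles cmap_one[OF f F G p] add.assoc)
    qed (use b in "simp add: carrier_cocycles")
    then show "\<exists>a\<in>carrier (cocycles F i p). \<exists>c\<in>coboundaries G i p. b = f i p a *[stk G i p] c" by (auto simp: carrier_cocycles coboundaries_def)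
  qed
qed

end

lemma quasi_iso_iff: assumes "F \<in> acs X" "G \<in> acs X" shows "quasi_iso X F G f \<longleftrightarrow> cmap X F G f \<and> (\<forall>p\<in>tsp X. crit F G f p)"
  unfolding quasi_iso_def chain_maps_iff
  using cohomology_map_iso_iff_crit[OF assms] by (metis (no_types, lifting))

text \<open>First the pair \<open>(f a, b)\<close> is solved for \<open>g\<close>; its solution
  \<open>b1\<close> forms with \<open>a\<close> a pair for \<open>f\<close>. The correction term of
  the second solution is moved through \<open>g\<close> and merged with that of the first.\<close>

lemma crit_cc: assumes F: "F \<in> acs X" and G: "G \<in> acs X" and H: "H \<in> acs X" and f: "cmap X F G f" and g: "cmap X G H g" and p: "p \<in> tsp X"
    and cf: "crit F G f p" and cg: "crit G H g p"
  shows "crit F H (cc X F g f) p"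
  unfolding qcrit_def
proof (intro allI ballI impI)
  fix i a b
  assume a: "a \<in> stc F (i + 1) p" and b: "b \<in> stc H i p" and ab: "dif F (i + 1) p a = 1[stk F (i + 2) p] \<and> dif H i p b = cc X F g f (i + 1) p a"
  interpret H: comm_group "stk H i p" using acD(1)[OF H p] .
  have fa: "f (i + 1) p a \<in> stc G (i + 1) p" by (rule cmapD(3)[OF f p a])
  have "dif G (i + 1) p (f (i + 1) p a) = 1[stk G (i + 2) p]" using cmapD(6)[OF f p a] ab cmap_one[OF f F G p, of "i + 2"] by (simp add: add.assoc)
  then have "\<exists>a'\<in>stc G i p. \<exists>b'\<in>stc H (i - 1) p. dif G i p a' = f (i + 1) p a \<and> b = g i p a' *[stk H i p] dif H (i - 1) p b'"
    using cg[unfolded qcrit_def, rule_format, OF fa b] ab a p by simp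
  then obtain b1 h where b1: "b1 \<in> stc G i p" "h \<in> stc H (i - 1) p" "dif G i p b1 = f (i + 1) p a" "b = g i p b1 *[stk H i p] dif H (i - 1) p h" by blast
  obtain a' g' where a': "a' \<in> stc F i p" "g' \<in> stc G (i - 1) p" "dif F i p a' = a" "b1 = f i p a' *[stk G i p] dif G (i - 1) p g'"
    using cf[unfolded qcrit_def, rule_format, OF a b1(1)] ab b1(3) by blast
  have gg: "g (i - 1) p g' \<in> stc H (i - 1) p" by (rule cmapD(3)[OF g p a'(2)])
  note cl = ac_closed(2)[OF G p a'(2), simplified] ac_closed(2)[OF H p b1(2), simplified] ac_closed(2)[OF H p gg, simplified] cmapD(3)[OF f p a'(1)]
  have "b = g i p (f i p a') *[stk H i p] (dif H (i - 1) p (g (i - 1) p g') *[stk H i p] dif H (i - 1) p h)" unfolding b1(4) a'(4) using cl cmapD(6)[OF g p a'(2)]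
    by (simp add: cmapD(4)[OF g p] cmapD(3)[OF g p] H.m_assoc)
  also have "dif H (i - 1) p (g (i - 1) p g') *[stk H i p] dif H (i - 1) p h = dif H (i - 1) p (g (i - 1) p g' *[stk H (i - 1) p] h)"
    using hom_mult[OF acD(7)[OF H p, of "i - 1"] gg b1(2)] by simp
  finally show "\<exists>a'\<in>stc F i p. \<exists>b'\<in>stc H (i - 1) p. dif F i p a' = a \<and> b = cc X F g f i p a' *[stk H i p] dif H (i - 1) p b'"
    using a' gg b1(2) p ac_closed(4)[OF H p gg b1(2)] by auto
qed

lemma crit_bij: assumes F: "F \<in> acs X" and G: "G \<in> acs X" and f: "cmap X F G f" and p: "p \<in> tsp X"
    and bij: "\<And>i. bij_betw (f i p) (stc F i p) (stc G i p)"
  shows "crit F G f p"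
  unfolding qcrit_def
proof (intro allI ballI impI)
  fix i a b
  assume a: "a \<in> stc F (i + 1) p" and b: "b \<in> stc G i p" and ab: "dif F (i + 1) p a = 1[stk F (i + 2) p] \<and> dif G i p b = f (i + 1) p a"
  interpret G: comm_group "stk G i p" using acD(1)[OF G p] .
  obtain a' where a': "a' \<in> stc F i p" "b = f i p a'" using bij b by (auto simp: bij_betw_def)
  have "f (i + 1) p (dif F i p a') = f (i + 1) p a" using a' ab p by (simp add: cmapD(6)[OF f])
  then have "dif F i p a' = a" using bij[of "i + 1"] a ac_closed(2)[OF F p a'(1)] by (auto simp: bij_betw_def inj_on_def)
  moreover have "dif G (i - 1) p 1[stk G (i - 1) p] = 1[stk G i p]" using hom_one[OF acD(7)[OF G p, of "i - 1"] acD(2)[OF G p] acD(2)[OF G p]] by simp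
  ultimately show "\<exists>a'\<in>stc F i p. \<exists>b'\<in>stc G (i - 1) p. dif F i p a' = a \<and> b = f i p a' *[stk G i p] dif G (i - 1) p b'"
    using a' b ac_closed(3)[OF G p, of "i - 1"] by (intro bexI[of _ a'] bexI[of _ "1[stk G (i - 1) p]"]) auto
qed

section \<open>Alternating sums over the faces of a list\<close>

text \<open>The alternating product over the faces of a list, the i-th face with sign
  \<open>(-1)^i\<close>. A one-element list has the empty list as its face, as in the augmented
  simplicial complex.\<close>

fun dl :: "('a, 'z) monoid_scheme => ('x list => 'a) => 'x list => 'a" where "dl G s [] = 1[G]"
| "dl G s (x # c) = s c *[G] inv[G] dl G (%c'. s (x # c')) c"

text \<open>Only the set of faces is recorded, to delimit where \<open>dl\<close> reads its
  argument; positions and signs remain in the recursion of \<open>dl\<close>.\<close>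

definition faces :: "nat => 'x list => 'x list set" where "faces k c = {c'. subseq c' c \<and> length c = length c' + k}"

text \<open>\<open>dl G (pt G l v) c\<close> is \<open>v\<close> multiplied by the incidence number
  of \<open>l\<close> in \<open>c\<close>. In this form the signs are available without indexing
  faces, and can be transposed to sums over cofaces.\<close>

definition pt :: "('a, 'z) monoid_scheme => 'x list => 'a => 'x list => 'a" where "pt G l v = (%c. if c = l then v else 1[G])"

lemma faces_simps: "c' \<in> faces k c ==> x # c' \<in> faces k (x # c)" "c \<in> faces (Suc 0) (x # c)" "c' \<in> faces k c ==> c' \<in> faces (Suc k) (x # c)"
  by (auto simp: faces_def)

lemma faces_trans: "c'' \<in> faces k c' ==> c' \<in> faces l c ==> c'' \<in> faces (k + l) c" by (auto simp: faces_def intro: subseq_order.order_trans)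

lemma dl_cong: assumes "\<And>c'. c' \<in> faces 1 c ==> s c' = t c'" shows "dl G s c = dl G t c" using assms
proof (induction c arbitrary: s t)
  case (Cons x c)
  have "dl G (%c'. s (x # c')) c = dl G (%c'. t (x # c')) c" by (rule Cons.IH) (simp add: Cons.prems faces_simps)
  then show ?case using Cons.prems[of c] by (simp add: faces_simps)
qed simp

context comm_group
begin

lemma inv_mult_mult: assumes "a \<in> carrier G" "b \<in> carrier G" "c \<in> carrier G" "d \<in> carrier G"
  shows "(a \<otimes> b) \<otimes> inv (c \<otimes> d) = (a \<otimes> inv c) \<otimes> (b \<otimes> inv d)"
  using assms by (simp add: inv_mult m_ac)

lemma mult_inv_cancel [simp]: assumes "a \<in> carrier G" "b \<in> carrier G"
  shows "a \<otimes> (inv a \<otimes> b) = b" "inv a \<otimes> (a \<otimes> b) = b" "a \<otimes> (b \<otimes> inv a) = b" "inv a \<otimes> (b \<otimes> a) = b"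
  using assms by (simp_all add: m_assoc[symmetric] m_lcomm) (metis assms m_assoc m_comm inv_closed r_inv l_one m_closed)+

lemma dl_closed: assumes "\<And>c'. c' \<in> faces 1 c ==> s c' \<in> carrier G" shows "dl G s c \<in> carrier G" using assms
proof (induction c arbitrary: s)
  case (Cons x c)
  have "dl G (%c'. s (x # c')) c \<in> carrier G" by (rule Cons.IH) (simp add: Cons.prems faces_simps)
  then show ?case using Cons.prems[of c] by (simp add: faces_simps)
qed simp

lemma dl_mult: assumes "\<And>c'. c' \<in> faces 1 c ==> s c' \<in> carrier G" "\<And>c'. c' \<in> faces 1 c ==> t c' \<in> carrier G"
  shows "dl G (%c'. s c' \<otimes> t c') c = dl G s c \<otimes> dl G t c"
  using assms
proof (induction c arbitrary: s t)
  case (Cons x c)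
  have "dl G (%c'. s (x # c') \<otimes> t (x # c')) c = dl G (%c'. s (x # c')) c \<otimes> dl G (%c'. t (x # c')) c"
    by (rule Cons.IH) (simp_all add: Cons.prems faces_simps)
  moreover have "dl G (%c'. s (x # c')) c \<in> carrier G" "dl G (%c'. t (x # c')) c \<in> carrier G" by (rule dl_closed, simp add: Cons.prems faces_simps)+
  ultimately show ?case using Cons.prems[of c] by (simp add: faces_simps inv_mult_mult)
qed simp

lemma dl_one [simp]: "dl G (%c. \<one>) c = \<one>" by (induction c) simp_all

lemma dl_inv: assumes "\<And>c'. c' \<in> faces 1 c ==> s c' \<in> carrier G" shows "dl G (%c'. inv (s c')) c = inv (dl G s c)" using assms
proof (induction c arbitrary: s)
  case (Cons x c)
  have "dl G (%c'. inv (s (x # c'))) c = inv (dl G (%c'. s (x # c')) c)" by (rule Cons.IH) (simp_all add: Cons.prems faces_simps)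
  moreover have "dl G (%c'. s (x # c')) c \<in> carrier G" by (rule dl_closed, simp add: Cons.prems faces_simps)
  ultimately show ?case using Cons.prems[of c] by (simp add: faces_simps inv_mult)
qed simp

lemma dl_hom: assumes h: "h \<in> hom G H" and H: "group H" and s: "\<And>c'. c' \<in> faces 1 c ==> s c' \<in> carrier G" shows "h (dl G s c) = dl H (%c'. h (s c')) c"
  using s
proof (induction c arbitrary: s)
  case Nil
  then show ?case using hom_one[OF h is_group H] by simp
next
  case (Cons x c)
  have "h (dl G (%c'. s (x # c')) c) = dl H (%c'. h (s (x # c'))) c" by (rule Cons.IH) (simp_all add: Cons.prems faces_simps)
  moreover have "dl G (%c'. s (x # c')) c \<in> carrier G" by (rule dl_closed, simp add: Cons.prems faces_simps)
  ultimately show ?case using Cons.prems[of c] by (simp add: faces_simps hom_mult[OF h] hom_group_inv[OF h is_group H])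
qed

text \<open>The faces that lose the head \<open>x\<close> appear twice with opposite signs; what
  remains keeps \<open>x\<close> throughout and is trivial by induction on the tail.\<close>

lemma dl_dl: assumes "\<And>c'. c' \<in> faces 2 c ==> s c' \<in> carrier G" shows "dl G (dl G s) c = \<one>" using assms
proof (induction c arbitrary: s)
  case (Cons x c)
  have cl: "dl G s c' \<in> carrier G" if "c' \<in> faces 1 (x # c)" for c'
    by (rule dl_closed) (use faces_trans[OF _ that, of _ 1] Cons.prems in "simp add: numeral_2_eq_2")
  have x: "dl G (%c'. s (x # c')) c' \<in> carrier G" if c': "c' \<in> faces 1 c" for c'
  proof (rule dl_closed)
    fix c'' assume "c'' \<in> faces 1 c'"
    then have "x # c'' \<in> faces 2 (x # c)" using faces_trans[OF _ c', of c'' 1] by (simp add: faces_simps numeral_2_eq_2)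
    then show "s (x # c'') \<in> carrier G" by (rule Cons.prems)
  qed
  have s1: "s c' \<in> carrier G" if "c' \<in> faces 1 c" for c' using that faces_simps(3)[of c' 1 c x] Cons.prems[of c'] by (simp add: numeral_2_eq_2)
  have "dl G (%c'. dl G s (x # c')) c = dl G (%c'. s c' \<otimes> inv (dl G (%c'. s (x # c')) c')) c" by simp
  also have "\<dots> = dl G s c \<otimes> inv (dl G (dl G (%c'. s (x # c'))) c)"
    using s1 x dl_mult[of c s "%c'. inv (dl G (%c'. s (x # c')) c')"] dl_inv[of c "dl G (%c'. s (x # c'))"] by simp
  also have "dl G (dl G (%c'. s (x # c'))) c = \<one>" by (rule Cons.IH) (simp add: Cons.prems faces_simps)
  finally show ?case using dl_closed[of c s] s1 by simp
qed simp

lemma dl_finprod: assumes "finite A" "\<And>l c'. l \<in> A ==> c' \<in> faces 1 c ==> f l c' \<in> carrier G"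
  shows "dl G (%c'. finprod G (%l. f l c') A) c = finprod G (%l. dl G (f l) c) A"
  using assms
proof (induction A rule: finite_induct)
  case (insert a A)
  have "dl G (%c'. finprod G (%l. f l c') (insert a A)) c = dl G (%c'. f a c' \<otimes> finprod G (%l. f l c') A) c" using insert by (intro dl_cong finprod_insert) auto
  also have "\<dots> = dl G (f a) c \<otimes> dl G (%c'. finprod G (%l. f l c') A) c" using insert.prems by (intro dl_mult finprod_closed) auto
  also have "\<dots> = finprod G (%l. dl G (f l) c) (insert a A)" using insert by (subst finprod_insert) (auto intro!: dl_closed)
  finally show ?case .
qed simp

lemma dl_pt_outside: "l \<notin> faces 1 c ==> dl G (pt G l v) c = \<one>" by (subst dl_cong[of c _ "%c. \<one>"]) (auto simp: pt_def)

text \<open>On the faces of \<open>c\<close> a cochain is the product of its one-point parts, and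
  \<open>dl\<close> is additive. The index set \<open>A\<close> may be larger than the set of faces,
  because the further terms are trivial.\<close>

lemma dl_sum: assumes A: "finite A" "faces 1 c \<subseteq> A" and s: "\<And>c'. c' \<in> faces 1 c ==> s c' \<in> carrier G"
  shows "dl G s c = finprod G (%l. dl G (pt G l (s l)) c) A"
proof -
  have "dl G s c = dl G (%c'. finprod G (%l. pt G l (s l) c') A) c"
  proof (rule dl_cong)
    fix c' assume c': "c' \<in> faces 1 c"
    have "finprod G (%l. pt G l (s l) c') A = finprod G (%l. if c' = l then s l else \<one>) A" using s[OF c'] by (intro finprod_cong') (auto simp: pt_def)
    also have "\<dots> = s c'"
    proof -
      have "finprod G (%l. if c' = l then s l else \<one>) A = finprod G (%l. if c' = l then s c' else \<one>) A" using s[OF c'] by (intro finprod_cong') auto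
      then show ?thesis using finprod_singleton[of c' A "%l. s c'"] A c' s[OF c'] by auto
    qed
    finally show "s c' = finprod G (%l. pt G l (s l) c') A" by simp
  qed
  also have "\<dots> = finprod G (%l. dl G (pt G l (s l)) c) A" using A s by (intro dl_finprod) (auto simp: pt_def)
  finally show ?thesis .
qed

lemma dl_pt_Nil: "v \<in> carrier G ==> dl G (pt G [] v) c = (if length c = 1 then v else \<one>)"
proof (cases c)
  case (Cons x c')
  assume v: "v \<in> carrier G"
  have "dl G (pt G [] v) c = pt G [] v c' \<otimes> inv (dl G (%c. \<one>) c')" unfolding Cons by (simp add: pt_def)
  then show ?thesis using v Cons by (simp add: pt_def)
qed simp

end

definition sg :: "('a, 'z) monoid_scheme => int => 'a => 'a" where "sg G n x = (if even n then x else inv[G] x)"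

context comm_group
begin

lemma sg_closed [simp]: "x \<in> carrier G ==> sg G n x \<in> carrier G" by (simp add: sg_def)

lemma sg_one [simp]: "sg G n \<one> = \<one>" by (simp add: sg_def)

lemma sg_mult: "x \<in> carrier G ==> y \<in> carrier G ==> sg G n (x \<otimes> y) = sg G n x \<otimes> sg G n y" by (simp add: sg_def inv_mult)

lemma sg_inv: "x \<in> carrier G ==> sg G n (inv x) = inv (sg G n x)" by (simp add: sg_def)

lemma sg_sg [simp]: "x \<in> carrier G ==> sg G n (sg G n x) = x" by (simp add: sg_def)

lemma sg_plus_one: "x \<in> carrier G ==> sg G (n + 1) x = inv (sg G n x)" by (simp add: sg_def)

lemma sg_minus_one: "x \<in> carrier G ==> sg G (n - 1) x = inv (sg G n x)" by (simp add: sg_def)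

lemma sg_hom: "h \<in> hom G H ==> group H ==> x \<in> carrier G ==> h (sg G n x) = sg H n (h x)" by (simp add: sg_def hom_group_inv is_group)

lemma dl_sg: assumes "\<And>c'. c' \<in> faces 1 c ==> s c' \<in> carrier G" shows "dl G (%c'. sg G n (s c')) c = sg G n (dl G s c)"
  using dl_inv[of c s] assms by (simp add: sg_def)

end

lemma comm_group_product_group: assumes "\<And>i. i \<in> I ==> comm_group (G i)" shows "comm_group (product_group I G)"
proof (rule group.group_comm_groupI)
  show "group (product_group I G)" using assms by (simp add: comm_group_def)
next
  fix x y assume "x \<in> carrier (product_group I G)" "y \<in> carrier (product_group I G)"
  then show "x *[product_group I G] y = y *[product_group I G] x" using assms by (auto intro!: restrict_ext comm_monoid.m_comm simp: comm_group_def)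
qed

lemma product_group_eqI: assumes "s \<in> carrier (product_group I G)" "t \<in> carrier (product_group I G)" "\<And>i. i \<in> I ==> s i = t i" shows "s = t"
  using assms by (auto intro: PiE_ext)

section \<open>Solving for cone coboundaries\<close>

locale gcmap =
  fixes A :: "int => 'a monoid" and d :: "int => 'a => 'a" and B :: "int => 'b monoid" and e :: "int => 'b => 'b" and f :: "int => 'a => 'b"
  assumes grA: "\<And>i. comm_group (A i)" and grB: "\<And>i. comm_group (B i)"
    and d: "\<And>i. d i \<in> hom (A i) (A (i + 1))" and e: "\<And>i. e i \<in> hom (B i) (B (i + 1))"
    and dd: "\<And>i a. a \<in> carrier (A i) ==> d (i + 1) (d i a) = 1[A (i + 2)]"
    and ee: "\<And>i b. b \<in> carrier (B i) ==> e (i + 1) (e i b) = 1[B (i + 2)]"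
    and f: "\<And>i. f i \<in> hom (A i) (B i)"
    and fd: "\<And>i a. a \<in> carrier (A i) ==> f (i + 1) (d i a) = e i (f i a)"
begin

text \<open>Up to sign, \<open>pre\<close> says that \<open>(a, b)\<close> is a cocycle of the
  mapping cone of \<open>f\<close>, and \<open>sol\<close> below that it is a coboundary.\<close>

definition pre :: "int => 'a => 'b => bool" where
  "pre i a b \<longleftrightarrow> a \<in> carrier (A (i + 1)) \<and> b \<in> carrier (B i) \<and> d (i + 1) a = 1[A (i + 2)] \<and> e i b = f (i + 1) a"

definition sol :: "int => 'a => 'b => bool" where
  "sol i a b \<longleftrightarrow> (\<exists>a'\<in>carrier (A i). \<exists>b'\<in>carrier (B (i - 1)). d i a' = a \<and> b = f i a' *[B i] e (i - 1) b')"

lemma qcrit_iff: "qcrit A d B e f \<longleftrightarrow> (\<forall>i a b. pre i a b --> sol i a b)" unfolding qcrit_def pre_def sol_def by blast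

lemma grA' [simp]: "group (A i)" and grB' [simp]: "group (B i)" using grA grB by (auto simp: comm_group_def)

lemma e': "e (i - 1) \<in> hom (B (i - 1)) (B i)" using e[of "i - 1"] by simp

lemma ee': "b \<in> carrier (B (i - 1)) ==> e i (e (i - 1) b) = 1[B (i + 1)]" using ee[of b "i - 1"] by (simp add: add.commute)

lemma closed [simp]: "a \<in> carrier (A i) ==> d i a \<in> carrier (A (i + 1))" "a \<in> carrier (A i) ==> f i a \<in> carrier (B i)"
  "b \<in> carrier (B i) ==> e i b \<in> carrier (B (i + 1))"
  "b \<in> carrier (B (i - 1)) ==> e (i - 1) b \<in> carrier (B i)"
  using d e f e' hom_in_carrier by metis+

lemma one_simps [simp]: "d i 1[A i] = 1[A (i + 1)]" "e i 1[B i] = 1[B (i + 1)]" "e (i - 1) 1[B (i - 1)] = 1[B i]" "f i 1[A i] = 1[B i]"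
  using hom_one[OF d, of i] hom_one[OF e, of i] hom_one[OF e', of i] hom_one[OF f, of i] by simp_all

text \<open>The new pair differs from the old one by the cone coboundary of \<open>(a1, b1)\<close>,
  so it is again a cocycle, and adding \<open>(a1, b1)\<close> to a solution for it solves the
  original pair. The arguments below remove part of the data in this way and then continue with what
  is left.\<close>

lemma assumes a1: "a1 \<in> carrier (A i)" and b1: "b1 \<in> carrier (B (i - 1))" and pre: "pre i a b"
  defines "a2 \<equiv> a *[A (i + 1)] inv[A (i + 1)] d i a1" and "b2 \<equiv> b *[B i] inv[B i] (f i a1 *[B i] e (i - 1) b1)"
  shows pre_modify: "pre i a2 b2" and sol_modify: "sol i a2 b2 ==> sol i a b"
proof -
  interpret A0: comm_group "A i" by (rule grA)
  interpret A1: comm_group "A (i + 1)" by (rule grA)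
  interpret B0: comm_group "B i" by (rule grB)
  interpret B1: comm_group "B (i + 1)" by (rule grB)
  interpret Bm: comm_group "B (i - 1)" by (rule grB)
  interpret A2: comm_group "A (i + 2)" by (rule grA)
  note p = pre[unfolded pre_def]
  have i2: "i + 1 + 1 = i + 2" by simp
  have da: "d (i + 1) a2 = 1[A (i + 2)]" using p a1 unfolding a2_def by (subst hom_mult[OF d]) (simp_all add: hom_group_inv[OF d] dd i2)
  have "e i b2 = e i b *[B (i + 1)] inv[B (i + 1)] (e i (f i a1) *[B (i + 1)] 1[B (i + 1)])"
    using p a1 b1 unfolding b2_def by (simp add: hom_mult[OF e] hom_group_inv[OF e] ee')
  also have "\<dots> = f (i + 1) a *[B (i + 1)] inv[B (i + 1)] f (i + 1) (d i a1)" using p a1 by (simp add: fd)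
  also have "\<dots> = f (i + 1) a2" using p a1 unfolding a2_def by (simp add: hom_mult[OF f] hom_group_inv[OF f])
  finally show "pre i a2 b2" using da p a1 b1 by (simp add: pre_def a2_def b2_def)
  assume "sol i a2 b2"
  then obtain a' b' where s: "a' \<in> carrier (A i)" "b' \<in> carrier (B (i - 1))" "d i a' = a2" "b2 = f i a' *[B i] e (i - 1) b'" unfolding sol_def by blast
  have "d i (a1 *[A i] a') = a" using s a1 p by (simp add: hom_mult[OF d] a2_def)
  moreover have "b = (f i a1 *[B i] e (i - 1) b1) *[B i] b2" using a1 b1 p by (simp add: b2_def)
  then have "b = f i (a1 *[A i] a') *[B i] e (i - 1) (b1 *[B (i - 1)] b')" using s(1,2) a1 b1 unfolding s(4) by (simp add: hom_mult[OF f] hom_mult[OF e'] B0.m_ac)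
  ultimately show "sol i a b" unfolding sol_def using s a1 b1 by (intro bexI[of _ "a1 *[A i] a'"] bexI[of _ "b1 *[B (i - 1)] b'"]) auto
qed

end

text \<open>The differentials are triangular for the rank \<open>r\<close>: where all lower ranks
  are trivial, only the diagonal entry \<open>dA c\<close> or \<open>dB c\<close> acts. This
  describes a finite filtration whose pieces are products of the factors, without speaking of
  subcomplexes.\<close>

locale filtered_gcmap = gcmap "%n. product_group I (%c. A c n)" DA "%n. product_group I (%c. B c n)" DB "%n s. \<lambda>c\<in>I. f c n (s c)"
  for I :: "'c set" and A :: "'c => int => 'a monoid" and B :: "'c => int => 'b monoid" and DA DB f +
  fixes r :: "'c => nat" and N :: nat and dA dB
  assumes grAc: "\<And>c i. c \<in> I ==> comm_group (A c i)" and grBc: "\<And>c i. c \<in> I ==> comm_group (B c i)" and bound: "\<And>c. c \<in> I ==> r c < N"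
    and DA: "\<And>n s c. s \<in> carrier (product_group I (%c. A c n)) ==> c \<in> I ==>
        (\<And>c'. c' \<in> I ==> r c' < r c ==> s c' = 1[A c' n]) ==> DA n s c = dA c n (s c)"
    and DB: "\<And>n s c. s \<in> carrier (product_group I (%c. B c n)) ==> c \<in> I ==>
        (\<And>c'. c' \<in> I ==> r c' < r c ==> s c' = 1[B c' n]) ==> DB n s c = dB c n (s c)"
    and d1: "\<And>c n. c \<in> I ==> dA c n 1[A c n] = 1[A c (n + 1)]"
    and e1: "\<And>c n. c \<in> I ==> dB c n 1[B c n] = 1[B c (n + 1)]"
    and f1: "\<And>c n. c \<in> I ==> f c n 1[A c n] = 1[B c n]"
    and crit: "\<And>c. c \<in> I ==> qcrit (A c) (dA c) (B c) (dB c) (f c)"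
begin

text \<open>In the lowest rank that is not yet trivial the equations are diagonal, so
  \<open>crit\<close> solves them factor by factor. Subtracting the coboundary of this partial
  solution clears one more rank.\<close>

lemma qcrit_filtered: "qcrit (%n. product_group I (%c. A c n)) DA (%n. product_group I (%c. B c n)) DB (%n s. \<lambda>c\<in>I. f c n (s c))" unfolding qcrit_iff
proof (intro allI impI)
  let ?PA = "%n. product_group I (%c. A c n)" and ?PB = "%n. product_group I (%c. B c n)"
  have gA [simp]: "group (A c n)" and gB [simp]: "group (B c n)" if "c \<in> I" for c n using grAc[OF that] grBc[OF that] by (auto simp: comm_group_def)
  have mA [simp]: "1[A c n] \<in> carrier (A c n)" and mB [simp]: "1[B c n] \<in> carrier (B c n)" if "c \<in> I" for c n
    using gA[OF that] gB[OF that] by (auto intro: monoid.one_closed group.is_monoid)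
  \<comment> \<open>The ranks below \<open>k\<close> are clear, and \<open>m\<close> bounds the
    number of ranks left; the induction is on \<open>m\<close>. When it reaches zero,
    \<open>bound\<close> makes the whole pair trivial.\<close>
  have main: "sol i a b" if "pre i a b" "N \<le> k + m" "\<And>c. c \<in> I ==> r c < k ==> a c = 1[A c (i + 1)] \<and> b c = 1[B c i]" for i a b k m using that
  proof (induction m arbitrary: k a b)
    case 0
    have ab: "a \<in> carrier (?PA (i + 1))" "b \<in> carrier (?PB i)" using 0 by (simp_all only: pre_def)
    have "a = 1[?PA (i + 1)]" by (rule product_group_eqI[OF ab(1)]) (use 0 bound in "auto dest: order_less_le_trans")
    moreover have "b = 1[?PB i]" by (rule product_group_eqI[OF ab(2)]) (use 0 bound in "auto dest: order_less_le_trans")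
    ultimately show ?case unfolding sol_def by (intro bexI[of _ "1[?PA i]"] bexI[of _ "1[?PB (i - 1)]"] conjI)
        (simp_all only: one_simps(1,3,4) monoid.one_closed[OF group.is_monoid[OF grA']] monoid.one_closed[OF group.is_monoid[OF grB']]
          monoid.r_one[OF group.is_monoid[OF grB']])
  next
    case (Suc m)
    have ab: "a \<in> carrier (?PA (i + 1))" "b \<in> carrier (?PB i)" "DA (i + 1) a = 1[?PA (i + 2)]" "DB i b = (\<lambda>c\<in>I. f c (i + 1) (a c))"
      using Suc.prems(1) by (simp_all only: pre_def)
    have ex: "\<exists>al be. al \<in> carrier (A c i) \<and> be \<in> carrier (B c (i - 1)) \<and> dA c i al = a c \<and>
        b c = f c i al *[B c i] dB c (i - 1) be" if c: "c \<in> I" "r c = k" for c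
    proof -
      have "dA c (i + 1) (a c) = DA (i + 1) a c" by (rule DA[OF ab(1) c(1), symmetric]) (use Suc.prems c in simp)
      then have "dA c (i + 1) (a c) = 1[A c (i + 2)]" using ab(3) c by simp
      moreover have "dB c i (b c) = DB i b c" by (rule DB[OF ab(2) c(1), symmetric]) (use Suc.prems c in simp)
      then have "dB c i (b c) = f c (i + 1) (a c)" using ab(4) c by simp
      moreover have "a c \<in> carrier (A c (i + 1))" "b c \<in> carrier (B c i)" using ab(1,2) c by (auto simp: PiE_iff)
      ultimately show ?thesis using crit[OF c(1)] unfolding qcrit_def by blast
    qed
    define al where "al c = (SOME al. \<exists>be. al \<in> carrier (A c i) \<and> be \<in> carrier (B c (i - 1)) \<and> dA c i al = a c \<and>
        b c = f c i al *[B c i] dB c (i - 1) be)" for c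
    have ex2: "\<exists>be. al c \<in> carrier (A c i) \<and> be \<in> carrier (B c (i - 1)) \<and> dA c i (al c) = a c \<and>
        b c = f c i (al c) *[B c i] dB c (i - 1) be" if c: "c \<in> I" "r c = k" for c
      unfolding al_def by (rule someI_ex[OF ex[OF c]])
    define be where "be c = (SOME be. al c \<in> carrier (A c i) \<and> be \<in> carrier (B c (i - 1)) \<and> dA c i (al c) = a c \<and>
        b c = f c i (al c) *[B c i] dB c (i - 1) be)" for c
    have albe: "al c \<in> carrier (A c i)" "be c \<in> carrier (B c (i - 1))" "dA c i (al c) = a c"
        "b c = f c i (al c) *[B c i] dB c (i - 1) (be c)" if c: "c \<in> I" "r c = k" for c
      using someI_ex[OF ex2[OF c]] unfolding be_def[symmetric] by blast+
    define a1 where "a1 = (\<lambda>c\<in>I. if r c = k then al c else 1[A c i])"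
    define b1 where "b1 = (\<lambda>c\<in>I. if r c = k then be c else 1[B c (i - 1)])"
    have a1: "a1 \<in> carrier (?PA i)" and b1: "b1 \<in> carrier (?PB (i - 1))" using albe by (auto simp: a1_def b1_def)
    have Da1: "DA i a1 c = dA c i (a1 c)" and Db1: "DB (i - 1) b1 c = dB c (i - 1) (b1 c)" if c: "c \<in> I" "r c \<le> k" for c
      by (rule DA[OF a1 c(1)]; use c in "simp add: a1_def") (rule DB[OF b1 c(1)]; use c in "simp add: b1_def")
    have e1': "dB c (i - 1) 1[B c (i - 1)] = 1[B c i]" if "c \<in> I" for c using e1[OF that, of "i - 1"] by simp
    let ?a = "a *[?PA (i + 1)] inv[?PA (i + 1)] DA i a1"
    let ?b = "b *[?PB i] inv[?PB i] ((\<lambda>c\<in>I. f c i (a1 c)) *[?PB i] DB (i - 1) b1)"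
    have DA1: "DA i a1 \<in> carrier (?PA (i + 1))" and DB1: "DB (i - 1) b1 \<in> carrier (?PB i)" and fa1: "(\<lambda>c\<in>I. f c i (a1 c)) \<in> carrier (?PB i)"
      by (rule closed(1)[OF a1], rule closed(4)[OF b1], rule closed(2)[OF a1])
    have fD: "(\<lambda>c\<in>I. f c i (a1 c)) *[?PB i] DB (i - 1) b1 \<in> carrier (?PB i)" by (rule monoid.m_closed[OF group.is_monoid[OF grB'] fa1 DB1])
    have "sol i ?a ?b"
    proof (rule Suc.IH[of _ _ "Suc k"])
      show "pre i ?a ?b" by (rule pre_modify[OF a1 b1 Suc.prems(1)])
      fix c assume c: "c \<in> I" "r c < Suc k"
      interpret Ac: comm_group "A c (i + 1)" by (rule grAc[OF c(1)])
      interpret Bc: comm_group "B c i" by (rule grBc[OF c(1)])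
      have acb: "a c \<in> carrier (A c (i + 1))" "b c \<in> carrier (B c i)" using ab(1,2) c by (auto simp: PiE_iff)
      have "?a c = a c *[A c (i + 1)] inv[A c (i + 1)] DA i a1 c" using c DA1 by (simp add: inv_product_group)
      also have "\<dots> = 1[A c (i + 1)]" using Da1[OF c(1)] c Suc.prems(3)[OF c(1)] acb albe(3)[OF c(1)] d1[OF c(1), of i] by (cases "r c = k") (simp_all add: a1_def)
      finally have 1: "?a c = 1[A c (i + 1)]" .
      have "?b c = b c *[B c i] inv[B c i] (f c i (a1 c) *[B c i] DB (i - 1) b1 c)" using c fD by (simp add: inv_product_group)
      also have "\<dots> = 1[B c i]" using Db1[OF c(1)] c Suc.prems(3)[OF c(1)] acb albe(4)[OF c(1)] e1'[OF c(1)] f1[OF c(1), of i]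
        by (cases "r c = k") (simp_all add: a1_def b1_def)
      finally show "?a c = 1[A c (i + 1)] \<and> ?b c = 1[B c i]" using 1 by simp
    qed (use Suc.prems in simp)
    then show ?case by (rule sol_modify[OF a1 b1 Suc.prems(1)])
  qed
  fix i a b assume "pre i a b"
  then show "sol i a b" by (rule main[of _ _ _ 0 N]) simp_all
qed

end

lemma qcrit_shift: assumes "qcrit A d B e f" shows "qcrit (%n. A (n + k)) (%n. d (n + k)) (%n. B (n + k)) (%n. e (n + k)) (%n. f (n + k))" unfolding qcrit_def
proof (intro allI ballI impI)
  fix i a b
  have e: "i + 1 + k = i + k + 1" "i + 2 + k = i + k + 2" "i - 1 + k = i + k - 1" by simp_all
  assume "a \<in> carrier (A (i + 1 + k))" "b \<in> carrier (B (i + k))" "d (i + 1 + k) a = 1[A (i + 2 + k)] \<and> e (i + k) b = f (i + 1 + k) a"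
  then show "\<exists>a'\<in>carrier (A (i + k)). \<exists>b'\<in>carrier (B (i - 1 + k)). d (i + k) a' = a \<and> b = f (i + k) a' *[B (i + k)] e (i - 1 + k) b'"
    using assms[unfolded qcrit_def, THEN spec, of "i + k"] unfolding e by blast
qed

section \<open>Cochains on strict chains\<close>

definition chs :: "'x topology => 'x set => 'x list set" where "chs X S = {c. c \<noteq> [] \<and> set c \<subseteq> S \<and> sorted_wrt (pt_less X) c}"

definition dg :: "'x list => int" where "dg c = int (length c) - 1"

lemma dg_simps [simp]: "dg [] = - 1" "dg (x # c) = dg c + 1" by (simp_all add: dg_def)

lemma pt_less_irrefl [simp]: "\<not> pt_less X p p" by (simp add: pt_less_def)

lemma pt_less_imp_le: "pt_less X p q ==> pt_le X p q" by (simp add: pt_less_def)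

lemma sorted_wrt_subseq: "subseq c' c ==> sorted_wrt R c ==> sorted_wrt R c'"
proof (induction rule: list_emb.induct)
  case (list_emb_Cons2 x y xs ys)
  then show ?case by (auto dest: list_emb_set)
qed auto

lemma subseq_set: "subseq c' c ==> set c' \<subseteq> set c" by (auto dest: list_emb_set)

lemma chsD: assumes "c \<in> chs X S" shows "c \<noteq> []" "last c \<in> S" "hd c \<in> S" "set c \<subseteq> S" using assms by (auto simp: chs_def)

lemma chs_mono: "S \<subseteq> S' ==> chs X S \<subseteq> chs X S'" by (auto simp: chs_def)

lemma chs_singleton [simp]: "[x] \<in> chs X S \<longleftrightarrow> x \<in> S" by (simp add: chs_def)

lemma faces_chs: "c' \<in> faces k c ==> c' \<noteq> [] ==> c \<in> chs X S ==> c' \<in> chs X S"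
  by (auto simp: chs_def faces_def dest: subseq_set intro: sorted_wrt_subseq)

lemma faces_dg: "c' \<in> faces 1 c ==> n - dg c' = n - dg c + 1" by (auto simp: faces_def dg_def)

lemma finite_chs: "finite S ==> finite (chs X S)"
proof -
  assume S: "finite S"
  have "distinct c" if "sorted_wrt (pt_less X) c" for c using that by (induction c) auto
  then have "length c \<le> card S" if "c \<in> chs X S" for c using that S by (metis (no_types, lifting) chs_def mem_Collect_eq distinct_card card_mono)
  then have "chs X S \<subseteq> {c. set c \<subseteq> S \<and> length c \<le> card S}" by (auto simp: chs_def)
  then show ?thesis using finite_lists_length_le[OF S] finite_subset by blast
qed

text \<open>All faces are brought into the stalk at the last point \<open>y\<close> of the chain;
  only the face that omits this point is really moved. The neutral value at the empty list turns the
  augmented \<open>dl\<close> into the unaugmented coboundary.\<close>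

definition rsx :: "('x, 'u) acomplex => int => 'x => ('x list => 'u) => 'x list => 'u" where
  "rsx F m y s c = (if c = [] then 1[stk F m y] else res (trm F m) (last c) y (s c))"

text \<open>The total differential at \<open>c\<close>. The simplicial part carries the sign of the
  total degree \<open>n\<close>, which changes from one application to the next; so the two mixed
  terms of the square cancel.\<close>

definition TD :: "('x, 'u) acomplex => int => ('x list => 'u) => 'x list => 'u" where "TD F n s c = dif F (n - dg c) (last c) (s c) *[stk F (n - dg c + 1) (last c)]
     sg (stk F (n - dg c + 1) (last c)) n (dl (stk F (n - dg c + 1) (last c)) (rsx F (n - dg c + 1) (last c) s) c)"

text \<open>Total degree \<open>n\<close> puts a term of degree \<open>n - dg c\<close> on the chain
  \<open>c\<close>. If no two points of \<open>S\<close> are equivalent, this is the normalized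
  complex for the derived limit of \<open>F\<close> over \<open>S\<close>.\<close>

definition TG :: "'x topology => ('x, 'u) acomplex => 'x set => int => ('x list => 'u) monoid" where
  "TG X F S n = product_group (chs X S) (%c. stk F (n - dg c) (last c))"

definition TS :: "'x topology => ('x, 'u) acomplex => 'x set => int => ('x list => 'u) => 'x list => 'u" where "TS X F S n s = (\<lambda>c\<in>chs X S. TD F n s c)"

lemma TG_mult [simp]: "(\<otimes>\<^bsub>TG X F S n\<^esub>) = (%s t. \<lambda>c\<in>chs X S. s c *[stk F (n - dg c) (last c)] t c)"
  and TG_one [simp]: "1[TG X F S n] = (\<lambda>c\<in>chs X S. 1[stk F (n - dg c) (last c)])"
  by (simp_all add: TG_def)

lemma TG_carrier: "s \<in> carrier (TG X F S n) \<longleftrightarrow> s \<in> extensional (chs X S) \<and> (\<forall>c\<in>chs X S. s c \<in> stc F (n - dg c) (last c))"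
  by (auto simp: TG_def PiE_iff)

lemma TG_eqI: assumes "s \<in> carrier (TG X F S n)" "t \<in> carrier (TG X F S n)" "\<And>c. c \<in> chs X S ==> s c = t c" shows "s = t"
  using assms unfolding TG_def by (rule product_group_eqI)

lemma TD_cong:
  fixes F :: "('x, 'u) acomplex"
  assumes "s c = t c" "\<And>c'. c' \<in> faces 1 c ==> c' \<noteq> [] ==> s c' = t c'"
  shows "TD F n s c = TD F n t c"
proof -
  have "dl G (rsx F m y s) c = dl G (rsx F m y t) c" for G :: "'u monoid" and m y by (rule dl_cong) (use assms(2) in "auto simp: rsx_def")
  then show ?thesis using assms(1) by (simp add: TD_def)
qed

text \<open>Nonempty faces of chains in \<open>S'\<close> are again chains in \<open>S'\<close>, and
  the value at the empty list is never read. Hence cochains over varying \<open>S\<close> restrict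
  compatibly with the differential.\<close>

lemma TS_restrict: assumes "S' \<subseteq> S" shows "restrict (TS X F S n s) (chs X S') = TS X F S' n (restrict s (chs X S'))"
proof (rule ext)
  fix c
  show "restrict (TS X F S n s) (chs X S') c = TS X F S' n (restrict s (chs X S')) c"
  proof (cases "c \<in> chs X S'")
    case True
    then have "TD F n s c = TD F n (restrict s (chs X S')) c" by (intro TD_cong) (auto dest: faces_chs)
    then show ?thesis using True chs_mono[OF assms] by (auto simp: TS_def)
  qed (auto simp: TS_def)
qed

context
  fixes X :: "'x topology" and F :: "('x, 'u) acomplex"
  assumes F: "F \<in> acs X"
begin

lemma res_cl [simp]: "pt_le X p q ==> s \<in> stc F i p ==> res (trm F i) p q s \<in> stc F i q"
  and dif_cl [simp]: "p \<in> tsp X ==> s \<in> stc F i p ==> dif F i p s \<in> stc F (i + 1) p"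
  and one_cl [simp]: "p \<in> tsp X ==> 1[stk F i p] \<in> stc F i p"
  and mult_cl [simp]: "p \<in> tsp X ==> s \<in> stc F i p ==> t \<in> stc F i p ==> s *[stk F i p] t \<in> stc F i p"
  and inv_cl [simp]: "p \<in> tsp X ==> s \<in> stc F i p ==> inv[stk F i p] s \<in> stc F i p"
  by (rule ac_closed[OF F]; assumption)+

lemma res_one [simp]: "pt_le X p q ==> res (trm F i) p q 1[stk F i p] = 1[stk F i q]" using hom_one[OF acD(3)[OF F]] acD(2)[OF F] pt_leD by metis

lemma dif_one [simp]: "p \<in> tsp X ==> dif F i p 1[stk F i p] = 1[stk F (i + 1) p]" using hom_one[OF acD(7)[OF F]] acD(2)[OF F] by metis

lemma res_mult [simp]: "pt_le X p q ==> s \<in> stc F i p ==> t \<in> stc F i p ==>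
    res (trm F i) p q (s *[stk F i p] t) = res (trm F i) p q s *[stk F i q] res (trm F i) p q t"
  using hom_mult[OF acD(3)[OF F]] by metis

lemma dif_mult [simp]: "p \<in> tsp X ==> s \<in> stc F i p ==> t \<in> stc F i p ==> dif F i p (s *[stk F i p] t) = dif F i p s *[stk F (i + 1) p] dif F i p t"
  using hom_mult[OF acD(7)[OF F]] by metis

lemma res_inv [simp]: "pt_le X p q ==> s \<in> stc F i p ==> res (trm F i) p q (inv[stk F i p] s) = inv[stk F i q] (res (trm F i) p q s)"
  using hom_group_inv[OF acD(3)[OF F]] acD(2)[OF F] pt_leD by metis

lemma dif_inv [simp]: "p \<in> tsp X ==> s \<in> stc F i p ==> dif F i p (inv[stk F i p] s) = inv[stk F (i + 1) p] (dif F i p s)"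
  using hom_group_inv[OF acD(7)[OF F]] acD(2)[OF F] by metis

lemma res_sg: "pt_le X p q ==> s \<in> stc F i p ==> res (trm F i) p q (sg (stk F i p) n s) = sg (stk F i q) n (res (trm F i) p q s)" by (simp add: sg_def)

lemma dif_sg: "p \<in> tsp X ==> s \<in> stc F i p ==> dif F i p (sg (stk F i p) n s) = sg (stk F (i + 1) p) n (dif F i p s)" by (simp add: sg_def)

context
  fixes S
  assumes S: "S \<subseteq> tsp X"
begin

lemma chs_last: "c \<in> chs X S ==> last c \<in> tsp X" using chsD(2) S by blast

lemma chs_le_last: assumes c: "c \<in> chs X S" and x: "x \<in> set c" shows "pt_le X x (last c)"
proof (cases "x = last c")
  case True
  then show ?thesis using chs_last[OF c] by simp
next
  case False
  have "c = butlast c @ [last c]" using chsD(1)[OF c] by simp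
  moreover from this False x have "x \<in> set (butlast c)" by (metis Un_iff empty_iff list.set(1) set_ConsD set_append)
  moreover have "sorted_wrt (pt_less X) c" using c by (simp add: chs_def)
  ultimately have "pt_less X x (last c)" by (metis sorted_wrt_append list.set_intros(1))
  then show ?thesis by (rule pt_less_imp_le)
qed

lemma faces_le: "c' \<in> faces k c ==> c' \<noteq> [] ==> c \<in> chs X S ==> pt_le X (last c') (last c)"
  by (rule chs_le_last) (use last_in_set subseq_set in "fastforce simp: faces_def")+

lemma comm_group_TG: "comm_group (TG X F S n)" unfolding TG_def by (rule comm_group_product_group) (simp add: acD(1)[OF F] chs_last)

lemma TG_face: "s \<in> carrier (TG X F S n) ==> c \<in> chs X S ==> c' \<in> faces 1 c ==> c' \<noteq> [] ==> s c' \<in> stc F (n - dg c + 1) (last c')"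
proof -
  assume s: "s \<in> carrier (TG X F S n)" and c: "c \<in> chs X S" "c' \<in> faces 1 c" "c' \<noteq> []"
  have "s c' \<in> stc F (n - dg c') (last c')" using s faces_chs[OF c(2,3,1)] unfolding TG_carrier by blast
  then show ?thesis unfolding faces_dg[OF c(2)] .
qed

lemma rsx_closed: "s \<in> carrier (TG X F S n) ==> c \<in> chs X S ==> c' \<in> faces 1 c ==> rsx F (n - dg c + 1) (last c) s c' \<in> stc F (n - dg c + 1) (last c)"
  using TG_face[of s n c c'] faces_le[of c' 1 c] chs_last[of c] by (auto simp: rsx_def)

lemma dl_rsx_closed: "s \<in> carrier (TG X F S n) ==> c \<in> chs X S ==>
    dl (stk F (n - dg c + 1) (last c)) (rsx F (n - dg c + 1) (last c) s) c \<in> stc F (n - dg c + 1) (last c)"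
  by (rule comm_group.dl_closed[OF acD(1)[OF F chs_last]]) (auto intro: rsx_closed)

lemma TD_closed: "s \<in> carrier (TG X F S n) ==> c \<in> chs X S ==> TD F n s c \<in> stc F (n - dg c + 1) (last c)" unfolding TD_def using dl_rsx_closed chs_last
  by (simp add: TG_carrier comm_group.sg_closed[OF acD(1)[OF F]])

lemma TS_closed: "s \<in> carrier (TG X F S n) ==> TS X F S n s \<in> carrier (TG X F S (n + 1))"
proof -
  assume s: "s \<in> carrier (TG X F S n)"
  have e: "n + 1 - dg c = n - dg c + 1" for c :: "'x list" by simp
  show ?thesis unfolding TG_carrier e using TD_closed[OF s] by (simp add: TS_def)
qed

lemma TD_mult: assumes s: "s \<in> carrier (TG X F S n)" and t: "t \<in> carrier (TG X F S n)" and c: "c \<in> chs X S"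
  shows "TD F n (s *[TG X F S n] t) c = TD F n s c *[stk F (n - dg c + 1) (last c)] TD F n t c"
proof -
  let ?m = "n - dg c + 1" and ?y = "last c"
  interpret G: comm_group "stk F ?m ?y" by (rule acD(1)[OF F chs_last[OF c]])
  have "rsx F ?m ?y (s *[TG X F S n] t) c' = rsx F ?m ?y s c' *[stk F ?m ?y] rsx F ?m ?y t c'" if c': "c' \<in> faces 1 c" for c'
  proof (cases "c' = []")
    case False
    have "(s *[TG X F S n] t) c' = s c' *[stk F (n - dg c') (last c')] t c'" using faces_chs[OF c' False c] by simp
    then show ?thesis using TG_face[OF s c c' False] TG_face[OF t c c' False] faces_le[OF c' False c] False unfolding faces_dg[OF c'] by (simp add: rsx_def)
  qed (simp add: rsx_def)
  then have "dl (stk F ?m ?y) (rsx F ?m ?y (s *[TG X F S n] t)) c = dl (stk F ?m ?y) (%c'. rsx F ?m ?y s c' *[stk F ?m ?y] rsx F ?m ?y t c') c" by (rule dl_cong)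
  also have "\<dots> = dl (stk F ?m ?y) (rsx F ?m ?y s) c *[stk F ?m ?y] dl (stk F ?m ?y) (rsx F ?m ?y t) c"
    using rsx_closed[OF s c] rsx_closed[OF t c] by (rule G.dl_mult)
  finally have "dl (stk F ?m ?y) (rsx F ?m ?y (s *[TG X F S n] t)) c = dl (stk F ?m ?y) (rsx F ?m ?y s) c *[stk F ?m ?y] dl (stk F ?m ?y) (rsx F ?m ?y t) c" .
  moreover have "s c \<in> stc F (n - dg c) ?y" "t c \<in> stc F (n - dg c) ?y" using s t c by (simp_all add: TG_carrier)
  moreover have "dif F (n - dg c) ?y (s c) \<in> stc F ?m ?y" "dif F (n - dg c) ?y (t c) \<in> stc F ?m ?y" using calculation(2,3) chs_last[OF c] by simp_all
  ultimately show ?thesis using dl_rsx_closed[OF s c] dl_rsx_closed[OF t c] c chs_last[OF c] by (simp add: TD_def G.sg_mult G.m_ac)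
qed

lemma TS_hom: "TS X F S n \<in> hom (TG X F S n) (TG X F S (n + 1))"
proof (rule homI[OF TS_closed])
  fix s t assume st: "s \<in> carrier (TG X F S n)" "t \<in> carrier (TG X F S n)"
  have e: "n + 1 - dg c = n - dg c + 1" for c :: "'x list" by simp
  show "TS X F S n (s *[TG X F S n] t) = TS X F S n s *[TG X F S (n + 1)] TS X F S n t" unfolding TG_mult[of X F S "n + 1"] e
    unfolding TS_def by (rule restrict_ext) (simp add: TD_mult[OF st] del: TG_mult)
qed

text \<open>The squares of \<open>dif\<close> and of \<open>dl\<close> are trivial. The two mixed
  terms both equal \<open>?A\<close>, with the opposite signs that belong to \<open>n\<close> and
  \<open>n + 1\<close>.\<close>

lemma TS_TS: assumes s: "s \<in> carrier (TG X F S n)" shows "TS X F S (n + 1) (TS X F S n s) = 1[TG X F S (n + 2)]"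
proof (rule ext)
  fix c
  show "TS X F S (n + 1) (TS X F S n s) c = 1[TG X F S (n + 2)] c"
  proof (cases "c \<in> chs X S")
    case c: True
    define m where "m = n - dg c + 1"
    define y where "y = last c"
    have i: "n + 1 - dg c = m" "n + 2 - dg c = m + 1" "n - dg c + 1 = m" by (simp_all add: m_def)
    have y: "y \<in> tsp X" using chs_last[OF c] by (simp add: y_def)
    interpret G1: comm_group "stk F m y" by (rule acD(1)[OF F y])
    interpret G2: comm_group "stk F (m + 1) y" by (rule acD(1)[OF F y])
    note rc = rsx_closed[OF s c, unfolded i, folded y_def]
    let ?A = "dl (stk F (m + 1) y) (%c'. dif F m y (rsx F m y s c')) c"
    have A: "?A \<in> stc F (m + 1) y" by (rule G2.dl_closed) (use rc y in simp)
    have sc: "s c \<in> stc F (n - dg c) y" using s c by (simp add: TG_carrier y_def)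
    have dl1: "dl (stk F m y) (rsx F m y s) c \<in> stc F m y" using dl_rsx_closed[OF s c] by (simp add: i y_def)
    have dd: "dif F m y (dif F (n - dg c) y (s c)) = 1[stk F (m + 1) y]" using acD(9)[OF F y sc] by (simp add: m_def add.assoc)
    have dsc: "dif F (n - dg c) y (s c) \<in> stc F m y" using dif_cl[OF y sc] by (simp add: m_def)
    have "dif F m y (TD F n s c) = sg (stk F (m + 1) y) n (dif F m y (dl (stk F m y) (rsx F m y s) c))"
      unfolding TD_def i y_def[symmetric] using dsc dl1 y dd by (simp add: dif_sg)
    also have "dif F m y (dl (stk F m y) (rsx F m y s) c) = ?A" by (rule G1.dl_hom[OF acD(7)[OF F y] G2.is_group]) (rule rc)
    finally have 1: "dif F m y (TD F n s c) = sg (stk F (m + 1) y) n ?A" .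
    \<comment> \<open>Restriction commutes with \<open>dif\<close> and with \<open>dl\<close>, so
      the values of \<open>TS\<close> on faces are expressed in the single stalk at
      \<open>y\<close>, where \<open>dl_dl\<close> applies.\<close>
    have face: "rsx F (m + 1) y (TS X F S n s) c' = dif F m y (rsx F m y s c') *[stk F (m + 1) y]
        sg (stk F (m + 1) y) n (dl (stk F (m + 1) y) (rsx F (m + 1) y s) c')" if c': "c' \<in> faces 1 c" for c'
    proof (cases "c' = []")
      case True
      then show ?thesis using y by (simp add: rsx_def)
    next
      case False
      define z where "z = last c'"
      have c'S: "c' \<in> chs X S" by (rule faces_chs[OF c' False c])
      have zy: "pt_le X z y" using faces_le[OF c' False c] by (simp add: z_def y_def)
      have z: "z \<in> tsp X" by (rule pt_leD(1)[OF zy])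
      have j: "n - dg c' = m" using faces_dg[OF c', of n] by (simp add: m_def)
      interpret H: comm_group "stk F (m + 1) z" by (rule acD(1)[OF F z])
      have sc': "s c' \<in> stc F m z" using s c'S j by (auto simp: TG_carrier z_def)
      have dlz: "dl (stk F (m + 1) z) (rsx F (m + 1) z s) c' \<in> stc F (m + 1) z" using dl_rsx_closed[OF s c'S] by (simp add: j z_def)
      have "rsx F (m + 1) y (TS X F S n s) c' = res (trm F (m + 1)) z y (TD F n s c')" using False c'S by (simp add: rsx_def TS_def z_def)
      also have "\<dots> = res (trm F (m + 1)) z y (dif F m z (s c')) *[stk F (m + 1) y]
          sg (stk F (m + 1) y) n (res (trm F (m + 1)) z y (dl (stk F (m + 1) z) (rsx F (m + 1) z s) c'))"
        unfolding TD_def j z_def[symmetric] using dlz sc' z zy by (simp add: res_sg)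
      also have "res (trm F (m + 1)) z y (dif F m z (s c')) = dif F m y (rsx F m y s c')" using False acD(8)[OF F zy sc'] by (simp add: rsx_def z_def)
      also have "res (trm F (m + 1)) z y (dl (stk F (m + 1) z) (rsx F (m + 1) z s) c') = dl (stk F (m + 1) y) (%c''. res (trm F (m + 1)) z y (rsx F (m + 1) z s c'')) c'"
        by (rule H.dl_hom[OF acD(3)[OF F zy] G2.is_group]) (use rsx_closed[OF s c'S] in "simp add: j z_def")
      also have "\<dots> = dl (stk F (m + 1) y) (rsx F (m + 1) y s) c'"
      proof (rule dl_cong)
        fix c'' assume c'': "c'' \<in> faces 1 c'"
        show "res (trm F (m + 1)) z y (rsx F (m + 1) z s c'') = rsx F (m + 1) y s c''"
        proof (cases "c'' = []")
          case False
          have "pt_le X (last c'') z" using faces_le[OF c'' False c'S] by (simp add: z_def)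
          moreover have "s c'' \<in> stc F (m + 1) (last c'')" using TG_face[OF s c'S c'' False] by (simp add: j)
          ultimately show ?thesis using False zy by (simp add: rsx_def acD(5)[OF F])
        qed (use zy in "simp add: rsx_def")
      qed
      finally show ?thesis .
    qed
    have r2: "rsx F (m + 1) y s c'' \<in> stc F (m + 1) y" if c'': "c'' \<in> faces 2 c" for c''
    proof (cases "c'' = []")
      case False
      have "c'' \<in> chs X S" by (rule faces_chs[OF c'' False c])
      moreover have "n - dg c'' = m + 1" using c'' by (auto simp: m_def faces_def dg_def)
      ultimately have "s c'' \<in> stc F (m + 1) (last c'')" using s by (auto simp: TG_carrier)
      then show ?thesis using False faces_le[OF c'' False c] by (simp add: rsx_def y_def)
    qed (use y in "simp add: rsx_def")
    have r1: "dl (stk F (m + 1) y) (rsx F (m + 1) y s) c' \<in> stc F (m + 1) y" if "c' \<in> faces 1 c" for c'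
    proof (rule G2.dl_closed)
      fix c'' assume "c'' \<in> faces 1 c'"
      from faces_trans[OF this that] show "rsx F (m + 1) y s c'' \<in> stc F (m + 1) y" by (intro r2) (simp add: numeral_2_eq_2)
    qed
    have "dl (stk F (m + 1) y) (rsx F (m + 1) y (TS X F S n s)) c = dl (stk F (m + 1) y) (%c'. dif F m y (rsx F m y s c') *[stk F (m + 1) y]
        sg (stk F (m + 1) y) n (dl (stk F (m + 1) y) (rsx F (m + 1) y s) c')) c"
      using face by (rule dl_cong)
    also have "\<dots> = ?A *[stk F (m + 1) y] dl (stk F (m + 1) y) (%c'. sg (stk F (m + 1) y) n (dl (stk F (m + 1) y) (rsx F (m + 1) y s) c')) c"
      by (rule G2.dl_mult) (use rc r1 y in simp_all)
    also have "dl (stk F (m + 1) y) (%c'. sg (stk F (m + 1) y) n (dl (stk F (m + 1) y) (rsx F (m + 1) y s) c')) c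
       = sg (stk F (m + 1) y) n (dl (stk F (m + 1) y) (dl (stk F (m + 1) y) (rsx F (m + 1) y s)) c)"
      by (rule G2.dl_sg) (rule r1)
    also have "dl (stk F (m + 1) y) (dl (stk F (m + 1) y) (rsx F (m + 1) y s)) c = 1[stk F (m + 1) y]" by (rule G2.dl_dl) (rule r2)
    finally have 2: "dl (stk F (m + 1) y) (rsx F (m + 1) y (TS X F S n s)) c = ?A" using A by simp
    have "TS X F S (n + 1) (TS X F S n s) c = dif F m y (TD F n s c) *[stk F (m + 1) y]
        sg (stk F (m + 1) y) (n + 1) (dl (stk F (m + 1) y) (rsx F (m + 1) y (TS X F S n s)) c)"
    proof -
      have "TS X F S (n + 1) (TS X F S n s) c = TD F (n + 1) (TS X F S n s) c" "TS X F S n s c = TD F n s c" using c by (simp_all add: TS_def)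
      then show ?thesis unfolding TD_def[of _ "n + 1"] i y_def[symmetric] by (simp only:)
    qed
    also have "\<dots> = 1[stk F (m + 1) y]" unfolding 1 2 using A by (simp add: G2.sg_plus_one)
    finally show ?thesis using c by (simp add: i y_def)
  qed (simp add: TS_def)
qed

lemma TD_singleton: assumes s: "s \<in> carrier (TG X F S n)" and x: "x \<in> S" shows "TD F n s [x] = dif F n x (s [x])"
proof -
  have xX: "x \<in> tsp X" using x S by blast
  interpret G: comm_group "stk F (n + 1) x" by (rule acD(1)[OF F xX])
  have "s [x] \<in> stc F (n - dg [x]) (last [x])" using s[unfolded TG_carrier, THEN conjunct2, rule_format, of "[x]"] x by simp
  then have "s [x] \<in> stc F n x" by simp
  then show ?thesis using xX by (simp add: TD_def rsx_def)
qed

end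

end

section \<open>Sections and flabbiness\<close>

definition secS :: "'x topology => ('x, 'u) acomplex => 'x set => int => ('x => 'u) monoid" where "secS X F S n = (product_group S (stk F n))
     \<lparr>carrier := {s \<in> (\<Pi>\<^sub>E p\<in>S. stc F n p). \<forall>p\<in>S. \<forall>q\<in>S. pt_le X p q --> res (trm F n) p q (s p) = s q}\<rparr>"

definition dS :: "('x, 'u) acomplex => 'x set => int => ('x => 'u) => 'x => 'u" where "dS F S n s = (\<lambda>p\<in>S. dif F n p (s p))"

text \<open>The augmentation of the cochain complex by its sections: a section is regarded as a
  cochain on one-point chains.\<close>

definition ep :: "'x topology => ('x, 'u) acomplex => 'x set => int => ('x => 'u) => 'x list => 'u" where
  "ep X F S n s = (\<lambda>c\<in>chs X S. if length c = 1 then s (last c) else 1[stk F (n - dg c) (last c)])"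

definition rfam :: "('x, 'u) acomplex => 'x set => int => 'x => 'u => 'x => 'u" where "rfam F S n x v = (\<lambda>y\<in>S. res (trm F n) x y v)"

lemma secS_carrier: "s \<in> carrier (secS X F S n) \<longleftrightarrow> s \<in> extensional S \<and> (\<forall>p\<in>S. s p \<in> stc F n p) \<and>
    (\<forall>p\<in>S. \<forall>q\<in>S. pt_le X p q --> res (trm F n) p q (s p) = s q)"
  by (auto simp: secS_def PiE_iff)

lemma secSD: assumes "s \<in> carrier (secS X F S n)" shows "p \<in> S ==> s p \<in> stc F n p"
    and "p \<in> S ==> q \<in> S ==> pt_le X p q ==> res (trm F n) p q (s p) = s q"
  using assms by (simp_all add: secS_carrier)

lemma secS_mult [simp]: "(\<otimes>\<^bsub>secS X F S n\<^esub>) = (%s t. \<lambda>p\<in>S. s p *[stk F n p] t p)"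
  and secS_one [simp]: "1[secS X F S n] = (\<lambda>p\<in>S. 1[stk F n p])"
  by (simp_all add: secS_def)

lemma secS_eqI: assumes "s \<in> carrier (secS X F S n)" "t \<in> carrier (secS X F S n)" "\<And>p. p \<in> S ==> s p = t p" shows "s = t"
  using assms by (auto simp: secS_carrier intro: extensionalityI)

lemma sections_eq_secS: "sections X (trm F n) = secS X F (tsp X) n"
proof -
  have "(\<forall>p q. pt_le X p q --> P p q) \<longleftrightarrow> (\<forall>p\<in>tsp X. \<forall>q\<in>tsp X. pt_le X p q --> P p q)" for P using pt_leD by metis
  then show ?thesis unfolding sections_def secS_def by simp
qed

lemma chs_Cons: "x # c \<in> chs X S \<longleftrightarrow> x \<in> S \<and> (c = [] \<or> c \<in> chs X {y \<in> S. pt_less X x y})" by (auto simp: chs_def)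

lemma chs_up_subset: "c \<in> chs X {y \<in> S. pt_less X x y} ==> c \<in> chs X S" by (auto simp: chs_def)

lemma TD_one: assumes F: "F \<in> acs X" and S: "S \<subseteq> tsp X" and c: "c \<in> chs X S"
  shows " TD F n (\<lambda>c\<in>chs X S. 1[stk F (n - dg c) (last c)]) c = 1[stk F (n - dg c + 1) (last c)]"
proof -
  have e: "n + 1 - dg c = n - dg c + 1" by simp
  have "TS X F S n 1[TG X F S n] = 1[TG X F S (n + 1)]" using hom_one[OF TS_hom[OF F S]] comm_group_TG[OF F S] by (simp add: comm_group_def del: TG_one)
  then have "TS X F S n 1[TG X F S n] c = 1[TG X F S (n + 1)] c" by (rule fun_cong)
  then show ?thesis using c unfolding TG_one e[symmetric] by (simp add: TS_def)
qed

context
  fixes X :: "'x topology" and F :: "('x, 'u) acomplex" and S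
  assumes F: "F \<in> acs X" and S: "S \<subseteq> tsp X"
begin

lemmas clF = res_cl[OF F] dif_cl[OF F] one_cl[OF F] mult_cl[OF F] inv_cl[OF F] res_one[OF F] dif_one[OF F] res_mult[OF F] dif_mult[OF F] res_inv[OF F] dif_inv[OF F]

lemma comm_group_secS: "comm_group (secS X F S n)"
proof -
  let ?G = "product_group S (stk F n)"
  let ?H = "{s \<in> (\<Pi>\<^sub>E p\<in>S. stc F n p). \<forall>p\<in>S. \<forall>q\<in>S. pt_le X p q --> res (trm F n) p q (s p) = s q}"
  have G: "comm_group ?G" by (rule comm_group_product_group) (use acD(1)[OF F] S in blast)
  interpret G: comm_group ?G by (rule G)
  have g: "group (stk F n p)" if "p \<in> S" for p using acD(2)[OF F] S that by blast
  have pS: "p \<in> tsp X" if "p \<in> S" for p using that S by blast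
  have "subgroup ?H ?G"
  proof (rule G.subgroupI)
    show "?H \<subseteq> carrier ?G" by auto
    have "1[?G] \<in> ?H" using pS by (auto simp: clF)
    then show "?H \<noteq> {}" by blast
    show "inv[?G] a \<in> ?H" if "a \<in> ?H" for a using that g by (auto simp: inv_product_group clF pS PiE_iff)
    show "a *[?G] b \<in> ?H" if "a \<in> ?H" "b \<in> ?H" for a b using that by (auto simp: clF pS PiE_iff)
  qed
  then have "group (?G\<lparr>carrier := ?H\<rparr>)" by (rule subgroup.subgroup_is_group) (rule G.is_group)
  then show ?thesis unfolding secS_def by (rule group.group_comm_groupI) (use G.m_comm in auto)
qed

lemma rfam_closed: assumes "q \<in> tsp X" "\<And>y. y \<in> S ==> pt_le X q y" "v \<in> stc F n q" shows "rfam F S n q v \<in> carrier (secS X F S n)"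
  using assms by (auto simp: secS_carrier rfam_def clF acD(5)[OF F])

lemma ep_closed: assumes "s \<in> carrier (secS X F S n)" shows "ep X F S n s \<in> carrier (TG X F S n)"
proof -
  have "ep X F S n s c \<in> stc F (n - dg c) (last c)" if c: "c \<in> chs X S" for c
    using chsD(2)[OF c] secSD(1)[OF assms] chs_last[OF F S c] c by (auto simp: ep_def dg_def clF)
  then show ?thesis by (simp add: TG_carrier ep_def)
qed

lemma dS_closed: assumes "s \<in> carrier (secS X F S n)" shows "dS F S n s \<in> carrier (secS X F S (n + 1))"
  using assms S by (auto simp: secS_carrier dS_def clF acD(8)[OF F, symmetric] subset_iff)

lemma TD_inv: assumes s: "s \<in> carrier (TG X F S n)" and c: "c \<in> chs X S"
  shows "TD F n (\<lambda>c\<in>chs X S. inv[stk F (n - dg c) (last c)] s c) c = inv[stk F (n - dg c + 1) (last c)] TD F n s c"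
proof -
  have e: "n + 1 - dg c = n - dg c + 1" by simp
  have gr: "group (TG X F S m)" for m using comm_group_TG[OF F S] by (simp add: comm_group_def)
  have gs: "group (stk F m (last c))" if "c \<in> chs X S" for c m by (rule acD(2)[OF F chs_last[OF F S that]])
  have i: "inv[TG X F S m] t = (\<lambda>c\<in>chs X S. inv[stk F (m - dg c) (last c)] t c)" if "t \<in> carrier (TG X F S m)" for t m
    using that gs unfolding TG_def by (subst inv_product_group) auto
  have "TS X F S n (inv[TG X F S n] s) = inv[TG X F S (n + 1)] TS X F S n s" by (rule hom_group_inv[OF TS_hom[OF F S] gr gr s])
  then have "TS X F S n (inv[TG X F S n] s) c = (inv[TG X F S (n + 1)] TS X F S n s) c" by (rule fun_cong)
  then show ?thesis using c unfolding i[OF s] i[OF TS_closed[OF F S s]] e[symmetric] by (simp add: TS_def)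
qed

text \<open>The differential on the chains that start with \<open>x\<close> is that of a mapping cone.\<close>

lemma TD_Cons: assumes s: "s \<in> carrier (TG X F S n)" and x: "x \<in> S" and c: "c \<in> chs X {y \<in> S. pt_less X x y}"
  defines "S2 \<equiv> {y \<in> S. pt_less X x y}"
  defines "G \<equiv> stk F (n - dg c) (last c)"
  shows "TD F n s (x # c) = TD F (n - 1) (\<lambda>c'\<in>chs X S2. s (x # c')) c *[G] (sg G n (s c) *[G] inv[G] sg G n (ep X F S2 n (rfam F S2 n x (s [x])) c))"
    and "(\<lambda>c'\<in>chs X S2. s (x # c')) \<in> carrier (TG X F S2 (n - 1))"
    and "rfam F S2 n x (s [x]) \<in> carrier (secS X F S2 n)"
proof -
  define y where "y = last c"
  define m where "m = n - dg c"
  define sx where "sx = (\<lambda>c'\<in>chs X S2. s (x # c'))"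
  \<comment> \<open>The contribution of the face \<open>[x]\<close>, which occurs only if
    \<open>c\<close> is a single point. The cochain \<open>sx\<close> misses it, because
    \<open>rsx\<close> is neutral at the empty list.\<close>
  define v where "v = ep X F S2 n (rfam F S2 n x (s [x])) c"
  have G: "G = stk F m y" by (simp add: G_def m_def y_def)
  have i: "n - dg (x # c) + 1 = m" "n - 1 - dg c + 1 = m" "n - dg (x # c) = n - 1 - dg c" by (simp_all add: m_def)
  have S2: "S2 \<subseteq> tsp X" using S by (auto simp: S2_def)
  have c2: "c \<in> chs X S2" and xc: "x # c \<in> chs X S" and cS: "c \<in> chs X S" and c0: "c \<noteq> []"
    using c x chs_up_subset[OF c] chsD(1)[OF c] by (simp_all add: S2_def chs_Cons)
  have y: "y \<in> tsp X" using chs_last[OF F S cS] by (simp add: y_def)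
  have xX: "x \<in> tsp X" using x S by blast
  interpret G: comm_group G unfolding G by (rule acD(1)[OF F y])
  show sx: "(\<lambda>c'\<in>chs X S2. s (x # c')) \<in> carrier (TG X F S2 (n - 1))" unfolding TG_carrier
  proof (intro conjI ballI)
    fix c' assume c': "c' \<in> chs X S2"
    then have "x # c' \<in> chs X S" "last (x # c') = last c'" using x chsD(1)[OF c'] by (simp_all add: S2_def chs_Cons)
    moreover have "n - dg (x # c') = n - 1 - dg c'" by simp
    ultimately show "(\<lambda>c'\<in>chs X S2. s (x # c')) c' \<in> stc F (n - 1 - dg c') (last c')" using s c' unfolding TG_carrier by (metis restrict_apply')
  qed simp
  have sx1: "s [x] \<in> stc F n x" using s[unfolded TG_carrier, THEN conjunct2, rule_format, of "[x]"] x by simp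
  show rf: "rfam F S2 n x (s [x]) \<in> carrier (secS X F S2 n)" using sx1 by (auto simp: secS_carrier rfam_def S2_def clF acD(5)[OF F] dest: pt_less_imp_le)
  have v: "v \<in> carrier G"
  proof (cases "length c = 1")
    case True
    then have "v = res (trm F n) x y (s [x])" "m = n" "y \<in> S2" using c2 chsD(2)[OF c2] by (simp_all add: v_def ep_def rfam_def y_def m_def dg_def)
    then show ?thesis using sx1 by (auto simp: G S2_def clF dest: pt_less_imp_le)
  qed (use c2 y in "simp add: v_def ep_def G_def clF y_def")
  have sc: "s c \<in> carrier G" using s cS unfolding TG_carrier G_def by blast
  have f: "rsx F m y s (x # c') = rsx F m y sx c' *[G] pt G [] v c'" "rsx F m y sx c' \<in> carrier G" if c': "c' \<in> faces 1 c" for c'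
  proof -
    show 1: "rsx F m y sx c' \<in> carrier G"
    proof (cases "c' = []")
      case False
      have c'2: "c' \<in> chs X S2" by (rule faces_chs[OF c' False c2])
      have "sx c' \<in> stc F (n - 1 - dg c') (last c')" using sx c'2 unfolding TG_carrier sx_def by blast
      moreover have "n - 1 - dg c' = m" using faces_dg[OF c', of n] by (simp add: m_def)
      moreover have "pt_le X (last c') y" using faces_le[OF F S2 c' False c2] by (simp add: y_def)
      ultimately show ?thesis using False by (simp add: rsx_def clF G)
    qed (simp add: rsx_def clF y G)
    show "rsx F m y s (x # c') = rsx F m y sx c' *[G] pt G [] v c'"
    proof (cases "c' = []")
      case True
      then have "length c = 1" using c' by (simp add: faces_def)
      then have "v = res (trm F n) x y (s [x])" "m = n" using c2 chsD(2)[OF c2] by (simp_all add: v_def ep_def rfam_def y_def m_def dg_def)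
      moreover have "rsx F m y sx [] = 1[G]" by (simp add: rsx_def G)
      ultimately show ?thesis using True v by (simp add: pt_def) (simp add: rsx_def)
    next
      case False
      have "c' \<in> chs X S2" by (rule faces_chs[OF c' False c2])
      then show ?thesis using False 1 by (simp add: rsx_def pt_def sx_def)
    qed
  qed
  have d2: "dl G (rsx F m y sx) c \<in> carrier G" using f(2) by (rule G.dl_closed)
  have "dl G (%c'. rsx F m y s (x # c')) c = dl G (%c'. rsx F m y sx c' *[G] pt G [] v c') c" using f(1) by (rule dl_cong)
  also have "\<dots> = dl G (rsx F m y sx) c *[G] dl G (pt G [] v) c" using f(2) v by (intro G.dl_mult) (auto simp: pt_def)
  also have "dl G (pt G [] v) c = v" using G.dl_pt_Nil[OF v, of c] c2 by (auto simp: v_def ep_def G_def)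
  finally have dlx: "dl G (%c'. rsx F m y s (x # c')) c = dl G (rsx F m y sx) c *[G] v" .
  have rc: "rsx F m y s c = s c" using c0 sc y by (simp add: rsx_def y_def[symmetric] G acD(4)[OF F])
  have dif: "dif F (n - 1 - dg c) y (s (x # c)) \<in> carrier G"
  proof -
    have "s (x # c) \<in> stc F (n - dg (x # c)) (last (x # c))" using s xc unfolding TG_carrier by blast
    then have "s (x # c) \<in> stc F (n - 1 - dg c) y" unfolding i(3) using c0 by (simp add: y_def)
    then have "dif F (n - 1 - dg c) y (s (x # c)) \<in> stc F (n - 1 - dg c + 1) y" by (rule dif_cl[OF F y])
    then show ?thesis unfolding i G .
  qed
  have "TD F n s (x # c) = dif F (n - 1 - dg c) y (s (x # c)) *[G] sg G n (s c *[G] inv[G] (dl G (rsx F m y sx) c *[G] v))"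
    using c0 unfolding TD_def i dlx[symmetric] by (simp add: rc y_def[symmetric] G[symmetric])
  \<comment> \<open>Faces that keep \<open>x\<close> have their sign reversed; the reversal is
    absorbed by reading \<open>sx\<close> in degree \<open>n - 1\<close> instead of
    \<open>n\<close>.\<close>
  also have "\<dots> = (dif F (n - 1 - dg c) y (s (x # c)) *[G] sg G (n - 1) (dl G (rsx F m y sx) c)) *[G] (sg G n (s c) *[G] inv[G] sg G n v)"
    using dif sc d2 v by (simp add: G.sg_mult G.sg_inv G.inv_mult G.sg_minus_one G.m_ac)
  also have "dif F (n - 1 - dg c) y (s (x # c)) *[G] sg G (n - 1) (dl G (rsx F m y sx) c) = TD F (n - 1) sx c"
    using c2 unfolding TD_def i by (simp add: sx_def y_def[symmetric] G[symmetric])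
  finally show "TD F n s (x # c) = TD F (n - 1) (\<lambda>c'\<in>chs X S2. s (x # c')) c *[G] (sg G n (s c) *[G] inv[G] sg G n (ep X F S2 n (rfam F S2 n x (s [x])) c))"
    by (simp add: v_def sx_def)
qed

text \<open>On a chain of two points the faces give the value at the upper point and the restriction
  of the value at the lower one; for a section these agree, and they enter with opposite signs. On
  longer chains all face values are neutral.\<close>

lemma TS_ep: assumes s: "s \<in> carrier (secS X F S n)" shows "TS X F S n (ep X F S n s) = ep X F S (n + 1) (dS F S n s)"
proof (rule TG_eqI[OF TS_closed[OF F S ep_closed[OF s]]])
  note e = ep_closed[OF s]
  show "ep X F S (n + 1) (dS F S n s) \<in> carrier (TG X F S (n + 1))" by (rule ep_closed[OF dS_closed[OF s]])
  fix c assume c: "c \<in> chs X S"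
  obtain x c' where xc: "c = x # c'" using chsD(1)[OF c] by (cases c) auto
  have x: "x \<in> S" using c by (simp add: xc chs_Cons)
  then have xX: "x \<in> tsp X" using S by blast
  show "TS X F S n (ep X F S n s) c = ep X F S (n + 1) (dS F S n s) c"
  proof (cases "c' = []")
    case True
    then show ?thesis using TD_singleton[OF F S e x] x c by (simp add: TS_def xc ep_def dS_def)
  next
    case False
    define S2 where "S2 = {y \<in> S. pt_less X x y}"
    have c': "c' \<in> chs X {y \<in> S. pt_less X x y}" using c False by (simp add: xc chs_Cons)
    have S2: "S2 \<subseteq> tsp X" using S by (auto simp: S2_def)
    have c'S: "c' \<in> chs X S" by (rule chs_up_subset[OF c'])
    define y where "y = last c'"
    have y: "y \<in> tsp X" using chs_last[OF F S c'S] by (simp add: y_def)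
    interpret G: comm_group "stk F (n - dg c') y" by (rule acD(1)[OF F y])
    have "(\<lambda>c'\<in>chs X S2. ep X F S n s (x # c')) = (\<lambda>c\<in>chs X S2. 1[stk F (n - 1 - dg c) (last c)])"
    proof (rule restrict_ext)
      fix d assume d: "d \<in> chs X S2"
      then have "x # d \<in> chs X S" "d \<noteq> []" using x chsD(1)[OF d] by (auto simp: chs_Cons S2_def)
      then show "ep X F S n s (x # d) = 1[stk F (n - 1 - dg d) (last d)]" by (simp add: ep_def algebra_simps)
    qed
    then have "TD F (n - 1) (\<lambda>c'\<in>chs X S2. ep X F S n s (x # c')) c' = 1[stk F (n - 1 - dg c' + 1) y]"
      using TD_one[OF F S2 c'[folded S2_def], of "n - 1"] by (simp only: y_def)
    then have 1: "TD F (n - 1) (\<lambda>c'\<in>chs X S2. ep X F S n s (x # c')) c' = 1[stk F (n - dg c') y]" by simp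
    have epc: "ep X F S n s c' \<in> stc F (n - dg c') y" using e c'S unfolding TG_carrier y_def by blast
    have 2: "ep X F S2 n (rfam F S2 n x (ep X F S n s [x])) c' = ep X F S n s c'"
    proof (cases "length c' = 1")
      case True
      have "y \<in> S2" using chsD(2)[OF c'] by (simp add: S2_def y_def)
      then show ?thesis using True c' c'S x secSD(2)[OF s x, of y] by (auto simp: ep_def rfam_def S2_def y_def dest: pt_less_imp_le)
    qed (use c' c'S in "simp add: ep_def S2_def")
    have "TD F n (ep X F S n s) (x # c') = 1[stk F (n - dg c') y]" using TD_Cons(1)[OF e x c', folded S2_def y_def] epc unfolding 1 2 by simp
    then show ?thesis using c False chsD(1)[OF c'] by (simp add: TS_def xc ep_def y_def)
  qed
qed

lemma gcmap_ep: "gcmap (secS X F S) (dS F S) (TG X F S) (TS X F S) (ep X F S)"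
proof (rule gcmap.intro)
  fix i
  show "comm_group (secS X F S i)" by (rule comm_group_secS)
  show "comm_group (TG X F S i)" by (rule comm_group_TG[OF F S])
  show "TS X F S i \<in> hom (TG X F S i) (TG X F S (i + 1))" by (rule TS_hom[OF F S])
  have pS: "p \<in> tsp X" if "p \<in> S" for p using that S by blast
  show "dS F S i \<in> hom (secS X F S i) (secS X F S (i + 1))"
  proof (rule homI[OF dS_closed])
    fix s t assume "s \<in> carrier (secS X F S i)" "t \<in> carrier (secS X F S i)"
    then show "dS F S i (s *[secS X F S i] t) = dS F S i s *[secS X F S (i + 1)] dS F S i t" by (auto simp: dS_def fun_eq_iff clF pS secS_carrier)
  qed
  show "ep X F S i \<in> hom (secS X F S i) (TG X F S i)"
  proof (rule homI[OF ep_closed])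
    fix s t assume st: "s \<in> carrier (secS X F S i)" "t \<in> carrier (secS X F S i)"
    have "ep X F S i (s *[secS X F S i] t) c = (ep X F S i s *[TG X F S i] ep X F S i t) c" for c
    proof (cases "c \<in> chs X S")
      case c: True
      interpret G: comm_group "stk F (i - dg c) (last c)" by (rule acD(1)[OF F chs_last[OF F S c]])
      show ?thesis using c chsD(2)[OF c] by (cases "length c = 1") (simp_all add: ep_def, simp add: dg_def)
    qed (simp add: ep_def)
    then show "ep X F S i (s *[secS X F S i] t) = ep X F S i s *[TG X F S i] ep X F S i t" by blast
  qed
  fix a b
  show "dS F S (i + 1) (dS F S i a) = 1[secS X F S (i + 2)]" if "a \<in> carrier (secS X F S i)" using that by (auto simp: dS_def fun_eq_iff secS_carrier acD(9)[OF F pS])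
  show "TS X F S (i + 1) (TS X F S i b) = 1[TG X F S (i + 2)]" if "b \<in> carrier (TG X F S i)" by (rule TS_TS[OF F S that])
  show "ep X F S (i + 1) (dS F S i a) = TS X F S i (ep X F S i a)" if "a \<in> carrier (secS X F S i)" by (rule TS_ep[OF that, symmetric])
qed

lemma gcmap_rfam: assumes q: "q \<in> tsp X" "\<And>y. y \<in> S ==> pt_le X q y"
  shows "gcmap (%n. stk F n q) (%n. dif F n q) (TG X F S) (TS X F S) (%n v. ep X F S n (rfam F S n q v))"
proof (rule gcmap.intro)
  interpret E: gcmap "secS X F S" "dS F S" "TG X F S" "TS X F S" "ep X F S" by (rule gcmap_ep)
  have rf: "rfam F S i q v \<in> carrier (secS X F S i)" if "v \<in> stc F i q" for i v by (rule rfam_closed[OF q that])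
  fix i
  show "comm_group (stk F i q)" by (rule acD(1)[OF F q(1)])
  show "comm_group (TG X F S i)" by (rule comm_group_TG[OF F S])
  show "TS X F S i \<in> hom (TG X F S i) (TG X F S (i + 1))" by (rule TS_hom[OF F S])
  show "dif F i q \<in> hom (stk F i q) (stk F (i + 1) q)" by (rule acD(7)[OF F q(1)])
  show "(%v. ep X F S i (rfam F S i q v)) \<in> hom (stk F i q) (TG X F S i)"
  proof (rule homI)
    fix v assume "v \<in> stc F i q"
    then show "ep X F S i (rfam F S i q v) \<in> carrier (TG X F S i)" by (intro ep_closed rf)
  next
    fix v w assume vw: "v \<in> stc F i q" "w \<in> stc F i q"
    have "rfam F S i q (v *[stk F i q] w) = rfam F S i q v *[secS X F S i] rfam F S i q w" using vw q by (auto simp: rfam_def fun_eq_iff clF)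
    then show "ep X F S i (rfam F S i q (v *[stk F i q] w)) = ep X F S i (rfam F S i q v) *[TG X F S i] ep X F S i (rfam F S i q w)"
      using hom_mult[OF E.f rf[OF vw(1)] rf[OF vw(2)]] by simp
  qed
  fix a b
  show "dif F (i + 1) q (dif F i q a) = 1[stk F (i + 2) q]" if "a \<in> stc F i q" by (rule acD(9)[OF F q(1) that])
  show "TS X F S (i + 1) (TS X F S i b) = 1[TG X F S (i + 2)]" if "b \<in> carrier (TG X F S i)" by (rule TS_TS[OF F S that])
  show "ep X F S (i + 1) (rfam F S (i + 1) q (dif F i q a)) = TS X F S i (ep X F S i (rfam F S i q a))" if a: "a \<in> stc F i q"
  proof -
    have "rfam F S (i + 1) q (dif F i q a) = dS F S i (rfam F S i q a)" using a q by (auto simp: rfam_def dS_def fun_eq_iff acD(8)[OF F])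
    then show ?thesis by (simp add: TS_ep[OF rf[OF a]])
  qed
qed

end

section \<open>Flabby complexes and resolutions\<close>

text \<open>\<open>P\<close> contains exactly one point of each class of points with the same
  closure. As a category it is equivalent to \<open>X\<close>, but it is a poset, so its strict
  chains are the nondegenerate simplices of the right nerve.\<close>

locale reps =
  fixes X :: "'x topology" and P :: "'x set"
  assumes fin: "finite (tsp X)" and P: "P \<subseteq> tsp X" and rep_ex: "q \<in> tsp X ==> \<exists>p\<in>P. pt_le X p q \<and> pt_le X q p"
    and P_antisym: "p \<in> P ==> q \<in> P ==> pt_le X p q ==> pt_le X q p ==> p = q"
begin

text \<open>The one-point case of extending sections from an open set to a larger one, from which
  finite posets are built up one minimal point at a time. It is a condition on each term, not on the
  differentials.\<close>

definition flabby :: "('x, 'u) acomplex => bool" where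
  "flabby F \<longleftrightarrow> (\<forall>x\<in>P. \<forall>n. \<forall>t\<in>carrier (secS X F {y \<in> P. pt_less X x y} n).
     \<exists>v\<in>stc F n x. \<forall>y\<in>P. pt_less X x y --> res (trm F n) x y v = t y)"

lemma finite_P: "finite P" using fin P finite_subset by blast

lemma P_less: "p \<in> P ==> q \<in> P ==> pt_le X p q ==> p \<noteq> q ==> pt_less X p q" using P_antisym by (auto simp: pt_less_def)

text \<open>The pair is trivial away from \<open>x\<close>. By \<open>TD_Cons\<close> the values of
  \<open>b\<close> on chains \<open>x # c\<close>, together with the restrictions of
  \<open>b [x]\<close>, form a cone cocycle over the points above \<open>x\<close>, one degree
  lower. Its solution is a section \<open>lam\<close>, which flabbiness lifts to the stalk at
  \<open>x\<close>, and a cochain \<open>\<gamma>\<close>, which is placed on the chains starting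
  with \<open>x\<close>.\<close>

lemma eps_crit_core:
  fixes F :: "('x, 'u) acomplex"
  assumes F: "F \<in> acs X" and fl: "flabby F" and SP: "S \<subseteq> P" and up: "\<And>x y. x \<in> S ==> y \<in> P ==> pt_le X x y ==> y \<in> S"
    and x: "x \<in> S" and min: "\<And>y. y \<in> S ==> \<not> pt_less X y x"
  defines "S1 \<equiv> S - {x}" and "S2 \<equiv> {y \<in> S. pt_less X x y}"
  assumes crit2: "qcrit (secS X F S2) (dS F S2) (TG X F S2) (TS X F S2) (ep X F S2)"
    and pre: "gcmap.pre (secS X F S) (dS F S) (TG X F S) (TS X F S) (ep X F S) (j + 1) a b"
    and a1': "\<And>p. p \<in> S1 ==> a p = 1[stk F (j + 1 + 1) p]"
    and b1: "\<And>c. c \<in> chs X S1 ==> b c = 1[stk F (j + 1 - dg c) (last c)]"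
  shows "gcmap.sol (secS X F S) (dS F S) (TG X F S) (TS X F S) (ep X F S) (j + 1) a b"
proof -
  have S: "S \<subseteq> tsp X" and S2: "S2 \<subseteq> tsp X" and S1: "S1 \<subseteq> tsp X" using SP P by (auto simp: S1_def S2_def)
  note cl = res_cl[OF F] dif_cl[OF F] one_cl[OF F] mult_cl[OF F] inv_cl[OF F] res_one[OF F] dif_one[OF F] res_mult[OF F] dif_mult[OF F] res_inv[OF F] dif_inv[OF F]
  interpret M: gcmap "secS X F S" "dS F S" "TG X F S" "TS X F S" "ep X F S" by (rule gcmap_ep[OF F S])
  interpret M2: gcmap "secS X F S2" "dS F S2" "TG X F S2" "TS X F S2" "ep X F S2" by (rule gcmap_ep[OF F S2])
  have xX: "x \<in> tsp X" using x S by blast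
  have pX: "p \<in> tsp X" if "p \<in> S" for p using that S by blast
  have S2P: "S2 = {y \<in> P. pt_less X x y}" using up[OF x] SP by (auto simp: S2_def dest: pt_less_imp_le)
  have xy: "pt_le X x y" "y \<in> S" "y \<noteq> x" "y \<in> S1" if "y \<in> S2" for y using that by (auto simp: S2_def S1_def dest: pt_less_imp_le)
  have ij: "j + 1 + 1 = j + 2" by simp
  note a1 = a1'[unfolded ij]
  have p: "a \<in> carrier (secS X F S (j + 2))" "b \<in> carrier (TG X F S (j + 1))"
    "dS F S (j + 2) a = 1[secS X F S (j + 1 + 2)]" "TS X F S (j + 1) b = ep X F S (j + 2) a"
    using pre unfolding M.pre_def ij by blast+
  define be0 where "be0 = b [x]"
  have bx: "b [x] \<in> stc F (j + 1) x" using p(2)[unfolded TG_carrier, THEN conjunct2, rule_format, of "[x]"] x by simp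
  have dbx: "dif F (j + 1) x (b [x]) = a x" using fun_cong[OF p(4), of "[x]"] TD_singleton[OF F S p(2) x] x by (simp add: TS_def ep_def)
  define r where "r = rfam F S2 (j + 1) x (b [x])"
  define bb where "bb = (\<lambda>c\<in>chs X S2. b (x # c))"
  have c2S: "c \<in> chs X S" "x # c \<in> chs X S" "c \<in> chs X S1" "c \<noteq> []" if "c \<in> chs X S2" for c
    using that x chs_up_subset[of c X S x] chsD(1)[OF that] by (auto simp: S2_def S1_def chs_Cons chs_def)
  have bb: "bb \<in> carrier (TG X F S2 j)" and r: "r \<in> carrier (secS X F S2 (j + 1))"
  proof -
    show "r \<in> carrier (secS X F S2 (j + 1))" unfolding r_def by (rule rfam_closed[OF F S2 xX xy(1) bx])
    show "bb \<in> carrier (TG X F S2 j)" unfolding TG_carrier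
    proof (intro conjI ballI)
      fix c assume c: "c \<in> chs X S2"
      have "b (x # c) \<in> stc F (j + 1 - dg (x # c)) (last (x # c))" using p(2) c2S(2)[OF c] unfolding TG_carrier by blast
      moreover have "j + 1 - dg (x # c) = j - dg c" by simp
      ultimately show "bb c \<in> stc F (j - dg c) (last c)" using c c2S(4)[OF c] by (simp only: bb_def restrict_apply' last.simps if_False)
    qed (simp add: bb_def)
  qed
  \<comment> \<open>This sign turns the relation from \<open>TD_Cons\<close> into the equation
    between \<open>TS\<close> of \<open>bb\<close> and \<open>ep\<close> of \<open>al\<close> that
    \<open>M2.pre\<close> asks for.\<close>
  define al where "al = (\<lambda>y\<in>S2. sg (stk F (j + 1) y) (j + 1) (r y))"
  have al: "al \<in> carrier (secS X F S2 (j + 1))" using r S2 unfolding secS_carrier by (auto simp: al_def res_sg[OF F] comm_group.sg_closed[OF acD(1)[OF F]] subset_iff)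
  have dal: "dS F S2 (j + 1) al = 1[secS X F S2 (j + 2)]"
  proof -
    have "dif F (j + 1) y (r y) = 1[stk F (j + 2) y]" if y: "y \<in> S2" for y
    proof -
      have "dif F (j + 1) y (r y) = res (trm F (j + 2)) x y (a x)" using y xy(1)[OF y] bx dbx by (simp add: r_def rfam_def acD(8)[OF F] ij)
      also have "\<dots> = a y" by (rule secSD(2)[OF p(1) x xy(2)[OF y] xy(1)[OF y]])
      finally show ?thesis using a1[OF xy(4)[OF y]] by simp
    qed
    then show ?thesis using r S2 by (auto simp: dS_def al_def fun_eq_iff secS_carrier dif_sg[OF F] ij subset_iff intro!: comm_group.sg_one acD(1)[OF F])
  qed
  have sgm: "sg (stk F m y) n v \<in> stc F m y" if "y \<in> tsp X" "v \<in> stc F m y" for m n y v by (rule comm_group.sg_closed[OF acD(1)[OF F that(1)] that(2)])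
  have epsg: "ep X F S2 n (\<lambda>y\<in>S2. sg (stk F n y) k (u y)) c = sg (stk F (n - dg c) (last c)) k (ep X F S2 n u c)" if c: "c \<in> chs X S2" for n k u c
  proof (cases "length c = 1")
    case True
    then have "dg c = 0" by (simp add: dg_def)
    then show ?thesis using True c chsD(2)[OF c] by (simp add: ep_def)
  next
    case False
    interpret G: comm_group "stk F (n - dg c) (last c)" by (rule acD(1)[OF F chs_last[OF F S2 c]])
    show ?thesis using False c by (simp add: ep_def)
  qed
  have D2: "TS X F S2 j bb = ep X F S2 (j + 1) al"
  proof (rule TG_eqI[OF TS_closed[OF F S2 bb] ep_closed[OF F S2 al]])
    fix c assume c: "c \<in> chs X S2"
    let ?G = "stk F (j + 1 - dg c) (last c)"
    have y: "last c \<in> tsp X" by (rule chs_last[OF F S2 c])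
    interpret G: comm_group ?G by (rule acD(1)[OF F y])
    have 1: "TD F (j + 1) b (x # c) = 1[?G]" using fun_cong[OF p(4), of "x # c"] c2S[OF c] by (simp add: TS_def ep_def) (simp add: algebra_simps)
    have 2: "TD F (j + 1) b (x # c) = TD F j bb c *[?G] (sg ?G (j + 1) (b c) *[?G] inv[?G] sg ?G (j + 1) (ep X F S2 (j + 1) r c))"
      using TD_Cons(1)[OF F S p(2) x c[unfolded S2_def], folded S2_def] by (simp add: bb_def r_def)
    have e: "j - dg c + 1 = j + 1 - dg c" by simp
    have t: "TD F j bb c \<in> carrier ?G" using TD_closed[OF F S2 bb c] unfolding e .
    have er: "ep X F S2 (j + 1) r c \<in> carrier ?G" using ep_closed[OF F S2 r] c unfolding TG_carrier by blast
    have "TD F j bb c *[?G] inv[?G] sg ?G (j + 1) (ep X F S2 (j + 1) r c) = 1[?G]" using 1 2 b1[OF c2S(3)[OF c]] er by simp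
    then have "TD F j bb c = sg ?G (j + 1) (ep X F S2 (j + 1) r c)" using t er G.inv_equality[of "TD F j bb c" "inv[?G] sg ?G (j + 1) (ep X F S2 (j + 1) r c)"] by simp
    then show "TS X F S2 j bb c = ep X F S2 (j + 1) al c" using c unfolding al_def epsg[OF c] by (simp add: TS_def)
  qed
  have "M2.pre j al bb" unfolding M2.pre_def using al bb dal D2 by simp
  then have "M2.sol j al bb" using crit2[unfolded M2.qcrit_iff] by blast
  then obtain lam \<gamma> where lam: "lam \<in> carrier (secS X F S2 j)" and \<gamma>: "\<gamma> \<in> carrier (TG X F S2 (j - 1))"
    and dlam: "dS F S2 j lam = al" and bbeq: "bb = ep X F S2 j lam *[TG X F S2 j] TS X F S2 (j - 1) \<gamma>"
    unfolding M2.sol_def by blast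
  \<comment> \<open>The same sign once more, undoing that of \<open>al\<close>: the differential of
    \<open>lam'\<close> is \<open>r\<close>, the family of restrictions of
    \<open>b [x]\<close>.\<close>
  define lam' where "lam' = (\<lambda>y\<in>S2. sg (stk F j y) (j + 1) (lam y))"
  have lam': "lam' \<in> carrier (secS X F S2 j)" using lam S2 unfolding secS_carrier
    by (auto simp: lam'_def res_sg[OF F] comm_group.sg_closed[OF acD(1)[OF F]] subset_iff)
  obtain be where be: "be \<in> stc F j x" and resbe: "\<And>y. y \<in> S2 ==> res (trm F j) x y be = lam' y" using fl lam' x SP unfolding flabby_def S2P by blast
  have dbe: "dif F j x be \<in> stc F (j + 1) x" using be xX by (simp add: cl)
  interpret Gx: comm_group "stk F (j + 1) x" by (rule acD(1)[OF F xX])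
  \<comment> \<open>At \<open>x\<close> the differential of the lift \<open>be\<close> is taken off
    \<open>b [x]\<close>; the restrictions to the points above \<open>x\<close> thereby become
    trivial, so that the neutral values elsewhere complete a section.\<close>
  define a' where "a' = (\<lambda>p\<in>S. if p = x then b [x] *[stk F (j + 1) x] inv[stk F (j + 1) x] dif F j x be else 1[stk F (j + 1) p])"
  define b' where "b' = (\<lambda>c\<in>chs X S. if c = [x] then be else if hd c = x then \<gamma> (tl c) else 1[stk F (j - dg c) (last c)])"
  have split: "c = [x] \<or> c \<in> chs X S1 \<or> (\<exists>c'\<in>chs X S2. c = x # c')" if c: "c \<in> chs X S" for c
  proof -
    obtain z c' where zc: "c = z # c'" using chsD(1)[OF c] by (cases c) auto
    show ?thesis
    proof (cases "z = x")
      case True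
      then show ?thesis using c by (auto simp: zc chs_Cons S2_def)
    next
      case False
      have "x \<notin> set c'" using c min by (auto simp: zc chs_def)
      then have "c \<in> chs X S1" using c False by (auto simp: zc chs_def S1_def)
      then show ?thesis by blast
    qed
  qed
  have hd1: "hd c \<noteq> x" "c \<noteq> [x]" "c \<in> chs X S" if "c \<in> chs X S1" for c using chsD(3)[OF that] that chs_mono[of S1 S X] by (auto simp: S1_def)
  have a': "a' \<in> carrier (secS X F S (j + 1))" unfolding secS_carrier
  proof (intro conjI ballI impI)
    fix q assume "q \<in> S"
    then show "a' q \<in> stc F (j + 1) q" using bx dbe pX by (simp add: a'_def cl)
  next
    fix q q' assume q: "q \<in> S" "q' \<in> S" "pt_le X q q'"
    show "res (trm F (j + 1)) q q' (a' q) = a' q'"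
    proof (cases "q = x")
      case qx: True
      show ?thesis
      proof (cases "q' = x")
        case True
        then show ?thesis using qx x bx dbe xX by (simp add: a'_def acD(4)[OF F])
      next
        case False
        then have q': "q' \<in> S2" using P_less[of x q'] q qx SP x by (auto simp: S2_def)
        have "res (trm F (j + 1)) x q' (dif F j x be) = dif F j q' (lam' q')" using acD(8)[OF F xy(1)[OF q'] be] resbe[OF q'] by simp
        also have "\<dots> = sg (stk F (j + 1) q') (j + 1) (dif F j q' (lam q'))" using q' lam pX[OF q(2)] by (simp add: lam'_def dif_sg[OF F] secS_carrier)
        also have "dif F j q' (lam q') = al q'" using fun_cong[OF dlam, of q'] q' by (simp add: dS_def)
        also have "sg (stk F (j + 1) q') (j + 1) (al q') = r q'" using q' r comm_group.sg_sg[OF acD(1)[OF F pX[OF q(2)]]] by (simp add: al_def secS_carrier)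
        finally have e: "res (trm F (j + 1)) x q' (dif F j x be) = res (trm F (j + 1)) x q' (b [x])" using q' by (simp add: r_def rfam_def)
        interpret Gq: comm_group "stk F (j + 1) q'" by (rule acD(1)[OF F pX[OF q(2)]])
        show ?thesis using qx x q False xy(1)[OF q'] bx dbe e by (simp add: a'_def cl)
      qed
    next
      case False
      then have "q' \<noteq> x" using min[OF q(1)] P_less[of q x] q SP x by auto
      then show ?thesis using False q by (simp add: a'_def cl)
    qed
  qed (simp add: a'_def)
  have b'x: "b' (x # c) = \<gamma> c" "x # c \<in> chs X S" if "c \<in> chs X S2" for c using c2S[OF that] by (simp_all add: b'_def)
  have b'S1: "b' c = 1[stk F (j - dg c) (last c)]" if "c \<in> chs X S1" for c using hd1[OF that] by (simp add: b'_def)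
  have b'1: "b' [x] = be" using x by (simp add: b'_def)
  have b': "b' \<in> carrier (TG X F S j)" unfolding TG_carrier
  proof (intro conjI ballI)
    fix c assume c: "c \<in> chs X S"
    from split[OF c] show "b' c \<in> stc F (j - dg c) (last c)"
    proof (elim disjE bexE)
      assume "c = [x]" then show ?thesis using b'1 be by simp
    next
      assume "c \<in> chs X S1" then show ?thesis using b'S1 one_cl[OF F chs_last[OF F S c]] by simp
    next
      fix c' assume c': "c' \<in> chs X S2" "c = x # c'"
      have g: "\<gamma> c' \<in> stc F (j - 1 - dg c') (last c')" using \<gamma> c'(1) unfolding TG_carrier by blast
      have e: "j - dg c = j - 1 - dg c'" "last c = last c'" "b' c = \<gamma> c'" using c2S(4)[OF c'(1)] b'x[OF c'(1)] c'(2) by simp_all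
      show ?thesis unfolding e by (rule g)
    qed
  qed (simp add: b'_def)
  have "dS F S (j + 1) a' = a"
  proof (rule secS_eqI[OF M.closed(1)[OF a']])
    show "a \<in> carrier (secS X F S (j + 1 + 1))" using p(1) unfolding ij .
    fix q assume q: "q \<in> S"
    show "dS F S (j + 1) a' q = a q"
    proof (cases "q = x")
      case True
      have ax: "a x \<in> stc F (j + 2) x" using p(1) x by (simp add: secS_carrier)
      interpret Gx2: comm_group "stk F (j + 2) x" by (rule acD(1)[OF F xX])
      show ?thesis using True q bx dbe xX ax acD(9)[OF F xX be] by (simp add: dS_def a'_def cl dbx ij)
    next
      case False
      then show ?thesis using q pX[OF q] a1[of q] by (simp add: dS_def a'_def cl ij S1_def)
    qed
  qed
  moreover have "b = ep X F S (j + 1) a' *[TG X F S (j + 1)] TS X F S j b'"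
  proof (rule TG_eqI[OF p(2)])
    show "ep X F S (j + 1) a' *[TG X F S (j + 1)] TS X F S j b' \<in> carrier (TG X F S (j + 1))"
      using comm_group_TG[OF F S, of "j + 1"] ep_closed[OF F S a'] TS_closed[OF F S b'] by (intro monoid.m_closed) (simp_all add: comm_group_def comm_monoid_def)
    fix c assume c: "c \<in> chs X S"
    interpret Gc: comm_group "stk F (j + 1 - dg c) (last c)" by (rule acD(1)[OF F chs_last[OF F S c]])
    have bc: "b c \<in> stc F (j + 1 - dg c) (last c)" using p(2) c unfolding TG_carrier by blast
    have "b c = ep X F S (j + 1) a' c *[stk F (j + 1 - dg c) (last c)] TD F j b' c" using split[OF c]
    proof (elim disjE bexE)
      assume cx: "c = [x]"
      show ?thesis using TD_singleton[OF F S b' x] x bx dbe by (simp add: cx b'1 ep_def a'_def Gx.m_assoc)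
    next
      assume c1: "c \<in> chs X S1"
      have "TD F j b' c = TD F j (\<lambda>c\<in>chs X S. 1[stk F (j - dg c) (last c)]) c"
      proof (rule TD_cong)
        fix c' assume "c' \<in> faces 1 c" "c' \<noteq> []"
        then have "c' \<in> chs X S1" by (rule faces_chs[OF _ _ c1])
        then show "b' c' = (\<lambda>c\<in>chs X S. 1[stk F (j - dg c) (last c)]) c'" using b'S1 hd1 by simp
      qed (use b'S1[OF c1] c in simp)
      then have "TD F j b' c = 1[stk F (j - dg c + 1) (last c)]" using TD_one[OF F S c, of j] by simp
      moreover have "j - dg c + 1 = j + 1 - dg c" by simp
      moreover have "ep X F S (j + 1) a' c = 1[stk F (j + 1 - dg c) (last c)]"
      proof (cases "length c = 1")
        case True
        then have "dg c = 0" by (simp add: dg_def)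
        then show ?thesis using True c chsD(2)[OF c1] by (simp add: ep_def a'_def S1_def)
      qed (use c in "simp add: ep_def")
      ultimately show ?thesis using b1[OF c1] by simp
    next
      fix c' assume c': "c' \<in> chs X S2" "c = x # c'"
      let ?G = "stk F (j - dg c') (last c')"
      have lc: "last c = last c'" "j + 1 - dg c = j - dg c'" using c2S(4)[OF c'(1)] c'(2) by simp_all
      have y: "last c' \<in> tsp X" by (rule chs_last[OF F S2 c'(1)])
      interpret G: comm_group ?G by (rule acD(1)[OF F y])
      have g: "(\<lambda>c'\<in>chs X S2. b' (x # c')) = \<gamma>" by (rule TG_eqI[OF _ \<gamma>]) (use \<gamma> b'x in "auto simp: TG_carrier")
      have rf: "rfam F S2 j x (b' [x]) = lam'" using resbe lam' by (intro extensionalityI[where A = S2]) (auto simp: rfam_def b'1 lam'_def)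
      have el: "ep X F S2 j lam c' \<in> carrier ?G" using ep_closed[OF F S2 lam] c'(1) unfolding TG_carrier by blast
      have "TD F j b' c = TD F (j - 1) \<gamma> c' *[?G] (sg ?G j (b' c') *[?G] inv[?G] sg ?G j (ep X F S2 j lam' c'))"
        using TD_Cons(1)[OF F S b' x c'(1)[unfolded S2_def], folded S2_def] unfolding g rf c'(2) by simp
      also have "b' c' = 1[?G]" by (rule b'S1[OF c2S(3)[OF c'(1)]])
      also have "ep X F S2 j lam' c' = sg ?G (j + 1) (ep X F S2 j lam c')" unfolding lam'_def by (rule epsg[OF c'(1)])
      finally have D: "TD F j b' c = TD F (j - 1) \<gamma> c' *[?G] ep X F S2 j lam c'" using el by (simp add: G.sg_plus_one G.sg_inv)
      have t: "TD F (j - 1) \<gamma> c' \<in> carrier ?G" using TD_closed[OF F S2 \<gamma> c'(1)] by (simp add: algebra_simps)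
      have "b c = bb c'" using c' by (simp add: bb_def)
      also have "\<dots> = ep X F S2 j lam c' *[?G] TD F (j - 1) \<gamma> c'" unfolding bbeq using c'(1) by (simp add: TS_def)
      finally have "b c = TD F j b' c" using D t el by (simp add: G.m_comm)
      moreover have "ep X F S (j + 1) a' c = 1[stk F (j + 1 - dg c) (last c)]" using c c2S(4)[OF c'(1)] c'(2) by (simp add: ep_def)
      ultimately show ?thesis using bc by simp
    qed
    then show "b c = (ep X F S (j + 1) a' *[TG X F S (j + 1)] TS X F S j b') c" using c by (simp add: TS_def)
  qed
  ultimately show ?thesis unfolding M.sol_def using a' b' by (intro bexI[of _ a'] bexI[of _ b']) simp_all
qed

text \<open>Induction on the size of the up-set \<open>S\<close>. A minimal point \<open>x\<close>
  is removed, and a solution over the rest is extended: the section to \<open>x\<close> by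
  flabbiness, the cochain by neutral elements. What remains is concentrated at \<open>x\<close> and
  is handled by \<open>eps_crit_core\<close>, which calls on the induction hypothesis for the points
  above \<open>x\<close>.\<close>

lemma eps_crit:
  fixes F :: "('x, 'u) acomplex"
  assumes F: "F \<in> acs X" and fl: "flabby F"
  shows "S \<subseteq> P ==> (\<And>x y. x \<in> S ==> y \<in> P ==> pt_le X x y ==> y \<in> S) ==> qcrit (secS X F S) (dS F S) (TG X F S) (TS X F S) (ep X F S)"
proof (induction "card S" arbitrary: S rule: less_induct)
  case less
  note SP = less.prems(1) and up = less.prems(2)
  have S: "S \<subseteq> tsp X" using SP P by blast
  interpret M: gcmap "secS X F S" "dS F S" "TG X F S" "TS X F S" "ep X F S" by (rule gcmap_ep[OF F S])
  have finS: "finite S" using SP finite_P finite_subset by blast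
  note cl = res_cl[OF F] dif_cl[OF F] one_cl[OF F] mult_cl[OF F] inv_cl[OF F] res_one[OF F] dif_one[OF F] res_mult[OF F] dif_mult[OF F] res_inv[OF F] dif_inv[OF F]
  show ?case unfolding M.qcrit_iff
  proof (intro allI impI)
    fix i a b assume pre: "M.pre i a b"
    have one: "1[secS X F S i] \<in> carrier (secS X F S i)" "1[TG X F S (i - 1)] \<in> carrier (TG X F S (i - 1))"
      by (rule monoid.one_closed[OF group.is_monoid[OF M.grA']], rule monoid.one_closed[OF group.is_monoid[OF M.grB']])
    show "M.sol i a b"
    proof (cases "S = {}")
      case True
      have "chs X S = {}" using True by (auto simp: chs_def)
      then show ?thesis using pre True one unfolding M.pre_def M.sol_def by (intro bexI[OF _ one(1)] bexI[OF _ one(2)]) (auto simp: secS_carrier TG_carrier dS_def)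
    next
      case False
      have "\<exists>x\<in>S. \<forall>y\<in>S. y \<noteq> x --> \<not> pt_less X y x" by (rule Finite_Set.bex_min_element[OF finS _ _ False])
          (auto intro!: asymp_onI transp_onI simp: pt_less_def dest: pt_le_trans)
      then obtain x where x: "x \<in> S" and min: "\<And>y. y \<in> S ==> \<not> pt_less X y x" by fastforce
      define S1 where "S1 = S - {x}"
      define S2 where "S2 = {y \<in> S. pt_less X x y}"
      have S1: "S1 \<subseteq> tsp X" "S1 \<subseteq> S" using S by (auto simp: S1_def)
      have crit2: "qcrit (secS X F S2) (dS F S2) (TG X F S2) (TS X F S2) (ep X F S2)"
      proof (rule less.hyps)
        have "x \<notin> S2" "S2 \<subseteq> S" by (auto simp: S2_def)
        with x show "card S2 < card S" by (intro psubset_card_mono[OF finS]) blast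
        fix z y assume "z \<in> S2" "y \<in> P" "pt_le X z y"
        then show "y \<in> S2" using up[of z y] by (auto simp: S2_def pt_less_def dest: pt_le_trans)
      qed (use SP in "auto simp: S2_def")
      have crit1: "qcrit (secS X F S1) (dS F S1) (TG X F S1) (TS X F S1) (ep X F S1)"
      proof (rule less.hyps)
        show "card S1 < card S" using finS x by (intro psubset_card_mono) (auto simp: S1_def)
        fix z y assume z: "z \<in> S1" "y \<in> P" "pt_le X z y"
        have "y \<noteq> x" using z min[of z] P_less[of z x] SP x by (auto simp: S1_def)
        then show "y \<in> S1" using up[of z y] z by (auto simp: S1_def)
      qed (use SP in "auto simp: S1_def")
      interpret M1: gcmap "secS X F S1" "dS F S1" "TG X F S1" "TS X F S1" "ep X F S1" by (rule gcmap_ep[OF F S1(1)])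
      note c1S = chs_mono[OF S1(2), THEN subsetD]
      note p = pre[unfolded M.pre_def]
      have "M1.pre i (restrict a S1) (restrict b (chs X S1))" unfolding M1.pre_def
      proof (intro conjI)
        have "a \<in> carrier (secS X F S (i + 1))" using p by blast
        then show "restrict a S1 \<in> carrier (secS X F S1 (i + 1))" using S1(2) unfolding secS_carrier by (simp add: subset_iff)
        show "restrict b (chs X S1) \<in> carrier (TG X F S1 i)" using p c1S by (auto simp: TG_carrier)
        have "dS F S1 (i + 1) (restrict a S1) = restrict (dS F S (i + 1) a) S1" using S1 by (auto simp: dS_def fun_eq_iff)
        also have "\<dots> = 1[secS X F S1 (i + 2)]" using p S1 by (auto simp: fun_eq_iff)
        finally show "dS F S1 (i + 1) (restrict a S1) = 1[secS X F S1 (i + 2)]" .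
        have "TS X F S1 i (restrict b (chs X S1)) = restrict (TS X F S i b) (chs X S1)" by (rule TS_restrict[OF S1(2), symmetric])
        also have "\<dots> = ep X F S1 (i + 1) (restrict a S1)" using p c1S chsD(2)[of _ X S1] by (auto simp: fun_eq_iff ep_def)
        finally show "TS X F S1 i (restrict b (chs X S1)) = ep X F S1 (i + 1) (restrict a S1)" .
      qed
      then have "M1.sol i (restrict a S1) (restrict b (chs X S1))" using crit1[unfolded M1.qcrit_iff] by blast
      then obtain a1 b1 where a1: "a1 \<in> carrier (secS X F S1 i)" and b1: "b1 \<in> carrier (TG X F S1 (i - 1))" and da1: "dS F S1 i a1 = restrict a S1"
        and eb1: "restrict b (chs X S1) = ep X F S1 i a1 *[TG X F S1 i] TS X F S1 (i - 1) b1"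
        unfolding M1.sol_def by blast
      have S2P: "{y \<in> P. pt_less X x y} = S2" using up[OF x] SP by (auto simp: S2_def dest: pt_less_imp_le)
      have "S2 \<subseteq> S1" by (auto simp: S1_def S2_def)
      then have "restrict a1 S2 \<in> carrier (secS X F S2 i)" using a1 unfolding secS_carrier by (simp add: subset_iff)
      then have "\<exists>v\<in>stc F i x. \<forall>y\<in>P. pt_less X x y --> res (trm F i) x y v = restrict a1 S2 y"
        using fl x SP unfolding flabby_def S2P[symmetric] by blast
      then obtain v where v1: "v \<in> stc F i x" and vr: "\<forall>y\<in>P. pt_less X x y --> res (trm F i) x y v = restrict a1 S2 y" by blast
      have v2: "res (trm F i) x y v = a1 y" if "y \<in> S2" for y using vr that SP by (simp add: S2_def subset_iff)
      note v = v1 v2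
      \<comment> \<open>The extension of the solution over \<open>S1\<close>; it solves the pair
        there, and an error is possible only at \<open>x\<close> and on chains through
        \<open>x\<close>.\<close>
      define a' where "a' = (\<lambda>p\<in>S. if p = x then v else a1 p)"
      define b' where "b' = (\<lambda>c\<in>chs X S. if c \<in> chs X S1 then b1 c else 1[stk F (i - 1 - dg c) (last c)])"
      have a': "a' \<in> carrier (secS X F S i)" unfolding secS_carrier
      proof (intro conjI ballI impI)
        fix q assume "q \<in> S"
        then show "a' q \<in> stc F i q" using v a1 by (auto simp: a'_def secS_carrier S1_def)
      next
        fix q q' assume q: "q \<in> S" "q' \<in> S" "pt_le X q q'"
        show "res (trm F i) q q' (a' q) = a' q'"
        proof (cases "q = x")
          case qx: True
          show ?thesis
          proof (cases "q' = x")
            case True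
            then show ?thesis using qx q v S by (auto simp: a'_def acD(4)[OF F])
          next
            case False
            then have "q' \<in> S2" using P_less[of x q'] q qx SP x by (auto simp: S2_def)
            then show ?thesis using v(2) q False qx by (simp add: a'_def)
          qed
        next
          case False
          then have "q' \<noteq> x" using min[OF q(1)] P_less[of q x] q SP x by auto
          then show ?thesis using False q a1 by (simp add: a'_def secS_carrier S1_def)
        qed
      qed (simp add: a'_def)
      have b': "b' \<in> carrier (TG X F S (i - 1))" using b1 chs_last[OF F S] by (auto simp: b'_def TG_carrier cl)
      let ?a = "a *[secS X F S (i + 1)] inv[secS X F S (i + 1)] dS F S i a'"
      let ?e = "ep X F S i a' *[TG X F S i] TS X F S (i - 1) b'"
      let ?b = "b *[TG X F S i] inv[TG X F S i] ?e"
      have pre2: "M.pre i ?a ?b" by (rule M.pre_modify[OF a' b' pre])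
      have e: "?e \<in> carrier (TG X F S i)" by (rule monoid.m_closed[OF group.is_monoid[OF M.grB'] M.closed(2)[OF a'] M.closed(4)[OF b']])
      have eq1: "u *[G] inv[G] w = 1[G] ==> u = w" if "group G" "u \<in> carrier G" "w \<in> carrier G" for u w :: 'z and G
        using that by (metis group.inv_closed group.inv_equality group.inv_inv group.is_monoid monoid.m_closed)
      have "1[secS X F S (i + 1)] p = 1[stk F (i + 1) p]" if "p \<in> S" for p using that by simp
      have aq: "?a q = 1[stk F (i + 1) q]" if q: "q \<in> S1" for q
      proof -
        have qS: "q \<in> S" using q S1 by blast
        then have qX: "q \<in> tsp X" using S by blast
        interpret G: comm_group "stk F (i + 1) q" by (rule acD(1)[OF F qX])
        have d: "dS F S i a' q = a q" using fun_cong[OF da1, of q] q qS by (auto simp: dS_def a'_def S1_def)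
        have ev: "(%s. s q) \<in> hom (secS X F S (i + 1)) (stk F (i + 1) q)" using qS by (auto intro!: homI simp: secS_carrier)
        have "(inv[secS X F S (i + 1)] dS F S i a') q = inv[stk F (i + 1) q] (dS F S i a' q)" using hom_group_inv[OF ev M.grA' G.is_group M.closed(1)[OF a']] by simp
        moreover have "a q \<in> stc F (i + 1) q" using p qS by (simp add: secS_carrier)
        ultimately show ?thesis using qS by (simp add: d)
      qed
      have bc: "?b c = 1[stk F (i - dg c) (last c)]" if c: "c \<in> chs X S1" for c
      proof -
        have cS: "c \<in> chs X S" by (rule c1S[OF c])
        have y: "last c \<in> tsp X" by (rule chs_last[OF F S cS])
        interpret G: comm_group "stk F (i - dg c) (last c)" by (rule acD(1)[OF F y])
        have "ep X F S i a' c = ep X F S1 i a1 c" using c cS chsD(2)[OF c] by (simp add: ep_def a'_def S1_def)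
        moreover have "TS X F S (i - 1) b' c = TS X F S1 (i - 1) b1 c"
        proof -
          have "restrict b' (chs X S1) = b1" using b1 c1S by (intro TG_eqI[OF _ b1]) (auto simp: TG_carrier b'_def)
          then show ?thesis using fun_cong[OF TS_restrict[OF S1(2), of X F "i - 1" b'], of c] c by simp
        qed
        ultimately have d: "?e c = b c" using fun_cong[OF eb1, of c] c cS by simp
        have ev: "(%s. s c) \<in> hom (TG X F S i) (stk F (i - dg c) (last c))" using cS by (auto intro!: homI simp: TG_carrier)
        have inv_e: "(inv[TG X F S i] ?e) c = inv[stk F (i - dg c) (last c)] (b c)" using hom_group_inv[OF ev M.grB' G.is_group e] unfolding d .
        have "b c \<in> stc F (i - dg c) (last c)" using p cS unfolding TG_carrier by blast
        moreover have "?b c = b c *[stk F (i - dg c) (last c)] (inv[TG X F S i] ?e) c" using cS by (simp only: TG_mult restrict_apply')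
        ultimately show ?thesis unfolding inv_e by simp
      qed
      obtain j where j: "i = j + 1" by (metis diff_add_cancel)
      have "M.sol i ?a ?b" unfolding j by (rule eps_crit_core[OF F fl SP up x min crit2[unfolded S2_def] pre2[unfolded j] aq[unfolded j S1_def] bc[unfolded j S1_def]])
      then show ?thesis by (rule M.sol_modify[OF a' b' pre])
    qed
  qed
qed

text \<open>The representative \<open>x\<close> of \<open>q\<close> is the least element of
  \<open>S\<close>, so the chains in \<open>S\<close> form a cone with apex \<open>x\<close>.
  Prepending \<open>x\<close> is a contracting homotopy.\<close>

lemma res_crit:
  fixes F :: "('x, 'u) acomplex"
  assumes F: "F \<in> acs X" and q: "q \<in> tsp X"
  defines "S \<equiv> {y \<in> P. pt_le X q y}"
  shows "qcrit (%n. stk F n q) (%n. dif F n q) (TG X F S) (TS X F S) (%n v. ep X F S n (rfam F S n q v))"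
proof -
  have S: "S \<subseteq> tsp X" and qS: "\<And>y. y \<in> S ==> pt_le X q y" using P by (auto simp: S_def)
  note cl = res_cl[OF F] dif_cl[OF F] one_cl[OF F] mult_cl[OF F] inv_cl[OF F] res_one[OF F] dif_one[OF F] res_mult[OF F] dif_mult[OF F] res_inv[OF F] dif_inv[OF F]
  interpret M: gcmap "%n. stk F n q" "%n. dif F n q" "TG X F S" "TS X F S" "%n v. ep X F S n (rfam F S n q v)" by (rule gcmap_rfam[OF F S q qS])
  obtain x where x: "x \<in> P" and xq: "pt_le X x q" and qx: "pt_le X q x" using rep_ex[OF q] by blast
  have xS: "x \<in> S" using x qx by (simp add: S_def)
  have xX: "x \<in> tsp X" using x P by blast
  define S2 where "S2 = {y \<in> S. pt_less X x y}"
  have S2: "S2 \<subseteq> tsp X" "S2 \<subseteq> S" using S by (auto simp: S2_def)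
  have xle: "pt_less X x y" if "y \<in> S" "y \<noteq> x" for y using P_less[of x y] x that pt_le_trans[OF xq, of y] by (auto simp: S_def)
  have min: "\<not> pt_less X y x" if "y \<in> S" for y using that pt_le_trans[OF xq, of y] by (auto simp: S_def pt_less_def)
  have split: "c = [x] \<or> c \<in> chs X S2 \<or> (\<exists>c'\<in>chs X S2. c = x # c')" if c: "c \<in> chs X S" for c
  proof -
    obtain z c' where zc: "c = z # c'" using chsD(1)[OF c] by (cases c) auto
    show ?thesis
    proof (cases "z = x")
      case True
      then show ?thesis using c by (auto simp: zc chs_Cons S2_def)
    next
      case False
      have "x \<notin> set c'" using c min by (auto simp: zc chs_def)
      then have "set c \<subseteq> S2" using c False xle by (auto simp: zc chs_def S2_def)
      then show ?thesis using c by (simp add: chs_def)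
    qed
  qed
  have c2S: "c \<in> chs X S" "x # c \<in> chs X S" "c \<noteq> []" "hd c \<noteq> x" if "c \<in> chs X S2" for c
    using that xS chs_up_subset[of c X S x] chsD(1,3)[OF that] by (auto simp: S2_def chs_Cons)
  \<comment> \<open>The normalised case: with \<open>a\<close> and \<open>b [x]\<close> trivial,
    \<open>b\<close> is a cocycle, and the homotopy exhibits it as a coboundary.\<close>
  have core: "M.sol (j + 1) a b" if pre: "M.pre (j + 1) a b" and a1: "a = 1[stk F (j + 1 + 1) q]" and bx: "b [x] = 1[stk F (j + 1) x]" for j a b
  proof -
    note p = pre[unfolded M.pre_def]
    have b: "b \<in> carrier (TG X F S (j + 1))" using p by blast
    have Db: "TS X F S (j + 1) b = 1[TG X F S (j + 1 + 1)]" using p a1 M.one_simps(4)[of "j + 1 + 1"] by simp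
    define bb where "bb = (\<lambda>c\<in>chs X S2. b (x # c))"
    have bb: "bb \<in> carrier (TG X F S2 j)" unfolding TG_carrier
    proof (intro conjI ballI)
      fix c assume c: "c \<in> chs X S2"
      have "b (x # c) \<in> stc F (j + 1 - dg (x # c)) (last (x # c))" using b c2S(2)[OF c] unfolding TG_carrier by blast
      moreover have "j + 1 - dg (x # c) = j - dg c" by simp
      ultimately show "bb c \<in> stc F (j - dg c) (last c)" using c c2S(3)[OF c] by (simp only: bb_def restrict_apply' last.simps if_False)
    qed (simp add: bb_def)
    \<comment> \<open>The homotopy: the value at \<open>c\<close> is that of \<open>b\<close> at
      \<open>x # c\<close>, with the sign of the degree \<open>j\<close>. Chains that already start
      with \<open>x\<close> receive the neutral element.\<close>
    define b' where "b' = (\<lambda>c\<in>chs X S. if c \<in> chs X S2 then sg (stk F (j - dg c) (last c)) j (bb c) else 1[stk F (j - dg c) (last c)])"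
    have b'2: "b' c = sg (stk F (j - dg c) (last c)) j (bb c)" "b' (x # c) = 1[stk F (j - 1 - dg c) (last c)]" if c: "c \<in> chs X S2" for c
    proof -
      show "b' c = sg (stk F (j - dg c) (last c)) j (bb c)" using c c2S[OF c] by (simp add: b'_def)
      have "x # c \<notin> chs X S2" using chsD(3)[of "x # c" X S2] by (auto simp: S2_def)
      then show "b' (x # c) = 1[stk F (j - 1 - dg c) (last c)]" using c2S[OF c] by (simp add: b'_def) (simp add: algebra_simps)
    qed
    have b'x: "b' [x] = 1[stk F j x]" using xS by (simp add: b'_def) (simp add: S2_def)
    have b': "b' \<in> carrier (TG X F S j)" unfolding TG_carrier
    proof (intro conjI ballI)
      fix c assume c: "c \<in> chs X S"
      interpret G: comm_group "stk F (j - dg c) (last c)" by (rule acD(1)[OF F chs_last[OF F S c]])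
      have "bb c \<in> stc F (j - dg c) (last c)" if "c \<in> chs X S2" using bb that unfolding TG_carrier by blast
      then show "b' c \<in> stc F (j - dg c) (last c)" using c by (simp add: b'_def)
    qed (simp add: b'_def)
    have main: "b c = TD F j b' c" if c: "c \<in> chs X S" for c using split[OF c]
    proof (elim disjE bexE)
      assume "c = [x]"
      then show ?thesis using TD_singleton[OF F S b' xS] bx b'x xX by (simp add: cl)
    next
      assume c2: "c \<in> chs X S2"
      let ?G = "stk F (j + 1 - dg c) (last c)"
      have y: "last c \<in> tsp X" by (rule chs_last[OF F S c])
      interpret G: comm_group ?G by (rule acD(1)[OF F y])
      have rf: "rfam F S2 (j + 1) x (b [x]) = 1[secS X F S2 (j + 1)]" unfolding bx by (auto simp: rfam_def fun_eq_iff S2_def cl dest: pt_less_imp_le)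
      have ep1: "ep X F S2 (j + 1) 1[secS X F S2 (j + 1)] c = 1[?G]"
      proof (cases "length c = 1")
        case True
        then have "dg c = 0" by (simp add: dg_def)
        then show ?thesis using True c2 chsD(2)[OF c2] by (simp add: ep_def)
      qed (use c2 in "simp add: ep_def")
      have e: "j - dg c + 1 = j + 1 - dg c" by simp
      have t: "TD F j bb c \<in> carrier ?G" using TD_closed[OF F S2(1) bb c2] unfolding e .
      have bc: "b c \<in> carrier ?G" using b c unfolding TG_carrier by blast
      have "TD F (j + 1) b (x # c) = 1[?G]" using fun_cong[OF Db, of "x # c"] c2S[OF c2] by (simp add: TS_def) (simp add: algebra_simps)
      moreover have "TD F (j + 1) b (x # c) = TD F j bb c *[?G] (sg ?G (j + 1) (b c) *[?G] inv[?G] sg ?G (j + 1) 1[?G])"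
        using TD_Cons(1)[OF F S b xS c2[unfolded S2_def], folded S2_def] unfolding rf ep1 by (simp add: bb_def)
      ultimately have "TD F j bb c *[?G] inv[?G] sg ?G j (b c) = 1[?G]" using bc by (simp add: G.sg_plus_one)
      then have Dbb: "TD F j bb c = sg ?G j (b c)" using t bc G.inv_equality[of "TD F j bb c" "inv[?G] sg ?G j (b c)"] by simp
      have "TD F j b' c = TD F j (restrict b' (chs X S2)) c" by (rule TD_cong) (use c2 faces_chs[OF _ _ c2] in auto)
      also have "\<dots> = sg ?G j (TD F j bb c)"
      proof (cases "even j")
        case True
        then have "restrict b' (chs X S2) = bb" using b'2(1) bb by (intro TG_eqI[OF _ bb]) (auto simp: sg_def TG_carrier)
        then show ?thesis using True by (simp add: sg_def)
      next
        case False
        then have "restrict b' (chs X S2) = (\<lambda>c\<in>chs X S2. inv[stk F (j - dg c) (last c)] bb c)" using b'2(1) by (intro restrict_ext) (simp add: sg_def)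
        then show ?thesis using False TD_inv[OF F S2(1) bb c2] unfolding e by (simp add: sg_def)
      qed
      finally show ?thesis unfolding Dbb using bc by simp
    next
      fix c' assume c': "c' \<in> chs X S2" "c = x # c'"
      let ?G = "stk F (j - dg c') (last c')"
      have y: "last c' \<in> tsp X" by (rule chs_last[OF F S2(1) c'(1)])
      interpret G: comm_group ?G by (rule acD(1)[OF F y])
      have bbc: "bb c' \<in> carrier ?G" using bb c'(1) unfolding TG_carrier by blast
      have 1: "TD F (j - 1) (\<lambda>c\<in>chs X S2. b' (x # c)) c' = 1[?G]"
      proof -
        have "(\<lambda>c\<in>chs X S2. b' (x # c)) = (\<lambda>c\<in>chs X S2. 1[stk F (j - 1 - dg c) (last c)])" using b'2(2) by (intro restrict_ext)
        moreover have "j - 1 - dg c' + 1 = j - dg c'" by simp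
        ultimately show ?thesis using TD_one[OF F S2(1) c'(1), of "j - 1"] by (simp only:)
      qed
      have rf: "rfam F S2 j x (b' [x]) = 1[secS X F S2 j]" unfolding b'x by (auto simp: rfam_def fun_eq_iff S2_def cl dest: pt_less_imp_le)
      have ep1: "ep X F S2 j 1[secS X F S2 j] c' = 1[?G]" using c'(1) chsD(2)[OF c'(1)] by (auto simp: ep_def dg_def)
      have "TD F j b' (x # c') = 1[?G] *[?G] (sg ?G j (b' c') *[?G] inv[?G] sg ?G j 1[?G])"
        using TD_Cons(1)[OF F S b' xS c'(1)[unfolded S2_def], folded S2_def] unfolding rf ep1 1 .
      also have "\<dots> = bb c'" using bbc by (simp add: b'2(1)[OF c'(1)])
      finally show ?thesis using c' by (simp add: bb_def)
    qed
    have "b = ep X F S (j + 1) (rfam F S (j + 1) q 1[stk F (j + 1) q]) *[TG X F S (j + 1)] TS X F S (j + 1 - 1) b'"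
    proof -
      have "b = TS X F S j b'" by (rule TG_eqI[OF b TS_closed[OF F S b']]) (simp add: main TS_def)
      then show ?thesis using M.one_simps(4)[of "j + 1"] TS_closed[OF F S b'] monoid.l_one[OF group.is_monoid[OF M.grB'[of "j + 1"]]] by (simp del: TG_mult TG_one)
    qed
    moreover have "dif F (j + 1) q 1[stk F (j + 1) q] = a" using a1 q by (simp add: cl)
    ultimately show ?thesis unfolding M.sol_def using b' q by (intro bexI[of _ "1[stk F (j + 1) q]"] bexI[of _ b'] conjI) (simp_all add: cl del: TG_mult TG_one)
  qed
  show ?thesis unfolding M.qcrit_iff
  proof (intro allI impI)
    fix i a b assume pre: "M.pre i a b"
    note p = pre[unfolded M.pre_def]
    have b: "b \<in> carrier (TG X F S i)" and a: "a \<in> stc F (i + 1) q" using p by blast+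
    have bx: "b [x] \<in> stc F i x" using b[unfolded TG_carrier, THEN conjunct2, rule_format, of "[x]"] xS by simp
    interpret Gq: comm_group "stk F (i + 1) q" by (rule acD(1)[OF F q])
    interpret Gx: comm_group "stk F i x" by (rule acD(1)[OF F xX])
    \<comment> \<open>The value at \<open>[x]\<close> is carried to the equivalent point
      \<open>q\<close>. Subtracting the pair that it generates makes both \<open>a\<close> and the
      value at \<open>[x]\<close> trivial, as \<open>core\<close> demands.\<close>
    let ?a1 = "res (trm F i) x q (b [x])" and ?b1 = "1[TG X F S (i - 1)]"
    have a1: "?a1 \<in> stc F i q" using xq bx by (simp add: cl)
    have b1: "?b1 \<in> carrier (TG X F S (i - 1))" by (rule monoid.one_closed[OF group.is_monoid[OF M.grB']])
    let ?e = "ep X F S i (rfam F S i q ?a1) *[TG X F S i] TS X F S (i - 1) ?b1"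
    let ?a = "a *[stk F (i + 1) q] inv[stk F (i + 1) q] dif F i q ?a1"
    let ?b = "b *[TG X F S i] inv[TG X F S i] ?e"
    have pre2: "M.pre i ?a ?b" by (rule M.pre_modify[OF a1 b1 pre])
    have "dif F i x (b [x]) = res (trm F (i + 1)) q x a" using fun_cong[OF p[THEN conjunct2, THEN conjunct2, THEN conjunct2], of "[x]"] TD_singleton[OF F S b xS] xS
      by (simp add: TS_def ep_def rfam_def)
    then have "dif F i q ?a1 = a" using acD(8)[OF F xq bx] acD(5)[OF F qx xq a] acD(4)[OF F q a] by simp
    then have a2: "?a = 1[stk F (i + 1) q]" using a by simp
    have e: "?e = ep X F S i (rfam F S i q ?a1)" using M.one_simps(3)[of i] M.closed(2)[OF a1] monoid.r_one[OF group.is_monoid[OF M.grB'[of i]]]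
      by (simp del: TG_mult TG_one)
    have "ep X F S i (rfam F S i q ?a1) [x] = b [x]" using xS acD(5)[OF F xq qx bx] acD(4)[OF F xX bx] by (simp add: ep_def rfam_def)
    moreover have ev: "(%s. s [x]) \<in> hom (TG X F S i) (stk F i x)"
    proof (rule homI)
      fix s assume "s \<in> carrier (TG X F S i)"
      from this[unfolded TG_carrier, THEN conjunct2, rule_format, of "[x]"] show "s [x] \<in> stc F i x" using xS by simp
    qed (use xS in simp)
    have "(inv[TG X F S i] ?e) [x] = inv[stk F i x] (?e [x])" unfolding e using hom_group_inv[OF ev M.grB' Gx.is_group M.closed(2)[OF a1]] by simp
    ultimately have b2: "?b [x] = 1[stk F i x]" using xS bx unfolding e by simp
    obtain j where j: "i = j + 1" by (metis diff_add_cancel)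
    have "M.sol i ?a ?b" using core[of j ?a ?b] pre2 a2 b2 unfolding j by blast
    then show "M.sol i a b" by (rule M.sol_modify[OF a1 b1 pre])
  qed
qed

end

section \<open>The chain complex of global cochains and the canonical resolution\<close>

definition TM :: "'x topology => 'x set => (int => 'x => 'u => 'v) => int => ('x list => 'u) => 'x list => 'v" where
  "TM X S f n s = (\<lambda>c\<in>chs X S. f (n - dg c) (last c) (s c))"

context
  fixes X :: "'x topology" and F :: "('x, 'u) acomplex" and G :: "('x, 'v) acomplex" and f S
  assumes F: "F \<in> acs X" and G: "G \<in> acs X" and f: "cmap X F G f" and S: "S \<subseteq> tsp X"
begin

lemma TM_closed: "s \<in> carrier (TG X F S n) ==> TM X S f n s \<in> carrier (TG X G S n)" by (simp add: TG_carrier TM_def cmapD(3)[OF f chs_last[OF F S]])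

lemma TM_hom: "TM X S f n \<in> hom (TG X F S n) (TG X G S n)"
proof (rule homI[OF TM_closed])
  fix s t assume "s \<in> carrier (TG X F S n)" "t \<in> carrier (TG X F S n)"
  then show "TM X S f n (s *[TG X F S n] t) = TM X S f n s *[TG X G S n] TM X S f n t" by (auto simp: TM_def TG_carrier fun_eq_iff cmapD(4)[OF f chs_last[OF F S]])
qed

lemma TM_TS: assumes s: "s \<in> carrier (TG X F S n)" shows "TM X S f (n + 1) (TS X F S n s) = TS X G S n (TM X S f n s)"
proof (rule TG_eqI[where F = G])
  have e: "n + 1 - dg c = n - dg c + 1" for c :: "'x list" by simp
  show "TM X S f (n + 1) (TS X F S n s) \<in> carrier (TG X G S (n + 1))" by (rule TM_closed[OF TS_closed[OF F S s]])
  show "TS X G S n (TM X S f n s) \<in> carrier (TG X G S (n + 1))" by (rule TS_closed[OF G S TM_closed[OF s]])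
  fix c assume c: "c \<in> chs X S"
  let ?y = "last c" and ?m = "n - dg c + 1"
  have y: "?y \<in> tsp X" by (rule chs_last[OF F S c])
  interpret A: comm_group "stk F ?m ?y" by (rule acD(1)[OF F y])
  interpret B: comm_group "stk G ?m ?y" by (rule acD(1)[OF G y])
  note h = cmapD(2)[OF f y, of ?m]
  have sc: "s c \<in> stc F (n - dg c) ?y" using s c unfolding TG_carrier by blast
  have d: "dif F (n - dg c) ?y (s c) \<in> stc F ?m ?y" by (rule dif_cl[OF F y sc])
  have dl: "f ?m ?y (dl (stk F ?m ?y) (rsx F ?m ?y s) c) = dl (stk G ?m ?y) (%c'. f ?m ?y (rsx F ?m ?y s c')) c"
    by (rule A.dl_hom[OF h B.is_group]) (rule rsx_closed[OF F S s c])
  have "dl (stk G ?m ?y) (%c'. f ?m ?y (rsx F ?m ?y s c')) c = dl (stk G ?m ?y) (rsx G ?m ?y (TM X S f n s)) c"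
  proof (rule dl_cong)
    fix c' assume c': "c' \<in> faces 1 c"
    show "f ?m ?y (rsx F ?m ?y s c') = rsx G ?m ?y (TM X S f n s) c'"
    proof (cases "c' = []")
      case True
      then show ?thesis using cmap_one[OF f F G y] by (simp add: rsx_def)
    next
      case False
      have "f ?m ?y (res (trm F ?m) (last c') ?y (s c')) = res (trm G ?m) (last c') ?y (f ?m (last c') (s c'))"
        by (rule cmapD(5)[OF f faces_le[OF F S c' False c] TG_face[OF F S s c c' False]])
      moreover have "TM X S f n s c' = f (n - dg c') (last c') (s c')" using faces_chs[OF c' False c] by (simp add: TM_def)
      then have "TM X S f n s c' = f ?m (last c') (s c')" unfolding faces_dg[OF c'] .
      ultimately show ?thesis using False by (simp add: rsx_def)
    qed
  qed
  then have "f ?m ?y (TD F n s c) = TD G n (TM X S f n s) c" unfolding TD_def using c hom_mult[OF h d] A.sg_hom[OF h B.is_group] dl cmapD(6)[OF f y sc]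
      A.sg_closed[OF dl_rsx_closed[OF F S s c]] dl_rsx_closed[OF F S s c]
    by (simp add: TM_def)
  then show "TM X S f (n + 1) (TS X F S n s) c = TS X G S n (TM X S f n s) c" using c by (simp add: TM_def[of _ _ _ "n + 1"] TS_def e)
qed

lemma gcmap_TM: "gcmap (TG X F S) (TS X F S) (TG X G S) (TS X G S) (TM X S f)" by (rule gcmap.intro)
    (simp_all add: comm_group_TG[OF F S] comm_group_TG[OF G S] TS_hom[OF F S] TS_hom[OF G S] TS_TS[OF F S] TS_TS[OF G S] TM_hom TM_TS del: TG_one)

text \<open>The simplicial part of the differential reads only shorter chains. So for the filtration
  by length only \<open>dif\<close> remains on the diagonal, where the factors are stalk complexes
  shifted by \<open>dg c\<close>.\<close>

lemma TM_crit: assumes fin: "finite S" and crit: "\<And>p. p \<in> S ==> crit F G f p" shows "qcrit (TG X F S) (TS X F S) (TG X G S) (TS X G S) (TM X S f)"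
proof -
  have eqs: "TG X F S = (%n. product_group (chs X S) (%c. stk F (n - dg c) (last c)))" "TG X G S = (%n. product_group (chs X S) (%c. stk G (n - dg c) (last c)))"
      "TM X S f = (%n s. \<lambda>c\<in>chs X S. f (n - dg c) (last c) (s c))"
    by (auto simp: TG_def TM_def fun_eq_iff)
  have e: "n + 1 - dg c = n - dg c + 1" for n and c :: "'x list" by simp
  have le: "length c < Suc (Max (length ` chs X S))" if "c \<in> chs X S" for c using finite_chs[OF fin] that by (auto intro!: Max_ge le_imp_less_Suc)
  have tri: "TS X H S n s c = dif H (n - dg c) (last c) (s c)" if H: "H \<in> acs X" and s: "s \<in> carrier (TG X H S n)" and c: "c \<in> chs X S"
      and low: "\<And>c'. c' \<in> chs X S ==> length c' < length c ==> s c' = 1[stk H (n - dg c') (last c')]"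
    for H :: "('x, 'z) acomplex" and n s c
  proof -
    let ?m = "n - dg c + 1" and ?y = "last c"
    have y: "?y \<in> tsp X" by (rule chs_last[OF H S c])
    interpret A: comm_group "stk H ?m ?y" by (rule acD(1)[OF H y])
    have "dl (stk H ?m ?y) (rsx H ?m ?y s) c = dl (stk H ?m ?y) (%c. 1[stk H ?m ?y]) c"
    proof (rule dl_cong)
      fix c' assume c': "c' \<in> faces 1 c"
      show "rsx H ?m ?y s c' = 1[stk H ?m ?y]"
      proof (cases "c' = []")
        case False
        have "s c' = 1[stk H ?m (last c')]" using low[OF faces_chs[OF c' False c]] c' faces_dg[OF c', of n] by (simp add: faces_def)
        then show ?thesis using False faces_le[OF H S c' False c] by (simp add: rsx_def res_one[OF H])
      qed (simp add: rsx_def)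
    qed
    moreover have "dif H (n - dg c) ?y (s c) \<in> stc H ?m ?y" using s c y unfolding TG_carrier by (intro dif_cl[OF H]) auto
    ultimately show ?thesis using c by (simp add: TS_def TD_def)
  qed
  have "filtered_gcmap (chs X S) (%c n. stk F (n - dg c) (last c))
     (%c n. stk G (n - dg c) (last c)) (TS X F S) (TS X G S) (%c n. f (n - dg c) (last c)) length (Suc (Max (length ` chs X S)))
     (%c n. dif F (n - dg c) (last c)) (%c n. dif G (n - dg c) (last c))"
  proof (intro filtered_gcmap.intro filtered_gcmap_axioms.intro)
    show "gcmap (%n. product_group (chs X S) (%c. stk F (n - dg c) (last c))) (TS X F S) (%n. product_group (chs X S) (%c. stk G (n - dg c) (last c))) (TS X G S)
     (%n s. \<lambda>c\<in>chs X S. f (n - dg c) (last c) (s c))" using gcmap_TM unfolding eqs .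
    fix c n s assume c: "c \<in> chs X S"
    have y: "last c \<in> tsp X" by (rule chs_last[OF F S c])
    show "comm_group (stk F (n - dg c) (last c))" "comm_group (stk G (n - dg c) (last c))" using acD(1)[OF F y] acD(1)[OF G y] by auto
    show "dif F (n - dg c) (last c) 1[stk F (n - dg c) (last c)] = 1[stk F (n + 1 - dg c) (last c)]"
      "dif G (n - dg c) (last c) 1[stk G (n - dg c) (last c)] = 1[stk G (n + 1 - dg c) (last c)]"
      unfolding e using dif_one[OF F y] dif_one[OF G y] by auto
    show "f (n - dg c) (last c) 1[stk F (n - dg c) (last c)] = 1[stk G (n - dg c) (last c)]" by (rule cmap_one[OF f F G y])
    show "length c < Suc (Max (length ` chs X S))" by (rule le[OF c])
    show "qcrit (%n. stk F (n - dg c) (last c)) (%n. dif F (n - dg c) (last c)) (%n. stk G (n - dg c) (last c))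
       (%n. dif G (n - dg c) (last c)) (%n. f (n - dg c) (last c))"
      using qcrit_shift[OF crit[OF chsD(2)[OF c]], of "- dg c"] by simp
    show "TS X F S n s c = dif F (n - dg c) (last c) (s c)" if "s \<in> carrier (product_group (chs X S) (%c. stk F (n - dg c) (last c)))"
        "\<And>c'. c' \<in> chs X S ==> length c' < length c ==> s c' = 1[stk F (n - dg c') (last c')]"
      using tri[OF F _ c, of s n] that by (simp add: TG_def)
  next
    fix c n s assume c: "c \<in> chs X S"
    show "TS X G S n s c = dif G (n - dg c) (last c) (s c)" if "s \<in> carrier (product_group (chs X S) (%c. stk G (n - dg c) (last c)))"
        "\<And>c'. c' \<in> chs X S ==> length c' < length c ==> s c' = 1[stk G (n - dg c') (last c')]"
      using tri[OF G _ c, of s n] that by (simp add: TG_def)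
  qed
  then show ?thesis using filtered_gcmap.qcrit_filtered unfolding eqs by blast
qed

end

lemma pt_le_point [simp]: "pt_le point p q" by (simp add: pt_le_def)

section \<open>The functors \<open>T\<close> and \<open>C\<close>, and the maps from a complex into
  its resolution\<close>

context reps
begin

definition Tc :: "('x, 'u) acomplex => (unit, 'x list => 'u) acomplex" where "Tc F = \<lparr>trm = (%n. \<lparr>stalk = (%_. TG X F P n), res = (%_ _ s. s)\<rparr>),
           dif = (%n _. \<lambda>s\<in>carrier (TG X F P n). TS X F P n s)\<rparr>"

definition Tm :: "('x, 'u) acomplex => (int => 'x => 'u => 'v) => int => unit => ('x list => 'u) => 'x list => 'v" where
  "Tm F f = (%n _. \<lambda>s\<in>carrier (TG X F P n). TM X P f n s)"

definition up :: "'x => 'x set" where "up q = {y \<in> P. pt_le X q y}"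

text \<open>A resolution in the manner of Godement: the stalk at \<open>q\<close> consists of the
  cochains on the smallest open neighbourhood of \<open>q\<close>, reduced to
  representatives.\<close>

definition Cc :: "('x, 'u) acomplex => ('x, 'x list => 'u) acomplex" where
  "Cc F = \<lparr>trm = (%n. \<lparr>stalk = (%q. TG X F (up q) n), res = (%q q' s. restrict s (chs X (up q')))\<rparr>),
           dif = (%n. \<lambda>q\<in>tsp X. \<lambda>s\<in>carrier (TG X F (up q) n). TS X F (up q) n s)\<rparr>"

definition Cm :: "('x, 'u) acomplex => (int => 'x => 'u => 'v) => int => 'x => ('x list => 'u) => 'x list => 'v" where
  "Cm F f = (%n. \<lambda>q\<in>tsp X. \<lambda>s\<in>carrier (TG X F (up q) n). TM X (up q) f n s)"

definition iC :: "('x, 'u) acomplex => int => 'x => 'u => 'x list => 'u" where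
  "iC F = (%n. \<lambda>q\<in>tsp X. \<lambda>v\<in>stc F n q. ep X F (up q) n (rfam F (up q) n q v))"

definition eT :: "('x, 'u) acomplex => int => unit => ('x => 'u) => 'x list => 'u" where
  "eT F = (%n _. \<lambda>s\<in>carrier (secS X F (tsp X) n). ep X F P n (restrict s P))"

lemma Tc_simps [simp]: "stk (Tc F) n p = TG X F P n" "res (trm (Tc F) n) p q s = s" "dif (Tc F) n p = (\<lambda>s\<in>carrier (TG X F P n). TS X F P n s)"
  by (simp_all add: Tc_def)

lemma Cc_simps [simp]: "stk (Cc F) n q = TG X F (up q) n" "res (trm (Cc F) n) q q' s = restrict s (chs X (up q'))"
  "q \<in> tsp X ==> dif (Cc F) n q = (\<lambda>s\<in>carrier (TG X F (up q) n). TS X F (up q) n s)"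
  by (simp_all add: Cc_def)

lemma up: "up q \<subseteq> P" "up q \<subseteq> tsp X" "finite (up q)" using P finite_P by (auto simp: up_def)

lemma up_mono: "pt_le X q q' ==> up q' \<subseteq> up q" by (auto simp: up_def dest: pt_le_trans)

lemma restrict_TG: "S' \<subseteq> S ==> s \<in> carrier (TG X F S n) ==> restrict s (chs X S') \<in> carrier (TG X F S' n)"
  using chs_mono[of S' S X] by (auto simp: TG_carrier)

lemma hom_restrict: "f \<in> hom A B ==> group A ==> restrict f (carrier A) \<in> hom A B" by (auto simp: hom_def Pi_iff group.is_monoid monoid.m_closed)

lemma Tc_acomplex: assumes F: "F \<in> acs X" shows "Tc F \<in> acs point"
proof (rule acomplexesI)
  fix n :: int and p q r :: unit and s
  show "comm_group (stk (Tc F) n p)" by (simp add: comm_group_TG[OF F P])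
  show "res (trm (Tc F) n) p q \<in> hom (stk (Tc F) n p) (stk (Tc F) n q)" by (simp add: hom_def)
  show "dif (Tc F) n p \<in> hom (stk (Tc F) n p) (stk (Tc F) (n + 1) p)" using hom_restrict[OF TS_hom[OF F P]] comm_group_TG[OF F P] by (simp add: comm_group_def)
  show "dif (Tc F) n q (res (trm (Tc F) n) p q s) = res (trm (Tc F) (n + 1)) p q (dif (Tc F) n p s)" by simp
  show "dif (Tc F) (n + 1) p (dif (Tc F) n p s) = 1[stk (Tc F) (n + 2) p]" if "s \<in> stc (Tc F) n p" using that TS_TS[OF F P] TS_closed[OF F P] by (simp del: TG_one)
qed (simp_all add: Tc_def)

lemma Cc_acomplex: assumes F: "F \<in> acs X" shows "Cc F \<in> acs X"
proof (rule acomplexesI)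
  fix n :: int and p q r and s
  show "comm_group (stk (Cc F) n p)" by (simp add: comm_group_TG[OF F up(2)])
  show "dif (Cc F) n p \<in> hom (stk (Cc F) n p) (stk (Cc F) (n + 1) p)" if "p \<in> tsp X"
    using hom_restrict[OF TS_hom[OF F up(2)]] comm_group_TG[OF F up(2)] that by (simp add: comm_group_def)
  show "dif (Cc F) (n + 1) p (dif (Cc F) n p s) = 1[stk (Cc F) (n + 2) p]" if "p \<in> tsp X" "s \<in> stc (Cc F) n p"
    using that TS_TS[OF F up(2)] TS_closed[OF F up(2)] by (simp del: TG_one)
  show "res (trm (Cc F) n) p q \<in> hom (stk (Cc F) n p) (stk (Cc F) n q)" if pq: "pt_le X p q"
  proof (rule homI)
    fix s t assume "s \<in> stc (Cc F) n p" "t \<in> stc (Cc F) n p"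
    then show "res (trm (Cc F) n) p q s \<in> stc (Cc F) n q" using restrict_TG[OF up_mono[OF pq]] by simp
    show "res (trm (Cc F) n) p q (s *[stk (Cc F) n p] t) = res (trm (Cc F) n) p q s *[stk (Cc F) n q] res (trm (Cc F) n) p q t"
      using chs_mono[OF up_mono[OF pq], of X] by (auto simp: fun_eq_iff)
  qed
  show "res (trm (Cc F) n) p p s = s" if "p \<in> tsp X" "s \<in> stc (Cc F) n p" using that by (simp add: TG_carrier extensional_restrict)
  show "res (trm (Cc F) n) q r (res (trm (Cc F) n) p q s) = res (trm (Cc F) n) p r s" if "pt_le X p q" "pt_le X q r" "s \<in> stc (Cc F) n p"
    using chs_mono[OF up_mono[OF that(2)], of X] by (auto simp: fun_eq_iff)
  show "dif (Cc F) n q (res (trm (Cc F) n) p q s) = res (trm (Cc F) (n + 1)) p q (dif (Cc F) n p s)" if pq: "pt_le X p q" and s: "s \<in> stc (Cc F) n p"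
    using restrict_TG[OF up_mono[OF pq], of s F n] s TS_restrict[OF up_mono[OF pq], of X F n s] pt_leD[OF pq] by simp
qed (simp_all add: Cc_def)

lemma Tm_cmap: assumes F: "F \<in> acs X" and G: "G \<in> acs X" and f: "cmap X F G f" shows "cmap point (Tc F) (Tc G) (Tm F f)"
proof (rule cmapI)
  fix n :: int and p q :: unit and s t
  show "Tm F f n p (s *[stk (Tc F) n p] t) = Tm F f n p s *[stk (Tc G) n p] Tm F f n p t" if "s \<in> stc (Tc F) n p" "t \<in> stc (Tc F) n p"
  proof -
    have "s *[TG X F P n] t \<in> carrier (TG X F P n)" using comm_group_TG[OF F P, of n] that by (simp add: comm_group_def group.is_monoid monoid.m_closed del: TG_mult)
    then show ?thesis using that hom_mult[OF TM_hom[OF F G f P]] by (simp add: Tm_def del: TG_mult)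
  qed
qed (simp_all add: Tm_def TM_closed[OF F G f P] TM_TS[OF F G f P] TS_closed[OF F P])

lemma Cm_cmap: assumes F: "F \<in> acs X" and G: "G \<in> acs X" and f: "cmap X F G f" shows "cmap X (Cc F) (Cc G) (Cm F f)"
proof (rule cmapI)
  fix n :: int and p q and s t
  show "Cm F f n p (s *[stk (Cc F) n p] t) = Cm F f n p s *[stk (Cc G) n p] Cm F f n p t" if "p \<in> tsp X" "s \<in> stc (Cc F) n p" "t \<in> stc (Cc F) n p"
  proof -
    have "s *[TG X F (up p) n] t \<in> carrier (TG X F (up p) n)"
      using comm_group_TG[OF F up(2), of p n] that by (simp add: comm_group_def group.is_monoid monoid.m_closed del: TG_mult)
    then show ?thesis using that hom_mult[OF TM_hom[OF F G f up(2)]] by (simp add: Cm_def del: TG_mult)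
  qed
  show "Cm F f n q (res (trm (Cc F) n) p q s) = res (trm (Cc G) n) p q (Cm F f n p s)" if pq: "pt_le X p q" "s \<in> stc (Cc F) n p"
    using pq pt_leD[OF pq(1)] restrict_TG[OF up_mono[OF pq(1)]] chs_mono[OF up_mono[OF pq(1)], of X] by (auto simp: Cm_def TM_def fun_eq_iff)
qed (simp_all add: Cm_def TM_closed[OF F G f up(2)] TM_TS[OF F G f up(2)] TS_closed[OF F up(2)])

lemma Tm_cc: assumes F: "F \<in> acs X" and G: "G \<in> acs X" and H: "H \<in> acs X" and f: "cmap X F G f" and g: "cmap X G H g"
  shows "Tm F (cc X F g f) = cc point (Tc F) (Tm G g) (Tm F f)"
proof (rule cmap_eqI[OF Tm_cmap[OF F H cmap_cc[OF F f g]] cmap_cc[OF Tc_acomplex[OF F] Tm_cmap[OF F G f] Tm_cmap[OF G H g]]])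
  fix n :: int and p :: unit and s
  assume s: "s \<in> stc (Tc F) n p"
  then show "Tm F (cc X F g f) n p s = cc point (Tc F) (Tm G g) (Tm F f) n p s"
    using TM_closed[OF F G f P] chs_last[OF F P] by (auto simp: Tm_def TM_def fun_eq_iff TG_carrier)
qed

lemma Tm_ci: assumes F: "F \<in> acs X" shows "Tm F (ci X F) = ci point (Tc F)"
proof (rule cmap_eqI[OF Tm_cmap[OF F F cmap_ci[OF F]] cmap_ci[OF Tc_acomplex[OF F]]])
  fix n :: int and p :: unit and s
  assume s: "s \<in> stc (Tc F) n p"
  then show "Tm F (ci X F) n p s = ci point (Tc F) n p s" using chs_last[OF F P] by (auto simp: Tm_def TM_def fun_eq_iff TG_carrier extensional_def)
qed

lemma Cm_cc: assumes F: "F \<in> acs X" and G: "G \<in> acs X" and H: "H \<in> acs X" and f: "cmap X F G f" and g: "cmap X G H g"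
  shows "Cm F (cc X F g f) = cc X (Cc F) (Cm G g) (Cm F f)"
proof (rule cmap_eqI[OF Cm_cmap[OF F H cmap_cc[OF F f g]] cmap_cc[OF Cc_acomplex[OF F] Cm_cmap[OF F G f] Cm_cmap[OF G H g]]])
  fix n :: int and p and s
  assume s: "p \<in> tsp X" "s \<in> stc (Cc F) n p"
  then show "Cm F (cc X F g f) n p s = cc X (Cc F) (Cm G g) (Cm F f) n p s"
    using TM_closed[OF F G f up(2)] chs_last[OF F up(2)] by (auto simp: Cm_def TM_def fun_eq_iff TG_carrier)
qed

lemma Cm_ci: assumes F: "F \<in> acs X" shows "Cm F (ci X F) = ci X (Cc F)"
proof (rule cmap_eqI[OF Cm_cmap[OF F F cmap_ci[OF F]] cmap_ci[OF Cc_acomplex[OF F]]])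
  fix n :: int and p and s
  assume s: "p \<in> tsp X" "s \<in> stc (Cc F) n p"
  then show "Cm F (ci X F) n p s = ci X (Cc F) n p s" using chs_last[OF F up(2)] by (auto simp: Cm_def TM_def fun_eq_iff TG_carrier extensional_def)
qed

text \<open>\<open>qcrit\<close> evaluates maps on carriers only. This strips the restrictions to
  carriers that the extensionality of morphisms imposes.\<close>

lemma qcrit_cong: assumes "\<And>n a. a \<in> carrier (A n) ==> d n a = d' n a" "\<And>n b. b \<in> carrier (B n) ==> e n b = e' n b"
    "\<And>n a. a \<in> carrier (A n) ==> f n a = f' n a"
  shows "qcrit A d B e f \<longleftrightarrow> qcrit A d' B e' f'"
proof -
  have "qcrit A d' B e' f'" if q: "qcrit A d B e f" and h: "\<And>n a. a \<in> carrier (A n) ==> d n a = d' n a"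
    "\<And>n b. b \<in> carrier (B n) ==> e n b = e' n b" "\<And>n a. a \<in> carrier (A n) ==> f n a = f' n a" for d e f d' e' f'
    unfolding qcrit_def
  proof (intro allI ballI impI)
    fix i a b assume ab: "a \<in> carrier (A (i + 1))" "b \<in> carrier (B i)" "d' (i + 1) a = 1[A (i + 2)] \<and> e' i b = f' (i + 1) a"
    then obtain a' b' where "a' \<in> carrier (A i)" "b' \<in> carrier (B (i - 1))" "d i a' = a" "b = f i a' *[B i] e (i - 1) b'"
      using q[unfolded qcrit_def, rule_format, OF ab(1,2)] h by auto
    then show "\<exists>a'\<in>carrier (A i). \<exists>b'\<in>carrier (B (i - 1)). d' i a' = a \<and> b = f' i a' *[B i] e' (i - 1) b'" using h by metis
  qed
  from this[of d e f d' e' f'] this[of d' e' f' d e f] show ?thesis using assms by metis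
qed

lemma Tm_crit: assumes F: "F \<in> acs X" and G: "G \<in> acs X" and f: "cmap X F G f" and crit: "\<And>p. p \<in> tsp X ==> crit F G f p"
  shows "crit (Tc F) (Tc G) (Tm F f) p"
  using TM_crit[OF F G f P finite_P crit] P by (subst qcrit_cong[where d' = "TS X F P" and e' = "TS X G P" and f' = "TM X P f"]) (auto simp: Tm_def)

lemma iC_cmap: assumes F: "F \<in> acs X" shows "cmap X F (Cc F) (iC F)"
proof (rule cmapI)
  fix n :: int and p q and s t
  have le: "\<And>y. y \<in> up q ==> pt_le X q y" for q by (simp add: up_def)
  note g = gcmap_rfam[OF F up(2) _ le]
  show "iC F n p s \<in> stc (Cc F) n p" if "p \<in> tsp X" "s \<in> stc F n p" using that gcmap.closed(2)[OF g[OF that(1)] that(2)] by (simp add: iC_def)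
  show "iC F n p (s *[stk F n p] t) = iC F n p s *[stk (Cc F) n p] iC F n p t" if "p \<in> tsp X" "s \<in> stc F n p" "t \<in> stc F n p"
    using that hom_mult[OF gcmap.f[OF g[OF that(1)]] that(2,3)] mult_cl[OF F that] by (simp add: iC_def del: TG_mult)
  show "iC F (n + 1) p (dif F n p s) = dif (Cc F) n p (iC F n p s)" if "p \<in> tsp X" "s \<in> stc F n p"
    using that gcmap.fd[OF g[OF that(1)] that(2)] gcmap.closed(2)[OF g[OF that(1)] that(2)] dif_cl[OF F that] by (simp add: iC_def)
  show "iC F n q (res (trm F n) p q s) = res (trm (Cc F) n) p q (iC F n p s)" if pq: "pt_le X p q" and s: "s \<in> stc F n p"
  proof -
    have "ep X F (up q) n (rfam F (up q) n q (res (trm F n) p q s)) = restrict (ep X F (up p) n (rfam F (up p) n p s)) (chs X (up q))"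
      using chs_mono[OF up_mono[OF pq], of X] up_mono[OF pq] chsD(2)[of _ X "up q"] s by (auto simp: ep_def rfam_def fun_eq_iff acD(5)[OF F pq] le)
    then show ?thesis using pq s pt_leD[OF pq] res_cl[OF F pq s] by (simp add: iC_def)
  qed
qed (simp_all add: iC_def)

lemma iC_crit: assumes F: "F \<in> acs X" and p: "p \<in> tsp X" shows "crit F (Cc F) (iC F) p" using res_crit[OF F p] p unfolding up_def[symmetric]
  by (subst qcrit_cong[where d' = "%n. dif F n p" and e' = "TS X F (up p)" and f' = "%n v. ep X F (up p) n (rfam F (up p) n p v)"]) (auto simp: iC_def)

lemma iC_natural: assumes F: "F \<in> acs X" and G: "G \<in> acs X" and f: "cmap X F G f" shows "cc X F (iC G) f = cc X F (Cm F f) (iC F)"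
proof (rule cmap_eqI[OF cmap_cc[OF F f iC_cmap[OF G]] cmap_cc[OF F iC_cmap[OF F] Cm_cmap[OF F G f]]])
  fix n p s assume p: "p \<in> tsp X" and s: "s \<in> stc F n p"
  have le: "\<And>y. y \<in> up p ==> pt_le X p y" by (simp add: up_def)
  have cl: "ep X F (up p) n (rfam F (up p) n p s) \<in> carrier (TG X F (up p) n)" using gcmap.closed(2)[OF gcmap_rfam[OF F up(2) p le] s] by simp
  have "ep X G (up p) n (rfam G (up p) n p (f n p s)) = TM X (up p) f n (ep X F (up p) n (rfam F (up p) n p s))"
  proof (rule ext)
    fix c
    show "ep X G (up p) n (rfam G (up p) n p (f n p s)) c = TM X (up p) f n (ep X F (up p) n (rfam F (up p) n p s)) c"
    proof (cases "c \<in> chs X (up p)")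
      case c: True
      show ?thesis
      proof (cases "length c = 1")
        case True
        then have "dg c = 0" by (simp add: dg_def)
        then show ?thesis using True c chsD(2)[OF c] s by (simp add: ep_def TM_def rfam_def cmapD(5)[OF f le])
      qed (use c chs_last[OF F up(2) c] in "simp add: ep_def TM_def cmap_one[OF f F G]")
    qed (simp add: ep_def TM_def)
  qed
  then show "cc X F (iC G) f n p s = cc X F (Cm F f) (iC F) n p s" using p s cl cmapD(3)[OF f p s] by (simp add: iC_def Cm_def)
qed

section \<open>Global sections as a functor, and their comparison with \<open>T\<close>\<close>

lemma restrict_secS: "S' \<subseteq> S ==> s \<in> carrier (secS X F S n) ==> restrict s S' \<in> carrier (secS X F S' n)"
  unfolding secS_carrier by (simp add: subset_iff)

lemma Gamma_simps [simp]: "stk (ob (Gamma X) F) n p = secS X F (tsp X) n" "res (trm (ob (Gamma X) F) n) p q s = s"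
  "dif (ob (Gamma X) F) n p = (\<lambda>s\<in>carrier (secS X F (tsp X) n). dS F (tsp X) n s)"
  by (simp_all add: Gamma_def sections_eq_secS dS_def)

lemma Gamma_acomplex: assumes F: "F \<in> acs X" shows "ob (Gamma X) F \<in> acs point"
proof (rule acomplexesI)
  interpret E: gcmap "secS X F (tsp X)" "dS F (tsp X)" "TG X F (tsp X)" "TS X F (tsp X)" "ep X F (tsp X)" by (rule gcmap_ep[OF F subset_refl])
  fix n :: int and p q r :: unit and s
  show "comm_group (stk (ob (Gamma X) F) n p)" by (simp add: comm_group_secS[OF F])
  show "res (trm (ob (Gamma X) F) n) p q \<in> hom (stk (ob (Gamma X) F) n p) (stk (ob (Gamma X) F) n q)" by (simp add: hom_def)
  show "dif (ob (Gamma X) F) n p \<in> hom (stk (ob (Gamma X) F) n p) (stk (ob (Gamma X) F) (n + 1) p)"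
    using hom_restrict[OF E.d] comm_group_secS[OF F] by (simp add: comm_group_def)
  show "dif (ob (Gamma X) F) n q (res (trm (ob (Gamma X) F) n) p q s) = res (trm (ob (Gamma X) F) (n + 1)) p q (dif (ob (Gamma X) F) n p s)" by simp
  show "dif (ob (Gamma X) F) (n + 1) p (dif (ob (Gamma X) F) n p s) = 1[stk (ob (Gamma X) F) (n + 2) p]" if "s \<in> stc (ob (Gamma X) F) n p"
    using that E.dd E.closed(1) by (simp del: secS_one)
qed (simp_all add: Gamma_def)

lemma Gamma_app: "s \<in> carrier (secS X F (tsp X) n) ==> hm (Gamma X) F G f n p s = (\<lambda>q\<in>tsp X. f n q (s q))" by (simp add: Gamma_def sections_eq_secS)

lemma Gamma_closed: assumes "cmap X F G f" "s \<in> carrier (secS X F (tsp X) n)" shows "(\<lambda>q\<in>tsp X. f n q (s q)) \<in> carrier (secS X G (tsp X) n)"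
  using assms(2) by (auto simp: secS_carrier cmapD(3)[OF assms(1)] cmapD(5)[OF assms(1), symmetric])

lemma Gamma_cmap: assumes F: "F \<in> acs X" and G: "G \<in> acs X" and f: "cmap X F G f" shows "cmap point (ob (Gamma X) F) (ob (Gamma X) G) (hm (Gamma X) F G f)"
proof (rule cmapI)
  interpret E: gcmap "secS X F (tsp X)" "dS F (tsp X)" "TG X F (tsp X)" "TS X F (tsp X)" "ep X F (tsp X)" by (rule gcmap_ep[OF F subset_refl])
  fix n :: int and p q :: unit and s t
  show "hm (Gamma X) F G f n p s \<in> stc (ob (Gamma X) G) n p" if "s \<in> stc (ob (Gamma X) F) n p" using that Gamma_closed[OF f] by (simp add: Gamma_app)
  show "hm (Gamma X) F G f n p (s *[stk (ob (Gamma X) F) n p] t) = hm (Gamma X) F G f n p s *[stk (ob (Gamma X) G) n p] hm (Gamma X) F G f n p t"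
    if st: "s \<in> stc (ob (Gamma X) F) n p" "t \<in> stc (ob (Gamma X) F) n p"
  proof -
    have "s *[secS X F (tsp X) n] t \<in> carrier (secS X F (tsp X) n)" using st monoid.m_closed[OF group.is_monoid[OF E.grA']] by simp
    then show ?thesis using st Gamma_closed[OF f] by (auto simp: Gamma_app fun_eq_iff secSD(1) cmapD(4)[OF f])
  qed
  show "hm (Gamma X) F G f (n + 1) p (dif (ob (Gamma X) F) n p s) = dif (ob (Gamma X) G) n p (hm (Gamma X) F G f n p s)" if "s \<in> stc (ob (Gamma X) F) n p"
    using that Gamma_closed[OF f] E.closed(1) by (auto simp: Gamma_app dS_def fun_eq_iff secSD(1) cmapD(6)[OF f])
qed (simp_all add: Gamma_def sections_eq_secS)

lemma is_functor_Gamma: "is_functor (Ch X) (Ch point) (Gamma X)" unfolding is_functor_def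
proof (intro conjI ballI)
  fix F :: "('x, 'u) acomplex" assume F: "F \<in> Obj (Ch X)"
  then show "ob (Gamma X) F \<in> Obj (Ch point)" by (simp add: Gamma_acomplex)
  have "hm (Gamma X) F F (ci X F) = ci point (ob (Gamma X) F)"
  proof (rule cmap_eqI[OF Gamma_cmap cmap_ci])
    fix n :: int and p :: unit and s assume "s \<in> stc (ob (Gamma X) F) n p"
    then show "hm (Gamma X) F F (ci X F) n p s = ci point (ob (Gamma X) F) n p s" by (auto simp: Gamma_app fun_eq_iff secS_carrier extensional_def)
  qed (use F Gamma_acomplex cmap_ci in auto)
  then show "hm (Gamma X) F F (Idt (Ch X) F) = Idt (Ch point) (ob (Gamma X) F)" by simp
next
  fix F G :: "('x, 'u) acomplex" and f assume "F \<in> Obj (Ch X)" "G \<in> Obj (Ch X)" "f \<in> Hom (Ch X) F G"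
  then show "hm (Gamma X) F G f \<in> Hom (Ch point) (ob (Gamma X) F) (ob (Gamma X) G)" by (simp add: chain_maps_iff Gamma_cmap)
next
  fix F G H :: "('x, 'u) acomplex" and f g
  assume a: "F \<in> Obj (Ch X)" "G \<in> Obj (Ch X)" "H \<in> Obj (Ch X)" "f \<in> Hom (Ch X) F G" "g \<in> Hom (Ch X) G H"
  then have b: "F \<in> acs X" "G \<in> acs X" "H \<in> acs X" "cmap X F G f" "cmap X G H g" by (simp_all add: chain_maps_iff)
  have "hm (Gamma X) F H (cc X F g f) = cc point (ob (Gamma X) F) (hm (Gamma X) G H g) (hm (Gamma X) F G f)"
  proof (rule cmap_eqI[OF Gamma_cmap[OF b(1,3) cmap_cc[OF b(1,4,5)]] cmap_cc[OF Gamma_acomplex[OF b(1)] Gamma_cmap[OF b(1,2,4)] Gamma_cmap[OF b(2,3,5)]]])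
    fix n :: int and p :: unit and s assume "s \<in> stc (ob (Gamma X) F) n p"
    then show "hm (Gamma X) F H (cc X F g f) n p s = cc point (ob (Gamma X) F) (hm (Gamma X) G H g) (hm (Gamma X) F G f) n p s"
      using Gamma_closed[OF b(4)] by (auto simp: Gamma_app fun_eq_iff secSD(1))
  qed
  then show "hm (Gamma X) F H (Comp (Ch X) F G H g f) = Comp (Ch point) (ob (Gamma X) F) (ob (Gamma X) G) (ob (Gamma X) H) (hm (Gamma X) G H g) (hm (Gamma X) F G f)"
    by simp
qed

lemma eT_cmap: assumes F: "F \<in> acs X" shows "cmap point (ob (Gamma X) F) (Tc F) (eT F)"
proof (rule cmapI)
  interpret E: gcmap "secS X F P" "dS F P" "TG X F P" "TS X F P" "ep X F P" by (rule gcmap_ep[OF F P])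
  interpret E': gcmap "secS X F (tsp X)" "dS F (tsp X)" "TG X F (tsp X)" "TS X F (tsp X)" "ep X F (tsp X)" by (rule gcmap_ep[OF F subset_refl])
  fix n :: int and p q :: unit and s t
  note r = restrict_secS[OF P]
  show "eT F n p s \<in> stc (Tc F) n p" if "s \<in> stc (ob (Gamma X) F) n p" using that E.closed(2)[OF r] by (simp add: eT_def)
  show "eT F n p (s *[stk (ob (Gamma X) F) n p] t) = eT F n p s *[stk (Tc F) n p] eT F n p t" if st: "s \<in> stc (ob (Gamma X) F) n p" "t \<in> stc (ob (Gamma X) F) n p"
  proof -
    have "s *[secS X F (tsp X) n] t \<in> carrier (secS X F (tsp X) n)" using st monoid.m_closed[OF group.is_monoid[OF E'.grA']] by simp
    moreover have "restrict (s *[secS X F (tsp X) n] t) P = restrict s P *[secS X F P n] restrict t P" using P by (auto simp: fun_eq_iff)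
    ultimately show ?thesis using st hom_mult[OF E.f r r] by (simp add: eT_def del: TG_mult secS_mult)
  qed
  show "eT F (n + 1) p (dif (ob (Gamma X) F) n p s) = dif (Tc F) n p (eT F n p s)" if s: "s \<in> stc (ob (Gamma X) F) n p"
  proof -
    have "restrict (dS F (tsp X) n s) P = dS F P n (restrict s P)" using P by (auto simp: dS_def fun_eq_iff)
    then show ?thesis using s E'.closed(1) E.closed(2)[OF r] E.fd[OF r] by (simp add: eT_def)
  qed
qed (simp_all add: eT_def)

lemma eT_natural: assumes F: "F \<in> acs X" and G: "G \<in> acs X" and f: "cmap X F G f"
  shows "cc point (ob (Gamma X) F) (eT G) (hm (Gamma X) F G f) = cc point (ob (Gamma X) F) (Tm F f) (eT F)"
proof (rule cmap_eqI[OF cmap_cc[OF Gamma_acomplex[OF F] Gamma_cmap[OF F G f] eT_cmap[OF G]] cmap_cc[OF Gamma_acomplex[OF F] eT_cmap[OF F] Tm_cmap[OF F G f]]])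
  fix n :: int and p :: unit and s assume "s \<in> stc (ob (Gamma X) F) n p"
  then have s: "s \<in> carrier (secS X F (tsp X) n)" by simp
  have cl: "ep X F P n (restrict s P) \<in> carrier (TG X F P n)" by (rule ep_closed[OF F P restrict_secS[OF P s]])
  have "ep X G P n (restrict (\<lambda>q\<in>tsp X. f n q (s q)) P) = TM X P f n (ep X F P n (restrict s P))"
  proof (rule ext)
    fix c
    show "ep X G P n (restrict (\<lambda>q\<in>tsp X. f n q (s q)) P) c = TM X P f n (ep X F P n (restrict s P)) c"
    proof (cases "c \<in> chs X P")
      case c: True
      show ?thesis
      proof (cases "length c = 1")
        case True
        then have "dg c = 0" by (simp add: dg_def)
        then show ?thesis using True c chsD(2)[OF c] chs_last[OF F P c] by (simp add: ep_def TM_def)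
      qed (use c chs_last[OF F P c] in "simp add: ep_def TM_def cmap_one[OF f F G]")
    qed (simp add: ep_def TM_def)
  qed
  then show "cc point (ob (Gamma X) F) (eT G) (hm (Gamma X) F G f) n p s = cc point (ob (Gamma X) F) (Tm F f) (eT F) n p s"
    using s cl Gamma_closed[OF f s] by (simp add: eT_def Gamma_app Tm_def)
qed

text \<open>For sections over \<open>P\<close> this is \<open>eps_crit\<close> with \<open>S\<close>
  equal to \<open>P\<close>. Sections over \<open>P\<close> and over the whole space correspond to
  each other, as every point is equivalent to a representative.\<close>

lemma eT_crit: assumes F: "F \<in> acs X" and fl: "flabby F" shows "crit (ob (Gamma X) F) (Tc F) (eT F) p"
proof -
  let ?T = "tsp X"
  have "qcrit (secS X F P) (dS F P) (TG X F P) (TS X F P) (ep X F P)" by (rule eps_crit[OF F fl subset_refl])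
  then have q: "\<exists>a'\<in>carrier (secS X F P i). \<exists>b'\<in>carrier (TG X F P (i - 1)). dS F P i a' = a \<and>
      b = ep X F P i a' *[TG X F P i] TS X F P (i - 1) b'"
    if "a \<in> carrier (secS X F P (i + 1))" "b \<in> carrier (TG X F P i)" "dS F P (i + 1) a = 1[secS X F P (i + 2)]" "TS X F P i b = ep X F P (i + 1) a" for i a b
    using that unfolding qcrit_def by blast
  have "qcrit (secS X F ?T) (dS F ?T) (TG X F P) (TS X F P) (%n s. ep X F P n (restrict s P))" unfolding qcrit_def
  proof (intro allI ballI impI)
    fix i a b
    assume a: "a \<in> carrier (secS X F ?T (i + 1))" and b: "b \<in> carrier (TG X F P i)"
      and h: "dS F ?T (i + 1) a = 1[secS X F ?T (i + 2)] \<and> TS X F P i b = ep X F P (i + 1) (restrict a P)"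
    have "dS F P (i + 1) (restrict a P) = restrict (dS F ?T (i + 1) a) P" using P by (auto simp: dS_def fun_eq_iff)
    also have "\<dots> = 1[secS X F P (i + 2)]" using h P by (auto simp: fun_eq_iff)
    finally obtain a' b' where a': "a' \<in> carrier (secS X F P i)" and b': "b' \<in> carrier (TG X F P (i - 1))"
      and da: "dS F P i a' = restrict a P" and eb: "b = ep X F P i a' *[TG X F P i] TS X F P (i - 1) b'"
      using q[OF restrict_secS[OF P a] b _ h[THEN conjunct2]] by blast
    define rh where "rh q = (SOME p. p \<in> P \<and> pt_le X p q \<and> pt_le X q p)" for q
    have rh: "rh q \<in> P" "pt_le X (rh q) q" "pt_le X q (rh q)" if "q \<in> ?T" for q
      using rep_ex[OF that] someI_ex[of "%p. p \<in> P \<and> pt_le X p q \<and> pt_le X q p"] unfolding rh_def by blast+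
    \<comment> \<open>The extension from \<open>P\<close>: the value at \<open>q\<close> is
      restricted from the equivalent point \<open>rh q\<close>. It is compatible because
      \<open>rh\<close> preserves the order.\<close>
    define s where "s = (\<lambda>q\<in>?T. res (trm F i) (rh q) q (a' (rh q)))"
    have a'c: "a' (rh q) \<in> stc F i (rh q)" if "q \<in> ?T" for q using secSD(1)[OF a' rh(1)[OF that]] .
    have s: "s \<in> carrier (secS X F ?T i)" unfolding secS_carrier
    proof (intro conjI ballI impI)
      fix q q' assume q: "q \<in> ?T" "q' \<in> ?T" "pt_le X q q'"
      have r: "pt_le X (rh q) (rh q')" by (rule pt_le_trans[OF rh(2)[OF q(1)] pt_le_trans[OF q(3) rh(3)[OF q(2)]]])
      have "res (trm F i) q q' (s q) = res (trm F i) (rh q) q' (a' (rh q))" using q rh a'c by (simp add: s_def acD(5)[OF F])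
      also have "\<dots> = res (trm F i) (rh q') q' (res (trm F i) (rh q) (rh q') (a' (rh q)))" by (rule acD(5)[OF F r rh(2)[OF q(2)] a'c[OF q(1)], symmetric])
      also have "\<dots> = s q'" using q secSD(2)[OF a' rh(1)[OF q(1)] rh(1)[OF q(2)] r] by (simp add: s_def)
      finally show "res (trm F i) q q' (s q) = s q'" .
    next
      fix q assume "q \<in> ?T"
      then show "s q \<in> stc F i q" using rh a'c by (simp add: s_def res_cl[OF F])
    qed (simp add: s_def)
    have sP: "restrict s P = a'"
    proof (rule secS_eqI[OF restrict_secS[OF P s] a'])
      fix q assume q: "q \<in> P"
      then have qT: "q \<in> ?T" using P by blast
      have "rh q = q" using P_antisym[OF rh(1)[OF qT] q rh(2,3)[OF qT]] .
      then show "restrict s P q = a' q" using q qT acD(4)[OF F qT] a'c[OF qT] by (simp add: s_def)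
    qed
    have "dS F ?T i s = a"
    proof (rule secS_eqI[OF dS_closed[OF F subset_refl s] a])
      fix q assume q: "q \<in> ?T"
      have "dif F i q (s q) = res (trm F (i + 1)) (rh q) q (dif F i (rh q) (a' (rh q)))" using q acD(8)[OF F rh(2)[OF q] a'c[OF q]] by (simp add: s_def)
      also have "dif F i (rh q) (a' (rh q)) = a (rh q)" using fun_cong[OF da, of "rh q"] rh(1)[OF q] by (simp add: dS_def)
      also have "res (trm F (i + 1)) (rh q) q (a (rh q)) = a q" using secSD(2)[OF a _ q rh(2)[OF q]] rh(1)[OF q] P by blast
      finally show "dS F ?T i s q = a q" using q by (simp add: dS_def)
    qed
    then show "\<exists>a'\<in>carrier (secS X F ?T i). \<exists>b'\<in>carrier (TG X F P (i - 1)). dS F ?T i a' = a \<and>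
        b = ep X F P i (restrict a' P) *[TG X F P i] TS X F P (i - 1) b'"
      using s b' sP eb by blast
  qed
  then show ?thesis by (subst qcrit_cong[where d' = "dS F ?T" and e' = "TS X F P" and f' = "%n s. ep X F P n (restrict s P)"]) (auto simp: eT_def)
qed

text \<open>A chain in \<open>up x\<close> that does not start at \<open>x\<close> starts at a point
  strictly above \<open>x\<close> and lies in the up-set of that point, so the given section
  prescribes its value; compatibility makes this independent of the point used. Chains starting at
  \<open>x\<close> are unconstrained and get the neutral element.\<close>

lemma Cc_flabby: assumes F: "F \<in> acs X" shows "flabby (Cc F)" unfolding flabby_def
proof (intro ballI allI)
  fix x n t assume x: "x \<in> P" and t: "t \<in> carrier (secS X (Cc F) {y \<in> P. pt_less X x y} n)"
  have xX: "x \<in> tsp X" using x P by blast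
  have tc: "t y \<in> carrier (TG X F (up y) n)" if "y \<in> P" "pt_less X x y" for y using secSD(1)[OF t, of y] that by simp
  have tr: "restrict (t y) (chs X (up y')) = t y'" if "y \<in> P" "pt_less X x y" "y' \<in> P" "pt_le X y y'" for y y'
  proof -
    have "pt_less X x y'" using that(2,4) by (auto simp: pt_less_def dest: pt_le_trans)
    then show ?thesis using secSD(2)[OF t, of y y'] that by simp
  qed
  define v where "v = (\<lambda>c\<in>chs X (up x). if hd c = x then 1[stk F (n - dg c) (last c)] else t (hd c) c)"
  have hdup: "c \<in> chs X (up (hd c))" "hd c \<in> P" "pt_le X x (hd c)" if c: "c \<in> chs X (up x)" for x c
  proof -
    obtain z c' where zc: "c = z # c'" using chsD(1)[OF c] by (cases c) auto
    show "hd c \<in> P" "pt_le X x (hd c)" using chsD(3)[OF c] by (auto simp: up_def)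
    then show "c \<in> chs X (up (hd c))" using c P by (auto simp: zc chs_def up_def dest: pt_less_imp_le)
  qed
  show "\<exists>v\<in>stc (Cc F) n x. \<forall>y\<in>P. pt_less X x y --> res (trm (Cc F) n) x y v = t y"
  proof (intro bexI[of _ v] ballI impI)
    fix y assume y: "y \<in> P" "pt_less X x y"
    have "restrict v (chs X (up y)) c = t y c" for c
    proof (cases "c \<in> chs X (up y)")
      case c: True
      have cx: "c \<in> chs X (up x)" using c chs_mono[OF up_mono[OF pt_less_imp_le[OF y(2)]], of X] by blast
      have h: "hd c \<in> P" "pt_le X y (hd c)" "c \<in> chs X (up (hd c))" using hdup[OF c] by auto
      have "hd c \<noteq> x" using h y by (auto simp: pt_less_def)
      then show ?thesis using cx c h fun_cong[OF tr[OF y h(1,2)], of c] by (simp add: v_def)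
    next
      case False
      then show ?thesis using tc[OF y] by (simp add: TG_carrier extensional_def)
    qed
    then show "res (trm (Cc F) n) x y v = t y" by auto
  next
    have "v c \<in> stc F (n - dg c) (last c)" if c: "c \<in> chs X (up x)" for c
    proof (cases "hd c = x")
      case True
      then show ?thesis using c chs_last[OF F up(2) c] by (simp add: v_def one_cl[OF F])
    next
      case False
      then have "pt_less X x (hd c)" using P_less[OF x] hdup[OF c] by blast
      then show ?thesis using False c tc[of "hd c"] hdup[OF c] by (simp add: v_def TG_carrier)
    qed
    then show "v \<in> stc (Cc F) n x" by (simp add: TG_carrier v_def)
  qed
qed

end

section \<open>The right adjoint\<close>

context comm_group
begin

lemma finprod_swap: assumes "finite A" "finite B" "\<And>i j. i \<in> A ==> j \<in> B ==> f i j \<in> carrier G"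
  shows "finprod G (%i. finprod G (f i) B) A = finprod G (%j. finprod G (%i. f i j) A) B"
  using assms(1,3)
proof (induction A rule: finite_induct)
  case empty
  then show ?case by (simp add: finprod_one_eqI)
next
  case (insert a A)
  have "finprod G (%i. finprod G (f i) B) (insert a A) = finprod G (f a) B \<otimes> finprod G (%i. finprod G (f i) B) A" using insert by (intro finprod_insert) auto
  also have "\<dots> = finprod G (f a) B \<otimes> finprod G (%j. finprod G (%i. f i j) A) B" using insert by simp
  also have "\<dots> = finprod G (%j. f a j \<otimes> finprod G (%i. f i j) A) B" using insert by (intro finprod_multf[symmetric]) auto
  also have "\<dots> = finprod G (%j. finprod G (%i. f i j) (insert a A)) B" using insert by (intro finprod_cong' refl finprod_insert[symmetric]) auto
  finally show ?case .
qed

lemma hom_finprod: assumes h: "h \<in> hom G H" and H: "comm_group H" and f: "\<And>i. i \<in> A ==> f i \<in> carrier G"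
  shows "h (finprod G f A) = finprod H (%i. h (f i)) A"
proof -
  interpret H: comm_group H by (rule H)
  show ?thesis
  proof (cases "finite A")
    case True
    then show ?thesis using f
    proof (induction A rule: finite_induct)
      case empty
      then show ?case using hom_one[OF h is_group H.is_group] by simp
    next
      case (insert a A)
      then have "h (finprod G f (insert a A)) = h (f a \<otimes> finprod G f A)" by (subst finprod_insert) auto
      also have "\<dots> = h (f a) *[H] finprod H (%i. h (f i)) A" using insert by (subst hom_mult[OF h]) (auto intro!: finprod_closed)
      also have "\<dots> = finprod H (%i. h (f i)) (insert a A)" using insert hom_in_carrier[OF h] by (intro H.finprod_insert[symmetric]) auto
      finally show ?case .
    qed
  next
    case False
    then show ?thesis using hom_one[OF h is_group H.is_group] by simp
  qed
qed

lemma sg_in_hom: "sg G k \<in> hom G G" by (rule homI) (simp_all add: sg_mult)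

lemma finprod_sg: assumes "\<And>i. i \<in> A ==> f i \<in> carrier G" shows "finprod G (%i. sg G k (f i)) A = sg G k (finprod G f A)"
  by (rule hom_finprod[symmetric]) (use assms sg_in_hom comm_group_axioms in auto)

lemma finprod_mono_neutral: assumes "finite B" "A \<subseteq> B" "\<And>i. i \<in> B - A ==> f i = \<one>" "\<And>i. i \<in> A ==> f i \<in> carrier G"
  shows "finprod G f A = finprod G f B"
proof (rule finprod_mono_neutral_cong_left)
  show "f \<in> B \<rightarrow> carrier G" using assms(3,4) by (metis DiffI Pi_I one_closed)
qed (use assms in auto)

lemma dl_pt_closed: "v \<in> carrier G ==> dl G (pt G l v) c \<in> carrier G" by (rule dl_closed) (simp add: pt_def)

lemma dl_pt_one [simp]: "dl G (pt G l \<one>) c = \<one>" by (simp add: pt_def)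

lemma dl_pt_hom: "(%v. dl G (pt G l v) c) \<in> hom G G"
proof (rule homI)
  fix v w assume "v \<in> carrier G" "w \<in> carrier G"
  then show "dl G (pt G l (v \<otimes> w)) c = dl G (pt G l v) c \<otimes> dl G (pt G l w) c"
    by (subst dl_mult[symmetric]) (auto simp: pt_def intro!: arg_cong[where f = "%s. dl G s c"])
qed (rule dl_pt_closed)

lemma hom_dl_pt: assumes "h \<in> hom G H" "group H" "v \<in> carrier G" shows "h (dl G (pt G l v) c) = dl H (pt H l (h v)) c"
proof -
  have "h (dl G (pt G l v) c) = dl H (%c'. h (pt G l v c')) c" by (rule dl_hom) (use assms in "auto simp: pt_def")
  also have "(%c'. h (pt G l v c')) = pt H l (h v)" using hom_one[OF assms(1) is_group assms(2)] by (auto simp: pt_def)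
  finally show ?thesis .
qed

end

section \<open>The right adjoint \<open>U\<close>, from complexes on the point to complexes on
  \<open>X\<close>\<close>

context reps
begin

text \<open>The chains for which \<open>q\<close> lies in the closure of the last point. They index
  the stalk at \<open>q\<close> of the sum over chains in the theorem.\<close>

definition UI :: "'x => 'x list set" where "UI q = {c \<in> chs X P. pt_le X q (last c)}"

definition supc :: "'x list => 'x list set" where "supc c = {c' \<in> chs X P. c \<in> faces 1 c'}"

text \<open>The transpose of \<open>dl\<close>: a sum over the cofaces of \<open>c\<close>, in which
  the value at a coface is multiplied by the incidence number of \<open>c\<close>.\<close>

definition UB :: "'v monoid => ('x list => 'v) => 'x list => 'v" where "UB H mu c = finprod H (%c'. dl H (pt H c (mu c')) c') (supc c)"

text \<open>The differential that the adjunction forces: \<open>dif M\<close> minus the transpose of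
  the simplicial part of \<open>TD\<close>. The exponent \<open>n + dg c\<close> is the degree in
  \<open>T\<close> of a cochain concentrated at \<open>c\<close> with value of degree
  \<open>n\<close>.\<close>

definition UD :: "(unit, 'v) acomplex => int => ('x list => 'v) => 'x list => 'v" where
  "UD M n mu c = dif M (n + dg c) () (mu c) *[stk M (n + dg c + 1) ()] inv[stk M (n + dg c + 1) ()]
     sg (stk M (n + dg c + 1) ()) (n + dg c) (UB (stk M (n + dg c + 1) ()) mu c)"

text \<open>The shift goes opposite to that in \<open>TG\<close>. If \<open>M\<close> lives in
  degree \<open>0\<close>, a chain of dimension \<open>p\<close> contributes in degree
  \<open>- p\<close> only.\<close>

definition UG :: "(unit, 'v) acomplex => 'x => int => ('x list => 'v) monoid" where "UG M q n = product_group (UI q) (%c. stk M (n + dg c) ())"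

definition US :: "(unit, 'v) acomplex => 'x => int => ('x list => 'v) => 'x list => 'v" where "US M q n mu = (\<lambda>c\<in>UI q. UD M n mu c)"

lemma UG_mult [simp]: "(\<otimes>\<^bsub>UG M q n\<^esub>) = (%s t. \<lambda>c\<in>UI q. s c *[stk M (n + dg c) ()] t c)"
  and UG_one [simp]: "1[UG M q n] = (\<lambda>c\<in>UI q. 1[stk M (n + dg c) ()])"
  by (simp_all add: UG_def)

lemma UG_carrier: "s \<in> carrier (UG M q n) \<longleftrightarrow> s \<in> extensional (UI q) \<and> (\<forall>c\<in>UI q. s c \<in> stc M (n + dg c) ())"
  by (auto simp: UG_def PiE_iff)

lemma UG_eqI: assumes "s \<in> carrier (UG M q n)" "t \<in> carrier (UG M q n)" "\<And>c. c \<in> UI q ==> s c = t c" shows "s = t"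
  using assms unfolding UG_def by (rule product_group_eqI)

lemma finite_chsP: "finite (chs X P)" by (rule finite_chs[OF finite_P])

lemma UI_chs: "c \<in> UI q ==> c \<in> chs X P" "c \<in> UI q ==> pt_le X q (last c)" by (simp_all add: UI_def)

lemma chsP_last: "c \<in> chs X P ==> last c \<in> tsp X" using chsD(2) P by blast

lemma chs_UI_last: "c \<in> chs X P ==> c \<in> UI (last c)" by (simp add: UI_def chsP_last)

lemma UI_mono: "pt_le X q q' ==> UI q' \<subseteq> UI q" by (auto simp: UI_def dest: pt_le_trans)

lemma finite_UI: "finite (UI q)" using finite_chsP by (simp add: UI_def)

lemma supc_dg: "c' \<in> supc c ==> n + dg c' = n + dg c + 1" by (auto simp: supc_def faces_def dg_def)

lemma chsP_le_last: "c \<in> chs X P ==> x \<in> set c ==> pt_le X x (last c)"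
proof -
  assume c: "c \<in> chs X P" and x: "x \<in> set c"
  show ?thesis
  proof (cases "x = last c")
    case False
    have "c = butlast c @ [last c]" using chsD(1)[OF c] by simp
    moreover from this False x have "x \<in> set (butlast c)" by (metis Un_iff empty_iff list.set(1) set_ConsD set_append)
    moreover have "sorted_wrt (pt_less X) c" using c by (simp add: chs_def)
    ultimately have "pt_less X x (last c)" by (metis sorted_wrt_append list.set_intros(1))
    then show ?thesis by (rule pt_less_imp_le)
  qed (simp add: chsP_last[OF c])
qed

lemma supc_le: "c \<noteq> [] ==> c' \<in> supc c ==> pt_le X (last c) (last c')"
  by (rule chsP_le_last) (use last_in_set subseq_set in "fastforce simp: supc_def faces_def")+

lemma supc_UI: "c \<in> UI q ==> c' \<in> supc c ==> c' \<in> UI q" using supc_le[of c c'] chsD(1)[of c X P] by (auto simp: UI_def supc_def dest: pt_le_trans)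

lemma finite_supc: "finite (supc c)" using finite_chsP by (simp add: supc_def)

lemma UB_cong: "(\<And>c'. c' \<in> supc c ==> mu c' = \<nu> c' \<and> \<nu> c' \<in> carrier H) ==> comm_group H ==> UB H mu c = UB H \<nu> c" unfolding UB_def
  by (rule comm_monoid.finprod_cong') (auto simp: comm_group_def intro!: comm_group.dl_pt_closed)

context
  fixes H :: "'v monoid"
  assumes H: "comm_group H"
begin

interpretation H: comm_group H by (rule H)

lemma UB_closed: "(\<And>c'. c' \<in> supc c ==> mu c' \<in> carrier H) ==> UB H mu c \<in> carrier H" unfolding UB_def by (auto intro!: H.finprod_closed H.dl_pt_closed)

lemma UB_mult: assumes "\<And>c'. c' \<in> supc c ==> mu c' \<in> carrier H" "\<And>c'. c' \<in> supc c ==> \<nu> c' \<in> carrier H"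
  shows "UB H (%c'. mu c' *[H] \<nu> c') c = UB H mu c *[H] UB H \<nu> c"
proof -
  have "UB H (%c'. mu c' *[H] \<nu> c') c = finprod H (%c'. dl H (pt H c (mu c')) c' *[H] dl H (pt H c (\<nu> c')) c') (supc c)" unfolding UB_def
  proof (rule H.finprod_cong')
    fix c' assume "c' \<in> supc c"
    from hom_mult[OF H.dl_pt_hom[where l = c and c = c'] assms(1)[OF this] assms(2)[OF this]]
    show "dl H (pt H c (mu c' *[H] \<nu> c')) c' = dl H (pt H c (mu c')) c' *[H] dl H (pt H c (\<nu> c')) c'" .
  qed (use assms in "auto intro: H.dl_pt_closed")
  also have "\<dots> = UB H mu c *[H] UB H \<nu> c" unfolding UB_def using assms by (intro H.finprod_multf) (auto intro: H.dl_pt_closed)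
  finally show ?thesis .
qed

lemma UB_hom: assumes h: "h \<in> hom H K" and K: "comm_group K" and mu: "\<And>c'. c' \<in> supc c ==> mu c' \<in> carrier H"
  shows "h (UB H mu c) = UB K (%c'. h (mu c')) c"
proof -
  interpret K: comm_group K by (rule K)
  have "h (UB H mu c) = finprod K (%c'. h (dl H (pt H c (mu c')) c')) (supc c)" unfolding UB_def by (rule H.hom_finprod[OF h K]) (simp add: H.dl_pt_closed mu)
  also have "\<dots> = UB K (%c'. h (mu c')) c" unfolding UB_def using mu hom_in_carrier[OF h]
    by (intro K.finprod_cong') (auto simp: H.hom_dl_pt[OF h K.is_group] intro!: K.dl_pt_closed)
  finally show ?thesis .
qed

text \<open>After exchanging the two sums, the coefficient belonging to \<open>mu c''\<close>
  collects the products of incidence numbers over all \<open>c'\<close> between \<open>c\<close> and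
  \<open>c''\<close>. It is \<open>dl\<close> applied twice to a cochain concentrated at
  \<open>c\<close>, so \<open>dl_dl\<close> applies.\<close>

lemma UB_UB: assumes c: "c \<in> chs X P" and mu: "\<And>c' c''. c' \<in> supc c ==> c'' \<in> supc c' ==> mu c'' \<in> carrier H" shows "UB H (UB H mu) c = 1[H]"
proof -
  let ?A = "chs X P"
  define w where "w c' c'' = dl H (pt H c' (mu c'')) c''" for c' c''
  have w: "w c' c'' \<in> carrier H" if "c' \<in> supc c" "c'' \<in> ?A" for c' c'' using that mu[OF that(1)] H.dl_pt_outside[of c' c''] unfolding w_def
    by (cases "c' \<in> faces 1 c''") (auto simp: supc_def intro!: H.dl_pt_closed)
  have in1: "UB H mu c' = finprod H (w c') ?A" if c': "c' \<in> supc c" for c' unfolding UB_def w_def[symmetric] by (rule H.finprod_mono_neutral[OF finite_chsP])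
      (use w[OF c'] H.dl_pt_outside[of c'] in "auto simp: supc_def w_def")
  have "UB H (UB H mu) c = finprod H (%c'. finprod H (%c''. dl H (pt H c (w c' c'')) c') ?A) (supc c)" unfolding UB_def[of _ "UB H mu"]
  proof (rule H.finprod_cong')
    fix c' assume c': "c' \<in> supc c"
    have "dl H (pt H c (UB H mu c')) c' = (%v. dl H (pt H c v) c') (finprod H (w c') ?A)" by (simp add: in1[OF c'])
    also have "\<dots> = finprod H (%c''. dl H (pt H c (w c' c'')) c') ?A" by (rule H.hom_finprod[OF H.dl_pt_hom H]) (rule w[OF c'])
    finally show "dl H (pt H c (UB H mu c')) c' = finprod H (%c''. dl H (pt H c (w c' c'')) c') ?A" .
  qed (use w in "auto intro!: H.finprod_closed H.dl_pt_closed")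
  also have "\<dots> = finprod H (%c''. finprod H (%c'. dl H (pt H c (w c' c'')) c') (supc c)) ?A"
    by (rule H.finprod_swap[OF finite_supc finite_chsP]) (simp add: w H.dl_pt_closed)
  also have "\<dots> = 1[H]"
  proof (rule H.finprod_one_eqI)
    fix c'' assume c'': "c'' \<in> ?A"
    show "finprod H (%c'. dl H (pt H c (w c' c'')) c') (supc c) = 1[H]"
    proof (cases "\<exists>c'\<in>supc c. c' \<in> faces 1 c''")
      case False
      then show ?thesis by (intro H.finprod_one_eqI) (simp add: w_def H.dl_pt_outside)
    next
      case True
      then have v: "mu c'' \<in> carrier H" using mu c'' by (auto simp: supc_def)
      let ?s = "dl H (pt H c (mu c''))"
      have s: "?s l \<in> carrier H" for l by (rule H.dl_pt_closed[OF v])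
      have "finprod H (%c'. dl H (pt H c (w c' c'')) c') (supc c) = finprod H (%c'. dl H (pt H c' (?s c')) c'') (supc c)"
      proof (rule H.finprod_cong')
        fix c' assume "c' \<in> supc c"
        have "dl H (pt H c (w c' c'')) c' = (%v. dl H (pt H c' v) c'') (dl H (pt H c (mu c'')) c')"
          unfolding w_def by (rule H.hom_dl_pt[OF H.dl_pt_hom H.is_group v, symmetric])
        then show "dl H (pt H c (w c' c'')) c' = dl H (pt H c' (?s c')) c''" by simp
      qed (auto intro!: H.dl_pt_closed s)
      \<comment> \<open>\<open>dl_sum\<close> wants an index set that contains all faces, the empty
        one included. The added terms are trivial, because \<open>c\<close> is not a face of the
        added lists.\<close>
      also have "\<dots> = finprod H (%c'. dl H (pt H c' (?s c')) c'') (insert [] ?A)"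
      proof (rule H.finprod_mono_neutral)
        fix l assume l: "l \<in> insert [] ?A - supc c"
        have "c \<notin> faces 1 l" using l chsD(1)[OF c] by (auto simp: supc_def faces_def)
        then show "dl H (pt H l (?s l)) c'' = 1[H]" by (simp add: H.dl_pt_outside)
      qed (use finite_chsP in "auto simp: supc_def intro!: H.dl_pt_closed s")
      also have "\<dots> = dl H ?s c''" by (rule H.dl_sum[symmetric]) (use finite_chsP faces_chs[OF _ _ c''] s in auto)
      also have "\<dots> = 1[H]" by (rule H.dl_dl) (simp add: pt_def v)
      finally show ?thesis .
    qed
  qed
  finally show ?thesis .
qed

end

context
  fixes M :: "(unit, 'v) acomplex"
  assumes M: "M \<in> acs point"
begin

lemmas clM = dif_cl[OF M] one_cl[OF M] mult_cl[OF M] inv_cl[OF M] dif_one[OF M] dif_mult[OF M] dif_inv[OF M]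

lemma stkM: "comm_group (stk M i p)" "group (stk M i p)" using acD(1,2)[OF M, of p i] by simp_all

lemma comm_group_UG: "comm_group (UG M q n)" unfolding UG_def by (rule comm_group_product_group) (rule stkM)

lemma UG_sup: "mu \<in> carrier (UG M q n) ==> c \<in> UI q ==> c' \<in> supc c ==> mu c' \<in> stc M (n + dg c + 1) ()"
proof -
  assume mu: "mu \<in> carrier (UG M q n)" and c: "c \<in> UI q" "c' \<in> supc c"
  have "mu c' \<in> stc M (n + dg c') ()" using mu supc_UI[OF c] unfolding UG_carrier by blast
  then show ?thesis unfolding supc_dg[OF c(2)] .
qed

lemma UBM_closed: "mu \<in> carrier (UG M q n) ==> c \<in> UI q ==> UB (stk M (n + dg c + 1) ()) mu c \<in> stc M (n + dg c + 1) ()"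
  by (rule UB_closed[OF stkM(1)]) (rule UG_sup)

lemma UD_closed: "mu \<in> carrier (UG M q n) ==> c \<in> UI q ==> UD M n mu c \<in> stc M (n + dg c + 1) ()" unfolding UD_def using UBM_closed
  by (simp add: UG_carrier clM comm_group.sg_closed[OF stkM(1)])

lemma US_closed: "mu \<in> carrier (UG M q n) ==> US M q n mu \<in> carrier (UG M q (n + 1))"
proof -
  assume mu: "mu \<in> carrier (UG M q n)"
  have e: "n + 1 + dg c = n + dg c + 1" for c :: "'x list" by simp
  show ?thesis unfolding UG_carrier e using UD_closed[OF mu] by (simp add: US_def)
qed

lemma US_hom: "US M q n \<in> hom (UG M q n) (UG M q (n + 1))"
proof (rule homI[OF US_closed])
  fix s t assume st: "s \<in> carrier (UG M q n)" "t \<in> carrier (UG M q n)"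
  have e: "n + 1 + dg c = n + dg c + 1" for c :: "'x list" by simp
  have "UD M n (s *[UG M q n] t) c = UD M n s c *[stk M (n + dg c + 1) ()] UD M n t c" if c: "c \<in> UI q" for c
  proof -
    let ?H = "stk M (n + dg c + 1) ()"
    interpret H: comm_group ?H by (rule stkM)
    have "UB ?H (s *[UG M q n] t) c = UB ?H (%c'. s c' *[?H] t c') c"
    proof (rule UB_cong[OF _ stkM(1)])
      fix c' assume c': "c' \<in> supc c"
      have "(s *[UG M q n] t) c' = s c' *[stk M (n + dg c') ()] t c'" using supc_UI[OF c c'] by simp
      then show "(s *[UG M q n] t) c' = s c' *[?H] t c' \<and> s c' *[?H] t c' \<in> carrier ?H"
        using UG_sup[OF st(1) c c'] UG_sup[OF st(2) c c'] unfolding supc_dg[OF c'] by simp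
    qed
    also have "\<dots> = UB ?H s c *[?H] UB ?H t c" using UG_sup[OF st(1) c] UG_sup[OF st(2) c] by (rule UB_mult[OF stkM(1)])
    finally have u: "UB ?H (s *[UG M q n] t) c = UB ?H s c *[?H] UB ?H t c" .
    have "s c \<in> stc M (n + dg c) ()" "t c \<in> stc M (n + dg c) ()" using st c by (simp_all add: UG_carrier)
    moreover from this have "dif M (n + dg c) () (s c) \<in> carrier ?H" "dif M (n + dg c) () (t c) \<in> carrier ?H" by (simp_all add: clM)
    ultimately show ?thesis using UBM_closed[OF st(1) c] UBM_closed[OF st(2) c] c u by (simp add: UD_def clM H.sg_mult H.inv_mult H.m_ac)
  qed
  then show "US M q n (s *[UG M q n] t) = US M q n s *[UG M q (n + 1)] US M q n t" unfolding UG_mult[of M q "n + 1"] e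
    unfolding US_def by (intro restrict_ext) (simp del: UG_mult)
qed

text \<open>The pattern of \<open>TS_TS\<close>, with \<open>UB_UB\<close> in the role of
  \<open>dl_dl\<close>: the mixed terms both equal \<open>A\<close>, up to the opposite signs for
  \<open>k\<close> and \<open>m\<close>.\<close>

lemma US_US: assumes mu: "mu \<in> carrier (UG M q n)" shows "US M q (n + 1) (US M q n mu) = 1[UG M q (n + 2)]"
proof (rule ext)
  fix c
  show "US M q (n + 1) (US M q n mu) c = 1[UG M q (n + 2)] c"
  proof (cases "c \<in> UI q")
    case c: True
    define k where "k = n + dg c"
    define m where "m = k + 1"
    have i: "n + dg c + 1 = m" "k + 1 = m" "n + dg c = k" "n + 1 + dg c = m" "n + 2 + dg c = m + 1" by (simp_all add: k_def m_def)
    interpret H1: comm_group "stk M m ()" by (rule stkM)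
    interpret H: comm_group "stk M (m + 1) ()" by (rule stkM)
    let ?H = "stk M (m + 1) ()"
    note sup = UG_sup[OF mu c, unfolded i]
    note UBc = UBM_closed[OF mu c, unfolded i]
    have muc: "mu c \<in> stc M k ()" using mu c unfolding UG_carrier k_def by blast
    define A where "A = UB ?H (%c'. dif M m () (mu c')) c"
    have A: "A \<in> carrier ?H" unfolding A_def by (rule UB_closed[OF stkM(1)], rule dif_cl[OF M], simp, rule sup)
    have dc: "dif M k () (mu c) \<in> stc M m ()" using dif_cl[OF M _ muc] by (simp add: m_def)
    have dd: "dif M m () (dif M k () (mu c)) = 1[?H]" using acD(9)[OF M _ muc] by (simp add: m_def add.assoc)
    have dUB: "dif M m () (UB (stk M m ()) mu c) = A" unfolding A_def by (rule UB_hom[OF stkM(1) acD(7)[OF M] stkM(1)]) (use sup in auto)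
    have 1: "dif M m () (UD M n mu c) = inv[?H] sg ?H k A" unfolding UD_def i using dc UBc dd dUB A by (simp add: clM dif_sg[OF M])
    have "UB ?H (US M q n mu) c = UB ?H (%c'. dif M m () (mu c') *[?H] inv[?H] sg ?H m (UB ?H mu c')) c"
    proof (rule UB_cong[OF _ stkM(1)])
      fix c' assume c': "c' \<in> supc c"
      have c'q: "c' \<in> UI q" by (rule supc_UI[OF c c'])
      have j: "n + dg c' = m" using supc_dg[OF c', of n] by (simp add: k_def m_def)
      have "US M q n mu c' = UD M n mu c'" using c'q by (simp add: US_def)
      then show "US M q n mu c' = dif M m () (mu c') *[?H] inv[?H] sg ?H m (UB ?H mu c') \<and> dif M m () (mu c') *[?H] inv[?H] sg ?H m (UB ?H mu c') \<in> carrier ?H"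
        using UBM_closed[OF mu c'q] sup[OF c'] unfolding UD_def j by (simp add: clM)
    qed
    also have "\<dots> = A *[?H] UB ?H (%c'. inv[?H] sg ?H m (UB ?H mu c')) c" unfolding A_def
    proof (rule UB_mult[OF stkM(1)])
      fix c' assume c': "c' \<in> supc c"
      have j: "n + dg c' = m" using supc_dg[OF c', of n] by (simp add: k_def m_def)
      show "dif M m () (mu c') \<in> carrier ?H" using sup[OF c'] by (simp add: clM)
      show "inv[?H] sg ?H m (UB ?H mu c') \<in> carrier ?H" using UBM_closed[OF mu supc_UI[OF c c']] unfolding j by simp
    qed
    also have "UB ?H (%c'. inv[?H] sg ?H m (UB ?H mu c')) c = 1[?H]"
    proof -
      have h: "(%v. inv[?H] sg ?H m v) \<in> hom ?H ?H" by (rule homI) (simp_all add: H.sg_mult H.inv_mult)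
      have cl: "UB ?H mu c' \<in> carrier ?H" if c': "c' \<in> supc c" for c'
      proof -
        have j: "n + dg c' = m" using supc_dg[OF c', of n] by (simp add: k_def m_def)
        show ?thesis using UBM_closed[OF mu supc_UI[OF c c']] unfolding j .
      qed
      have z: "UB ?H (UB ?H mu) c = 1[?H]"
      proof (rule UB_UB[OF stkM(1) UI_chs(1)[OF c]])
        fix c' c'' assume c': "c' \<in> supc c" "c'' \<in> supc c'"
        have "n + dg c' + 1 = m + 1" using supc_dg[OF c'(1), of n] by (simp add: k_def m_def)
        then show "mu c'' \<in> carrier ?H" using UG_sup[OF mu supc_UI[OF c c'(1)] c'(2)] by simp
      qed
      have "UB ?H (%c'. inv[?H] sg ?H m (UB ?H mu c')) c = (%v. inv[?H] sg ?H m v) (UB ?H (UB ?H mu) c)" by (rule UB_hom[OF stkM(1) h stkM(1), symmetric]) (rule cl)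
      then show ?thesis unfolding z by simp
    qed
    finally have 2: "UB ?H (US M q n mu) c = A" using A by simp
    have u: "US M q (n + 1) (US M q n mu) c = UD M (n + 1) (US M q n mu) c" "US M q n mu c = UD M n mu c" using c by (simp_all add: US_def)
    have "US M q (n + 1) (US M q n mu) c = inv[?H] sg ?H k A *[?H] inv[?H] sg ?H m A" unfolding u(1) UD_def[of M "n + 1"] i u(2) 1 2 ..
    also have "\<dots> = 1[?H]" using A H.sg_plus_one[OF A, of k] by (simp add: m_def[symmetric])
    finally show ?thesis using c unfolding UG_one by (simp add: i)
  qed (simp add: US_def)
qed

end

lemma US_restrict: assumes "pt_le X q q'" shows "comm_group (stk M (n + dg c + 1) ()) ==> mu \<in> carrier (UG M q n) ==> M \<in> acs point ==>
    restrict (US M q n mu) (UI q') = US M q' n (restrict mu (UI q'))"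
proof (rule ext)
  fix c assume mu: "mu \<in> carrier (UG M q n)" and M: "M \<in> acs point"
  show "restrict (US M q n mu) (UI q') c = US M q' n (restrict mu (UI q')) c"
  proof (cases "c \<in> UI q'")
    case c: True
    then have cq: "c \<in> UI q" using UI_mono[OF assms] by blast
    have "UB (stk M (n + dg c + 1) ()) mu c = UB (stk M (n + dg c + 1) ()) (restrict mu (UI q')) c"
      by (rule UB_cong[OF _ stkM(1)[OF M]]) (use supc_UI[OF c] UG_sup[OF M mu cq] in auto)
    then show ?thesis using c cq by (simp add: US_def UD_def)
  qed (simp add: US_def)
qed

definition Uc :: "(unit, 'v) acomplex => ('x, 'x list => 'v) acomplex" where
  "Uc M = \<lparr>trm = (%n. \<lparr>stalk = (%q. UG M q n), res = (%q q' s. restrict s (UI q'))\<rparr>),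
           dif = (%n. \<lambda>q\<in>tsp X. \<lambda>s\<in>carrier (UG M q n). US M q n s)\<rparr>"

definition Um :: "(unit, 'v) acomplex => (int => unit => 'v => 'w) => int => 'x => ('x list => 'v) => 'x list => 'w" where
  "Um M f = (%n. \<lambda>q\<in>tsp X. \<lambda>s\<in>carrier (UG M q n). \<lambda>c\<in>UI q. f (n + dg c) () (s c))"

lemma Uc_simps [simp]: "stk (Uc M) n q = UG M q n" "res (trm (Uc M) n) q q' s = restrict s (UI q')"
  "q \<in> tsp X ==> dif (Uc M) n q = (\<lambda>s\<in>carrier (UG M q n). US M q n s)"
  by (simp_all add: Uc_def)

lemma restrict_UG: "pt_le X q q' ==> s \<in> carrier (UG M q n) ==> restrict s (UI q') \<in> carrier (UG M q' n)" using UI_mono[of q q'] by (auto simp: UG_carrier)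

lemma Uc_acomplex: assumes M: "M \<in> acs point" shows "Uc M \<in> acs X"
proof (rule acomplexesI)
  fix n :: int and p q r and s
  show "comm_group (stk (Uc M) n p)" by (simp add: comm_group_UG[OF M])
  show "dif (Uc M) n p \<in> hom (stk (Uc M) n p) (stk (Uc M) (n + 1) p)" if "p \<in> tsp X"
    using hom_restrict[OF US_hom[OF M]] comm_group_UG[OF M] that by (simp add: comm_group_def)
  show "dif (Uc M) (n + 1) p (dif (Uc M) n p s) = 1[stk (Uc M) (n + 2) p]" if "p \<in> tsp X" "s \<in> stc (Uc M) n p"
    using that US_US[OF M] US_closed[OF M] by (simp del: UG_one)
  show "res (trm (Uc M) n) p q \<in> hom (stk (Uc M) n p) (stk (Uc M) n q)" if pq: "pt_le X p q"
  proof (rule homI)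
    fix s t assume "s \<in> stc (Uc M) n p" "t \<in> stc (Uc M) n p"
    then show "res (trm (Uc M) n) p q s \<in> stc (Uc M) n q" using restrict_UG[OF pq] by simp
    show "res (trm (Uc M) n) p q (s *[stk (Uc M) n p] t) = res (trm (Uc M) n) p q s *[stk (Uc M) n q] res (trm (Uc M) n) p q t"
      using UI_mono[OF pq] by (auto simp: fun_eq_iff)
  qed
  show "res (trm (Uc M) n) p p s = s" if "p \<in> tsp X" "s \<in> stc (Uc M) n p" using that by (simp add: UG_carrier extensional_restrict)
  show "res (trm (Uc M) n) q r (res (trm (Uc M) n) p q s) = res (trm (Uc M) n) p r s" if "pt_le X p q" "pt_le X q r" "s \<in> stc (Uc M) n p"
    using UI_mono[OF that(2)] by (auto simp: fun_eq_iff)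
  show "dif (Uc M) n q (res (trm (Uc M) n) p q s) = res (trm (Uc M) (n + 1)) p q (dif (Uc M) n p s)" if pq: "pt_le X p q" and s: "s \<in> stc (Uc M) n p"
    using restrict_UG[OF pq, of s M n] s US_restrict[OF pq stkM(1)[OF M], of s n] M pt_leD[OF pq] by simp
qed (simp_all add: Uc_def)

context
  fixes M :: "(unit, 'v) acomplex" and N :: "(unit, 'w) acomplex" and f
  assumes M: "M \<in> acs point" and N: "N \<in> acs point" and f: "cmap point M N f"
begin

lemma UM_closed: "s \<in> carrier (UG M q n) ==> (\<lambda>c\<in>UI q. f (n + dg c) () (s c)) \<in> carrier (UG N q n)" by (simp add: UG_carrier cmapD(3)[OF f])

lemma UM_US: assumes s: "s \<in> carrier (UG M q n)"
  shows "(\<lambda>c\<in>UI q. f (n + 1 + dg c) () (US M q n s c)) = US N q n (\<lambda>c\<in>UI q. f (n + dg c) () (s c))"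
  unfolding US_def[of N]
proof (rule restrict_ext)
  fix c assume c: "c \<in> UI q"
  let ?k = "n + dg c"
  have e: "n + 1 + dg c = ?k + 1" by simp
  interpret A: comm_group "stk M (?k + 1) ()" by (rule stkM(1)[OF M])
  interpret B: comm_group "stk N (?k + 1) ()" by (rule stkM(1)[OF N])
  have h: "f (?k + 1) () \<in> hom (stk M (?k + 1) ()) (stk N (?k + 1) ())" by (rule cmapD(2)[OF f]) simp
  have sc: "s c \<in> stc M ?k ()" using s c unfolding UG_carrier by blast
  note sup = UG_sup[OF M s c]
  have "f (?k + 1) () (UB (stk M (?k + 1) ()) s c) = UB (stk N (?k + 1) ()) (%c'. f (?k + 1) () (s c')) c" by (rule UB_hom[OF stkM(1)[OF M] h stkM(1)[OF N]]) (rule sup)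
  also have "\<dots> = UB (stk N (?k + 1) ()) (\<lambda>c\<in>UI q. f (n + dg c) () (s c)) c"
  proof (rule UB_cong[OF _ stkM(1)[OF N]])
    fix c' assume c': "c' \<in> supc c"
    have "f (?k + 1) () (s c') \<in> stc N (?k + 1) ()" using sup[OF c'] by (simp add: cmapD(3)[OF f])
    then show "f (?k + 1) () (s c') = (\<lambda>c\<in>UI q. f (n + dg c) () (s c)) c' \<and> (\<lambda>c\<in>UI q. f (n + dg c) () (s c)) c' \<in> stc N (?k + 1) ()"
      using supc_UI[OF c c'] supc_dg[OF c', of n] by (simp only: restrict_apply')
  qed
  finally have u: "f (?k + 1) () (UB (stk M (?k + 1) ()) s c) = UB (stk N (?k + 1) ()) (\<lambda>c\<in>UI q. f (n + dg c) () (s c)) c" .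
  have "f (?k + 1) () (UD M n s c) = UD N n (\<lambda>c\<in>UI q. f (n + dg c) () (s c)) c" unfolding UD_def using c sc UBM_closed[OF M s c] u dif_cl[OF M _ sc]
    by (simp add: hom_mult[OF h] hom_group_inv[OF h A.is_group B.is_group] A.sg_hom[OF h B.is_group] cmapD(6)[OF f])
  then show "f (n + 1 + dg c) () (US M q n s c) = UD N n (\<lambda>c\<in>UI q. f (n + dg c) () (s c)) c" using c unfolding e by (simp add: US_def)
qed

lemma Um_cmap: "cmap X (Uc M) (Uc N) (Um M f)"
proof (rule cmapI)
  fix n :: int and p q and s t
  show "Um M f n p (s *[stk (Uc M) n p] t) = Um M f n p s *[stk (Uc N) n p] Um M f n p t" if st: "p \<in> tsp X" "s \<in> stc (Uc M) n p" "t \<in> stc (Uc M) n p"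
  proof -
    have "s *[UG M p n] t \<in> carrier (UG M p n)" using comm_group_UG[OF M, of p n] st by (simp add: comm_group_def group.is_monoid monoid.m_closed del: UG_mult)
    then show ?thesis using st by (auto simp: Um_def fun_eq_iff UG_carrier cmapD(4)[OF f])
  qed
  show "Um M f n q (res (trm (Uc M) n) p q s) = res (trm (Uc N) n) p q (Um M f n p s)" if pq: "pt_le X p q" "s \<in> stc (Uc M) n p"
    using pq pt_leD[OF pq(1)] restrict_UG[OF pq(1)] UI_mono[OF pq(1)] by (auto simp: Um_def fun_eq_iff)
  show "Um M f (n + 1) p (dif (Uc M) n p s) = dif (Uc N) n p (Um M f n p s)" if "p \<in> tsp X" "s \<in> stc (Uc M) n p"
    using that UM_US UM_closed US_closed[OF M] by (simp add: Um_def)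
qed (simp_all add: Um_def UM_closed)

text \<open>Here the differential reads longer chains, so the filtration is by decreasing length; on
  its diagonal stand shifted copies of \<open>M\<close> and \<open>N\<close>.\<close>

lemma Um_crit: assumes crit: "crit M N f ()" and q: "q \<in> tsp X" shows "crit (Uc M) (Uc N) (Um M f) q"
proof -
  \<comment> \<open>Larger than every length that occurs, so that subtraction on \<open>nat\<close>
    reverses the order of lengths strictly.\<close>
  let ?B = "Suc (Max (length ` UI q))"
  have le: "length c \<le> Max (length ` UI q)" if "c \<in> UI q" for c using finite_UI that by (intro Max_ge) auto
  have e: "n + 1 + dg c = n + dg c + 1" for n and c :: "'x list" by simp
  have tri: "US K q n s c = dif K (n + dg c) () (s c)" if K: "K \<in> acs point" and s: "s \<in> carrier (UG K q n)" and c: "c \<in> UI q"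
      and low: "\<And>c'. c' \<in> UI q ==> ?B - length c' < ?B - length c ==> s c' = 1[stk K (n + dg c') ()]"
    for K :: "(unit, 'z) acomplex" and n s c
  proof -
    let ?H = "stk K (n + dg c + 1) ()"
    interpret H: comm_group ?H by (rule stkM(1)[OF K])
    have "UB ?H s c = 1[?H]" unfolding UB_def
    proof (rule H.finprod_one_eqI)
      fix c' assume c': "c' \<in> supc c"
      have "length c < length c'" using c' by (auto simp: supc_def faces_def)
      then have "s c' = 1[stk K (n + dg c') ()]" using le[OF supc_UI[OF c c']] by (intro low[OF supc_UI[OF c c']]) simp
      then show "dl ?H (pt ?H c (s c')) c' = 1[?H]" unfolding supc_dg[OF c'] by simp
    qed
    moreover have "dif K (n + dg c) () (s c) \<in> carrier ?H" using s c unfolding UG_carrier by (intro dif_cl[OF K]) auto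
    ultimately show ?thesis using c by (simp add: US_def UD_def)
  qed
  have g: "gcmap (%n. product_group (UI q) (%c. stk M (n + dg c) ())) (US M q) (%n. product_group (UI q) (%c. stk N (n + dg c) ())) (US N q)
     (%n s. \<lambda>c\<in>UI q. f (n + dg c) () (s c))"
    unfolding UG_def[symmetric]
  proof (rule gcmap.intro)
    fix n
    show "(%s. \<lambda>c\<in>UI q. f (n + dg c) () (s c)) \<in> hom (UG M q n) (UG N q n)" by (rule homI[OF UM_closed]) (auto simp: fun_eq_iff UG_carrier cmapD(4)[OF f])
  qed (simp_all add: comm_group_UG[OF M] comm_group_UG[OF N] US_hom[OF M] US_hom[OF N] US_US[OF M] US_US[OF N] UM_US UM_closed del: UG_one)
  have "filtered_gcmap (UI q) (%c n. stk M (n + dg c) ()) (%c n. stk N (n + dg c) ()) (US M q) (US N q) (%c n. f (n + dg c) ()) (%c. ?B - length c) (Suc ?B)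
     (%c n. dif M (n + dg c) ()) (%c n. dif N (n + dg c) ())"
  proof (intro filtered_gcmap.intro filtered_gcmap_axioms.intro g)
    fix c n s assume c: "c \<in> UI q"
    show "comm_group (stk M (n + dg c) ())" "comm_group (stk N (n + dg c) ())" using stkM(1)[OF M] stkM(1)[OF N] by auto
    show "dif M (n + dg c) () 1[stk M (n + dg c) ()] = 1[stk M (n + 1 + dg c) ()]" "dif N (n + dg c) () 1[stk N (n + dg c) ()] = 1[stk N (n + 1 + dg c) ()]"
      unfolding e using dif_one[OF M] dif_one[OF N] by auto
    show "f (n + dg c) () 1[stk M (n + dg c) ()] = 1[stk N (n + dg c) ()]" by (rule cmap_one[OF f M N]) simp
    show "?B - length c < Suc ?B" by simp
    show "qcrit (%n. stk M (n + dg c) ()) (%n. dif M (n + dg c) ()) (%n. stk N (n + dg c) ()) (%n. dif N (n + dg c) ()) (%n. f (n + dg c) ())"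
      by (rule qcrit_shift[OF crit])
    show "US M q n s c = dif M (n + dg c) () (s c)" if "s \<in> carrier (product_group (UI q) (%c. stk M (n + dg c) ()))"
        "\<And>c'. c' \<in> UI q ==> ?B - length c' < ?B - length c ==> s c' = 1[stk M (n + dg c') ()]"
      using tri[OF M _ c, of s n] that by (simp add: UG_def)
  next
    fix c n s assume c: "c \<in> UI q"
    show "US N q n s c = dif N (n + dg c) () (s c)" if "s \<in> carrier (product_group (UI q) (%c. stk N (n + dg c) ()))"
        "\<And>c'. c' \<in> UI q ==> ?B - length c' < ?B - length c ==> s c' = 1[stk N (n + dg c') ()]"
      using tri[OF N _ c, of s n] that by (simp add: UG_def)
  qed
  from filtered_gcmap.qcrit_filtered[OF this] have "qcrit (UG M q) (US M q) (UG N q) (US N q) (%n s. \<lambda>c\<in>UI q. f (n + dg c) () (s c))"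
    unfolding UG_def[symmetric] .
  then show ?thesis using q by (subst qcrit_cong[where d' = "US M q" and e' = "US N q" and f' = "%n s. \<lambda>c\<in>UI q. f (n + dg c) () (s c)"]) (auto simp: Um_def)
qed

end

lemma Um_cc: assumes M: "M \<in> acs point" and N: "N \<in> acs point" and K: "K \<in> acs point" and f: "cmap point M N f" and g: "cmap point N K g"
  shows "Um M (cc point M g f) = cc X (Uc M) (Um N g) (Um M f)"
proof (rule cmap_eqI[OF Um_cmap[OF M K cmap_cc[OF M f g]] cmap_cc[OF Uc_acomplex[OF M] Um_cmap[OF M N f] Um_cmap[OF N K g]]])
  fix n :: int and p and s
  assume s: "p \<in> tsp X" "s \<in> stc (Uc M) n p"
  then show "Um M (cc point M g f) n p s = cc X (Uc M) (Um N g) (Um M f) n p s" using UM_closed[OF M N f] by (auto simp: Um_def fun_eq_iff UG_carrier)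
qed

lemma Um_ci: assumes M: "M \<in> acs point" shows "Um M (ci point M) = ci X (Uc M)"
proof (rule cmap_eqI[OF Um_cmap[OF M M cmap_ci[OF M]] cmap_ci[OF Uc_acomplex[OF M]]])
  fix n :: int and p and s
  assume s: "p \<in> tsp X" "s \<in> stc (Uc M) n p"
  then show "Um M (ci point M) n p s = ci X (Uc M) n p s" by (auto simp: Um_def fun_eq_iff UG_carrier extensional_def)
qed

end

subsection \<open>The adjunction bijection\<close>

context reps
begin

definition io :: "('x, 'u) acomplex => int => 'x list => 'u => 'x list => 'u" where
  "io F k c w = (\<lambda>l\<in>chs X P. if l = c then w else 1[stk F (k - dg l) (last l)])"

text \<open>Transposition from maps out of \<open>T\<close> to maps into \<open>U\<close>: an
  element at \<open>q\<close> is restricted to the last point of each chain in \<open>UI q\<close>,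
  and \<open>ph\<close> is applied to the cochain with this value at that chain only.\<close>

definition Psi :: "('x, 'u) acomplex => (int => unit => ('x list => 'u) => 'v) => int => 'x => 'u => 'x list => 'v" where
  "Psi F ph = (%n. \<lambda>q\<in>tsp X. \<lambda>v\<in>stc F n q. \<lambda>c\<in>UI q. ph (n + dg c) () (io F (n + dg c) c (res (trm F n) q (last c) v)))"

text \<open>The inverse transposition. Each value \<open>s c\<close> is sent by \<open>g\<close> to
  a family over chains, of which only the entry at \<open>c\<close> itself is kept.\<close>

definition Theta :: "('x, 'u) acomplex => (unit, 'v) acomplex => (int => 'x => 'u => 'x list => 'v) => int => unit => ('x list => 'u) => 'v" where
  "Theta F M g = (%n _. \<lambda>s\<in>carrier (TG X F P n). finprod (stk M n ()) (%c. g (n - dg c) (last c) (s c) c) (chs X P))"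

lemma io_closed: assumes F: "F \<in> acs X" and w: "w \<in> stc F (k - dg c) (last c)" shows "io F k c w \<in> carrier (TG X F P k)"
  using w chs_last[OF F P] by (auto simp: TG_carrier io_def one_cl[OF F])

lemma io_hom: assumes F: "F \<in> acs X" shows "io F k c \<in> hom (stk F (k - dg c) (last c)) (TG X F P k)"
proof (rule homI[OF io_closed[OF F]])
  have "1[stk F (k - dg l) (last l)] *[stk F (k - dg l) (last l)] 1[stk F (k - dg l) (last l)] = 1[stk F (k - dg l) (last l)]" if "l \<in> chs X P" for l
    using acD(2)[OF F chs_last[OF F P that]] by (simp add: group.is_monoid)
  then show "io F k c (v *[stk F (k - dg c) (last c)] w) = io F k c v *[TG X F P k] io F k c w" for v w by (auto simp: io_def fun_eq_iff)
qed

context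
  fixes F :: "('x, 'u) acomplex" and M :: "(unit, 'v) acomplex"
  assumes F: "F \<in> acs X" and M: "M \<in> acs point"
begin

text \<open>A cochain is the product of its parts concentrated at single chains, so a homomorphism
  is determined by its values on these; \<open>io\<close> plays the role of a basis.\<close>

lemma io_decompose: assumes \<psi>: "\<psi> \<in> hom (TG X F P k) H" and H: "comm_group H" and t: "t \<in> carrier (TG X F P k)"
  shows "\<psi> t = finprod H (%l. \<psi> (io F k l (t l))) (chs X P)"
proof -
  interpret T: comm_group "TG X F P k" by (rule comm_group_TG[OF F P])
  have tl: "t l \<in> stc F (k - dg l) (last l)" if "l \<in> chs X P" for l using t that unfolding TG_carrier by blast
  have cl: "io F k l (t l) \<in> carrier (TG X F P k)" if "l \<in> chs X P" for l by (rule io_closed[OF F tl[OF that]])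
  have sum: "finprod (TG X F P k) (%l. io F k l (t l)) (chs X P) = t"
  proof (rule TG_eqI[OF _ t])
    show "finprod (TG X F P k) (%l. io F k l (t l)) (chs X P) \<in> carrier (TG X F P k)" using cl by (intro T.finprod_closed) auto
    fix c assume c: "c \<in> chs X P"
    interpret G: comm_group "stk F (k - dg c) (last c)" by (rule acD(1)[OF F chs_last[OF F P c]])
    have ev: "(%s. s c) \<in> hom (TG X F P k) (stk F (k - dg c) (last c))" by (rule homI) (use c in "simp_all add: TG_carrier")
    have "finprod (TG X F P k) (%l. io F k l (t l)) (chs X P) c = finprod (stk F (k - dg c) (last c)) (%l. io F k l (t l) c) (chs X P)"
      by (rule T.hom_finprod[OF ev G.comm_group_axioms cl])
    also have "\<dots> = finprod (stk F (k - dg c) (last c)) (%l. if c = l then t c else 1[stk F (k - dg c) (last c)]) (chs X P)"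
      using tl[OF c] c by (intro G.finprod_cong') (auto simp: io_def)
    also have "\<dots> = t c" using G.finprod_singleton[of c "chs X P" "%l. t c"] c finite_chsP tl[OF c] by simp
    finally show "finprod (TG X F P k) (%l. io F k l (t l)) (chs X P) c = t c" .
  qed
  show ?thesis using T.hom_finprod[OF \<psi> H, of "chs X P" "%l. io F k l (t l)"] cl sum by simp
qed

text \<open>\<open>TS\<close> of a cochain concentrated at \<open>c\<close> lives on
  \<open>c\<close>, where it is the differential of the value, and on the cofaces of
  \<open>c\<close>, where the incidence sign enters; \<open>ph\<close> turns the coface part into
  \<open>UB\<close>. As \<open>ph\<close> is assumed to be additive only, the equivalence yields
  both that \<open>Psi\<close> of a chain map is a chain map and the converse for
  \<open>Theta\<close>.\<close>

lemma Psi_UD: assumes ph: "\<And>k. ph k () \<in> hom (TG X F P k) (stk M k ())" and q: "q \<in> tsp X" and v: "v \<in> stc F n q" and c: "c \<in> UI q"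
  shows "UD M n (Psi F ph n q v) c = ph (n + dg c + 1) () (io F (n + dg c + 1) c (res (trm F (n + 1)) q (last c) (dif F n q v))) \<longleftrightarrow>
    dif M (n + dg c) () (ph (n + dg c) () (io F (n + dg c) c (res (trm F n) q (last c) v))) =
    ph (n + dg c + 1) () (TS X F P (n + dg c) (io F (n + dg c) c (res (trm F n) q (last c) v)))"
proof -
  define k where "k = n + dg c"
  define m where "m = k + 1"
  define y where "y = last c"
  define w where "w = res (trm F n) q y v"
  define H where "H = stk M m ()"
  let ?Ps = "Psi F ph n q v"
  note cP = UI_chs(1)[OF c]
  have qy: "pt_le X q y" using UI_chs(2)[OF c] by (simp add: y_def)
  have y: "y \<in> tsp X" by (rule pt_leD(2)[OF qy])
  have i: "n + dg c + 1 = m" "k + 1 = m" "n + dg c = k" "k - dg c = n" "m - dg c = n + 1" by (simp_all add: k_def m_def)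
  have w: "w \<in> stc F n y" unfolding w_def by (rule res_cl[OF F qy v])
  have dw: "dif F n y w \<in> stc F (n + 1) y" by (rule dif_cl[OF F y w])
  interpret H: comm_group H unfolding H_def by (rule stkM(1)[OF M])
  have phh: "ph m () \<in> hom (TG X F P m) H" using ph[of m] by (simp add: H_def)
  have ioc: "io F k c w \<in> carrier (TG X F P k)" using w by (intro io_closed[OF F]) (simp add: i y_def)
  have Psc: "?Ps c = ph k () (io F k c w)" using q v c by (simp add: Psi_def k_def w_def y_def)
  let ?t = "TS X F P k (io F k c w)"
  have t: "?t \<in> carrier (TG X F P m)" using TS_closed[OF F P ioc] by (simp only: i)
  have rs1: "rsx F (k - dg l + 1) (last l) (io F k c w) c' = 1[stk F (k - dg l + 1) (last l)]"
    if l: "l \<in> chs X P" and c': "c' \<in> faces 1 l" "c' \<noteq> c" for l c'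
  proof (cases "c' = []")
    case False
    have "io F k c w c' = 1[stk F (k - dg c') (last c')]" using faces_chs[OF c'(1) False l] c'(2) by (simp add: io_def)
    then show ?thesis using False faces_le[OF F P c'(1) False l] unfolding faces_dg[OF c'(1)] by (simp add: rsx_def res_one[OF F])
  qed (simp add: rsx_def)
  have tc: "?t c = dif F n y w"
  proof -
    interpret G: comm_group "stk F (n + 1) y" by (rule acD(1)[OF F y])
    have "dl (stk F (k - dg c + 1) (last c)) (rsx F (k - dg c + 1) (last c) (io F k c w)) c =
        dl (stk F (k - dg c + 1) (last c)) (%c'. 1[stk F (k - dg c + 1) (last c)]) c"
      by (rule dl_cong, rule rs1[OF cP]) (auto simp: faces_def)
    then show ?thesis using cP dw by (simp add: TS_def TD_def i y_def[symmetric]) (simp add: io_def)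
  qed
  define e where "e l = dl (stk F n (last l)) (pt (stk F n (last l)) c (res (trm F n) y (last l) w)) l" for l
  have sup: "l \<in> chs X P" "k - dg l + 1 = n" "m - dg l = n" "pt_le X y (last l)" "last l \<in> tsp X" "l \<noteq> c" "n + dg l = m" if l: "l \<in> supc c" for l
  proof -
    show lP: "l \<in> chs X P" using l by (simp add: supc_def)
    have "dg l = dg c + 1" using supc_dg[OF l, of 0] by simp
    then show "k - dg l + 1 = n" "m - dg l = n" "n + dg l = m" by (simp_all add: k_def m_def)
    show "pt_le X y (last l)" unfolding y_def by (rule supc_le[OF chsD(1)[OF cP] l])
    then show "last l \<in> tsp X" by (rule pt_leD)
    show "l \<noteq> c" using l by (auto simp: supc_def faces_def)
  qed
  have rw: "res (trm F n) y (last l) w \<in> stc F n (last l)" if "l \<in> supc c" for l by (rule res_cl[OF F sup(4)[OF that] w])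
  have ecl: "e l \<in> stc F n (last l)" if l: "l \<in> supc c" for l unfolding e_def by (rule comm_group.dl_pt_closed[OF acD(1)[OF F sup(5)[OF l]] rw[OF l]])
  have ts: "?t l = sg (stk F n (last l)) k (e l)" if l: "l \<in> supc c" for l
  proof -
    interpret G: comm_group "stk F n (last l)" by (rule acD(1)[OF F sup(5)[OF l]])
    have "dl (stk F (k - dg l + 1) (last l)) (rsx F (k - dg l + 1) (last l) (io F k c w)) l = e l" unfolding sup(2)[OF l] e_def
    proof (rule dl_cong)
      fix c' assume c': "c' \<in> faces 1 l"
      show "rsx F n (last l) (io F k c w) c' = pt (stk F n (last l)) c (res (trm F n) y (last l) w) c'"
      proof (cases "c' = c")
        case True
        then show ?thesis using cP chsD(1)[OF cP] by (simp add: rsx_def pt_def io_def y_def)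
      next
        case False
        then show ?thesis using rs1[OF sup(1)[OF l] c' False] unfolding sup(2)[OF l] by (simp add: pt_def)
      qed
    qed
    moreover have "io F k c w l = 1[stk F (k - dg l) (last l)]" using sup[OF l] by (simp add: io_def)
    moreover have "dif F (k - dg l) (last l) 1[stk F (k - dg l) (last l)] = 1[stk F n (last l)]"
      using dif_one[OF F sup(5)[OF l], of "k - dg l"] by (simp only: sup(2)[OF l])
    ultimately show ?thesis using sup(1)[OF l] ecl[OF l] by (simp add: TS_def TD_def sup(2)[OF l])
  qed
  have t1: "?t l = 1[stk F (m - dg l) (last l)]" if l: "l \<in> chs X P" "l \<noteq> c" "l \<notin> supc c" for l
  proof -
    have ly: "last l \<in> tsp X" by (rule chs_last[OF F P l(1)])
    have e: "k - dg l + 1 = m - dg l" by (simp add: m_def)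
    interpret G: comm_group "stk F (m - dg l) (last l)" by (rule acD(1)[OF F ly])
    have "dl (stk F (k - dg l + 1) (last l)) (rsx F (k - dg l + 1) (last l) (io F k c w)) l =
        dl (stk F (k - dg l + 1) (last l)) (%c'. 1[stk F (k - dg l + 1) (last l)]) l"
      by (rule dl_cong, rule rs1[OF l(1)]) (use l in "auto simp: supc_def")
    moreover have "io F k c w l = 1[stk F (k - dg l) (last l)]" using l by (simp add: io_def)
    ultimately show ?thesis using l(1) dif_one[OF F ly, of "k - dg l"] by (simp add: TS_def TD_def e)
  qed
  have io1: "ph m () (io F m l 1[stk F (m - dg l) (last l)]) = 1[H]" if l: "l \<in> chs X P" for l
  proof -
    have "io F m l 1[stk F (m - dg l) (last l)] = 1[TG X F P m]" by (auto simp: io_def fun_eq_iff)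
    then show ?thesis using hom_one[OF phh] comm_group_TG[OF F P, of m] H.is_group by (simp add: comm_group_def del: TG_one)
  qed
  have phio: "(%u. ph m () (io F m l u)) \<in> hom (stk F (m - dg l) (last l)) H" for l using hom_compose[OF io_hom[OF F, of m l] phh] by (simp add: comp_def)
  have tcl: "?t l \<in> stc F (m - dg l) (last l)" if "l \<in> chs X P" for l using t that unfolding TG_carrier by blast
  have pht: "ph m () (io F m l (?t l)) \<in> carrier H" if "l \<in> chs X P" for l by (rule hom_in_carrier[OF phio tcl[OF that]])
  have "ph m () ?t = finprod H (%l. ph m () (io F m l (?t l))) (chs X P)" by (rule io_decompose[OF phh H.comm_group_axioms t])
  also have "\<dots> = finprod H (%l. ph m () (io F m l (?t l))) (insert c (supc c))"
  proof (rule H.finprod_mono_neutral[symmetric, OF finite_chsP])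
    show "insert c (supc c) \<subseteq> chs X P" using cP by (auto simp: supc_def)
    fix l assume "l \<in> chs X P - insert c (supc c)"
    then show "ph m () (io F m l (?t l)) = 1[H]" using t1 io1 by simp
  qed (use pht cP in "auto simp: supc_def")
  also have "\<dots> = ph m () (io F m c (?t c)) *[H] finprod H (%l. ph m () (io F m l (?t l))) (supc c)"
    by (rule H.finprod_insert[OF finite_supc]) (use pht cP in "auto simp: supc_def faces_def")
  also have "finprod H (%l. ph m () (io F m l (?t l))) (supc c) = sg H k (UB H ?Ps c)"
  proof -
    have e2: "ph m () (io F m l (?t l)) = sg H k (dl H (pt H c (?Ps l)) l)" and e3: "?Ps l \<in> carrier H" if l: "l \<in> supc c" for l
    proof -
      interpret G: comm_group "stk F n (last l)" by (rule acD(1)[OF F sup(5)[OF l]])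
      note hl = phio[of l, unfolded sup(3)[OF l]]
      have Psl: "?Ps l = ph m () (io F m l (res (trm F n) y (last l) w))" using q v supc_UI[OF c l] acD(5)[OF F qy sup(4)[OF l] v]
        by (simp add: Psi_def w_def sup(7)[OF l])
      have "ph m () (io F m l (?t l)) = sg H k (ph m () (io F m l (e l)))" unfolding ts[OF l] by (rule G.sg_hom[OF hl H.is_group ecl[OF l]])
      also have "ph m () (io F m l (e l)) = dl H (pt H c (?Ps l)) l" unfolding e_def Psl by (rule G.hom_dl_pt[OF hl H.is_group rw[OF l]])
      finally show "ph m () (io F m l (?t l)) = sg H k (dl H (pt H c (?Ps l)) l)" .
      show "?Ps l \<in> carrier H" unfolding Psl by (rule hom_in_carrier[OF hl rw[OF l]])
    qed
    have "finprod H (%l. ph m () (io F m l (?t l))) (supc c) = finprod H (%l. sg H k (dl H (pt H c (?Ps l)) l)) (supc c)"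
      by (rule H.finprod_cong') (auto simp: e2 e3 H.dl_pt_closed)
    also have "\<dots> = sg H k (UB H ?Ps c)" unfolding UB_def by (rule H.finprod_sg) (simp add: e3 H.dl_pt_closed)
    finally show ?thesis .
  qed
  finally have D: "ph m () ?t = ph m () (io F m c (dif F n y w)) *[H] sg H k (UB H ?Ps c)" unfolding tc .
  have UBc: "UB H ?Ps c \<in> carrier H"
  proof (rule UB_closed[OF H.comm_group_axioms])
    fix l assume l: "l \<in> supc c"
    have "?Ps l = ph m () (io F m l (res (trm F n) q (last l) v))" using q v supc_UI[OF c l] by (simp add: Psi_def sup(7)[OF l])
    moreover have "res (trm F n) q (last l) v \<in> stc F (m - dg l) (last l)" unfolding sup(3)[OF l] by (rule res_cl[OF F pt_le_trans[OF qy sup(4)[OF l]] v])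
    ultimately show "?Ps l \<in> carrier H" using hom_in_carrier[OF phio] by simp
  qed
  have phdw: "ph m () (io F m c (dif F n y w)) \<in> carrier H" using pht[OF cP] by (simp add: tc)
  have dk: "dif M k () (?Ps c) \<in> carrier H" using dif_cl[OF M, of "()" "?Ps c" k] hom_in_carrier[OF ph ioc] by (simp add: Psc H_def i)
  have UD: "UD M n ?Ps c = dif M k () (?Ps c) *[H] inv[H] sg H k (UB H ?Ps c)" by (simp add: UD_def i H_def)
  have dv: "res (trm F (n + 1)) q y (dif F n q v) = dif F n y w" unfolding w_def by (rule acD(8)[OF F qy v, symmetric])
  have "UD M n ?Ps c = ph m () (io F m c (dif F n y w)) \<longleftrightarrow> dif M k () (?Ps c) = ph m () ?t"
    unfolding D UD H.inv_solve_right[OF phdw dk H.sg_closed[OF UBc], symmetric] by (rule eq_commute)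
  then show ?thesis unfolding Psc by (simp only: i y_def[symmetric] w_def[symmetric] dv)
qed

lemma Psi_cmap: assumes ph: "cmap point (Tc F) M ph" shows "cmap X F (Uc M) (Psi F ph)"
proof (rule cmapI)
  have h: "ph k () \<in> hom (TG X F P k) (stk M k ())" for k using cmapD(2)[OF ph, of "()" k] by simp
  have rc: "io F (n + dg c) c (res (trm F n) q (last c) v) \<in> carrier (TG X F P (n + dg c))" if "c \<in> UI q" "v \<in> stc F n q" for n q c v
    using res_cl[OF F UI_chs(2)[OF that(1)] that(2)] by (intro io_closed[OF F]) simp
  have cl: "Psi F ph n q v \<in> carrier (UG M q n)" if "q \<in> tsp X" "v \<in> stc F n q" for n q v using that rc cmapD(3)[OF ph] by (simp add: UG_carrier Psi_def)
  fix n :: int and p q and s t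
  show "Psi F ph n p s \<in> stc (Uc M) n p" if "p \<in> tsp X" "s \<in> stc F n p" using cl[OF that] by simp
  show "Psi F ph n p (s *[stk F n p] t) = Psi F ph n p s *[stk (Uc M) n p] Psi F ph n p t" if st: "p \<in> tsp X" "s \<in> stc F n p" "t \<in> stc F n p"
  proof -
    have "ph (n + dg c) () (io F (n + dg c) c (res (trm F n) p (last c) (s *[stk F n p] t))) =
      ph (n + dg c) () (io F (n + dg c) c (res (trm F n) p (last c) s)) *[stk M (n + dg c) ()]
      ph (n + dg c) () (io F (n + dg c) c (res (trm F n) p (last c) t))" if c: "c \<in> UI p" for c
    proof -
      note le = UI_chs(2)[OF c]
      have "io F (n + dg c) c (res (trm F n) p (last c) (s *[stk F n p] t)) =
         io F (n + dg c) c (res (trm F n) p (last c) s) *[TG X F P (n + dg c)] io F (n + dg c) c (res (trm F n) p (last c) t)"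
        using hom_mult[OF io_hom[OF F, of "n + dg c" c]] st le by (simp add: res_mult[OF F] res_cl[OF F] del: TG_mult)
      then show ?thesis using cmapD(4)[OF ph, of "()" "io F (n + dg c) c (res (trm F n) p (last c) s)" "n + dg c"] rc[OF c] st by (simp del: TG_mult)
    qed
    then show ?thesis using st by (auto simp: Psi_def fun_eq_iff mult_cl[OF F])
  qed
  show "Psi F ph n q (res (trm F n) p q s) = res (trm (Uc M) n) p q (Psi F ph n p s)" if pq: "pt_le X p q" and s: "s \<in> stc F n p"
    using UI_mono[OF pq] pt_leD[OF pq] s acD(5)[OF F pq UI_chs(2) s] res_cl[OF F pq s] by (auto simp: Psi_def fun_eq_iff)
  show "Psi F ph (n + 1) p (dif F n p s) = dif (Uc M) n p (Psi F ph n p s)" if ps: "p \<in> tsp X" "s \<in> stc F n p"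
  proof -
    have e: "n + 1 + dg c = n + dg c + 1" for c :: "'x list" by simp
    have UD: "UD M n (Psi F ph n p s) c = ph (n + dg c + 1) () (io F (n + dg c + 1) c (res (trm F (n + 1)) p (last c) (dif F n p s)))" if c: "c \<in> UI p" for c
      unfolding Psi_UD[where ph = ph, OF h ps c] using cmapD(6)[OF ph, of "()" _ "n + dg c"] rc[OF c ps(2)] by simp
    have "Psi F ph (n + 1) p (dif F n p s) = US M p n (Psi F ph n p s)" unfolding US_def using UD ps dif_cl[OF F ps] by (auto simp: Psi_def e fun_eq_iff)
    then show ?thesis using ps cl by simp
  qed
qed (simp_all add: Psi_def)

text \<open>Of the product in \<open>Theta\<close> only the factor at \<open>c\<close> is
  nontrivial. There \<open>g\<close> is evaluated at the last point of \<open>c\<close>, and its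
  compatibility with restriction leads back to \<open>q\<close>.\<close>

lemma Theta_io: assumes g: "cmap X F (Uc M) g" and q: "q \<in> tsp X" and v: "v \<in> stc F n q" and c: "c \<in> UI q"
  shows "Theta F M g (n + dg c) () (io F (n + dg c) c (res (trm F n) q (last c) v)) = g n q v c"
proof -
  define k where "k = n + dg c"
  let ?w = "res (trm F n) q (last c) v"
  note cP = UI_chs(1)[OF c] and le = UI_chs(2)[OF c]
  have k: "k - dg c = n" by (simp add: k_def)
  interpret H: comm_group "stk M k ()" by (rule stkM(1)[OF M])
  have w: "?w \<in> stc F (k - dg c) (last c)" unfolding k by (rule res_cl[OF F le v])
  have gvc: "g n q v c \<in> stc M k ()" using cmapD(3)[OF g q v] c unfolding Uc_simps UG_carrier k_def by blast
  have "Theta F M g k () (io F k c ?w) = finprod (stk M k ()) (%l. g (k - dg l) (last l) (io F k c ?w l) l) (chs X P)" using io_closed[OF F w] by (simp add: Theta_def)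
  also have "\<dots> = finprod (stk M k ()) (%l. if c = l then g n q v c else 1[stk M k ()]) (chs X P)"
  proof (rule H.finprod_cong')
    fix l assume l: "l \<in> chs X P"
    show "g (k - dg l) (last l) (io F k c ?w l) l = (if c = l then g n q v c else 1[stk M k ()])"
    proof (cases "c = l")
      case True
      have "g n (last c) ?w = restrict (g n q v) (UI (last c))" using cmapD(5)[OF g le v] by simp
      then show ?thesis unfolding True[symmetric] using cP chs_UI_last[OF cP] by (simp add: io_def k)
    next
      case False
      have "g (k - dg l) (last l) 1[stk F (k - dg l) (last l)] = 1[UG M (last l) (k - dg l)]" using cmap_one[OF g F Uc_acomplex[OF M] chs_last[OF F P l]] by simp
      then show ?thesis using False l chs_UI_last[OF l] by (auto simp: io_def)
    qed
  qed (use gvc in auto)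
  also have "\<dots> = g n q v c" using H.finprod_singleton[of c "chs X P" "%l. g n q v c"] cP finite_chsP gvc by simp
  finally show ?thesis unfolding k_def .
qed

text \<open>By additivity it is enough to compare the differentials on cochains concentrated at one
  chain. For these \<open>Psi_UD\<close> reduces the claim to the chain map property of
  \<open>g\<close>.\<close>

lemma Theta_cmap: assumes g: "cmap X F (Uc M) g" shows "cmap point (Tc F) M (Theta F M g)"
proof (rule cmapI)
  have gcl: "g (n - dg l) (last l) (s l) c \<in> stc M (n - dg l + dg c) ()" if "s \<in> carrier (TG X F P n)" "l \<in> chs X P" "c \<in> UI (last l)" for n s c l
  proof -
    have "s l \<in> stc F (n - dg l) (last l)" using that unfolding TG_carrier by blast
    then have "g (n - dg l) (last l) (s l) \<in> carrier (UG M (last l) (n - dg l))" using cmapD(3)[OF g chs_last[OF F P that(2)]] by simp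
    then show ?thesis using that(3) unfolding UG_carrier by blast
  qed
  have gcc: "g (n - dg c) (last c) (s c) c \<in> stc M n ()" if "s \<in> carrier (TG X F P n)" "c \<in> chs X P" for n s c
    using gcl[OF that chs_UI_last[OF that(2)]] by simp
  have closed: "Theta F M g n () s \<in> stc M n ()" if "s \<in> carrier (TG X F P n)" for n s
  proof -
    interpret H: comm_group "stk M n ()" by (rule stkM(1)[OF M])
    show ?thesis using that gcc by (auto simp: Theta_def intro!: H.finprod_closed)
  qed
  have mult: "Theta F M g n () (s *[TG X F P n] t) = Theta F M g n () s *[stk M n ()] Theta F M g n () t"
    if st: "s \<in> carrier (TG X F P n)" "t \<in> carrier (TG X F P n)" for n s t
  proof -
    interpret H: comm_group "stk M n ()" by (rule stkM(1)[OF M])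
    have stc: "s *[TG X F P n] t \<in> carrier (TG X F P n)"
      using comm_group_TG[OF F P, of n] st by (simp add: comm_group_def group.is_monoid monoid.m_closed del: TG_mult)
    have "finprod (stk M n ()) (%c. g (n - dg c) (last c) ((s *[TG X F P n] t) c) c) (chs X P) =
        finprod (stk M n ()) (%c. g (n - dg c) (last c) (s c) c *[stk M n ()] g (n - dg c) (last c) (t c) c) (chs X P)"
    proof (rule H.finprod_cong')
      fix c assume c: "c \<in> chs X P"
      have "s c \<in> stc F (n - dg c) (last c)" "t c \<in> stc F (n - dg c) (last c)" using st c unfolding TG_carrier by blast+
      then have "g (n - dg c) (last c) (s c *[stk F (n - dg c) (last c)] t c) c =
          g (n - dg c) (last c) (s c) c *[stk M (n - dg c + dg c) ()] g (n - dg c) (last c) (t c) c"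
        using cmapD(4)[OF g chs_last[OF F P c]] chs_UI_last[OF c] by simp
      then show "g (n - dg c) (last c) ((s *[TG X F P n] t) c) c = g (n - dg c) (last c) (s c) c *[stk M n ()] g (n - dg c) (last c) (t c) c" using c by simp
    qed (use gcc st in auto)
    also have "\<dots> = finprod (stk M n ()) (%c. g (n - dg c) (last c) (s c) c) (chs X P) *[stk M n ()]
        finprod (stk M n ()) (%c. g (n - dg c) (last c) (t c) c) (chs X P)"
      by (rule H.finprod_multf) (use gcc st in auto)
    finally show ?thesis using st stc by (simp add: Theta_def del: TG_mult)
  qed
  fix n :: int and p q :: unit and s t
  show "Theta F M g n p s \<in> stc M n p" if "s \<in> stc (Tc F) n p" using that closed by simp
  show "Theta F M g n p (s *[stk (Tc F) n p] t) = Theta F M g n p s *[stk M n p] Theta F M g n p t" if "s \<in> stc (Tc F) n p" "t \<in> stc (Tc F) n p"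
    using that mult by (simp del: TG_mult)
  show "Theta F M g n q (res (trm (Tc F) n) p q s) = res (trm M n) p q (Theta F M g n p s)" if "s \<in> stc (Tc F) n p"
    using that closed acD(4)[OF M, of "()" _ n] by simp
  have h: "Theta F M g k () \<in> hom (TG X F P k) (stk M k ())" for k using closed mult by (simp add: hom_def del: TG_mult)
  show "Theta F M g (n + 1) p (dif (Tc F) n p s) = dif M n p (Theta F M g n p s)" if "s \<in> stc (Tc F) n p"
  proof -
    let ?th = "Theta F M g" and ?H = "stk M (n + 1) ()"
    have s: "s \<in> carrier (TG X F P n)" using that by simp
    interpret H: comm_group ?H by (rule stkM(1)[OF M])
    have 1: "(%t. ?th (n + 1) () (TS X F P n t)) \<in> hom (TG X F P n) ?H" using hom_compose[OF TS_hom[OF F P] h] by (simp add: comp_def)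
    have 2: "(%t. dif M n () (?th n () t)) \<in> hom (TG X F P n) ?H" using hom_compose[OF h acD(7)[OF M]] by (simp add: comp_def)
    \<comment> \<open>On such cochains \<open>Psi\<close> of \<open>Theta\<close> is already known
      to give back \<open>g\<close>, by \<open>Theta_io\<close>; so \<open>Psi_UD\<close> is applied
      before \<open>Theta\<close> is known to be a chain map.\<close>
    have gen: "?th (n + 1) () (TS X F P n (io F n c v)) = dif M n () (?th n () (io F n c v))" if c: "c \<in> chs X P" and v: "v \<in> stc F (n - dg c) (last c)" for c v
    proof -
      note y = chs_last[OF F P c] and u = chs_UI_last[OF c]
      define k where "k = n - dg c"
      then have k: "k + dg c = n" "n - dg c = k" "k + 1 + dg c = n + 1" by simp_all
      note v' = v[unfolded k]
      note io = Theta_io[OF g y v' u, unfolded k] Theta_io[OF g y dif_cl[OF F y v'] u, unfolded k]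
      have "Psi F ?th k (last c) v = g k (last c) v" using Theta_io[OF g y v'] cmapD(3)[OF g y v'] y v' by (auto simp: Psi_def UG_carrier fun_eq_iff extensional_def)
      moreover have "UD M k (g k (last c) v) c = g (k + 1) (last c) (dif F k (last c) v) c" using cmapD(6)[OF g y v'] cmapD(3)[OF g y v'] y u by (simp add: US_def)
      ultimately show ?thesis using Psi_UD[where ph = ?th, OF h y v' u, unfolded k] io acD(4)[OF F y v'] by simp
    qed
    have "?th (n + 1) () (TS X F P n s) = dif M n () (?th n () s)" unfolding io_decompose[OF 1 H.comm_group_axioms s] io_decompose[OF 2 H.comm_group_axioms s]
    proof (rule H.finprod_cong')
      fix c assume c: "c \<in> chs X P"
      then have sc: "s c \<in> stc F (n - dg c) (last c)" using s unfolding TG_carrier by blast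
      show "?th (n + 1) () (TS X F P n (io F n c (s c))) = dif M n () (?th n () (io F n c (s c)))" by (rule gen[OF c sc])
    qed (use s io_closed[OF F] hom_in_carrier[OF 2] in "auto simp: TG_carrier")
    then show ?thesis using s by simp
  qed
qed (simp_all add: Theta_def)

lemma Theta_Psi: assumes ph: "cmap point (Tc F) M ph" shows "Theta F M (Psi F ph) = ph"
proof (rule cmap_eqI[OF Theta_cmap[OF Psi_cmap[OF ph]] ph])
  fix n :: int and p :: unit and s assume "s \<in> stc (Tc F) n p"
  then have s: "s \<in> carrier (TG X F P n)" by simp
  interpret H: comm_group "stk M n ()" by (rule stkM(1)[OF M])
  have sc: "s c \<in> stc F (n - dg c) (last c)" if "c \<in> chs X P" for c using s that unfolding TG_carrier by blast
  have "Theta F M (Psi F ph) n p s = finprod (stk M n ()) (%c. ph n () (io F n c (s c))) (chs X P)" using s unfolding Theta_def by (simp, intro H.finprod_cong')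
      (use sc io_closed[OF F sc] cmapD(3)[OF ph] chs_last[OF F P] chs_UI_last in \<open>auto simp: Psi_def acD(4)[OF F]\<close>)
  also have "\<dots> = ph n () s" by (rule io_decompose[OF _ stkM(1)[OF M] s, symmetric]) (use cmapD(2)[OF ph, of "()" n] in simp)
  finally show "Theta F M (Psi F ph) n p s = ph n p s" by simp
qed

lemma Psi_Theta: assumes g: "cmap X F (Uc M) g" shows "Psi F (Theta F M g) = g"
proof (rule cmap_eqI[OF Psi_cmap[OF Theta_cmap[OF g]] g])
  fix n q v assume q: "q \<in> tsp X" and v: "v \<in> stc F n q"
  have gv: "g n q v \<in> carrier (UG M q n)" using cmapD(3)[OF g q v] by simp
  note Theta_io[OF g q v]
  then show "Psi F (Theta F M g) n q v = g n q v" using q v gv by (auto simp: Psi_def UG_carrier fun_eq_iff extensional_def)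
qed

end

lemma Psi_cc_left: assumes F: "F \<in> acs X" and M: "M \<in> acs point" and N: "N \<in> acs point" and ph: "cmap point (Tc F) M ph" and h: "cmap point M N h"
  shows "Psi F (cc point (Tc F) h ph) = cc X F (Um M h) (Psi F ph)"
proof (rule cmap_eqI[OF Psi_cmap[OF F N cmap_cc[OF Tc_acomplex[OF F] ph h]] cmap_cc[OF F Psi_cmap[OF F M ph] Um_cmap[OF M N h]]])
  fix n q v assume q: "q \<in> tsp X" and v: "v \<in> stc F n q"
  have "io F (n + dg c) c (res (trm F n) q (last c) v) \<in> carrier (TG X F P (n + dg c))" if "c \<in> UI q" for c
    using res_cl[OF F UI_chs(2)[OF that] v] by (intro io_closed[OF F]) simp
  then show "Psi F (cc point (Tc F) h ph) n q v = cc X F (Um M h) (Psi F ph) n q v"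
    using q v cmapD(3)[OF Psi_cmap[OF F M ph] q v] by (auto simp: Um_def Psi_def fun_eq_iff)
qed

lemma Psi_cc_right: assumes F: "F \<in> acs X" and G: "G \<in> acs X" and M: "M \<in> acs point" and f: "cmap X F G f" and ph: "cmap point (Tc G) M ph"
  shows "Psi F (cc point (Tc F) ph (Tm F f)) = cc X F (Psi G ph) f"
proof (rule cmap_eqI[OF Psi_cmap[OF F M cmap_cc[OF Tc_acomplex[OF F] Tm_cmap[OF F G f] ph]] cmap_cc[OF F f Psi_cmap[OF G M ph]]])
  fix n q v assume q: "q \<in> tsp X" and v: "v \<in> stc F n q"
  have io: "io F (n + dg c) c (res (trm F n) q (last c) v) \<in> carrier (TG X F P (n + dg c))" if "c \<in> UI q" for c
    using res_cl[OF F UI_chs(2)[OF that] v] by (intro io_closed[OF F]) simp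
  have "TM X P f (n + dg c) (io F (n + dg c) c (res (trm F n) q (last c) v)) = io G (n + dg c) c (res (trm G n) q (last c) (f n q v))" if c: "c \<in> UI q" for c
    using cmapD(5)[OF f UI_chs(2)[OF c] v] cmap_one[OF f F G chs_last[OF F P]] by (auto simp: TM_def io_def fun_eq_iff)
  then show "Psi F (cc point (Tc F) ph (Tm F f)) n q v = cc X F (Psi G ph) f n q v" using q v io cmapD(3)[OF f q v] by (auto simp: Psi_def Tm_def intro!: restrict_ext)
qed

end

section \<open>Change of universe\<close>

text \<open>A bound on the size of each stalk separately. The injections need not respect any
  structure, since structure is transported along them afterwards. The argument \<open>t\<close>
  only names the universe.\<close>

definition fits :: "'x topology => ('x, 'w) acomplex => 't itself => bool" where
  "fits X F t \<longleftrightarrow> (\<forall>i. \<forall>p\<in>tsp X. \<exists>e :: 'w => 't. inj_on e (stc F i p))"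

definition ee :: "('x, 'w) acomplex => int => 'x => 'w => 't" where "ee F i p = (SOME e. inj_on e (stc F i p))"

definition ed :: "('x, 'w) acomplex => int => 'x => 't => 'w" where "ed F i p = inv_into (stc F i p) (ee F i p)"

text \<open>Transport of structure along the chosen injections: \<open>em\<close> and
  \<open>dm\<close> below become mutually inverse maps of complexes between the two
  universes.\<close>

definition enc :: "'x topology => ('x, 'w) acomplex => ('x, 't) acomplex" where "enc X F = \<lparr>trm = (%i. \<lparr>stalk = (%p. \<lparr>carrier = ee F i p ` stc F i p,
        monoid.mult = (%s t. ee F i p (ed F i p s *[stk F i p] ed F i p t)), one = ee F i p 1[stk F i p]\<rparr>),
      res = (%p q s. ee F i q (res (trm F i) p q (ed F i p s)))\<rparr>),
    dif = (%i. \<lambda>p\<in>tsp X. \<lambda>s\<in>ee F i p ` stc F i p. ee F (i + 1) p (dif F i p (ed F i p s)))\<rparr>"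

definition em :: "'x topology => ('x, 'w) acomplex => int => 'x => 'w => 't" where "em X F i = (\<lambda>p\<in>tsp X. \<lambda>s\<in>stc F i p. ee F i p s)"

definition dm :: "'x topology => ('x, 'w) acomplex => int => 'x => 't => 'w" where "dm X F i = (\<lambda>p\<in>tsp X. \<lambda>s\<in>ee F i p ` stc F i p. ed F i p s)"

context
  fixes X :: "'x topology" and F :: "('x, 'w) acomplex" and t :: "'t itself"
  assumes F: "F \<in> acs X" and fits: "fits X F t"
begin

abbreviation (input) E :: "('x, 't) acomplex" where "E \<equiv> enc X F"

lemma inj_ee: "p \<in> tsp X ==> inj_on (ee F i p :: 'w => 't) (stc F i p)" using fits unfolding fits_def ee_def by (metis someI_ex)

lemma ed_ee: "p \<in> tsp X ==> s \<in> stc F i p ==> ed F i p (ee F i p s :: 't) = s" unfolding ed_def by (rule inv_into_f_f[OF inj_ee])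

lemma enc_simps: "stc E i p = ee F i p ` stc F i p" "1[stk E i p] = ee F i p 1[stk F i p]" "p \<in> tsp X ==> u \<in> stc F i p ==> v \<in> stc F i p ==>
     ee F i p u *[stk E i p] ee F i p v = ee F i p (u *[stk F i p] v)"
  "p \<in> tsp X ==> u \<in> stc F i p ==> res (trm E i) p q (ee F i p u) = ee F i q (res (trm F i) p q u)"
  "p \<in> tsp X ==> u \<in> stc F i p ==> dif E i p (ee F i p u) = ee F (i + 1) p (dif F i p u)"
  by (auto simp: enc_def ed_ee)

lemma enc_iso: "p \<in> tsp X ==> ee F i p \<in> iso (stk F i p) (stk E i p)" using inj_ee by (auto simp: iso_def hom_def bij_betw_def enc_simps)

lemmas cl = ac_closed[OF F]

lemma enc_acomplex: "E \<in> acs X"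
proof (rule acomplexesI)
  fix i p q r s assume p: "p \<in> tsp X"
  show "comm_group (stk E i p)"
  proof -
    interpret comm_group "stk F i p" by (rule acD(1)[OF F p])
    have "comm_group ((stk E i p)\<lparr>one := ee F i p 1[stk F i p]\<rparr>)" by (rule iso_imp_img_comm_group[OF enc_iso[OF p]])
    then show ?thesis by (simp add: enc_def)
  qed
next
  fix i p q r s assume le: "pt_le X p q" "pt_le X q r" and s: "s \<in> stc E i p"
  then show "res (trm E i) q r (res (trm E i) p q s) = res (trm E i) p r s" using acD(5)[OF F le] pt_leD[OF le(1)] by (auto simp: enc_simps cl)
next
  fix i p q assume le: "pt_le X p q"
  show "res (trm E i) p q \<in> hom (stk E i p) (stk E i q)" using pt_leD[OF le] hom_mult[OF acD(3)[OF F le]] le by (auto simp: hom_def enc_simps cl)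
next
  fix i p assume p: "p \<in> tsp X"
  show "dif E i p \<in> hom (stk E i p) (stk E (i + 1) p)" using p hom_mult[OF acD(7)[OF F p]] by (auto simp: hom_def enc_simps cl)
  show "dif E i p \<in> extensional (stc E i p)" using p by (simp add: enc_def)
next
  fix i p s assume p: "p \<in> tsp X" and s: "s \<in> stc E i p"
  define j where "j = i + 1"
  then have j: "j + 1 = i + 2" "i + 1 = j" by simp_all
  show "dif E (i + 1) p (dif E i p s) = 1[stk E (i + 2) p]" using s p acD(9)[OF F p, of _ i] cl(2)[OF p, of _ i] unfolding j by (auto simp: enc_simps j)
qed (auto simp: enc_simps cl acD[OF F] pt_leD, simp add: enc_def)

lemma dm_ee: "p \<in> tsp X ==> s \<in> stc F i p ==> dm X F i p (ee F i p s :: 't) = s" by (simp add: dm_def ed_ee)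

lemma em_cmap: "cmap X F E (em X F)" by (rule cmapI) (auto simp: em_def enc_simps cl pt_leD)

lemma dm_cmap: "cmap X E F (dm X F)" by (rule cmapI) (auto simp: dm_ee enc_simps cl pt_leD, auto simp: dm_def enc_simps)

lemma dm_em: "cc X F (dm X F) (em X F :: int => 'x => 'w => 't) = ci X F"
  by (rule cmap_eqI[OF cmap_cc[OF F em_cmap dm_cmap] cmap_ci[OF F]]) (simp add: em_def dm_def ed_ee)

lemma em_dm: "cc X E (em X F) (dm X F) = ci X E" by (rule cmap_eqI[OF cmap_cc[OF enc_acomplex dm_cmap em_cmap] cmap_ci[OF enc_acomplex]])
    (auto simp: em_def dm_def ed_ee enc_simps)

lemma em_crit: "p \<in> tsp X ==> crit F E (em X F) p" by (rule crit_bij[OF F enc_acomplex em_cmap])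
    (auto simp: em_def bij_betw_def enc_simps inj_on_def dest: inj_ee[THEN inj_onD])

lemma dm_crit: "p \<in> tsp X ==> crit E F (dm X F) p" by (rule crit_bij[OF enc_acomplex F dm_cmap]) (auto simp: dm_def bij_betw_def enc_simps inj_on_def ed_ee image_iff)

lemma fits_enc: "fits X F u ==> fits X E u" for u :: "'s itself" unfolding fits_def
proof (intro allI ballI)
  fix i p assume *: "\<forall>i. \<forall>p\<in>tsp X. \<exists>e :: 'w => 's. inj_on e (stc F i p)" and p: "p \<in> tsp X"
  then obtain e :: "'w => 's" where e: "inj_on e (stc F i p)" by blast
  have "inj_on (e \<circ> ed F i p) (stc E i p)" using e p by (auto simp: inj_on_def enc_simps ed_ee)
  then show "\<exists>e :: 't => 's. inj_on e (stc E i p)" by blast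
qed

end

text \<open>Turns a construction \<open>K\<close>, \<open>Km\<close> with values in an unwanted
  universe into a functor with values in the wanted one, by conjugation with \<open>em\<close> and
  \<open>dm\<close>.\<close>

definition ef :: "'y topology => ('o => ('y, 'w) acomplex) => ('o => 'o => 'm => ('y, 'w) amap) => ('o, 'm, ('y, 't) acomplex, ('y, 't) amap) ftor" where
  "ef Y K Km = \<lparr>onObj = (%a. enc Y (K a)), onHom = (%a b f. cc Y (enc Y (K a)) (em Y (K b)) (cc Y (enc Y (K a)) (Km a b f) (dm Y (K a))))\<rparr>"

lemma ef_simps: "ob (ef Y K Km) a = enc Y (K a)" "hm (ef Y K Km) a b f = cc Y (enc Y (K a)) (em Y (K b)) (cc Y (enc Y (K a)) (Km a b f) (dm Y (K a)))"
  by (simp_all add: ef_def)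

lemma cc_cancel: assumes A: "A \<in> acs Y" and B: "B \<in> acs Y" and C: "C \<in> acs Y"
    and f: "cmap Y A B f" and g: "cmap Y B C g" and g': "cmap Y C B g'" and inv: "cc Y B g' g = ci Y B"
  shows "cc Y A g' (cc Y A g f) = f"
  unfolding cc_assoc[OF A B f g g', symmetric] inv by (rule cc_ci(2)[OF A f B])

context
  fixes C :: "('o, 'm) cat" and Y :: "'y topology" and K :: "'o => ('y, 'w) acomplex" and Km and t :: "'t itself"
  assumes C: "is_category C" and K: "\<And>a. a \<in> Obj C ==> K a \<in> acs Y" "\<And>a. a \<in> Obj C ==> fits Y (K a) t"
    and Km: "\<And>a b f. a \<in> Obj C ==> b \<in> Obj C ==> f \<in> Hom C a b ==> cmap Y (K a) (K b) (Km a b f)"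
begin

abbreviation (input) T :: "('o, 'm, ('y, 't) acomplex, ('y, 't) amap) ftor" where "T \<equiv> ef Y K Km"

lemma ef_cmap: "a \<in> Obj C ==> b \<in> Obj C ==> f \<in> Hom C a b ==> cmap Y (ob T a) (ob T b) (hm T a b f)"
  unfolding ef_simps by (intro cmap_cc[OF _ cmap_cc]) (auto intro: enc_acomplex K Km em_cmap dm_cmap)

lemma ef_crit: assumes ab: "a \<in> Obj C" "b \<in> Obj C" and f: "f \<in> Hom C a b" and crit: "crit (K a) (K b) (Km a b f) p" and p: "p \<in> tsp Y"
  shows "crit (ob T a) (ob T b) (hm T a b f) p"
proof -
  note a = K[OF ab(1)] and b = K[OF ab(2)]
  note c = cmap_cc[OF enc_acomplex[OF a] dm_cmap[OF a] Km[OF ab f]]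
  have "crit (enc Y (K a) :: ('y, 't) acomplex) (K b) (cc Y (enc Y (K a)) (Km a b f) (dm Y (K a))) p"
    by (rule crit_cc[OF enc_acomplex[OF a] a(1) b(1) dm_cmap[OF a] Km[OF ab f] p dm_crit[OF a p] crit])
  then show ?thesis unfolding ef_simps by (rule crit_cc[OF enc_acomplex[OF a] b(1) enc_acomplex[OF b] c em_cmap[OF b] p _ em_crit[OF b p]])
qed

text \<open>Naturality of \<open>em\<close>. As \<open>em\<close> joins different universes, it is
  not a morphism of one category; composed with an arbitrary \<open>al\<close> the equation takes
  the form in which it is used.\<close>

lemma ef_pre: assumes ab: "a \<in> Obj C" "b \<in> Obj C" and f: "f \<in> Hom C a b" and L: "L \<in> acs Y" and al: "cmap Y L (K a) al"
  shows "cc Y L (hm T a b f) (cc Y L (em Y (K a)) al) = cc Y L (em Y (K b)) (cc Y L (Km a b f) al)"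
proof -
  note a = K[OF ab(1)] and b = K[OF ab(2)]
  note ac = enc_acomplex[OF a] and eal = cmap_cc[OF L al em_cmap[OF a]]
  show ?thesis unfolding ef_simps cc_assoc[OF L ac eal cmap_cc[OF ac dm_cmap[OF a] Km[OF ab f]] em_cmap[OF b]] cc_assoc[OF L ac eal dm_cmap[OF a] Km[OF ab f]]
      cc_cancel[OF L a(1) ac al em_cmap[OF a] dm_cmap[OF a] dm_em[OF a]] ..
qed

lemma is_functor_ef: assumes Km_id: "\<And>a. a \<in> Obj C ==> Km a a (Idt C a) = ci Y (K a)"
    and Km_comp: "\<And>a b c f g. a \<in> Obj C ==> b \<in> Obj C ==> c \<in> Obj C ==> f \<in> Hom C a b ==> g \<in> Hom C b c ==>
      Km a c (Comp C a b c g f) = cc Y (K a) (Km b c g) (Km a b f)"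
  shows "is_functor C (Ch Y) T"
  unfolding is_functor_def
proof (intro conjI ballI)
  fix a assume a: "a \<in> Obj C"
  note k = K[OF a]
  show "hm T a a (Idt C a) = Idt (Ch Y) (ob T a)" unfolding ef_simps by (simp add: Km_id[OF a] cc_ci(2)[OF enc_acomplex[OF k] dm_cmap[OF k] k(1)] em_dm[OF k])
  show "ob T a \<in> Obj (Ch Y)" by (simp add: ef_simps enc_acomplex[OF k])
next
  fix a b f assume "a \<in> Obj C" "b \<in> Obj C" "f \<in> Hom C a b"
  then show "hm T a b f \<in> Hom (Ch Y) (ob T a) (ob T b)" using ef_cmap by (simp add: chain_maps_iff)
next
  fix a b c f g assume o: "a \<in> Obj C" "b \<in> Obj C" "c \<in> Obj C" and f: "f \<in> Hom C a b" and g: "g \<in> Hom C b c"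
  note a = K[OF o(1)] and b = K[OF o(2)] and c = K[OF o(3)]
  note F = Km[OF o(1,2) f] and G = Km[OF o(2,3) g]
  note ac = enc_acomplex[OF a]
  show "hm T a c (Comp C a b c g f) = Comp (Ch Y) (ob T a) (ob T b) (ob T c) (hm T b c g) (hm T a b f)" using ef_pre[OF o(2,3) g ac cmap_cc[OF ac dm_cmap[OF a] F]]
    by (simp add: ef_simps(1) ef_simps(2)[where a = a] Km_comp[OF o f g] cc_assoc[OF ac a(1) dm_cmap[OF a] F G])
qed

end

subsection \<open>Cardinality\<close>

lemma inj_prod: assumes "infinite (UNIV :: 'u set)" obtains h :: "'u \<times> 'u => 'u" where "inj h"
proof -
  show thesis using that card_of_ordLeq[THEN iffD2, OF ordIso_imp_ordLeq[OF card_of_Times_same_infinite[OF assms]]] by auto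
qed

text \<open>An infinite type is equinumerous with its square, so a finite product of sets that embed
  into it embeds again.\<close>

lemma PiE_fits:
  fixes A :: "'i => 'v set"
  assumes inf: "infinite (UNIV :: 'u set)" and "finite I" and "\<And>i. i \<in> I ==> \<exists>e :: 'v => 'u. inj_on e (A i)"
  shows "\<exists>e :: ('i => 'v) => 'u. inj_on e (PiE I A)"
  using assms(2,3)
proof (induction I)
  case (insert i I)
  obtain h :: "'u \<times> 'u => 'u" where h: "inj h" by (rule inj_prod[OF inf])
  obtain e1 :: "('i => 'v) => 'u" where e1: "inj_on e1 (PiE I A)" using insert by blast
  obtain e2 :: "'v => 'u" where e2: "inj_on e2 (A i)" using insert by blast
  have "inj_on (%s. h (e2 (s i), e1 (restrict s I))) (PiE (insert i I) A)"
  proof (rule inj_onI)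
    fix s t assume st: "s \<in> PiE (insert i I) A" "t \<in> PiE (insert i I) A" "h (e2 (s i), e1 (restrict s I)) = h (e2 (t i), e1 (restrict t I))"
    then have "e2 (s i) = e2 (t i)" "e1 (restrict s I) = e1 (restrict t I)" using h by (auto dest: injD)
    then have "s i = t i" using st(1,2) by (intro inj_onD[OF e2]) auto
    moreover have "restrict s I = restrict t I" using \<open>e1 _ = e1 _\<close> st(1,2) by (intro inj_onD[OF e1]) (auto simp: PiE_iff)
    ultimately have "s j = t j" if "j \<in> insert i I" for j using that by (metis insertE restrict_apply')
    then show "s = t" using st by (blast intro: PiE_ext)
  qed
  then show ?case by blast
qed auto


text \<open>The full subcategory of those complexes on the point whose stalks embed into
  \<open>'u\<close>. On these \<open>U\<close> can be transported into the universe
  \<open>'u\<close> of the complexes on \<open>X\<close>.\<close>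

definition small_Ch :: "'u itself => ((unit, 'v) acomplex, (unit, 'v) amap) cat" where "small_Ch t = (Ch point)\<lparr>Obj := {M \<in> acs point. fits point M t}\<rparr>"

lemma small_Ch_simps [simp]: "Obj (small_Ch t) = {M \<in> acs point. fits point M t}"
  "Hom (small_Ch t) = chain_maps point" "Idt (small_Ch t) M = ci point M" "Comp (small_Ch t) M N K g f = cc point M g f"
  unfolding small_Ch_def using Ch_simps[of point] by (simp_all add: Ch_def)

lemma is_category_small_Ch: "is_category (small_Ch t)" using is_category_Ch[of point] unfolding is_category_def small_Ch_simps Ch_simps by blast

lemma quasi_isoD: "quasi_iso Y A B f ==> A \<in> acs Y ==> B \<in> acs Y ==> p \<in> tsp Y ==> crit A B f p" by (simp add: quasi_iso_iff)

section \<open>The functors \<open>C\<close>, \<open>T\<close> and \<open>U\<close> transported into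
  the required universes\<close>

context reps
begin

lemma finite_chs_up: "finite (chs X (up q))" using finite_chs[OF finite_subset[OF _ finite_P]] by (auto simp: up_def)

definition Cf :: "(('x, 'u) acomplex, ('x, 'u) amap, ('x, 'u) acomplex, ('x, 'u) amap) ftor" where "Cf = ef X Cc (%F G. Cm F)"

text \<open>The target universe is that of \<open>Gamma X\<close>, because a derived functor of
  \<open>Gamma X\<close> must take its values there.\<close>

definition Tf :: "(('x, 'u) acomplex, ('x, 'u) amap, (unit, 'x => 'u) acomplex, (unit, 'x => 'u) amap) ftor" where "Tf = ef point Tc (%F G. Tm F)"

definition Uf :: "((unit, 'v) acomplex, (unit, 'v) amap, ('x, 'u) acomplex, ('x, 'u) amap) ftor" where "Uf = ef X Uc (%M N. Um M)"

context
  fixes t :: "'u itself"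
  assumes inf: "infinite (UNIV :: 'u set)"
begin

lemma fits_product: assumes "finite I" "\<And>i. i \<in> I ==> \<exists>e :: 'v => 'u. inj_on e (carrier (G i))"
  shows "\<exists>e :: ('i => 'v) => 'u. inj_on e (carrier (product_group I G))"
  using PiE_fits[OF inf assms] by (simp add: product_group_def)

lemma fits_Tc: "fits point (Tc F) t" for F :: "('x, 'u) acomplex" unfolding fits_def Tc_simps TG_def by (intro allI ballI fits_product finite_chsP exI[of _ id]) simp

lemma fits_Tc': "fits point (Tc F) s" for F :: "('x, 'u) acomplex" and s :: "('x => 'u) itself" unfolding fits_def
proof (intro allI ballI)
  fix i :: int and p :: unit assume "p \<in> tsp point"
  then obtain e :: "('x list => 'u) => 'u" where "inj_on e (stc (Tc F) i p)" using fits_Tc[of F] unfolding fits_def by blast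
  then have "inj_on (%s (_ :: 'x). e s) (stc (Tc F) i p)" by (auto simp: inj_on_def fun_eq_iff)
  then show "\<exists>e :: ('x list => 'u) => 'x => 'u. inj_on e (stc (Tc F) i p)" by blast
qed

lemma fits_Cc: "fits X (Cc F) t" for F :: "('x, 'u) acomplex" unfolding fits_def Cc_simps TG_def by (intro allI ballI fits_product finite_chs_up exI[of _ id]) simp

lemma fits_Uc: "fits point M t ==> fits X (Uc M) t" unfolding fits_def Uc_simps UG_def by (intro allI ballI fits_product finite_UI) simp

lemma Tc_ok: "F \<in> acs X ==> Tc F \<in> acs point" "F \<in> acs X ==> fits point (Tc F) s" for F :: "('x, 'u) acomplex" and s :: "('x => 'u) itself"
  by (rule Tc_acomplex, assumption, rule fits_Tc')

lemma Cc_ok: "F \<in> acs X ==> Cc F \<in> acs X" "F \<in> acs X ==> fits X (Cc F) t" for F :: "('x, 'u) acomplex" by (rule Cc_acomplex, assumption, rule fits_Cc)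

lemma is_functor_Cf: "is_functor (Ch X) (Ch X) (Cf :: (('x, 'u) acomplex, _, _, _) ftor)"
  unfolding Cf_def by (rule is_functor_ef[where t = t]) (simp_all add: is_category_Ch Cc_ok chain_maps_iff Cm_cmap Cm_ci Cm_cc)

lemma is_functor_Tf: "is_functor (Ch X) (Ch point) (Tf :: (('x, 'u) acomplex, _, _, _) ftor)"
  unfolding Tf_def by (rule is_functor_ef[where t = "TYPE('x => 'u)"]) (simp_all add: is_category_Ch Tc_ok chain_maps_iff Tm_cmap Tm_ci Tm_cc)

text \<open>The stalks of \<open>Tc F\<close> are finite products of stalks of \<open>F\<close> and
  hence embed into \<open>'u\<close>; \<open>fits_enc\<close> keeps this bound after transport to
  the universe of \<open>Gamma X\<close>.\<close>

lemma is_functor_Tf_small: "is_functor (Ch X) (small_Ch t) (Tf :: (('x, 'u) acomplex, _, _, _) ftor)"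
  using is_functor_Tf fits_enc[OF Tc_ok fits_Tc] unfolding is_functor_def by (auto simp: Tf_def ef_simps)

lemma is_functor_Uf: "is_functor (small_Ch t) (Ch X) (Uf :: ((unit, 'v) acomplex, _, ('x, 'u) acomplex, _) ftor)" unfolding Uf_def by (rule is_functor_ef[where t = t])
    (simp_all add: is_category_small_Ch Uc_acomplex fits_Uc chain_maps_iff Um_cmap Um_ci, blast intro: Um_cc)

lemma preserves_Tf: "preserves (Ch X) (quasi_iso X) (quasi_iso point) (Tf :: (('x, 'u) acomplex, _, _, _) ftor)" unfolding preserves_def
proof (intro ballI impI)
  fix a b :: "('x, 'u) acomplex" and w assume ab: "a \<in> Obj (Ch X)" "b \<in> Obj (Ch X)" and w: "w \<in> Hom (Ch X) a b" "quasi_iso X a b w"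
  note T = is_functor_Tf
  have c: "crit (Tc a) (Tc b) (Tm a w) p" for p by (rule Tm_crit) (use ab w in "simp_all add: chain_maps_iff quasi_isoD")
  have "crit (ob Tf a :: (unit, 'x => 'u) acomplex) (ob Tf b) (hm Tf a b w) p" for p
    unfolding Tf_def by (rule ef_crit[where t = "TYPE('x => 'u)" and K = Tc and Km = "%F G. Tm F" and Y = point, OF is_category_Ch _ _ _ _ _ _ c])
      (use ab w in "simp_all add: Tc_ok chain_maps_iff Tm_cmap")
  then show "quasi_iso point (ob Tf a :: (unit, 'x => 'u) acomplex) (ob Tf b) (hm Tf a b w)" using is_functorD(1,2)[OF T] ab w by (simp add: quasi_iso_iff chain_maps_iff)
qed

lemma preserves_Uf: "preserves (small_Ch t) (quasi_iso point) (quasi_iso X) (Uf :: ((unit, 'v) acomplex, _, ('x, 'u) acomplex, _) ftor)" unfolding preserves_def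
proof (intro ballI impI)
  fix a b :: "(unit, 'v) acomplex" and w
  assume ab: "a \<in> Obj (small_Ch t)" "b \<in> Obj (small_Ch t)" and w: "w \<in> Hom (small_Ch t) a b" "quasi_iso point a b w"
  note U = is_functor_Uf[where 'v = 'v]
  have c: "crit (Uc a) (Uc b) (Um a w) p" if "p \<in> tsp X" for p by (rule Um_crit) (use that ab w in "simp_all add: chain_maps_iff quasi_isoD")
  have "crit (ob Uf a :: ('x, 'u) acomplex) (ob Uf b) (hm Uf a b w) p" if "p \<in> tsp X" for p
    unfolding Uf_def by (rule ef_crit[where t = t and K = Uc and Km = "%M N. Um M" and Y = X, OF is_category_small_Ch[of t] _ _ _ _ _ _ c[OF that]])
      (use that ab w in "simp_all add: Uc_acomplex fits_Uc chain_maps_iff Um_cmap")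
  then show "quasi_iso X (ob Uf a :: ('x, 'u) acomplex) (ob Uf b) (hm Uf a b w)" using is_functorD(1)[OF U ab(1)] is_functorD(1)[OF U ab(2)] is_functorD(2)[OF U ab w(1)]
    by (subst quasi_iso_iff) (simp_all add: chain_maps_iff)
qed

lemma flabby_enc:
  fixes s :: "'s itself"
  assumes F: "F \<in> acs X" and fits: "fits X F s" and fl: "flabby F"
  shows "flabby (enc X F :: ('x, 's) acomplex)"
  unfolding flabby_def
proof (intro ballI allI)
  let ?E = "enc X F :: ('x, 's) acomplex"
  note d = dm_cmap[OF F fits] and e = em_cmap[OF F fits]
  fix x n and \<tau> :: "'x => 's" assume x: "x \<in> P" and \<tau>: "\<tau> \<in> carrier (secS X ?E {y \<in> P. pt_less X x y} n)"
  have PX: "y \<in> tsp X" if "y \<in> P" for y using P that by blast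
  have "(\<lambda>y\<in>{y \<in> P. pt_less X x y}. dm X F n y (\<tau> y)) \<in> carrier (secS X F {y \<in> P. pt_less X x y} n)"
    using \<tau> by (auto simp: secS_carrier cmapD(3)[OF d] cmapD(5)[OF d, symmetric] PX)
  then obtain v where v: "v \<in> stc F n x" "\<And>y. y \<in> P ==> pt_less X x y ==> res (trm F n) x y v = dm X F n y (\<tau> y)"
    using fl x unfolding flabby_def by fastforce
  have "res (trm ?E n) x y (em X F n x v) = \<tau> y" if y: "y \<in> P" "pt_less X x y" for y
  proof -
    have le: "pt_le X x y" using y by (simp add: pt_less_def)
    have ty: "\<tau> y \<in> stc ?E n y" using \<tau> y unfolding secS_carrier by blast
    have "res (trm ?E n) x y (em X F n x v) = em X F n y (dm X F n y (\<tau> y))" using cmapD(5)[OF e le v(1)] v(2)[OF y] by simp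
    also have "\<dots> = cc X ?E (em X F) (dm X F) n y (\<tau> y)" using PX y(1) ty by simp
    finally show ?thesis using PX y(1) ty by (simp add: em_dm[OF F fits])
  qed
  then show "\<exists>v\<in>stc ?E n x. \<forall>y\<in>P. pt_less X x y --> res (trm ?E n) x y v = \<tau> y" using cmapD(3)[OF e PX[OF x] v(1)] by blast
qed

text \<open>The criterion \<open>is_total_right_derivedI\<close> with the resolution
  \<open>Cf\<close>: transported \<open>C\<close>-complexes are still flabby, so on them the
  augmentation from \<open>Gamma X\<close> to \<open>T\<close> is a quasi-isomorphism by
  \<open>eT_crit\<close>.\<close>

lemma RGamma_Tf: "is_RGamma X (loc_lift (Ch X) (Ch point) (quasi_iso point) (Tf :: (('x, 'u) acomplex, _, _, _) ftor))" unfolding is_RGamma_def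
proof (rule exI, rule is_total_right_derivedI[where K = Cf and eps = "%a. cc point (ob (Gamma X) a) (em point (Tc a)) (eT a)" and i = "%a. cc X a (em X (Cc a)) (iC a)"])
  note G = is_functor_Gamma
  have iC: "cmap X a (enc X (Cc a) :: ('x, 'u) acomplex) (cc X a (em X (Cc a)) (iC a))" if "a \<in> acs X" for a :: "('x, 'u) acomplex"
    by (rule cmap_cc[OF that iC_cmap[OF that] em_cmap[OF Cc_ok[OF that]]])
  have eT: "cmap point (ob (Gamma X) a) (enc point (Tc a) :: (unit, 'x => 'u) acomplex) (cc point (ob (Gamma X) a) (em point (Tc a)) (eT a))"
    if "a \<in> acs X" for a :: "('x, 'u) acomplex"
    by (rule cmap_cc[OF Gamma_acomplex[OF that] eT_cmap[OF that] em_cmap[OF Tc_ok[OF that]]])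
  show "is_nat_trans (Ch X) (Ch point) (Gamma X) (Tf :: (('x, 'u) acomplex, _, _, _) ftor) (%a. cc point (ob (Gamma X) a) (em point (Tc a)) (eT a))"
    unfolding is_nat_trans_def
  proof (intro conjI ballI)
    fix a b :: "('x, 'u) acomplex" and f assume o: "a \<in> Obj (Ch X)" "b \<in> Obj (Ch X)" and f: "f \<in> Hom (Ch X) a b"
    have a: "a \<in> acs X" and b: "b \<in> acs X" and f': "cmap X a b f" using o f by (simp_all add: chain_maps_iff)
    have "cc point (ob (Gamma X) a) (hm Tf a b f) (cc point (ob (Gamma X) a) (em point (Tc a)) (eT a)) =
       cc point (ob (Gamma X) a) (em point (Tc b)) (cc point (ob (Gamma X) a) (Tm a f) (eT a) :: (unit, _) amap)"
      unfolding Tf_def by (rule ef_pre[where t = "TYPE('x => 'u)", OF is_category_Ch]) (use o f in "simp_all add: Tc_ok chain_maps_iff Tm_cmap eT_cmap Gamma_acomplex")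
    then show "Comp (Ch point) (ob (Gamma X) a) (ob (Gamma X) b) (ob Tf b) (cc point (ob (Gamma X) b) (em point (Tc b)) (eT b)) (hm (Gamma X) a b f) =
        Comp (Ch point) (ob (Gamma X) a) (ob Tf a) (ob Tf b) (hm Tf a b f) (cc point (ob (Gamma X) a) (em point (Tc a)) (eT a))"
      using cc_assoc[OF Gamma_acomplex[OF a] Gamma_acomplex[OF b] Gamma_cmap[OF a b f'] eT_cmap[OF b] em_cmap[OF Tc_ok[OF b]]] eT_natural[OF a b f'] by simp
  qed (simp_all add: Tf_def ef_simps chain_maps_iff eT)
  show "is_nat_trans (Ch X) (Ch X) id_functor Cf (%a :: ('x, 'u) acomplex. cc X a (em X (Cc a)) (iC a))" unfolding is_nat_trans_def
  proof (intro conjI ballI)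
    fix a b :: "('x, 'u) acomplex" and f assume o: "a \<in> Obj (Ch X)" "b \<in> Obj (Ch X)" and f: "f \<in> Hom (Ch X) a b"
    have a: "a \<in> acs X" and b: "b \<in> acs X" and f': "cmap X a b f" using o f by (simp_all add: chain_maps_iff)
    have "cc X a (hm Cf a b f) (cc X a (em X (Cc a)) (iC a)) = cc X a (em X (Cc b)) (cc X a (Cm a f) (iC a))"
      unfolding Cf_def by (rule ef_pre[where t = t, OF is_category_Ch]) (use o f in "simp_all add: Cc_ok chain_maps_iff Cm_cmap iC_cmap")
    then show "Comp (Ch X) (ob id_functor a) (ob id_functor b) (ob Cf b) (cc X b (em X (Cc b)) (iC b)) (hm id_functor a b f) =
        Comp (Ch X) (ob id_functor a) (ob Cf a) (ob Cf b) (hm Cf a b f) (cc X a (em X (Cc a)) (iC a))"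
      using cc_assoc[OF a b f' iC_cmap[OF b] em_cmap[OF Cc_ok[OF b]]] iC_natural[OF a b f'] by simp
  qed (simp_all add: Cf_def ef_simps chain_maps_iff iC)
  fix a :: "('x, 'u) acomplex" assume "a \<in> Obj (Ch X)"
  then have a: "a \<in> acs X" by simp
  note E = enc_acomplex[OF Cc_ok[OF a]]
  have "crit a (enc X (Cc a) :: ('x, 'u) acomplex) (cc X a (em X (Cc a)) (iC a)) p" if "p \<in> tsp X" for p
    by (rule crit_cc[OF a Cc_acomplex[OF a] E iC_cmap[OF a] em_cmap[OF Cc_ok[OF a]] that iC_crit[OF a that] em_crit[OF Cc_ok[OF a] that]])
  then show "quasi_iso X a (ob Cf a) (cc X a (em X (Cc a)) (iC a))" using a E iC[OF a] by (simp add: quasi_iso_iff Cf_def ef_simps)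
  have fl: "flabby (enc X (Cc a) :: ('x, 'u) acomplex)" by (rule flabby_enc[OF Cc_ok[OF a] Cc_flabby[OF a]])
  note T = Tc_ok[OF E]
  let ?E = "enc X (Cc a) :: ('x, 'u) acomplex"
  have "crit (ob (Gamma X) ?E) (enc point (Tc ?E) :: (unit, 'x => 'u) acomplex) (cc point (ob (Gamma X) ?E) (em point (Tc ?E)) (eT ?E)) p" for p
    by (rule crit_cc[OF Gamma_acomplex[OF E] T(1) enc_acomplex[OF T] eT_cmap[OF E] em_cmap[OF T] _ eT_crit[OF E fl] em_crit[OF T]]) simp_all
  then show "quasi_iso point (ob (Gamma X) (ob Cf a)) (ob Tf (ob Cf a)) (cc point (ob (Gamma X) (ob Cf a)) (em point (Tc (ob Cf a))) (eT (ob Cf a)))"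
    using eT[OF E] enc_acomplex[OF T] Gamma_acomplex[OF E] by (simp add: quasi_iso_iff Cf_def Tf_def ef_simps)
qed (simp_all add: is_category_Ch is_functor_Gamma is_functor_Tf is_functor_Cf preserves_Tf)

text \<open>\<open>Psi\<close> between the transported functors: decoding on the side of
  \<open>T\<close> becomes composition with \<open>em\<close>, and the result is encoded into
  \<open>U\<close> by another \<open>em\<close>.\<close>

definition Adj :: "('x, 'u) acomplex => (unit, 'v) acomplex => (int => unit => 'v => 'v) => ('x, 'u) amap" where
  "Adj F M f = cc X F (em X (Uc M)) (Psi F (cc point (Tc F) f (em point (Tc F))))"

lemma hom_adjunction_Tf_Uf: "hom_adjunction (Ch X) (small_Ch t) (Tf :: (('x, 'u) acomplex, _, (unit, 'x => 'u) acomplex, _) ftor) Uf Adj" unfolding hom_adjunction_def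
proof (intro conjI ballI)
  fix a :: "('x, 'u) acomplex" and d :: "(unit, 'x => 'u) acomplex" assume "a \<in> Obj (Ch X)" "d \<in> Obj (small_Ch t)"
  then have a: "a \<in> acs X" and d: "d \<in> acs point" and fd: "fits point d t" by simp_all
  note T = Tc_ok[OF a] and U = Uc_acomplex[OF d] fits_Uc[OF fd]
  let ?T = "enc point (Tc a) :: (unit, 'x => 'u) acomplex" and ?U = "enc X (Uc d) :: ('x, 'u) acomplex"
  note ET = enc_acomplex[OF T]
  have 1: "cmap point (Tc a) d (cc point (Tc a) f (em point (Tc a)))" if "cmap point ?T d f" for f by (rule cmap_cc[OF T(1) em_cmap[OF T] that])
  have 2: "cmap X a (Uc d) (cc X a (dm X (Uc d)) g)" if "cmap X a ?U g" for g by (rule cmap_cc[OF a that dm_cmap[OF U]])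
  have 3: "cc point ?T (cc point (Tc a) f (em point (Tc a))) (dm point (Tc a)) = f" if f: "cmap point ?T d f" for f
    using cc_assoc[OF ET T(1) dm_cmap[OF T] em_cmap[OF T] f] em_dm[OF T] cc_ci(1)[OF ET f] by simp
  have 4: "cc point (Tc a) (cc point ?T f (dm point (Tc a))) (em point (Tc a)) = f" if f: "cmap point (Tc a) d f" for f
    using cc_assoc[OF T(1) ET em_cmap[OF T] dm_cmap[OF T] f] dm_em[OF T] cc_ci(1)[OF T(1) f] by simp
  show "bij_betw (Adj a d) (Hom (small_Ch t) (ob Tf a) d) (Hom (Ch X) a (ob Uf d))" unfolding small_Ch_simps Ch_simps Tf_def Uf_def ef_simps
  proof (rule bij_betwI[where g = "%g. cc point ?T (Theta a d (cc X a (dm X (Uc d)) g)) (dm point (Tc a))"], safe)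
    fix f assume "f \<in> chain_maps point ?T d"
    then have f: "cmap point ?T d f" by (simp add: chain_maps_iff)
    note p = Psi_cmap[OF a d 1[OF f]]
    show "Adj a d f \<in> chain_maps X a ?U" unfolding Adj_def chain_maps_iff by (rule cmap_cc[OF a p em_cmap[OF U]])
    show "cc point ?T (Theta a d (cc X a (dm X (Uc d)) (Adj a d f))) (dm point (Tc a)) = f"
      unfolding Adj_def cc_cancel[OF a U(1) enc_acomplex[OF U] p em_cmap[OF U] dm_cmap[OF U] dm_em[OF U]] Theta_Psi[OF a d 1[OF f]] by (rule 3[OF f])
  next
    fix g assume "g \<in> chain_maps X a ?U"
    then have g: "cmap X a ?U g" by (simp add: chain_maps_iff)
    note p = Theta_cmap[OF a d 2[OF g]]
    show "cc point ?T (Theta a d (cc X a (dm X (Uc d)) g)) (dm point (Tc a)) \<in> chain_maps point ?T d"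
      unfolding chain_maps_iff by (rule cmap_cc[OF ET dm_cmap[OF T] p])
    show "Adj a d (cc point ?T (Theta a d (cc X a (dm X (Uc d)) g)) (dm point (Tc a))) = g" unfolding Adj_def 4[OF p] Psi_Theta[OF a d 2[OF g]]
      by (rule cc_cancel[OF a enc_acomplex[OF U] U(1) g dm_cmap[OF U] em_cmap[OF U] em_dm[OF U]])
  qed
  {
    fix d' f g assume "d' \<in> Obj (small_Ch t)" "f \<in> Hom (small_Ch t) (ob Tf a) d" "g \<in> Hom (small_Ch t) d d'"
    then have d': "d' \<in> acs point" "fits point d' t" and f: "cmap point ?T d f" and g: "cmap point d d' g" by (simp_all add: chain_maps_iff Tf_def ef_simps)
    have "cc X a (hm Uf d d' g) (Adj a d f) = cc X a (em X (Uc d')) (cc X a (Um d g) (Psi a (cc point (Tc a) f (em point (Tc a)))))"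
      unfolding Uf_def Adj_def by (rule ef_pre[where t = t, OF is_category_small_Ch[of t]])
        (use a d d' fd g Psi_cmap[OF a d 1[OF f]] in "simp_all add: Uc_acomplex fits_Uc chain_maps_iff Um_cmap")
    then show "Adj a d' (Comp (small_Ch t) (ob Tf a) d d' g f) = Comp (Ch X) a (ob Uf d) (ob Uf d') (hm Uf d d' g) (Adj a d f)"
      using Psi_cc_left[OF a d d'(1) 1[OF f] g] cc_assoc[OF T(1) ET em_cmap[OF T] f g] by (simp add: Adj_def Tf_def ef_simps)
  }
  {
    fix b h f assume o: "b \<in> Obj (Ch X)" "h \<in> Hom (Ch X) b a" and "f \<in> Hom (small_Ch t) (ob Tf a) d"
    then have b: "b \<in> acs X" and h: "cmap X b a h" and f: "cmap point ?T d f" by (simp_all add: chain_maps_iff Tf_def ef_simps)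
    note B = Tc_ok[OF b]
    let ?B = "enc point (Tc b) :: (unit, 'x => 'u) acomplex"
    have c: "cmap point ?B ?T (hm Tf b a h)" using is_functorD(2)[OF is_functor_Tf] o a by (simp add: chain_maps_iff Tf_def ef_simps)
    have "cc point (Tc b) (hm Tf b a h) (cc point (Tc b) (em point (Tc b)) (ci point (Tc b))) =
       (cc point (Tc b) (em point (Tc a)) (cc point (Tc b) (Tm b h) (ci point (Tc b))) :: int => unit => ('x list => 'u) => 'x => 'u)"
      unfolding Tf_def by (rule ef_pre[where t = "TYPE('x => 'u)", OF is_category_Ch]) (use a b h in "simp_all add: Tc_ok chain_maps_iff Tm_cmap cmap_ci")
    then have "cc point (Tc b) (hm Tf b a h) (em point (Tc b)) = (cc point (Tc b) (em point (Tc a)) (Tm b h) :: int => unit => ('x list => 'u) => 'x => 'u)"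
      unfolding cc_ci(1)[OF B(1) em_cmap[OF B]] cc_ci(1)[OF B(1) Tm_cmap[OF b a h]] .
    then have "cc point (Tc b) (cc point ?B f (hm Tf b a h)) (em point (Tc b)) = cc point (Tc b) (cc point (Tc a) f (em point (Tc a))) (Tm b h)"
      using cc_assoc[OF B(1) enc_acomplex[OF B] em_cmap[OF B] c f] cc_assoc[OF B(1) T(1) Tm_cmap[OF b a h] em_cmap[OF T] f] by simp
    then show "Adj b d (Comp (small_Ch t) (ob Tf b) (ob Tf a) d f (hm Tf b a h)) = Comp (Ch X) b a (ob Uf d) (Adj a d f) h"
      using Psi_cc_right[OF b a d h 1[OF f]] cc_assoc[OF b a h Psi_cmap[OF a d 1[OF f]] em_cmap[OF U]] by (simp add: Adj_def Tf_def ef_simps)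
  }
qed

text \<open>The adjunction descends here with the localized small complexes as target.
  \<open>right_adjoint_value_inclusion\<close> later replaces them by the full derived category of
  the point.\<close>

lemma right_adjoint_value_Tf_small: assumes "Z \<in> acs point" "fits point Z t" shows "right_adjoint_value (DCat X) (localization (small_Ch t) (quasi_iso point))
     (loc_lift (Ch X) (small_Ch t) (quasi_iso point) (Tf :: (('x, 'u) acomplex, _, _, _) ftor)) Z (enc X (Uc Z))"
proof -
  have "preserves (Ch X) (quasi_iso X) (quasi_iso point) (Tf :: (('x, 'u) acomplex, _, _, _) ftor)" by (rule preserves_Tf)
  from right_adjoint_value_localization[OF is_category_Ch is_category_small_Ch[of t] is_functor_Tf_small this is_functor_Uf preserves_Uf hom_adjunction_Tf_Uf, of Z] assms
  show ?thesis by (simp add: DCat_def Uf_def ef_simps)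
qed

end

end

section \<open>Localizing the small complexes\<close>

text \<open>The stages are ranges of maps from \<open>'t\<close>: \<open>g (Suc m)\<close>
  enumerates all values of the operations on stage \<open>m\<close>, with triples of an operation
  number and two arguments coded in \<open>'t\<close> by \<open>j\<close>. The union of the stages
  is then enumerated by \<open>s\<close>, and a section of \<open>s\<close> is the
  injection.\<close>

lemma small_closure:
  fixes g0 :: "'t => 'e" and ops :: "('e => 'e => 'e) set"
  assumes inf: "infinite (UNIV :: 't set)" and ops: "countable ops"
  obtains S and e :: "'e => 't" where "range g0 \<subseteq> S" "inj_on e S" "\<And>f x y. f \<in> ops ==> x \<in> S ==> y \<in> S ==> f x y \<in> S"
proof -
  obtain h :: "'t \<times> 't => 't" where h: "inj h" by (rule inj_prod[OF inf])
  obtain k :: "nat => 't" where k: "inj k" using infinite_countable_subset[OF inf] by blast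
  define j where "j x = h (k (fst x), h (snd x))" for x
  have j: "inj j" by (rule injI) (simp add: j_def inj_eq[OF h] inj_eq[OF k] prod_eq_iff)
  \<comment> \<open>The first projection is added so that each stage contains the previous one and
    the set to be enumerated is nonempty.\<close>
  define c where "c = from_nat_into (insert (%x y. x) ops)"
  have c: "range c = insert (%x y. x) ops" unfolding c_def by (rule range_from_nat_into) (simp_all add: ops)
  define g where "g = rec_nat g0 (%_ g x. case inv_into UNIV j x of (n, u, v) => c n (g u) (g v))"
  have g: "g 0 = g0" "g (Suc m) (j (n, u, v)) = c n (g m u) (g m v)" for m n u v by (simp_all add: g_def inv_f_f[OF j])
  have op_g: "f (g m u) (g m v) \<in> range (g (Suc m))" if "f \<in> insert (%x y. x) ops" for f m u v
  proof -
    obtain n where "f = c n" using \<open>f \<in> _\<close> unfolding c[symmetric] by blast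
    then have "f (g m u) (g m v) = g (Suc m) (j (n, u, v))" by (simp only: g(2))
    then show ?thesis by (simp only: rangeI)
  qed
  have mono: "range (g m) \<subseteq> range (g m')" if "m \<le> m'" for m m' by (rule lift_Suc_mono_le[OF _ that]) (use op_g[of "%x y. x"] in auto)
  \<comment> \<open>The code for triples is used again: the first entry selects the stage, the
    second an element of it, and the third is ignored.\<close>
  define s where "s x = (case inv_into UNIV j x of (n, u, v) => g n u)" for x
  have s: "s (j (n, u, v)) = g n u" for n u v by (simp add: s_def inv_f_f[OF j])
  have S: "range s = (\<Union>m. range (g m))"
  proof
    show "range s \<subseteq> (\<Union>m. range (g m))" by (auto simp: s_def split: prod.split) (metis rangeI)
    show "(\<Union>m. range (g m)) \<subseteq> range s" by (intro UN_least image_subsetI range_eqI) (rule s[symmetric])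
  qed
  show thesis
  proof (rule that)
    show "range g0 \<subseteq> range s" unfolding S using g(1) by blast
    show "inj_on (inv_into UNIV s) (range s)" by (rule inj_on_inv_into) simp
    fix f x y assume f: "f \<in> ops" and "x \<in> range s" "y \<in> range s"
    then obtain m m' where "x \<in> range (g m)" "y \<in> range (g m')" unfolding S by blast
    then have "x \<in> range (g (max m m'))" "y \<in> range (g (max m m'))" using mono[of m "max m m'"] mono[of m' "max m m'"] by auto
    then obtain u v where "x = g (max m m') u" "y = g (max m m') v" by blast
    then have "f x y \<in> range (g (Suc (max m m')))" using op_g f by simp
    then show "f x y \<in> range s" unfolding S by blast
  qed
qed

section \<open>Subcomplexes cut out by a set of tagged elements\<close>

type_synonym 'v elt = "(unit, 'v) acomplex \<times> int \<times> 'v"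

text \<open>Since elements carry their complex and degree, a single set \<open>S\<close> selects a
  subset of every stalk of every complex, and one closure argument can treat several complexes at a
  time.\<close>

definition sub_car :: "'v elt set => (unit, 'v) acomplex => int => 'v set" where "sub_car S M i = {s \<in> stc M i (). (M, i, s) \<in> S}"

definition sub :: "'v elt set => (unit, 'v) acomplex => (unit, 'v) acomplex" where
  "sub S M = \<lparr>trm = (%i. \<lparr>stalk = (%p. (stk M i p)\<lparr>carrier := sub_car S M i\<rparr>), res = res (trm M i)\<rparr>),
     dif = (%i p. restrict (dif M i p) (sub_car S M i))\<rparr>"

definition sub_ob :: "'v elt set => (unit, 'v) acomplex => bool" where
  "sub_ob S M \<longleftrightarrow> (\<forall>i. 1[stk M i ()] \<in> sub_car S M i \<and> (\<forall>s\<in>sub_car S M i.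
     inv[stk M i ()] s \<in> sub_car S M i \<and> dif M i () s \<in> sub_car S M (i + 1) \<and>
     (\<forall>t\<in>sub_car S M i. s *[stk M i ()] t \<in> sub_car S M i)))"

definition sub_map :: "'v elt set => (unit, 'v) acomplex => (unit, 'v) acomplex => (unit, 'v) amap => bool" where
  "sub_map S A B f \<longleftrightarrow> (\<forall>i. \<forall>s\<in>sub_car S A i. f i () s \<in> sub_car S B i)"

text \<open>The criterion \<open>crit\<close> for the restricted map. The witnesses have to lie in
  the subcomplexes, which does not follow from \<open>crit\<close> for the whole complexes;
  \<open>S\<close> will be closed under chosen witnesses.\<close>

definition sub_qi :: "'v elt set => (unit, 'v) acomplex => (unit, 'v) acomplex => (unit, 'v) amap => bool" where
  "sub_qi S A B f \<longleftrightarrow> (\<forall>i. \<forall>a\<in>sub_car S A (i + 1). \<forall>b\<in>sub_car S B i.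
     dif A (i + 1) () a = 1[stk A (i + 2) ()] \<and> dif B i () b = f (i + 1) () a -->
     (\<exists>a'\<in>sub_car S A i. \<exists>b'\<in>sub_car S B (i - 1). dif A i () a' = a \<and> b = f i () a' *[stk B i ()] dif B (i - 1) () b'))"

definition rm :: "'v elt set => (unit, 'v) acomplex => (unit, 'v) amap => (unit, 'v) amap" where "rm S A f = (%i p. restrict (f i p) (sub_car S A i))"

lemma sub_simps [simp]: "stc (sub S M) i p = sub_car S M i" "monoid.mult (stk (sub S M) i p) = monoid.mult (stk M i p)" "one (stk (sub S M) i p) = one (stk M i p)"
  "res (trm (sub S M) i) = res (trm M i)" "dif (sub S M) i p = restrict (dif M i p) (sub_car S M i)"
  by (simp_all add: sub_def)

lemma sub_acomplex: assumes M: "M \<in> acs point" and ob: "sub_ob S M" shows "sub S M \<in> acs point"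
proof (rule acomplexesI)
  note o = ob[unfolded sub_ob_def, rule_format]
  have car: "sub_car S M i \<subseteq> stc M i ()" for i by (auto simp: sub_car_def)
  fix i :: int and p q :: unit and s
  have rs: "res (trm M i) () () s = s" if "s \<in> sub_car S M i" for s i using acD(4)[OF M, of "()" s i] subsetD[OF car that] by simp
  interpret comm_group "stk M i ()" using acD(1)[OF M, of "()" i] by simp
  have "subgroup (sub_car S M i) (stk M i ())" using car o by unfold_locales auto
  from subgroup.subgroup_is_group[OF this is_group] show "comm_group (stk (sub S M) i p)"
    by (intro group.group_comm_groupI) (use m_comm[OF car[THEN subsetD] car[THEN subsetD]] in "auto simp: sub_def")
  show "res (trm (sub S M) i) p q \<in> hom (stk (sub S M) i p) (stk (sub S M) i q)" using rs o by (intro homI) simp_all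
  show "dif (sub S M) i p \<in> hom (stk (sub S M) i p) (stk (sub S M) (i + 1) p)" using hom_mult[OF acD(7)[OF M, of "()" i]] o car[THEN subsetD] by (intro homI) simp_all
  show "dif (sub S M) (i + 1) p (dif (sub S M) i p s) = 1[stk (sub S M) (i + 2) p]" if "s \<in> stc (sub S M) i p"
    using that o car[THEN subsetD] acD(9)[OF M, of "()" s i] by simp
  show "dif (sub S M) i q (res (trm (sub S M) i) p q s) = res (trm (sub S M) (i + 1)) p q (dif (sub S M) i p s)" if "s \<in> stc (sub S M) i p" using that rs o by simp
qed (use acD(4)[OF M] in "auto simp: sub_car_def")

lemma rm_cmap: assumes M: "M \<in> acs point" "sub_ob S M" and N: "N \<in> acs point" and f: "cmap point M N f" "sub_map S M N f"
  shows "cmap point (sub S M) (sub S N) (rm S M f)"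
proof (rule cmapI)
  note o = M(2)[unfolded sub_ob_def, rule_format] f(2)[unfolded sub_map_def, rule_format]
  have car: "s \<in> stc K i p" if "s \<in> sub_car S K i" for i s p and K :: "(unit, 'a) acomplex" using that by (auto simp: sub_car_def)
  note r = acD(4)[OF M(1)] acD(4)[OF N]
  fix i :: int and p q :: unit and s t
  show "rm S M f (i + 1) p (dif (sub S M) i p s) = dif (sub S N) i p (rm S M f i p s)" if "s \<in> stc (sub S M) i p"
    using that o car[of s M i] cmapD(6)[OF f(1), of p s i] by (simp add: rm_def)
  show "rm S M f i p (s *[stk (sub S M) i p] t) = rm S M f i p s *[stk (sub S N) i p] rm S M f i p t" if "s \<in> stc (sub S M) i p" "t \<in> stc (sub S M) i p"
    using that o car[of s M i] car[of t M i] cmapD(4)[OF f(1), of p s i t] by (simp add: rm_def)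
  show "rm S M f i q (res (trm (sub S M) i) p q s) = res (trm (sub S N) i) p q (rm S M f i p s)" if "s \<in> stc (sub S M) i p"
    using that r(1)[of p s i] r(2)[of p "f i p s" i] car[of s M i] cmapD(3)[OF f(1), of p s i] by (simp add: rm_def)
qed (use f(2) in "auto simp: rm_def sub_map_def")

lemma rm_quasi_iso: assumes M: "M \<in> acs point" "sub_ob S M" and N: "N \<in> acs point" "sub_ob S N" and f: "cmap point M N f" "sub_map S M N f" "sub_qi S M N f"
  shows "quasi_iso point (sub S M) (sub S N) (rm S M f)"
proof -
  note o = M(2)[unfolded sub_ob_def, rule_format] f(2)[unfolded sub_map_def, rule_format]
  have "crit (sub S M) (sub S N) (rm S M f) p" for p unfolding qcrit_def
  proof (intro allI ballI impI)
    fix i a b assume ab: "a \<in> stc (sub S M) (i + 1) p" "b \<in> stc (sub S N) i p"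
      "dif (sub S M) (i + 1) p a = 1[stk (sub S M) (i + 2) p] \<and> dif (sub S N) i p b = rm S M f (i + 1) p a"
    then have "dif M (i + 1) () a = 1[stk M (i + 2) ()] \<and> dif N i () b = f (i + 1) () a" by (simp add: rm_def)
    then obtain a' b' where "a' \<in> sub_car S M i" "b' \<in> sub_car S N (i - 1)" "dif M i () a' = a" "b = f i () a' *[stk N i ()] dif N (i - 1) () b'"
      using f(3)[unfolded sub_qi_def, rule_format, of a i b] ab by auto
    then show "\<exists>a'\<in>stc (sub S M) i p. \<exists>b'\<in>stc (sub S N) (i - 1) p.
        dif (sub S M) i p a' = a \<and> b = rm S M f i p a' *[stk (sub S N) i p] dif (sub S N) (i - 1) p b'"
      by (auto simp: rm_def)
  qed
  then show ?thesis using rm_cmap[OF M N(1) f(1,2)] sub_acomplex[OF M] sub_acomplex[OF N] by (simp add: quasi_iso_iff)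
qed

lemma sub_whole: assumes M: "M \<in> acs point" and S: "\<And>i s. s \<in> stc M i () ==> (M, i, s) \<in> S" shows "sub S M = M"
proof -
  have c: "sub_car S M i = stc M i p" for i p using S by (auto simp: sub_car_def)
  have "dif M i p \<in> extensional (stc M i p)" for i p using M by (auto simp: acomplexes_def ad_hom_def)
  then have "dif (sub S M) = dif M" by (auto simp: fun_eq_iff c[of _ "()"] extensional_def)
  moreover have "trm (sub S M) = trm M" by (intro ext adata.equality) (auto simp: sub_def c[of _ "()"])
  ultimately show ?thesis by simp
qed

definition sub_cat :: "'v elt set => (unit, 'v) acomplex set => ((unit, 'v) acomplex, (unit, 'v) amap) cat" where
  "sub_cat S Ob = (Ch point)\<lparr>Obj := {M \<in> Ob. sub_ob S M}, Hom := (%A B. {f \<in> chain_maps point A B. sub_map S A B f})\<rparr>"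

definition sub_W :: "'v elt set => (unit, 'v) acomplex => (unit, 'v) acomplex => (unit, 'v) amap => bool" where
  "sub_W S A B f \<longleftrightarrow> quasi_iso point A B f \<and> sub_qi S A B f"

text \<open>What \<open>S\<close> must satisfy for the arrow to survive the passage to subcomplexes.
  A quasi-isomorphism has to remain one, because it may occur inverted in a zigzag.\<close>

definition adm :: "'v elt set => (unit, 'v) acomplex \<times> (unit, 'v) acomplex \<times> (unit, 'v) amap => bool" where
  "adm S = (%(A, B, f). sub_ob S A \<and> sub_ob S B \<and> sub_map S A B f \<and> (quasi_iso point A B f --> sub_qi S A B f))"

lemma admD: assumes "adm S (A, B, f)" shows "sub_ob S A" "sub_ob S B" "sub_map S A B f" "quasi_iso point A B f ==> sub_W S A B f"
  using assms by (simp_all add: adm_def sub_W_def)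

lemma sub_cat_simps [simp]: "Obj (sub_cat S Ob) = {M \<in> Ob. sub_ob S M}" "Hom (sub_cat S Ob) A B = {f \<in> chain_maps point A B. sub_map S A B f}"
  "Idt (sub_cat S Ob) A = ci point A" "Comp (sub_cat S Ob) A B C g f = cc point A g f"
  unfolding sub_cat_def using Ch_simps[of point] by (simp_all add: Ch_def)

text \<open>A Skolem function for \<open>crit\<close>. The degree is taken from the second argument;
  the first argument lies one degree higher.\<close>

definition sol :: "(unit, 'v) acomplex => (unit, 'v) acomplex => (unit, 'v) amap => 'v elt => 'v elt => 'v \<times> 'v" where
  "sol A B f = (%(_, _, a) (_, i, b). SOME p. fst p \<in> stc A i () \<and> snd p \<in> stc B (i - 1) () \<and>
     dif A i () (fst p) = a \<and> b = f i () (fst p) *[stk B i ()] dif B (i - 1) () (snd p))"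

text \<open>Constants and unary operations are padded to binary ones to fit
  \<open>small_closure\<close>. There is one constant for each degree, so the set is
  countable.\<close>

definition ob_ops :: "(unit, 'v) acomplex => ('v elt => 'v elt => 'v elt) set" where "ob_ops M = range (%i _ _. (M, i, 1[stk M i ()])) \<union>
     {%(_, i, s) (_, _, t). (M, i, s *[stk M i ()] t), %(_, i, s) _. (M, i, inv[stk M i ()] s), %(_, i, s) _. (M, i + 1, dif M i () s)}"

definition map_ops where "map_ops = (%(A, B, f). ob_ops A \<union> ob_ops B \<union>
     {%(_, i, s) _. (B, i, f i () s), %x y. (A, fst (snd y), fst (sol A B f x y)), %x y. (B, fst (snd y) - 1, snd (sol A B f x y))})"

lemma sub_obI: assumes M: "M \<in> acs point" and S: "\<And>f x y. f \<in> ob_ops M ==> x \<in> S ==> y \<in> S ==> f x y \<in> S" and ne: "x0 \<in> S" shows "sub_ob S M"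
proof -
  note cl = ac_closed[OF M, of "()"]
  have "(M, i, 1[stk M i ()]) \<in> S" for i using S[OF _ ne ne, of "%_ _. (M, i, 1[stk M i ()])"] by (auto simp: ob_ops_def)
  moreover have "(M, i, s *[stk M i ()] t) \<in> S" if "(M, i, s) \<in> S" "(M, i, t) \<in> S" for i s t
    using S[OF _ that, of "%(_, i, s) (_, _, t). (M, i, s *[stk M i ()] t)"] by (auto simp: ob_ops_def)
  moreover have "(M, i, inv[stk M i ()] s) \<in> S" if "(M, i, s) \<in> S" for i s
    using S[OF _ that that, of "%(_, i, s) _. (M, i, inv[stk M i ()] s)"] by (auto simp: ob_ops_def)
  moreover have "(M, i + 1, dif M i () s) \<in> S" if "(M, i, s) \<in> S" for i s
    using S[OF _ that that, of "%(_, i, s) _. (M, i + 1, dif M i () s)"] by (auto simp: ob_ops_def)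
  ultimately show ?thesis using cl by (auto simp: sub_ob_def sub_car_def)
qed

lemma admI: assumes A: "A \<in> acs point" and B: "B \<in> acs point" and f: "f \<in> chain_maps point A B"
    and S: "\<And>h x y. h \<in> map_ops (A, B, f) ==> x \<in> S ==> y \<in> S ==> h x y \<in> S" and ne: "x0 \<in> S"
  shows "adm S (A, B, f)"
proof -
  have "sub_ob S A" "sub_ob S B" by (rule sub_obI[OF A _ ne], rule S, simp add: map_ops_def, assumption+)
      (rule sub_obI[OF B _ ne], rule S, simp add: map_ops_def, assumption+)
  moreover have "sub_map S A B f" unfolding sub_map_def
  proof (intro allI ballI)
    fix i s assume "s \<in> sub_car S A i"
    then show "f i () s \<in> sub_car S B i" using S[of "%(_, i, s) _. (B, i, f i () s)" "(A, i, s)" "(A, i, s)"] cmapD(3)[of point A B f "()" s i] f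
      by (auto simp: map_ops_def sub_car_def chain_maps_iff)
  qed
  moreover have "sub_qi S A B f" if qi: "quasi_iso point A B f" unfolding sub_qi_def
  proof (intro allI ballI impI)
    fix i a b assume a: "a \<in> sub_car S A (i + 1)" and b: "b \<in> sub_car S B i"
      and ab: "dif A (i + 1) () a = 1[stk A (i + 2) ()] \<and> dif B i () b = f (i + 1) () a"
    have "crit A B f ()" using qi by (simp add: quasi_iso_iff[OF A B])
    then have ex: "\<exists>p. fst p \<in> stc A i () \<and> snd p \<in> stc B (i - 1) () \<and>
        dif A i () (fst p) = a \<and> b = f i () (fst p) *[stk B i ()] dif B (i - 1) () (snd p)"
      using a b ab unfolding qcrit_def sub_car_def by fastforce
    define p where "p = sol A B f (A, i + 1, a) (B, i, b)"
    have "(A, i, fst p) \<in> S" "(B, i - 1, snd p) \<in> S" using S[of "%x y. (A, fst (snd y), fst (sol A B f x y))" "(A, i + 1, a)" "(B, i, b)"]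
        S[of "%x y. (B, fst (snd y) - 1, snd (sol A B f x y))" "(A, i + 1, a)" "(B, i, b)"] a b
      by (auto simp: map_ops_def sub_car_def p_def)
    moreover note someI_ex[OF ex]
    moreover have "p = (SOME p. fst p \<in> stc A i () \<and> snd p \<in> stc B (i - 1) () \<and>
        dif A i () (fst p) = a \<and> b = f i () (fst p) *[stk B i ()] dif B (i - 1) () (snd p))"
      by (simp add: p_def sol_def)
    ultimately show "\<exists>a'\<in>sub_car S A i. \<exists>b'\<in>sub_car S B (i - 1). dif A i () a' = a \<and> b = f i () a' *[stk B i ()] dif B (i - 1) () b'"
      by (intro bexI[of _ "fst p"] bexI[of _ "snd p"]) (simp_all add: sub_car_def)
  qed
  ultimately show ?thesis by (simp add: adm_def)
qed

definition arrs :: "((unit, 'v) acomplex \<times> (unit, 'v) acomplex \<times> (unit, 'v) amap) set" where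
  "arrs = {(A, B, f). A \<in> acs point \<and> B \<in> acs point \<and> f \<in> chain_maps point A B}"

text \<open>\<open>S\<close> starts from all elements of \<open>a\<close> and \<open>b\<close>, so
  these two complexes are not cut down at all, and is closed under the operations of the finitely
  many arrows. By \<open>small_closure\<close> it still embeds into \<open>'t\<close>, and so do the
  stalks of all the subcomplexes.\<close>

lemma admissible_set:
  fixes Ar :: "((unit, 'v) acomplex \<times> (unit, 'v) acomplex \<times> (unit, 'v) amap) set" and t :: "'t itself"
  assumes inf: "infinite (UNIV :: 't set)" and Ar: "finite Ar" "Ar \<subseteq> arrs" and ab: "fits point a t" "fits point b t"
  obtains S where "\<And>al. al \<in> Ar ==> adm S al" "\<And>M. fits point (sub S M) t"
    "\<And>i s. s \<in> stc a i () ==> (a, i, s) \<in> S" "\<And>i s. s \<in> stc b i () ==> (b, i, s) \<in> S"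
proof -
  obtain h :: "'t \<times> 't => 't" where h: "inj h" by (rule inj_prod[OF inf])
  obtain k :: "int => 't" where k: "inj k" using infinite_countable_subset[OF inf] inj_compose[OF _ inj_to_nat[where 'a = int]] by (metis)
  have "\<exists>e. \<forall>i. inj_on (e i :: 'v => 't) (stc M i ())" if "fits point M t" for M using that unfolding fits_def by (auto intro: choice)
  then obtain ea eb where e: "\<And>i. inj_on (ea i :: 'v => 't) (stc a i ())" "\<And>i. inj_on (eb i :: 'v => 't) (stc b i ())" using ab by metis
  define G where "G M = {(M, i, s) |i s. s \<in> stc M i ()}" for M :: "(unit, 'v) acomplex"
  have G: "\<exists>g :: 't => 'v elt. G M \<subseteq> range g" if "\<And>i. inj_on (e i :: 'v => 't) (stc M i ())" for M e
  proof -
    let ?F = "%(_, i, s). h (k i, e i s)"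
    have "inj_on ?F (G M)" using that by (auto simp: G_def inj_on_def inj_eq[OF h] inj_eq[OF k])
    then have "x = inv_into (G M) ?F (?F x)" if "x \<in> G M" for x using that by (simp only: inv_into_f_f)
    then show ?thesis by blast
  qed
  obtain ga gb :: "'t => 'v elt" where g: "G a \<subseteq> range ga" "G b \<subseteq> range gb" using G[OF e(1)] G[OF e(2)] by blast
  obtain x :: 't where True by simp
  \<comment> \<open>One map that enumerates both starting sets: the first entry of a coded pair
    decides between \<open>a\<close> and \<open>b\<close>.\<close>
  define g0 where "g0 y = (case inv_into UNIV h y of (u, v) => if u = x then ga v else gb v)" for y
  obtain x' where x': "x' \<noteq> x" using inf by (metis (full_types) finite.emptyI finite_insert finite_subset insertI1 subsetI)
  have g0: "g0 (h (x, v)) = ga v" "g0 (h (x', v)) = gb v" for v using x' by (simp_all add: g0_def inv_f_f[OF h])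
  have "countable (ob_ops M)" for M :: "(unit, 'v) acomplex" by (simp add: ob_ops_def)
  then have "countable (\<Union>al\<in>Ar. map_ops al)" by (intro countable_UN countable_finite[OF Ar(1)]) (auto simp: map_ops_def split: prod.split)
  from small_closure[OF inf this, of g0]
  obtain S and e :: "'v elt => 't" where S: "range g0 \<subseteq> S" "inj_on e S"
      "\<And>f x y. f \<in> (\<Union>al\<in>Ar. map_ops al) ==> x \<in> S ==> y \<in> S ==> f x y \<in> S"
    by blast
  have "range ga \<subseteq> S" "range gb \<subseteq> S" unfolding image_subset_iff g0[symmetric] using S(1) by blast+
  then have GS: "G a \<subseteq> S" "G b \<subseteq> S" using g by auto
  show thesis
  proof (rule that)
    fix al assume al: "al \<in> Ar"
    then obtain A B f where "al = (A, B, f)" "A \<in> acs point" "B \<in> acs point" "f \<in> chain_maps point A B" using Ar by (auto simp: arrs_def)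
    moreover have "h x y \<in> S" if "h \<in> map_ops al" "x \<in> S" "y \<in> S" for h x y using S(3) that al by blast
    moreover have "g0 x \<in> S" using S(1) by blast
    ultimately show "adm S al" using admI by metis
  next
    fix M
    have "inj_on (%s. e (M, i, s)) (sub_car S M i)" for i using S(2) by (auto simp: inj_on_def sub_car_def)
    then show "fits point (sub S M) t" unfolding fits_def by auto
  qed (use GS in "auto simp: G_def")
qed

text \<open>A zigzag has finitely many arrows, and these form \<open>Ar\<close>. For the empty
  zigzag an identity is taken, so that its end becomes an object of \<open>sub_cat\<close>. The set
  \<open>Ob\<close> lets the lemma serve for all complexes and for the small ones.\<close>

lemma zigzag_sub_cat: assumes O: "Ob \<subseteq> acs point" shows "zigzag ((Ch point)\<lparr>Obj := Ob\<rparr>) (quasi_iso point) a b u ==>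
    \<exists>Ar. finite Ar \<and> Ar \<subseteq> arrs \<and> (\<forall>S. (\<forall>al\<in>Ar. adm S al) --> zigzag (sub_cat S Ob) (sub_W S) a b u)"
proof (induction rule: zigzag.induct)
  case (zz_nil a)
  then show ?case using O by (intro exI[of _ "{(a, a, ci point a)}"]) (auto simp: arrs_def chain_maps_iff cmap_ci dest: admD intro!: zigzag.zz_nil)
next
  case (zz_fwd a b f c u)
  then obtain Ar where Ar: "finite Ar" "Ar \<subseteq> arrs" "\<And>S. \<forall>al\<in>Ar. adm S al ==> zigzag (sub_cat S Ob) (sub_W S) b c u" by blast
  have f: "a \<in> Ob" "b \<in> Ob" "f \<in> chain_maps point a b" using zz_fwd.hyps by (simp_all add: Ch_def)
  have "zigzag (sub_cat S Ob) (sub_W S) a c (Fwd a b f # u)" if "\<forall>al\<in>insert (a, b, f) Ar. adm S al" for S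
    by (rule zigzag.zz_fwd) (use Ar(3) that f admD[OF bspec[OF that insertI1]] in simp_all)
  then show ?case using Ar(1,2) f O by (intro exI[of _ "insert (a, b, f) Ar"]) (auto simp: arrs_def)
next
  case (zz_bwd a b f c u)
  then obtain Ar where Ar: "finite Ar" "Ar \<subseteq> arrs" "\<And>S. \<forall>al\<in>Ar. adm S al ==> zigzag (sub_cat S Ob) (sub_W S) a c u" by blast
  have f: "a \<in> Ob" "b \<in> Ob" "f \<in> chain_maps point a b" "quasi_iso point a b f" using zz_bwd.hyps by (simp_all add: Ch_def)
  have "zigzag (sub_cat S Ob) (sub_W S) b c (Bwd a b f # u)" if "\<forall>al\<in>insert (a, b, f) Ar. adm S al" for S
    by (rule zigzag.zz_bwd) (use Ar(3) that f admD[OF bspec[OF that insertI1]] in simp_all)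
  then show ?case using Ar(1,2) f O by (intro exI[of _ "insert (a, b, f) Ar"]) (auto simp: arrs_def)
qed

lemma Ch_Obj_update: "(Ch point)\<lparr>Obj := acs point\<rparr> = Ch point" by (simp add: Ch_def)

text \<open>The derivation of an equivalence is finite, so it involves only finitely many arrows,
  including those of intermediate zigzags that no longer show in \<open>u\<close> and
  \<open>v\<close>.\<close>

lemma zeq_sub_cat: "zeq (Ch point) (quasi_iso point) a b u v ==>
    \<exists>Ar. finite Ar \<and> Ar \<subseteq> arrs \<and> (\<forall>S. (\<forall>al\<in>Ar. adm S al) --> zeq (sub_cat S (acs point)) (sub_W S) a b u v)"
  (is "_ ==> ?P a b u v")
proof (induction rule: zeq.induct)
  case (zeq_refl a b u)
  from zigzag_sub_cat[OF subset_refl, unfolded Ch_Obj_update, OF this] obtain Ar where Ar: "finite Ar" "Ar \<subseteq> arrs"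
     "\<And>S. \<forall>al\<in>Ar. adm S al ==> zigzag (sub_cat S (acs point)) (sub_W S) a b u"
    by blast
  then show ?case by (intro exI[of _ Ar] conjI allI impI zeq.zeq_refl)
next
  case (zeq_sym a b u v)
  from zeq_sym.IH obtain Ar where Ar: "finite Ar" "Ar \<subseteq> arrs" "\<And>S. \<forall>al\<in>Ar. adm S al ==> zeq (sub_cat S (acs point)) (sub_W S) a b u v" by blast
  then show ?case by (intro exI[of _ Ar] conjI allI impI zeq.zeq_sym[where u = u])
next
  case (zeq_trans a b u v w)
  then obtain A B where A: "finite A" "A \<subseteq> arrs" "\<And>S. \<forall>al\<in>A. adm S al ==> zeq (sub_cat S (acs point)) (sub_W S) a b u v"
    and B: "finite B" "B \<subseteq> arrs" "\<And>S. \<forall>al\<in>B. adm S al ==> zeq (sub_cat S (acs point)) (sub_W S) a b v w"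
    by blast
  show ?case
  proof (intro exI[of _ "A \<union> B"] conjI allI impI)
    fix S :: "'a elt set" assume "\<forall>al\<in>A \<union> B. adm S al"
    then show "zeq (sub_cat S (acs point)) (sub_W S) a b u w" by (intro zeq.zeq_trans[OF A(3) B(3)]) simp_all
  qed (use A B in simp_all)
next
  case (zeq_app a b u v c u' v')
  then obtain A B where A: "finite A" "A \<subseteq> arrs" "\<And>S. \<forall>al\<in>A. adm S al ==> zeq (sub_cat S (acs point)) (sub_W S) a b u v"
    and B: "finite B" "B \<subseteq> arrs" "\<And>S. \<forall>al\<in>B. adm S al ==> zeq (sub_cat S (acs point)) (sub_W S) b c u' v'"
    by blast
  show ?case
  proof (intro exI[of _ "A \<union> B"] conjI allI impI)
    fix S :: "'a elt set" assume "\<forall>al\<in>A \<union> B. adm S al"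
    then show "zeq (sub_cat S (acs point)) (sub_W S) a c (u @ u') (v @ v')" by (intro zeq.zeq_app[OF A(3) B(3)]) simp_all
  qed (use A B in simp_all)
next
  case (zeq_id a)
  show ?case using zeq.zeq_id[of a "sub_cat _ (acs point)"] zeq_id by (intro exI[of _ "{(a, a, ci point a)}"]) (auto simp: arrs_def chain_maps_iff cmap_ci dest: admD)
next
  case (zeq_comp a b c f g)
  have "zeq (sub_cat S (acs point)) (sub_W S) a c [Fwd a b f, Fwd b c g] [Fwd a c (cc point a g f)]" if "adm S (a, b, f)" "adm S (b, c, g)" for S
    using zeq.zeq_comp[of a "sub_cat S (acs point)" b c f g] zeq_comp admD[OF that(1)] admD[OF that(2)] by simp
  then show ?case using zeq_comp by (intro exI[of _ "{(a, b, f), (b, c, g)}"]) (auto simp: arrs_def)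
next
  case (zeq_inv1 a b w)
  have "zeq (sub_cat S (acs point)) (sub_W S) a a [Fwd a b w, Bwd a b w] []" if "adm S (a, b, w)" for S by (rule zeq.zeq_inv1) (use zeq_inv1 admD[OF that] in simp_all)
  then show ?case using zeq_inv1 by (intro exI[of _ "{(a, b, w)}"]) (auto simp: arrs_def)
next
  case (zeq_inv2 a b w)
  have "zeq (sub_cat S (acs point)) (sub_W S) b b [Bwd a b w, Fwd a b w] []" if "adm S (a, b, w)" for S by (rule zeq.zeq_inv2) (use zeq_inv2 admD[OF that] in simp_all)
  then show ?case using zeq_inv2 by (intro exI[of _ "{(a, b, w)}"]) (auto simp: arrs_def)
qed

section \<open>Passing to subcomplexes as a functor, and full faithfulness of the small
  localization\<close>

definition sub_functor :: "'v elt set => ((unit, 'v) acomplex, (unit, 'v) amap, (unit, 'v) acomplex, (unit, 'v) amap) ftor" where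
  "sub_functor S = \<lparr>onObj = sub S, onHom = (%A B f. rm S A f)\<rparr>"

lemma sub_functor_simps [simp]: "ob (sub_functor S) = sub S" "hm (sub_functor S) A B f = rm S A f" by (simp_all add: sub_functor_def)

text \<open>The identity map of \<open>sub S M\<close>, read with target \<open>M\<close>, is the
  inclusion of the subcomplex; it is natural on arrows that preserve \<open>S\<close>. With small
  values and preserved quasi-isomorphisms, this lets zigzags be compared with their cut-down
  copies.\<close>

lemma is_functor_sub: assumes Ob: "Ob \<subseteq> acs point" and fits: "\<And>M. fits point (sub S M) t" shows "is_functor (sub_cat S Ob) (small_Ch t) (sub_functor S)"
    and "preserves (sub_cat S Ob) (sub_W S) (quasi_iso point) (sub_functor S)"
    and "is_nat_trans (sub_cat S Ob) (Ch point) (sub_functor S) id_functor (%M. ci point (sub S M))"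
proof -
  have "rm S A (ci point A) = ci point (sub S A)" for A by (auto simp: rm_def ci_def ad_id_def fun_eq_iff sub_car_def)
  moreover have "rm S A (cc point A g f) = cc point (sub S A) (rm S B g) (rm S A f)" if "sub_map S A B f" for A B f g
    using that by (auto simp: rm_def cc_def ad_comp_def compose_def fun_eq_iff sub_car_def sub_map_def)
  ultimately show "is_functor (sub_cat S Ob) (small_Ch t) (sub_functor S)"
    using Ob fits by (auto simp: is_functor_def sub_acomplex chain_maps_iff subset_iff intro!: rm_cmap)
  show "preserves (sub_cat S Ob) (sub_W S) (quasi_iso point) (sub_functor S)"
    using Ob by (auto simp: preserves_def sub_W_def chain_maps_iff subset_iff intro!: rm_quasi_iso)
  have inc: "cmap point (sub S M) M (ci point (sub S M))" if M: "M \<in> acs point" "sub_ob S M" for M using ac_closed[OF sub_acomplex[OF M], simplified] M(2)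
    by (intro cmapI) (auto simp: ci_def ad_id_def sub_car_def[of S M] sub_ob_def)
  have "cc point (sub S A) (ci point (sub S B)) (rm S A f) = cc point (sub S A) f (ci point (sub S A))" if "sub_map S A B f" for A B f
    using that by (auto simp: rm_def cc_def ci_def ad_id_def ad_comp_def compose_def fun_eq_iff sub_car_def sub_map_def)
  then show "is_nat_trans (sub_cat S Ob) (Ch point) (sub_functor S) id_functor (%M. ci point (sub S M))"
    using Ob by (auto simp: is_nat_trans_def chain_maps_iff subset_iff inc)
qed

lemma is_functor_inclusion: "is_functor (small_Ch t) (Ch point) id_functor" "preserves (small_Ch t) (quasi_iso point) (quasi_iso point) id_functor"
  by (auto simp: is_functor_def preserves_def)

lemma zeq_remove_ends: assumes C: "a \<in> Obj C" "b \<in> Obj C" and u: "zigzag C W a b u" and v: "zigzag C W a b v"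
    and eq: "zeq C W a b (u @ [Fwd b b (Idt C b)]) (Fwd a a (Idt C a) # v)"
  shows "zeq C W a b u v"
proof -
  have "zeq C W a b (u @ []) (u @ [Fwd b b (Idt C b)])" by (rule zeq_appL[OF u zeq_sym[OF zeq_id[OF C(2)]]])
  moreover have "zeq C W a b ([Fwd a a (Idt C a)] @ v) ([] @ v)" by (rule zeq_appR[OF zeq_id[OF C(1)] v])
  ultimately show ?thesis using zeq_trans[OF zeq_trans[OF _ eq]] by simp
qed

context
  fixes t :: "'t itself" and a b :: "(unit, 'v) acomplex"
  assumes inf: "infinite (UNIV :: 't set)" and a: "a \<in> acs point" "fits point a t" and b: "b \<in> acs point" "fits point b t"
begin

text \<open>Fullness. The zigzag is cut down by a suitable \<open>S\<close>, which makes it small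
  and leaves its ends unchanged; naturality of the inclusions shows that it still represents the
  same morphism.\<close>

lemma zigzag_small: assumes u: "zigzag (Ch point) (quasi_iso point) a b u"
  shows "\<exists>u'. zigzag (small_Ch t) (quasi_iso point) a b u' \<and> zeq (Ch point) (quasi_iso point) a b u' u"
proof -
  obtain Ar where Ar: "finite Ar" "Ar \<subseteq> arrs" "\<forall>S. (\<forall>al\<in>Ar. adm S al) --> zigzag (sub_cat S (acs point)) (sub_W S) a b u"
    using zigzag_sub_cat[OF subset_refl, unfolded Ch_Obj_update, OF u] by blast
  obtain S where S: "\<And>al. al \<in> Ar ==> adm S al" "\<And>M. fits point (sub S M) t"
    "\<And>i s. s \<in> stc a i () ==> (a, i, s) \<in> S" "\<And>i s. s \<in> stc b i () ==> (b, i, s) \<in> S"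
    using admissible_set[OF inf Ar(1,2) a(2) b(2)] by metis
  note F = is_functor_sub[OF subset_refl S(2)]
  note ab = sub_whole[OF a(1) S(3)] sub_whole[OF b(1) S(4)]
  have z: "zigzag (sub_cat S (acs point)) (sub_W S) a b u" using Ar(3) S(1) by blast
  have z': "zigzag (small_Ch t) (quasi_iso point) a b (map (map_arrow (sub_functor S)) u)" using zigzag_map[OF F(1,2) z] by (simp add: ab)
  have "is_functor (sub_cat S (acs point)) (Ch point) (sub_functor S)" using F(1) by (auto simp: is_functor_def)
  from zeq_naturality[OF is_category_Ch this F(2) _ _ F(3) z]
  have "zeq (Ch point) (quasi_iso point) a b (map (map_arrow (sub_functor S)) u @ [Fwd b b (Idt (Ch point) b)]) (Fwd a a (Idt (Ch point) a) # u)"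
    by (simp add: ab is_functor_def preserves_def sub_W_def)
  then have "zeq (Ch point) (quasi_iso point) a b (map (map_arrow (sub_functor S)) u) u"
    by (rule zeq_remove_ends[rotated 4]) (use a b u zigzag_map[OF is_functor_inclusion z'] in simp_all)
  then show ?thesis using z' by blast
qed

text \<open>Faithfulness. A derivation that passes through large complexes is carried by
  \<open>sub S\<close> to one among small complexes, which relates the cut-down copies of
  \<open>u\<close> and \<open>v\<close>.\<close>

lemma zeq_small: assumes u: "zigzag (small_Ch t) (quasi_iso point) a b u" and v: "zigzag (small_Ch t) (quasi_iso point) a b v"
    and uv: "zeq (Ch point) (quasi_iso point) a b u v"
  shows "zeq (small_Ch t) (quasi_iso point) a b u v"
proof -
  let ?O = "{M \<in> acs point. fits point M t} :: (unit, 'v) acomplex set"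
  have C: "(Ch point)\<lparr>Obj := ?O\<rparr> = small_Ch t" by (simp add: small_Ch_def)
  have O: "?O \<subseteq> acs point" by blast
  obtain A1 where A1: "finite A1" "A1 \<subseteq> arrs" "\<forall>S. (\<forall>al\<in>A1. adm S al) --> zigzag (sub_cat S ?O) (sub_W S) a b u"
    using zigzag_sub_cat[OF O, of a b u, unfolded C, OF u] by blast
  obtain A2 where A2: "finite A2" "A2 \<subseteq> arrs" "\<forall>S. (\<forall>al\<in>A2. adm S al) --> zigzag (sub_cat S ?O) (sub_W S) a b v"
    using zigzag_sub_cat[OF O, of a b v, unfolded C, OF v] by blast
  obtain A3 where A3: "finite A3" "A3 \<subseteq> arrs" "\<forall>S. (\<forall>al\<in>A3. adm S al) --> zeq (sub_cat S (acs point)) (sub_W S) a b u v"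
    using zeq_sub_cat[OF uv] by blast
  have "finite (A1 \<union> A2 \<union> A3)" "A1 \<union> A2 \<union> A3 \<subseteq> arrs" using A1 A2 A3 by simp_all
  then obtain S where S: "\<And>al. al \<in> A1 \<union> A2 \<union> A3 ==> adm S al" "\<And>M. fits point (sub S M) t"
    "\<And>i s. s \<in> stc a i () ==> (a, i, s) \<in> S" "\<And>i s. s \<in> stc b i () ==> (b, i, s) \<in> S"
    using admissible_set[OF inf _ _ a(2) b(2), of "A1 \<union> A2 \<union> A3"] by metis
  note ab = sub_whole[OF a(1) S(3)] sub_whole[OF b(1) S(4)]
  note F = is_functor_sub[OF subset_refl S(2)]
  note F' = is_functor_sub[OF O S(2)]
  have id: "is_functor (sub_cat S ?O) (small_Ch t) id_functor" "preserves (sub_cat S ?O) (sub_W S) (quasi_iso point) id_functor"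
    by (auto simp: is_functor_def preserves_def sub_W_def)
  have nat: "is_nat_trans (sub_cat S ?O) (small_Ch t) (sub_functor S) id_functor (%M. ci point (sub S M))" using F'(3) by (simp add: is_nat_trans_def)
  \<comment> \<open>A small zigzag is equivalent to its cut-down copy by an equivalence inside
    \<open>small_Ch\<close>. This is where \<open>u\<close> and \<open>v\<close> must be zigzags
    over the small objects compatible with \<open>S\<close>, as \<open>A1\<close> and
    \<open>A2\<close> ensure.\<close>
  have rel: "zeq (small_Ch t) (quasi_iso point) a b (map (map_arrow (sub_functor S)) w) w"
    if w: "zigzag (sub_cat S ?O) (sub_W S) a b w" "zigzag (small_Ch t) (quasi_iso point) a b w" for w
  proof (rule zeq_remove_ends)
    show "zeq (small_Ch t) (quasi_iso point) a b (map (map_arrow (sub_functor S)) w @ [Fwd b b (Idt (small_Ch t) b)]) (Fwd a a (Idt (small_Ch t) a) # w)"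
      using zeq_naturality[OF is_category_small_Ch F'(1,2) id nat w(1)] by (simp add: ab)
    show "zigzag (small_Ch t) (quasi_iso point) a b (map (map_arrow (sub_functor S)) w)" using zigzag_map[OF F'(1,2) w(1)] by (simp add: ab)
  qed (use a b w in simp_all)
  have "zeq (small_Ch t) (quasi_iso point) a b (map (map_arrow (sub_functor S)) u) (map (map_arrow (sub_functor S)) v)"
    using zeq_map[OF F(1,2), of a b u v] A3(3) S(1) by (simp add: ab)
  moreover have "zigzag (sub_cat S ?O) (sub_W S) a b u" "zigzag (sub_cat S ?O) (sub_W S) a b v" using A1(3) A2(3) S(1) by simp_all
  ultimately show ?thesis using zeq_trans[OF zeq_trans[OF zeq_sym[OF rel[OF _ u]]] rel[OF _ v]] by blast
qed

end

text \<open>The inclusion of localizations is full and faithful on small complexes, so its own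
  action on morphisms into \<open>Z\<close> is the required bijection.\<close>

lemma right_adjoint_value_inclusion:
  fixes t :: "'t itself" and Z :: "(unit, 'v) acomplex"
  assumes inf: "infinite (UNIV :: 't set)" and Z: "Z \<in> acs point" "fits point Z t"
  shows "right_adjoint_value (localization (small_Ch t) (quasi_iso point)) (DCat point) (loc_lift (small_Ch t) (Ch point) (quasi_iso point) id_functor) Z Z"
proof -
  let ?I = "loc_lift (small_Ch t) (Ch point) (quasi_iso point) id_functor :: ((unit, 'v) acomplex, _, (unit, 'v) acomplex, _) ftor"
  let ?z = "zclass (Ch point) (quasi_iso point)" and ?z' = "zclass (small_Ch t) (quasi_iso point)"
  note I = is_functor_loc_lift[OF is_functor_inclusion[of t], folded DCat_def]
  have hom: "hm ?I a b (?z' a b u) = ?z a b u" if "zigzag (small_Ch t) (quasi_iso point) a b u" for a b u using onHom_loc_lift[OF is_functor_inclusion that] by simp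
  have "bij_betw (hm ?I a Z) (Hom (localization (small_Ch t) (quasi_iso point)) a Z) (Hom (DCat point) (ob ?I a) Z)"
    if "a \<in> Obj (localization (small_Ch t) (quasi_iso point))" for a
    unfolding bij_betw_def
  proof
    have a: "a \<in> acs point" "fits point a t" using that by simp_all
    show "inj_on (hm ?I a Z) (Hom (localization (small_Ch t) (quasi_iso point)) a Z)"
    proof (rule inj_onI, elim Hom_localizationE)
      fix f g u v assume fg: "hm ?I a Z f = hm ?I a Z g" and u: "zigzag (small_Ch t) (quasi_iso point) a Z u" "f = ?z' a Z u"
        and v: "zigzag (small_Ch t) (quasi_iso point) a Z v" "g = ?z' a Z v"
      have "zeq (Ch point) (quasi_iso point) a Z u v" using fg zigzag_map[OF is_functor_inclusion u(1)] unfolding u(2) v(2) hom[OF u(1)] hom[OF v(1)]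
        by (simp add: zclass_eq_iff)
      then show "f = g" unfolding u(2) v(2) by (intro zclass_eqI zeq_small[OF inf a Z u(1) v(1)])
    qed
    show "hm ?I a Z ` Hom (localization (small_Ch t) (quasi_iso point)) a Z = Hom (DCat point) (ob ?I a) Z"
    proof (intro equalityI subsetI)
      fix f assume "f \<in> hm ?I a Z ` Hom (localization (small_Ch t) (quasi_iso point)) a Z"
      then show "f \<in> Hom (DCat point) (ob ?I a) Z" using is_functorD(2)[OF I, of a Z] a Z by auto
    next
      fix f assume "f \<in> Hom (DCat point) (ob ?I a) Z"
      then obtain u where u: "zigzag (Ch point) (quasi_iso point) a Z u" "f = ?z a Z u" unfolding DCat_def by (auto elim: Hom_localizationE)
      obtain u' where u': "zigzag (small_Ch t) (quasi_iso point) a Z u'" "zeq (Ch point) (quasi_iso point) a Z u' u" using zigzag_small[OF inf a Z u(1)] by blast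
      have "f = hm ?I a Z (?z' a Z u')" unfolding u(2) hom[OF u'(1)] by (rule zclass_eqI[OF u'(2), symmetric])
      then show "f \<in> hm ?I a Z ` Hom (localization (small_Ch t) (quasi_iso point)) a Z" using Hom_localizationI[OF u'(1)] by blast
    qed
  qed
  moreover have "hm ?I a Z (Comp (localization (small_Ch t) (quasi_iso point)) a b Z g f) = Comp (DCat point) (ob ?I a) (ob ?I b) Z (hm ?I b Z g) (hm ?I a b f)"
    if "a \<in> Obj (localization (small_Ch t) (quasi_iso point))" "b \<in> Obj (localization (small_Ch t) (quasi_iso point))"
      "f \<in> Hom (localization (small_Ch t) (quasi_iso point)) a b" "g \<in> Hom (localization (small_Ch t) (quasi_iso point)) b Z" for a b f g
    using is_functorD(4)[OF I that(1,2) _ that(3,4)] Z by simp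
  ultimately show ?thesis unfolding right_adjoint_value_def using Z by (intro conjI exI[of _ "%a. hm ?I a Z"]) (simp_all add: DCat_def)
qed

section \<open>Cohomology in the derived category\<close>

text \<open>Cohomology at \<open>p\<close> extended to zigzags, a backward arrow acting by the
  inverse of an isomorphism. By \<open>act_zeq\<close> it depends on the class only, which makes
  cohomology an invariant of isomorphism in the derived category.\<close>

fun act :: "int => 'x => (('x, 'u) acomplex, ('x, 'u) amap) arrow list => 'u set => 'u set" where "act i p [] c = c"
| "act i p (Fwd a b f # u) c = act i p u (cohomology_map b f i p c)"
| "act i p (Bwd a b w # u) c = act i p u (inv_into (carrier (cohomology a i p)) (cohomology_map b w i p) c)"

lemma act_append: "act i p (u @ v) c = act i p v (act i p u c)" by (induction i p u c rule: act.induct) simp_all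

context
  fixes X :: "'x topology" and p :: 'x and i :: int
  assumes p: "p \<in> tsp X"
begin

lemma act_hom: "zigzag (Ch X) (quasi_iso X) a b u ==> act i p u \<in> hom (cohomology a i p) (cohomology b i p)"
proof (induction rule: zigzag.induct)
  case (zz_nil a)
  then show ?case by (simp add: hom_def)
next
  case (zz_fwd a b f c u)
  then have "cohomology_map b f i p \<in> hom (cohomology a i p) (cohomology b i p)" using cohomology_map_hom[OF _ _ _ p] by (simp add: chain_maps_iff)
  from hom_compose[OF this zz_fwd.IH] show ?case by (simp add: comp_def)
next
  case (zz_bwd a b w c u)
  then have "cohomology_map b w i p \<in> iso (cohomology a i p) (cohomology b i p)" using p by (simp add: quasi_iso_def)
  moreover have "group (cohomology a i p)" using comm_group_cohomology[of a X p i] p zz_bwd by (simp add: comm_group_def)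
  ultimately have "inv_into (carrier (cohomology a i p)) (cohomology_map b w i p) \<in> hom (cohomology b i p) (cohomology a i p)"
    using group.iso_set_sym[of "cohomology a i p"] unfolding iso_def by blast
  from hom_compose[OF this zz_bwd.IH] show ?case by (simp add: comp_def)
qed

lemma carrier_cohomologyE: assumes "c \<in> carrier (cohomology F i p)"
  obtains a where "a \<in> carrier (cocycles F i p)" "c = coboundaries F i p #>\<^bsub>cocycles F i p\<^esub> a"
  using assms by (auto simp: cohomology_def carrier_FactGroup)

lemma act_zeq: "zeq (Ch X) (quasi_iso X) a b u v ==> \<forall>c\<in>carrier (cohomology a i p). act i p u c = act i p v c"
proof (induction rule: zeq.induct)
  case (zeq_app a b u v c u' v')
  show ?case
  proof
    fix d assume d: "d \<in> carrier (cohomology a i p)"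
    have "act i p u d \<in> carrier (cohomology b i p)" using act_hom d zeq_zigzag[OF is_category_Ch zeq_app.hyps(1)] hom_in_carrier by fast
    then show "act i p (u @ u') d = act i p (v @ v') d" using zeq_app.IH d by (simp add: act_append)
  qed
next
  case (zeq_id a)
  then have a: "a \<in> acs X" by simp
  show ?case
  proof
    fix c assume c: "c \<in> carrier (cohomology a i p)"
    then obtain s where s: "s \<in> carrier (cocycles a i p)" "c = coboundaries a i p #>\<^bsub>cocycles a i p\<^esub> s" by (rule carrier_cohomologyE)
    show "act i p [Fwd a a (Idt (Ch X) a)] c = act i p [] c" using s(1) p by (simp add: s(2) cohomology_map_coset[OF a a cmap_ci[OF a] p s(1)] carrier_cocycles)
  qed
next
  case (zeq_comp a b c f g)
  then have o: "a \<in> acs X" "b \<in> acs X" "c \<in> acs X" and f: "cmap X a b f" and g: "cmap X b c g" by (simp_all add: chain_maps_iff)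
  show ?case
  proof
    fix d assume d: "d \<in> carrier (cohomology a i p)"
    then obtain s where s: "s \<in> carrier (cocycles a i p)" "d = coboundaries a i p #>\<^bsub>cocycles a i p\<^esub> s" by (rule carrier_cohomologyE)
    have fs: "f i p s \<in> carrier (cocycles b i p)" using cmap_cocycles[OF o(1,2) f p] s(1) by (rule hom_in_carrier)
    show "act i p [Fwd a b f, Fwd b c g] d = act i p [Fwd a c (Comp (Ch X) a b c g f)] d"
      using s(1) p by (simp add: s(2) cohomology_map_coset[OF o(1,2) f p s(1)] cohomology_map_coset[OF o(2,3) g p fs]
          cohomology_map_coset[OF o(1,3) cmap_cc[OF o(1) f g] p s(1)] carrier_cocycles)
  qed
next
  case (zeq_inv1 a b w)
  then have "bij_betw (cohomology_map b w i p) (carrier (cohomology a i p)) (carrier (cohomology b i p))" using p by (simp add: quasi_iso_def iso_def)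
  then show ?case by (auto simp: bij_betw_def inv_into_f_f)
next
  case (zeq_inv2 a b w)
  then have "bij_betw (cohomology_map b w i p) (carrier (cohomology a i p)) (carrier (cohomology b i p))" using p by (simp add: quasi_iso_def iso_def)
  then show ?case by (auto simp: bij_betw_def f_inv_into_f)
qed auto

lemma isomorphic_cohomology: assumes "isomorphic_in (DCat X) D K" obtains h where "h \<in> iso (cohomology K i p) (cohomology D i p)"
proof -
  from assms obtain f g where f: "f \<in> Hom (DCat X) D K" and g: "g \<in> Hom (DCat X) K D"
    and gf: "Comp (DCat X) D K D g f = Idt (DCat X) D" "Comp (DCat X) K D K f g = Idt (DCat X) K"
    unfolding isomorphic_in_def by blast
  let ?z = "zigzag (Ch X) (quasi_iso X)" and ?e = "zeq (Ch X) (quasi_iso X)"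
  from f g obtain u v where u: "?z D K u" "f = zclass (Ch X) (quasi_iso X) D K u" and v: "?z K D v" "g = zclass (Ch X) (quasi_iso X) K D v"
    unfolding DCat_def by (metis Hom_localizationE)
  have "?e D D (u @ v) []" "?e K K (v @ u) []" using gf zigzag_append[OF u(1) v(1)] zigzag_append[OF v(1) u(1)] unfolding DCat_def u(2) v(2)
    by (simp_all add: Comp_localization[OF u(1) v(1)] Comp_localization[OF v(1) u(1)] Idt_localization zclass_eq_iff)
  note e = this[THEN act_zeq, unfolded act_append act.simps]
  note h = act_hom[OF u(1)] act_hom[OF v(1)]
  have "bij_betw (act i p v) (carrier (cohomology K i p)) (carrier (cohomology D i p))" by (rule bij_betwI[where g = "act i p u"]) (use e h in "auto simp: hom_def")
  then show thesis using that h(2) by (simp add: iso_def)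
qed

end

section \<open>Finite generation\<close>

lemma finitely_generated_iso: assumes "finitely_generated G" "h \<in> iso G H" "group G" "group H" shows "finitely_generated H"
proof -
  interpret group_hom G H h using assms by (simp add: group_hom_def group_hom_axioms_def iso_def)
  obtain S where "finite S" "S \<subseteq> carrier G" "generate G S = carrier G" using assms(1) unfolding finitely_generated_def by blast
  then show ?thesis unfolding finitely_generated_def using generate_img[of S] assms(2) by (intro exI[of _ "h ` S"]) (auto simp: iso_def bij_betw_def)
qed

text \<open>On \<open>H\<close> the maps \<open>ph i\<close> are jointly injective into a finite
  power of the integers. By induction on the coordinates the part of \<open>H\<close> on which
  \<open>ph j\<close> vanishes is covered by finitely many generators; one more element, with least
  positive value of \<open>ph j\<close>, covers the rest by division with remainder.\<close>

lemma (in comm_group) finitely_generated_integer_homs: assumes "finite I" "\<And>i. i \<in> I ==> ph i \<in> hom G integer_group" "subgroup H G"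
    "\<And>x. x \<in> H ==> (\<And>i. i \<in> I ==> ph i x = 0) ==> x = \<one>"
  shows "\<exists>S. finite S \<and> S \<subseteq> H \<and> H \<subseteq> generate G S"
  using assms
proof (induction I arbitrary: H)
  case empty
  then have "H \<subseteq> generate G {}" by (auto intro: generate.one)
  then show ?case by blast
next
  case (insert j I)
  interpret H: subgroup H G by fact
  interpret ph: group_hom G integer_group "ph j" using insert.prems(1) by (simp add: group_hom_def group_hom_axioms_def)
  let ?H = "{x \<in> H. ph j x = 0}"
  have "subgroup ?H G" by unfold_locales (auto simp: ph.hom_inv)
  then obtain S where S: "finite S" "S \<subseteq> ?H" "?H \<subseteq> generate G S"
  proof -
    have "\<exists>S. finite S \<and> S \<subseteq> ?H \<and> ?H \<subseteq> generate G S" by (rule insert.IH) (use insert.prems \<open>subgroup ?H G\<close> in auto)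
    then show thesis using that by blast
  qed
  show ?case
  proof (cases "?H = H")
    case True
    then show ?thesis using S by blast
  next
    case False
    then obtain y where y: "y \<in> H" "ph j y \<noteq> 0" by blast
    define Q where "Q n \<longleftrightarrow> n > 0 \<and> (\<exists>x\<in>H. ph j x = int n)" for n
    have "Q (nat \<bar>ph j y\<bar>)"
    proof (cases "ph j y > 0")
      case False
      then have "ph j (inv y) = int (nat \<bar>ph j y\<bar>)" using y by simp
      then show ?thesis using H.m_inv_closed[OF y(1)] y(2) unfolding Q_def by auto
    qed (use y in "auto simp: Q_def")
    \<comment> \<open>Such a value exists because some element or its inverse has positive value. By
      minimality no remainder modulo \<open>d\<close> can be positive.\<close>
    define d where "d = (LEAST n. Q n)"
    have "Q d" unfolding d_def by (rule LeastI) fact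
    then obtain x0 where x0: "x0 \<in> H" "ph j x0 = int d" and d: "d > 0" by (auto simp: Q_def)
    have "x \<in> generate G (insert x0 S)" if x: "x \<in> H" for x
    proof -
      define k where "k = ph j x div int d"
      define z where "z = x \<otimes> x0 [^] (- k)"
      have xc: "x \<in> carrier G" "x0 \<in> carrier G" using x x0 by auto
      have z: "z \<in> H" unfolding z_def by (intro H.m_closed x subgroup_int_pow_closed[OF insert.prems(2) x0(1)])
      have "ph j (x0 [^] (- k)) = - k * int d" using xc by (simp add: ph.hom_int_pow x0(2))
      then have "ph j z = ph j x mod int d" using xc by (simp add: z_def k_def minus_div_mult_eq_mod [symmetric])
      moreover have "\<not> Q (nat (ph j x mod int d))" using not_less_Least[of "nat (ph j x mod int d)" Q] d by (simp add: d_def[symmetric] nat_less_iff)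
      moreover have "ph j x mod int d = 0 \<or> ph j x mod int d > 0" using pos_mod_sign[of "int d" "ph j x"] d by linarith
      ultimately have "ph j z = 0" using z by (auto simp: Q_def)
      then have "z \<in> generate G (insert x0 S)" using S(3) z mono_generate[of S "insert x0 S"] by blast
      moreover have "x0 [^] k \<in> generate G (insert x0 S)" by (rule subgroup_int_pow_closed[OF generate_is_subgroup]) (use S(2) xc in "auto intro: generate.incl")
      moreover have "x = z \<otimes> x0 [^] k" using xc by (simp add: z_def m_assoc int_pow_mult[symmetric])
      ultimately show ?thesis by (metis generate.eng)
    qed
    then show ?thesis using S x0 by (intro exI[of _ "insert x0 S"]) auto
  qed
qed

text \<open>The cocycles form a subgroup to which \<open>finitely_generated_integer_homs\<close>
  applies, and cohomology is their quotient.\<close>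

lemma finitely_generated_cohomology: assumes F: "F \<in> acs X" and p: "p \<in> tsp X" and I: "finite I"
    and ph: "\<And>c. c \<in> I ==> ph c \<in> hom (stk F i p) integer_group"
    and inj: "\<And>s. s \<in> stc F i p ==> (\<And>c. c \<in> I ==> ph c s = 0) ==> s = 1[stk F i p]"
  shows "finitely_generated (cohomology F i p)"
proof -
  interpret Z: comm_group "cocycles F i p" by (rule comm_group_cocycles[OF F p])
  interpret H: comm_group "cohomology F i p" by (rule comm_group_cohomology[OF F p])
  let ?\<pi> = "%a. coboundaries F i p #>\<^bsub>cocycles F i p\<^esub> a"
  interpret N: normal "coboundaries F i p" "cocycles F i p" by (rule Z.subgroup_imp_normal[OF subgroup_coboundaries[OF F p]])
  interpret \<pi>: group_hom "cocycles F i p" "cohomology F i p" ?\<pi> unfolding group_hom_def group_hom_axioms_def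
    using N.r_coset_hom_Mod Z.is_group H.is_group by (simp add: cohomology_def)
  obtain S where S: "finite S" "S \<subseteq> carrier (cocycles F i p)" "carrier (cocycles F i p) \<subseteq> generate (cocycles F i p) S"
  proof -
    have "\<exists>S. finite S \<and> S \<subseteq> carrier (cocycles F i p) \<and> carrier (cocycles F i p) \<subseteq> generate (cocycles F i p) S"
      by (rule Z.finitely_generated_integer_homs[OF I _ Z.subgroup_self, of ph]) (use ph inj in "auto simp: hom_def carrier_cocycles")
    then show thesis using that by blast
  qed
  have "generate (cohomology F i p) (?\<pi> ` S) = ?\<pi> ` carrier (cocycles F i p)" using \<pi>.generate_img[OF S(2)] S(3) Z.generate_incl[OF S(2)] by auto
  also have "\<dots> = carrier (cohomology F i p)" by (auto simp: cohomology_def carrier_FactGroup)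
  finally show ?thesis unfolding finitely_generated_def using S(1,2) by (intro exI[of _ "?\<pi> ` S"]) auto
qed

lemma trivial_cohomology: assumes F: "F \<in> acs X" and p: "p \<in> tsp X" and tr: "trivial_group (stk F i p)" shows "trivial_group (cohomology F i p)"
proof -
  interpret Z: comm_group "cocycles F i p" by (rule comm_group_cocycles[OF F p])
  interpret H: comm_group "cohomology F i p" by (rule comm_group_cohomology[OF F p])
  have "carrier (cocycles F i p) = {1[cocycles F i p]}" using tr Z.one_closed by (auto simp: trivial_group_def carrier_cocycles)
  then have "\<exists>x. carrier (cohomology F i p) = {x}" by (simp add: cohomology_def carrier_FactGroup)
  then show ?thesis using H.one_closed H.is_group by (auto simp: trivial_group_def)
qed

lemma trivial_group_iso: "trivial_group G ==> h \<in> iso G H ==> group H ==> trivial_group H" by (rule isomorphic_group_triviality1[OF is_isoI])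

section \<open>The dualizing complex\<close>

lemma ad_isomorphic_trans: assumes A: "A \<in> abelian_data X" and "ad_isomorphic X A B" "ad_isomorphic X B C" shows "ad_isomorphic X A C"
proof -
  obtain f g where f: "f \<in> ad_hom X A B" "\<And>p. p \<in> tsp X ==> f p \<in> iso (stalk A p) (stalk B p)"
    and g: "g \<in> ad_hom X B C" "\<And>p. p \<in> tsp X ==> g p \<in> iso (stalk B p) (stalk C p)"
    using assms(2,3) unfolding ad_isomorphic_def by blast
  have r: "res A p q s \<in> carrier (stalk A q)" if "pt_le X p q" "s \<in> carrier (stalk A p)" for p q s using A that by (auto simp: abelian_data_def hom_def)
  have iso: "ad_comp X A g f p \<in> iso (stalk A p) (stalk C p)" if p: "p \<in> tsp X" for p
  proof -
    have "g p \<circ> f p \<in> iso (stalk A p) (stalk C p)" by (rule iso_set_trans[OF f(2)[OF p] g(2)[OF p]])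
    moreover have "group (stalk A p)" using A p by (auto simp: abelian_data_def comm_group_def)
    ultimately have "compose (carrier (stalk A p)) (g p) (f p) \<in> iso (stalk A p) (stalk C p)"
      using monoid.m_closed[OF group.is_monoid, of "stalk A p"] by (auto simp: iso_def hom_def compose_def bij_betw_def inj_on_def image_iff)
    then show ?thesis using p by (simp add: ad_comp_def)
  qed
  have fc: "f p s \<in> carrier (stalk B p)" if "p \<in> tsp X" "s \<in> carrier (stalk A p)" for p s using f(2)[OF that(1)] that(2) by (auto simp: iso_def hom_def)
  have "ad_comp X A g f \<in> ad_hom X A C" unfolding ad_hom_def
  proof (intro CollectI conjI ballI allI impI IntI)
    fix p q s assume le: "pt_le X p q" and s: "s \<in> carrier (stalk A p)"
    have "f q (res A p q s) = res B p q (f p s)" "g q (res B p q (f p s)) = res C p q (g p (f p s))"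
      using f(1) g(1) le s fc[OF pt_leD(1)[OF le] s] by (auto simp: ad_hom_def)
    then show "ad_comp X A g f q (res A p q s) = res C p q (ad_comp X A g f p s)" using pt_leD[OF le] s r[OF le s] by (simp add: ad_comp_def compose_def)
  qed (use iso in "auto simp: iso_def ad_comp_def")
  then show ?thesis using iso unfolding ad_isomorphic_def by blast
qed

lemma ad_isomorphic_enc:
  fixes t :: "'t itself"
  assumes F: "F \<in> acs X" and fits: "fits X F t"
  shows "ad_isomorphic X (trm (enc X F :: ('x, 't) acomplex) i) (trm F i)"
proof -
  have "dm X F i p \<in> iso (stk (enc X F :: ('x, 't) acomplex) i p) (stk F i p)" if p: "p \<in> tsp X" for p using cmapD(2)[OF dm_cmap[OF F fits] p, of i] p
    by (auto simp: iso_def bij_betw_def inj_on_def enc_simps[OF F fits] dm_ee[OF F fits] image_iff)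
  then show ?thesis unfolding ad_isomorphic_def using cmapD(1)[OF dm_cmap[OF F fits]] by blast
qed

lemma ad_is_zero_enc:
  fixes t :: "'t itself"
  assumes F: "F \<in> acs X" and fits: "fits X F t" and "ad_is_zero X (trm F i)"
  shows "ad_is_zero X (trm (enc X F :: ('x, 't) acomplex) i)"
  unfolding ad_is_zero_def
proof
  fix p assume p: "p \<in> tsp X"
  then show "trivial_group (stk (enc X F :: ('x, 't) acomplex) i p)" using assms(3) acD(2)[OF enc_acomplex[OF F fits] p, of i]
    by (simp add: ad_is_zero_def trivial_group_def enc_simps[OF F fits])
qed

text \<open>A copy of the integers is countable, whatever universe it lives in, and the other terms
  are trivial.\<close>

lemma is_integers_fits:
  fixes t :: "'t itself"
  assumes inf: "infinite (UNIV :: 't set)" and Z: "is_integers Z"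
  shows "fits point Z t"
  unfolding fits_def
proof (intro allI ballI)
  fix i and p :: unit assume "p \<in> tsp point"
  obtain k :: "nat => 't" where k: "inj k" using infinite_countable_subset[OF inf] by blast
  show "\<exists>e :: 'a => 't. inj_on e (stc Z i p)"
  proof (cases "i = 0")
    case True
    obtain f where "f \<in> iso (stk Z 0 p) (stalk (Z_on UNIV) p)" using Z by (auto simp: is_integers_def ad_isomorphic_def)
    then have "inj_on f (stc Z 0 p)" by (simp add: iso_def bij_betw_def)
    then have "inj_on (%s. k (to_nat (f s))) (stc Z i p)" by (auto simp: inj_on_def inj_eq[OF k] True)
    then show ?thesis by blast
  next
    case False
    then have "stc Z i p = {1[stk Z i p]}" using Z by (simp add: is_integers_def ad_is_zero_def trivial_group_def)
    then show ?thesis by (intro exI[of _ "%_. undefined"]) simp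
  qed
qed

lemma is_integers_exists: assumes inf: "infinite (UNIV :: 'v set)" shows "\<exists>Z :: (unit, 'v) acomplex. is_integers Z"
proof -
  define B :: "(unit, int) acomplex" where
    "B = \<lparr>trm = (%i. Z_on (if i = 0 then UNIV else {})), dif = (%i p. restrict (%_. 0) (carrier (stalk (Z_on (if i = 0 then UNIV else {})) p)))\<rparr>"
  have B: "stk B i p = (if i = 0 then integer_group else singleton_group 0)" "res (trm B i) p q s = (if i = 0 then s else 0)"
     "dif B i p = restrict (%_. 0) (stc B i p)" for i p q s
    by (simp_all add: B_def Z_on_def)
  have ac: "B \<in> acs point" by (rule acomplexesI) (simp add: B abelian_integer_group, auto simp: B hom_def singleton_group_def)
  obtain k :: "nat => 'v" where k: "inj k" using infinite_countable_subset[OF inf] by blast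
  have fits: "fits point B TYPE('v)" unfolding fits_def by (intro allI ballI exI[of _ "%n. k (to_nat n)"]) (simp add: inj_on_def inj_eq[OF k])
  have "ad_is_zero point (trm B i)" if "i \<noteq> 0" for i using that by (simp add: ad_is_zero_def B)
  then have "is_integers (enc point B :: (unit, 'v) acomplex)" unfolding is_integers_def
    using enc_acomplex[OF ac fits] ad_isomorphic_enc[OF ac fits, of 0] ad_is_zero_enc[OF ac fits] by (simp add: B_def)
  then show ?thesis by blast
qed

text \<open>The choice of \<open>r x\<close> depends on the closure of \<open>x\<close> alone, so
  points with the same closure get the same representative, and \<open>r\<close> fixes its
  values.\<close>

lemma reps_exist: assumes fin: "finite (tsp X)" shows "\<exists>P. reps X P"
proof -
  define r where "r x = (SOME y. y \<in> tsp X \<and> pt_closure X y = pt_closure X x)" for x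
  have r: "r x \<in> tsp X \<and> pt_closure X (r x) = pt_closure X x" if "x \<in> tsp X" for x unfolding r_def by (rule someI[of _ x]) (simp add: that)
  have "r (r x) = r x" if "x \<in> tsp X" for x using r[OF that] by (simp add: r_def)
  then have "reps X (r ` tsp X)" using r fin by unfold_locales (auto simp: pt_le_def, metis r_def subset_antisym)
  then show ?thesis by blast
qed

lemma mem_pt_closure_iff: "x \<in> tsp X ==> q \<in> pt_closure X x \<longleftrightarrow> pt_le X q x"
proof
  assume x: "x \<in> tsp X" and "q \<in> pt_closure X x"
  then show "pt_le X q x" using closure_of_minimal[of "{q}" "pt_closure X x" X] closure_of_subset_topspace[of X "{x}"] by (auto simp: pt_le_def)
next
  assume "pt_le X q x"
  then show "q \<in> pt_closure X x" using closure_of_subset[of "{q}" X] by (auto simp: pt_le_def)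
qed

context reps
begin

text \<open>\<open>T\<close> into all complexes on the point factors through the small ones, so the
  two adjoint values compose. An arbitrary derived functor \<open>R\<close> is naturally isomorphic
  to \<open>T\<close> by uniqueness and therefore has the same adjoint value.\<close>

lemma right_adjoint_value_Uc:
  fixes R :: "(('x, 'u) acomplex, _, (unit, 'x => 'u) acomplex, _) ftor"
  assumes inf: "infinite (UNIV :: 'u set)" and R: "is_RGamma X R" and Z: "is_integers Z"
  shows "right_adjoint_value (DCat X) (DCat point) R Z (enc X (Uc Z))"
proof -
  let ?t = "TYPE('u)"
  have Z': "Z \<in> acs point" "fits point Z ?t" using is_integers_fits[OF inf Z] Z by (simp_all add: is_integers_def)
  let ?R = "loc_lift (Ch X) (Ch point) (quasi_iso point) (Tf :: (('x, 'u) acomplex, _, (unit, 'x => 'u) acomplex, _) ftor)"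
  let ?L = "loc_lift (Ch X) (small_Ch ?t) (quasi_iso point) (Tf :: (('x, 'u) acomplex, _, (unit, 'x => 'u) acomplex, _) ftor)"
  let ?M = "loc_lift (small_Ch ?t) (Ch point) (quasi_iso point) (id_functor :: ((unit, 'x => 'u) acomplex, _, _, _) ftor)"
  note C = is_category_localization[of "Ch X" "quasi_iso X", folded DCat_def] and D = is_category_localization[of "Ch point" "quasi_iso point", folded DCat_def]
  note T = is_functor_Tf[OF inf] preserves_Tf[OF inf] and T' = is_functor_Tf_small[OF inf, of ?t] preserves_Tf[OF inf]
  have comp: "right_adjoint_value (DCat X) (DCat point) (fcomp ?M ?L) Z (enc X (Uc Z))" using right_adjoint_value_fcomp[OF is_functor_loc_lift[OF T', folded DCat_def]
        right_adjoint_value_Tf_small[OF inf Z'] right_adjoint_value_inclusion[OF inf Z']] .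
  have "right_adjoint_value (DCat X) (DCat point) ?R Z (enc X (Uc Z))"
  proof (rule right_adjoint_value_cong[OF _ _ comp])
    fix a b :: "('x, 'u) acomplex" and f assume "f \<in> Hom (DCat X) a b"
    then obtain u where u: "zigzag (Ch X) (quasi_iso X) a b u" "f = zclass (Ch X) (quasi_iso X) a b u" unfolding DCat_def by (rule Hom_localizationE)
    show "hm (fcomp ?M ?L) a b f = hm ?R a b f" using onHom_loc_lift[OF is_functor_inclusion zigzag_map[OF T' u(1)]]
      by (simp add: u(2) onHom_loc_lift[OF T u(1)] onHom_loc_lift[OF T' u(1)])
  qed simp
  moreover obtain eps where eps: "is_total_right_derived (Ch X) (quasi_iso X) (Ch point) (quasi_iso point) (Gamma X) R eps" using R unfolding is_RGamma_def by blast
  moreover obtain eps' where eps': "is_total_right_derived (Ch X) (quasi_iso X) (Ch point) (quasi_iso point) (Gamma X) ?R eps'"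
    using RGamma_Tf[OF inf] unfolding is_RGamma_def by blast
  moreover obtain th th' where "is_nat_trans (DCat X) (DCat point) R ?R th" "\<And>a. a \<in> Obj (DCat X) ==> inv_pair (DCat point) (ob R a) (ob ?R a) (th a) (th' a)"
    using total_right_derived_unique[OF is_category_Ch is_category_Ch eps eps' is_functor_Gamma]
    unfolding DCat_def by auto
  moreover have "is_functor (DCat X) (DCat point) R" "is_functor (DCat X) (DCat point) ?R" using eps eps' unfolding is_total_right_derived_def Let_def DCat_def by blast+
  ultimately show ?thesis using right_adjoint_value_nat_iso[OF C D] by metis
qed

text \<open>On \<open>P\<close> a point is determined by its closure, which gives injectivity. A
  chain of arbitrary points can be moved to representatives without changing any closure, which
  gives surjectivity.\<close>

lemma map_closure_chains: "bij_betw (map (pt_closure X)) {c \<in> chs X P. length c = Suc p} (closure_chains X p)" unfolding bij_betw_def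
proof
  have inj: "inj_on (pt_closure X) P" using P P_antisym by (auto simp: inj_on_def pt_le_def subset_eq)
  show "inj_on (map (pt_closure X)) {c \<in> chs X P. length c = Suc p}" by (rule inj_on_subset[OF inj_on_map_lists[OF inj]]) (auto simp: chs_def)
  show "map (pt_closure X) ` {c \<in> chs X P. length c = Suc p} = closure_chains X p"
  proof (intro equalityI subsetI)
    fix C assume "C \<in> map (pt_closure X) ` {c \<in> chs X P. length c = Suc p}"
    then show "C \<in> closure_chains X p" using P by (auto simp: closure_chains_def strict_chains_def chs_def)
  next
    fix C assume "C \<in> closure_chains X p"
    then obtain xs where xs: "length xs = Suc p" "set xs \<subseteq> tsp X" "sorted_wrt (pt_less X) xs" "C = map (pt_closure X) xs"
      by (auto simp: closure_chains_def strict_chains_def)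
    obtain r where r: "\<And>x. x \<in> tsp X ==> r x \<in> P \<and> pt_le X (r x) x \<and> pt_le X x (r x)" using rep_ex by metis
    have "sorted_wrt (pt_less X) (map r xs)" unfolding sorted_wrt_map by (rule sorted_wrt_mono_rel[OF _ xs(3)]) (use r xs(2) in "meson pt_le_trans pt_less_def subsetD")
    moreover have "map (pt_closure X) (map r xs) = C" using r xs(2) by (auto simp: xs(4) pt_le_def)
    ultimately show "C \<in> map (pt_closure X) ` {c \<in> chs X P. length c = Suc p}" using xs r by (intro image_eqI[of _ _ "map r xs"]) (auto simp: chs_def)
  qed
qed

section \<open>The complex \<open>U Z\<close> for a copy \<open>Z\<close> of the integers\<close>

context
  fixes Z :: "(unit, 'v) acomplex"
  assumes Z: "is_integers Z"
begin

lemma Z_acomplex: "Z \<in> acs point" using Z by (simp add: is_integers_def)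

lemma Z_trivial: "i \<noteq> 0 ==> trivial_group (stk Z i ())" using Z by (simp add: is_integers_def ad_is_zero_def)

lemma dg_bounds: "c \<in> chs X P ==> 0 \<le> dg c \<and> dg c \<le> int (dim_space X)"
proof -
  assume c: "c \<in> chs X P"
  have "{q. strict_chains X q \<noteq> {}} \<subseteq> (%c. length c - 1) ` chs X (tsp X)"
  proof
    fix q assume "q \<in> {q. strict_chains X q \<noteq> {}}"
    then obtain c where "c \<in> strict_chains X q" by blast
    then show "q \<in> (%c. length c - 1) ` chs X (tsp X)" by (intro image_eqI[of _ _ c]) (auto simp: strict_chains_def chs_def)
  qed
  then have "finite {q. strict_chains X q \<noteq> {}}" by (rule finite_subset[OF _ finite_imageI[OF finite_chs[OF fin]]])
  moreover have "strict_chains X (length c - 1) \<noteq> {}" using c P by (auto simp: strict_chains_def chs_def)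
  ultimately have "length c - 1 \<le> dim_space X" unfolding dim_space_def by (intro Max_ge) simp_all
  moreover have "length c > 0" using c by (auto simp: chs_def)
  ultimately show ?thesis by (simp add: dg_def)
qed

text \<open>The factor of a chain \<open>c\<close> in degree \<open>i\<close> is the term of
  \<open>Z\<close> in degree \<open>i + dg c\<close>. It can be nontrivial only for
  \<open>i = - dg c\<close>, and \<open>dg c\<close> lies between \<open>0\<close> and the
  dimension.\<close>

lemma Uc_zero: "i \<notin> {- int (dim_space X)..0} ==> ad_is_zero X (trm (Uc Z) i)" unfolding ad_is_zero_def
proof
  fix p assume i: "i \<notin> {- int (dim_space X)..0}"
  have "stc Z (i + dg c) () = {1[stk Z (i + dg c) ()]}" if "c \<in> UI p" for c
    using Z_trivial[of "i + dg c"] dg_bounds[OF UI_chs(1)[OF that]] i by (auto simp: trivial_group_def)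
  then have "carrier (UG Z p i) = {1[UG Z p i]}" by (auto simp: UG_carrier extensional_def fun_eq_iff)
  then show "trivial_group (stk (Uc Z) i p)" using comm_group_UG[OF Z_acomplex] by (simp add: trivial_group_def comm_group_def)
qed

text \<open>In degree \<open>- p\<close> exactly the chains of dimension \<open>p\<close> carry a
  copy of the integers, all other factors being trivial. These chains match the closure chains, and
  \<open>q\<close> belongs to the last closure exactly if the chain belongs to
  \<open>UI q\<close>.\<close>

lemma Uc_chain_term: "ad_isomorphic X (trm (Uc Z) (- int p)) (chain_term X p)"
proof -
  obtain z' where "z' \<in> ad_hom point (trm Z 0) (Z_on UNIV)" "z' () \<in> iso (stk Z 0 ()) (stalk (Z_on UNIV) ())"
    using Z by (auto simp: is_integers_def ad_isomorphic_def)
  define z where "z = z' ()"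
  have z: "z \<in> hom (stk Z 0 ()) integer_group" "bij_betw z (stc Z 0 ()) UNIV" using \<open>z' () \<in> _\<close> by (simp_all add: z_def iso_def Z_on_def)
  define I where "I = closure_chains X p"
  define J where "J = {c \<in> chs X P. length c = Suc p}"
  define rh where "rh = inv_into J (map (pt_closure X))"
  note bij = map_closure_chains[of p, folded I_def J_def]
  have rh: "rh C \<in> J" "map (pt_closure X) (rh C) = C" if "C \<in> I" for C using bij that unfolding rh_def bij_betw_def by (auto intro: inv_into_into f_inv_into_f)
  have rh_map: "rh (map (pt_closure X) c) = c" "map (pt_closure X) c \<in> I" if "c \<in> J" for c using bij that unfolding rh_def bij_betw_def by auto
  have finI: "finite I" using bij_betw_finite[OF bij] finite_chsP by (simp add: J_def)
  have J: "c \<in> chs X P" "- int p + dg c = 0" "c \<noteq> []" if "c \<in> J" for c using that by (auto simp: J_def dg_def)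
  have mem: "q \<in> last C \<longleftrightarrow> rh C \<in> UI q" if C: "C \<in> I" for q C
  proof -
    have "last C = pt_closure X (last (rh C))" using last_map[of "rh C" "pt_closure X"] J(3)[OF rh(1)[OF C]] rh(2)[OF C] by simp
    then show ?thesis using mem_pt_closure_iff[OF chsP_last[OF J(1)[OF rh(1)[OF C]]]] J(1)[OF rh(1)[OF C]] by (simp add: UI_def)
  qed
  have stC: "stalk (chain_term X p) q = sum_group I (%C. stalk (Z_on (last C)) q)"
    "res (chain_term X p) q q' s = (\<lambda>C\<in>I. if q \<in> last C \<and> q' \<in> last C then s C else 0)" for q q' s
    by (simp_all add: chain_term_def ad_sum_def I_def Z_on_def)
  \<comment> \<open>As the index set is finite, the direct sum is the full product; only the
    vanishing outside the closures is left as a condition.\<close>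
  have car: "x \<in> carrier (stalk (chain_term X p) q) \<longleftrightarrow> x \<in> extensional I \<and> (\<forall>C\<in>I. q \<notin> last C --> x C = 0)" for x q
    unfolding stC by (subst carrier_sum_group) (auto simp: Z_on_def PiE_iff finI)
  define f where "f = (\<lambda>q\<in>tsp X. \<lambda>s\<in>carrier (UG Z q (- int p)). \<lambda>C\<in>I. if q \<in> last C then z (s (rh C)) else 0)"
  have sc: "s (rh C) \<in> stc Z 0 ()" if "s \<in> carrier (UG Z q (- int p))" "C \<in> I" "q \<in> last C" for s q C
    using that mem[OF that(2)] J(2)[OF rh(1)[OF that(2)]] unfolding UG_carrier by metis
  have hom: "f q \<in> hom (UG Z q (- int p)) (stalk (chain_term X p) q)" if q: "q \<in> tsp X" for q
  proof (rule homI)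
    interpret U: comm_group "UG Z q (- int p)" by (rule comm_group_UG[OF Z_acomplex])
    fix s t assume st: "s \<in> carrier (UG Z q (- int p))" "t \<in> carrier (UG Z q (- int p))"
    have "z ((s *[UG Z q (- int p)] t) (rh C)) = z (s (rh C)) + z (t (rh C))" if C: "C \<in> I" "q \<in> last C" for C
      using hom_mult[OF z(1) sc[OF st(1) C] sc[OF st(2) C]] mem[OF C(1)] C(2) J(2)[OF rh(1)[OF C(1)]] by simp
    then show "f q (s *[UG Z q (- int p)] t) = f q s *[stalk (chain_term X p) q] f q t"
      using st q U.m_closed[OF st] by (auto simp: f_def stC(1) Z_on_def singleton_group_def simp del: UG_mult intro!: restrict_ext)
  qed (use q in "simp add: f_def car")
  have bij_f: "bij_betw (f q) (carrier (UG Z q (- int p))) (carrier (stalk (chain_term X p) q))" if q: "q \<in> tsp X" for q unfolding bij_betw_def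
  proof
    show "inj_on (f q) (carrier (UG Z q (- int p)))"
    proof (rule inj_onI)
      fix s t assume st: "s \<in> carrier (UG Z q (- int p))" "t \<in> carrier (UG Z q (- int p))" "f q s = f q t"
      show "s = t"
      proof (rule UG_eqI[OF st(1,2)])
        fix c assume c: "c \<in> UI q"
        have sc': "s c \<in> stc Z (- int p + dg c) ()" "t c \<in> stc Z (- int p + dg c) ()" using st c unfolding UG_carrier by blast+
        show "s c = t c"
        proof (cases "c \<in> J")
          case True
          have "q \<in> last (map (pt_closure X) c)" using mem[OF rh_map(2)[OF True]] c by (simp add: rh_map[OF True])
          then have "z (s c) = z (t c)" using fun_cong[OF st(3), of "map (pt_closure X) c"] q st(1,2) rh_map[OF True] by (simp add: f_def)
          then show ?thesis using z(2) sc' J(2)[OF True] by (auto simp: bij_betw_def dest: inj_onD)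
        next
          case False
          then have "- int p + dg c \<noteq> 0" using UI_chs(1)[OF c] by (auto simp: J_def dg_def chs_def)
          then show ?thesis using Z_trivial sc' by (auto simp: trivial_group_def)
        qed
      qed
    qed
    show "f q ` carrier (UG Z q (- int p)) = carrier (stalk (chain_term X p) q)"
    proof (intro equalityI subsetI)
      fix y assume "y \<in> f q ` carrier (UG Z q (- int p))"
      then show "y \<in> carrier (stalk (chain_term X p) q)" using hom_in_carrier[OF hom[OF q]] by blast
    next
      fix y assume y: "y \<in> carrier (stalk (chain_term X p) q)"
      define w where "w = inv_into (stc Z 0 ()) z"
      have w: "w n \<in> stc Z 0 ()" "z (w n) = n" for n using z(2) unfolding w_def bij_betw_def by (auto intro: inv_into_into f_inv_into_f)
      define s where "s = (\<lambda>c\<in>UI q. if c \<in> J then w (y (map (pt_closure X) c)) else 1[stk Z (- int p + dg c) ()])"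
      have s: "s \<in> carrier (UG Z q (- int p))" using J(2) w(1) ac_closed(3)[OF Z_acomplex, of "()"] by (auto simp: s_def UG_carrier)
      have "y = f q s"
      proof
        fix C show "y C = f q s C" using y q s mem[of C q] rh[of C] w(2) by (cases "C \<in> I") (auto simp: f_def s_def car extensional_def)
      qed
      then show "y \<in> f q ` carrier (UG Z q (- int p))" using s by blast
    qed
  qed
  have nat: "f q' (restrict s (UI q')) = res (chain_term X p) q q' (f q s)" if le: "pt_le X q q'" and s: "s \<in> carrier (UG Z q (- int p))" for q q' s
    using pt_leD[OF le] restrict_UG[OF le s] s UI_mono[OF le] mem by (auto simp: f_def stC(2) intro!: restrict_ext)
  have "f \<in> ad_hom X (trm (Uc Z) (- int p)) (chain_term X p)" unfolding ad_hom_def using hom nat by (simp add: f_def)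
  then show ?thesis unfolding ad_isomorphic_def using hom bij_f by (auto simp: iso_def)
qed

text \<open>The coordinates at the chains with \<open>i + dg c = 0\<close>, read as integers, are
  jointly injective on the stalk, since all other factors are trivial.\<close>

lemma finitely_generated_Uc:
  fixes t :: "'u itself"
  assumes fits: "fits X (Uc Z) t" and q: "q \<in> tsp X"
  shows "finitely_generated (cohomology (enc X (Uc Z) :: ('x, 'u) acomplex) i q)"
proof -
  note U = Uc_acomplex[OF Z_acomplex]
  let ?K = "enc X (Uc Z) :: ('x, 'u) acomplex"
  obtain z' where "z' () \<in> iso (stk Z 0 ()) (stalk (Z_on UNIV) ())" using Z by (auto simp: is_integers_def ad_isomorphic_def)
  then have z: "z' () \<in> hom (stk Z 0 ()) integer_group" "inj_on (z' ()) (stc Z 0 ())" by (simp_all add: iso_def Z_on_def bij_betw_def)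
  interpret Z0: group_hom "stk Z 0 ()" integer_group "z' ()" using z(1) acD(2)[OF Z_acomplex, of "()"] by (simp add: group_hom_def group_hom_axioms_def)
  show ?thesis
  proof (rule finitely_generated_cohomology[OF enc_acomplex[OF U fits] q, of "{c \<in> UI q. i + dg c = 0}" "%c s. z' () (dm X (Uc Z) i q s c)"])
    show "finite {c \<in> UI q. i + dg c = 0}" using finite_UI by simp
    have d: "dm X (Uc Z) i q s \<in> carrier (UG Z q i)" if "s \<in> stc ?K i q" for s using cmapD(3)[OF dm_cmap[OF U fits] q that] by simp
    have d': "dm X (Uc Z) i q s c \<in> stc Z (i + dg c) ()" if "s \<in> stc ?K i q" "c \<in> UI q" for s c using d[OF that(1)] that(2) unfolding UG_carrier by blast
    show "(%s. z' () (dm X (Uc Z) i q s c)) \<in> hom (stk ?K i q) integer_group" if c: "c \<in> {c \<in> UI q. i + dg c = 0}" for c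
    proof (rule homI)
      fix s t assume st: "s \<in> stc ?K i q" "t \<in> stc ?K i q"
      have "dm X (Uc Z) i q (s *[stk ?K i q] t) c = dm X (Uc Z) i q s c *[stk Z 0 ()] dm X (Uc Z) i q t c" using cmapD(4)[OF dm_cmap[OF U fits] q st] c by simp
      then show "z' () (dm X (Uc Z) i q (s *[stk ?K i q] t) c) = z' () (dm X (Uc Z) i q s c) *[integer_group] z' () (dm X (Uc Z) i q t c)"
        using hom_mult[OF z(1), of "dm X (Uc Z) i q s c" "dm X (Uc Z) i q t c"] d'[OF st(1), of c] d'[OF st(2), of c] c by simp
    qed simp
    fix s assume s: "s \<in> stc ?K i q" and 0: "\<And>c. c \<in> {c \<in> UI q. i + dg c = 0} ==> z' () (dm X (Uc Z) i q s c) = 0"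
    have "dm X (Uc Z) i q s = 1[UG Z q i]"
    proof (rule UG_eqI[OF d[OF s]])
      show "1[UG Z q i] \<in> carrier (UG Z q i)" using comm_group_UG[OF Z_acomplex] by (meson comm_group_def group.is_monoid monoid.one_closed)
      fix c assume c: "c \<in> UI q"
      show "dm X (Uc Z) i q s c = 1[UG Z q i] c"
      proof (cases "i + dg c = 0")
        case True
        then have "z' () (dm X (Uc Z) i q s c) = z' () 1[stk Z 0 ()]" using 0 c Z0.hom_one by simp
        then show ?thesis using inj_onD[OF z(2)] d'[OF s c] True Z0.one_closed c by simp
      next
        case False
        then show ?thesis using Z_trivial[OF False] d'[OF s c] c by (auto simp: trivial_group_def)
      qed
    qed
    then have "dm X (Uc Z) i q s = dm X (Uc Z) i q 1[stk ?K i q]" using cmap_one[OF dm_cmap[OF U fits] enc_acomplex[OF U fits] U q, of i] by simp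
    then have "cc X ?K (em X (Uc Z) :: int => 'x => _ => 'u) (dm X (Uc Z)) i q s = cc X ?K (em X (Uc Z)) (dm X (Uc Z)) i q 1[stk ?K i q]"
      using q s ac_closed(3)[OF enc_acomplex[OF U fits] q] by simp
    then show "s = 1[stk ?K i q]" unfolding em_dm[OF U fits] using q s ac_closed(3)[OF enc_acomplex[OF U fits] q] by simp
  qed
qed

end

theorem dualizing_complex_exists: assumes inf: "infinite (UNIV :: 'u set)" shows "\<exists>D :: ('x, 'u) acomplex. is_dualizing_complex X D"
proof -
  have "infinite (UNIV :: ('x => 'u) set)" using inf finite_fun_UNIVD2 by blast
  then obtain Z :: "(unit, 'x => 'u) acomplex" where "is_integers Z" using is_integers_exists by blast
  then show ?thesis unfolding is_dualizing_complex_def using right_adjoint_value_Uc[OF inf RGamma_Tf[OF inf]] RGamma_Tf[OF inf] by blast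
qed

lemma dualizing_complex_isomorphic:
  fixes D :: "('x, 'u) acomplex"
  assumes inf: "infinite (UNIV :: 'u set)" and D: "is_dualizing_complex X D"
  obtains Z :: "(unit, 'x => 'u) acomplex" where "is_integers Z" "isomorphic_in (DCat X) D (enc X (Uc Z))"
proof -
  from D obtain R :: "(('x, 'u) acomplex, _, (unit, 'x => 'u) acomplex, _) ftor" and Z where R: "is_RGamma X R" and Z: "is_integers Z"
    and rav: "right_adjoint_value (DCat X) (DCat point) R Z D"
    unfolding is_dualizing_complex_def by blast
  have "is_functor (DCat X) (DCat point) R" using R unfolding is_RGamma_def is_total_right_derived_def Let_def DCat_def by blast
  from right_adjoint_value_unique[OF _ _ this rav right_adjoint_value_Uc[OF inf R Z]]
  have "isomorphic_in (DCat X) D (enc X (Uc Z))" by (simp add: DCat_def is_category_localization)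
  then show thesis using that Z by blast
qed

text \<open>\<open>K\<close> is the transported \<open>U Z\<close>. Finite type and amplitude are
  read off from its terms and passed on to \<open>D\<close>, as isomorphic objects of the derived
  category have isomorphic cohomology.\<close>

theorem dualizing_complex:
  fixes D :: "('x, 'u) acomplex"
  assumes inf: "infinite (UNIV :: 'u set)" and D: "is_dualizing_complex X D"
  shows "(\<exists>K :: ('x, 'u) acomplex. K \<in> acs X \<and> (\<forall>p\<le>dim_space X. ad_isomorphic X (trm K (- int p)) (chain_term X p)) \<and>
          (\<forall>i. i \<notin> {- int (dim_space X)..0} --> ad_is_zero X (trm K i)) \<and>
          isomorphic_in (DCat X) D K)" (is ?ex)
    and "of_finite_type X D" and "has_amplitude X D {- int (dim_space X)..0}"
proof -
  obtain Z :: "(unit, 'x => 'u) acomplex" where Z: "is_integers Z" and iso: "isomorphic_in (DCat X) D (enc X (Uc Z))" by (rule dualizing_complex_isomorphic[OF inf D])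
  note U = Uc_acomplex[OF Z_acomplex[OF Z]]
  have fits: "fits X (Uc Z) TYPE('u)" by (rule fits_Uc[OF inf is_integers_fits[OF inf Z]])
  let ?K = "enc X (Uc Z) :: ('x, 'u) acomplex"
  note K = enc_acomplex[OF U fits]
  have D': "D \<in> acs X" using iso by (simp add: isomorphic_in_def DCat_def)
  have zero: "ad_is_zero X (trm ?K i)" if "i \<notin> {- int (dim_space X)..0}" for i by (rule ad_is_zero_enc[OF U fits Uc_zero[OF Z that]])
  have "trm ?K i \<in> abelian_data X" for i using K by (simp add: acomplexes_def)
  then have "ad_isomorphic X (trm ?K (- int p)) (chain_term X p)" for p by (rule ad_isomorphic_trans[OF _ ad_isomorphic_enc[OF U fits] Uc_chain_term[OF Z]])
  then show ?ex using K zero iso by blast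
  show "of_finite_type X D" unfolding of_finite_type_def
  proof (intro allI ballI)
    fix i p assume p: "p \<in> tsp X"
    obtain h where "h \<in> iso (cohomology ?K i p) (cohomology D i p)" by (rule isomorphic_cohomology[OF p iso])
    then show "finitely_generated (cohomology D i p)" by (rule finitely_generated_iso[OF finitely_generated_Uc[OF Z fits p]])
        (use comm_group_cohomology[OF K p] comm_group_cohomology[OF D' p] in "simp_all add: comm_group_def")
  qed
  show "has_amplitude X D {- int (dim_space X)..0}" unfolding has_amplitude_def
  proof (intro allI ballI impI)
    fix i p assume p: "p \<in> tsp X" and i: "i \<notin> {- int (dim_space X)..0}"
    obtain h where h: "h \<in> iso (cohomology ?K i p) (cohomology D i p)" by (rule isomorphic_cohomology[OF p iso])
    show "trivial_group (cohomology D i p)" by (rule trivial_group_iso[OF trivial_cohomology[OF K p] h])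
        (use zero[OF i] p comm_group_cohomology[OF D' p] in "simp_all add: ad_is_zero_def comm_group_def")
  qed
qed

end

theorem theorem4p3p4:
  fixes X :: "'x topology"
  assumes finite_space: "finite (topspace X)"
    and universe: "infinite (UNIV :: 'u set)"
  shows "(\<exists>D :: ('x, 'u) acomplex. is_dualizing_complex X D) \<and>
    (\<forall>D :: ('x, 'u) acomplex. is_dualizing_complex X D \<longrightarrow>
       (\<exists>K :: ('x, 'u) acomplex.
          K \<in> acomplexes X \<and>
          (\<forall>p\<le>dim_space X. ad_isomorphic X (trm K (- int p)) (chain_term X p)) \<and>
          (\<forall>i. i \<notin> {- int (dim_space X)..0} \<longrightarrow> ad_is_zero X (trm K i)) \<and>
          isomorphic_in (DCat X) D K) \<and>
       of_finite_type X D \<and>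
       has_amplitude X D {- int (dim_space X)..0})"
proof -
  obtain P where "reps X P"
    using reps_exist[OF finite_space] by blast
  then interpret reps X P .
  show ?thesis
    using dualizing_complex_exists[OF universe] dualizing_complex[OF universe] by blast
qed

end
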